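(* Let $b\in\mathbb{C}$, let $N\ge 1$ be an integer and let $R>0$. Let $A_s(z),B_s(z)$ be the polynomials defined in the context (with $f(z)=z^2$ and $\mu=b-1$), and $a_s(z),b_s(z)$ the associated polynomials defined there. (i) There are functions $g_2(u,z),h_2(u,z)$ and positive constants $K_2,u_2$ independent of $z$ and $u$ such that, for real $u\ge u_2$ and for all $z$ on the Riemann surface of the logarithm with $0<|z|\le R$ (no restriction on $\arg z$), $$\Gamma\big(1+\tfrac14u^2-\tfrac12 b\big)2^{-b}u^{b-1}e^{-\frac12z^2}z^b\, U\big(\tfrac14u^2+\tfrac12 b,b,z^2\big)= zK_{b-1}(uz)\left(\sum_{s=0}^{N-1} \frac{A_s(z)}{u^{2s}}+g_2(u,z)\right)-\frac{z}{u}K_b(uz)\left(\sum_{s=0}^{N-1} \frac{B_s(z)}{u^{2s}}+z\,h_2(u,z)\right),$$ and $$|g_2(u,z)|+|h_2(u,z)|\le \frac{K_2}{u^{2N}}.$$ (ii) Likewise, there are (possibly different) functions $g_2(u,z),h_2(u,z)$ and positive constants $K_2,u_2$ independent of $z$ and $u$ such that, for real $u\ge u_2$ and all $z$ on the Riemann surface of the logarithm with $0<|z|\le R$ (no restriction on $\arg z$), $$\Gamma\big(\tfrac14u^2+\tfrac12 b\big)2^{b-2}u^{1-b}e^{-\frac12z^2}z^b\, U\big(\tfrac14u^2+\tfrac12 b,b,z^2\big)= zK_{b-1}(uz)\left(\sum_{s=0}^{N-1} \frac{a_s(z)}{u^{2s}}+g_2(u,z)\right)-\frac{z}{u}K_b(uz)\left(\sum_{s=0}^{N-1}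 \frac{b_s(z)}{u^{2s}}+z\,h_2(u,z)\right),$$ and $|g_2(u,z)|+|h_2(u,z)|\le K_2/u^{2N}$.
   Context: $U(a,b,x)$ is the Kummer (Tricomi) confluent hypergeometric function, and $K_\nu$ the modified Bessel function of the second kind; they, and the power $z^b$, are regarded as functions on the Riemann surface of the logarithm (so $\arg(z^2)=2\arg z$, and $\arg(uz)=\arg z$ for $u>0$). For $\mu\in\mathbb{C}$ and $f(z)=z^2$, the polynomials $A_s(z)=A_s(\mu,z)$ (even) and $B_s(z)=B_s(\mu,z)$ (odd), $s\ge0$, are uniquely determined by $A_0(z)=1$, $A_s(0)=0$ for $s\ge1$, and for $s\ge 0$ $$2B_s(z) = -A_s'(z)+\int_0^z\left(f(t)A_s(t)-\frac{2\mu+1}{t} A_s'(t)\right) dt,$$ $$2A_{s+1}(z) = \frac{2\mu+1}{z} B_s(z)- B_s'(z)+\int f(z)B_s(z)\, dz,$$ where the last integral denotes an antiderivative of $fB_s$, the constant of integration being fixed by the condition $A_{s+1}(0)=0$. The polynomials $a_s,b_s$ are defined by $a_0(z)=1$ and, for $s\ge 0$, $a_{s+1}(z)=A_{s+1}(-\mu,z)+\frac{2\mu}{z}B_s(-\mu,z)$, $b_s(z)=B_s(-\mu,z)$. Here $\mu=b-1$ throughout. *)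

theory Defs
  imports "HOL-Complex_Analysis.Complex_Analysis"
begin

text \<open>
  A point \<open>z\<close> of the Riemann surface of the logarithm is represented by its logarithm
  \<open>w = ln \<bar>z\<bar> + \<i> arg z\<close>, an arbitrary complex number. Thus the projection of the point to
  the punctured plane is \<open>exp w\<close>, the power \<open>z\<^sup>b\<close> is \<open>exp (b * w)\<close>, the point \<open>z\<^sup>2\<close> is \<open>2 * w\<close>,
  and for \<open>u > 0\<close> the point \<open>u z\<close> is \<open>ln u + w\<close>.
  The functions \<open>besselI\<close>, \<open>besselK\<close>, \<open>kummerU\<close> below take this representation as their last
  argument.
\<close>

section \<open>Bessel and Kummer functions\<close>

definition besselI :: "complex \<Rightarrow> complex \<Rightarrow> complex" where
  "besselI \<nu> w = exp (\<nu> * (w - of_real (ln 2))) *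
     (\<Sum>k. rGamma (\<nu> + of_nat k + 1) / fact k * (exp w / 2) ^ (2 * k))"

text \<open>
  For integer order (respectively integer second parameter \<open>b\<close> of \<open>U\<close>) the quotients below have
  removable singularities and, as usual, the functions are defined there by the limiting value.
\<close>

definition besselK_quot :: "complex \<Rightarrow> complex \<Rightarrow> complex" where
  "besselK_quot w \<nu> =
     of_real pi / 2 * (besselI (- \<nu>) w - besselI \<nu> w) / sin (of_real pi * \<nu>)"

definition besselK :: "complex \<Rightarrow> complex \<Rightarrow> complex" where
  "besselK \<nu> w =
     (if \<nu> \<in> \<int> then Lim (at \<nu>) (besselK_quot w) else besselK_quot w \<nu>)"

text \<open>The regularized function \<open>M(a,b,z) / \<Gamma>(b)\<close>, entire in all three arguments.\<close>

definition kummerM_reg :: "complex \<Rightarrow> complex \<Rightarrow> complex \<Rightarrow> complex" where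
  "kummerM_reg a b z = (\<Sum>n. pochhammer a n * rGamma (b + of_nat n) / fact n * z ^ n)"

definition kummerU_quot :: "complex \<Rightarrow> complex \<Rightarrow> complex \<Rightarrow> complex" where
  "kummerU_quot a w b =
     of_real pi / sin (of_real pi * b) *
       (rGamma (a - b + 1) * kummerM_reg a b (exp w)
        - exp ((1 - b) * w) * rGamma a * kummerM_reg (a - b + 1) (2 - b) (exp w))"

definition kummerU :: "complex \<Rightarrow> complex \<Rightarrow> complex \<Rightarrow> complex" where
  "kummerU a b w =
     (if b \<in> \<int> then Lim (at b) (kummerU_quot a w) else kummerU_quot a w b)"

section \<open>The coefficient polynomials\<close>

definition antideriv0 :: "complex poly \<Rightarrow> complex poly" where
  "antideriv0 p = (\<Sum>i\<le>degree p. monom (coeff p i / of_nat (Suc i)) (Suc i))"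

abbreviation f_poly :: "complex poly" where
  "f_poly \<equiv> [:0, 0, 1:]"

abbreviation div_z :: "complex poly \<Rightarrow> complex poly" where
  "div_z p \<equiv> p div [:0, 1:]"

text \<open>
  One half-step each of the recursion. All divisions by \<open>z\<close> are exact along the recursion,
  because \<open>A\<^sub>s\<close> is even and \<open>B\<^sub>s\<close> is odd (see \<open>A_poly_even\<close>, \<open>B_poly_odd\<close>).
\<close>

definition B_of_A :: "complex \<Rightarrow> complex poly \<Rightarrow> complex poly" where
  "B_of_A \<mu> p = smult (1/2)
     (- pderiv p + antideriv0 (f_poly * p - smult (2 * \<mu> + 1) (div_z (pderiv p))))"

text \<open>
  The constant term of \<open>(2\<mu>+1)/z B(z) - B'(z)\<close> need not vanish; the constant of integration is
  the one that makes the constant term of the whole expression zero.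
\<close>

definition A_of_B :: "complex \<Rightarrow> complex poly \<Rightarrow> complex poly" where
  "A_of_B \<mu> q =
     (let r = smult (2 * \<mu> + 1) (div_z q) - pderiv q + antideriv0 (f_poly * q)
      in smult (1/2) (r - [:coeff r 0:]))"

primrec A_poly :: "complex \<Rightarrow> nat \<Rightarrow> complex poly" where
  "A_poly \<mu> 0 = 1"
| "A_poly \<mu> (Suc s) = A_of_B \<mu> (B_of_A \<mu> (A_poly \<mu> s))"

definition B_poly :: "complex \<Rightarrow> nat \<Rightarrow> complex poly" where
  "B_poly \<mu> s = B_of_A \<mu> (A_poly \<mu> s)"

primrec a_poly :: "complex \<Rightarrow> nat \<Rightarrow> complex poly" where
  "a_poly \<mu> 0 = 1"
| "a_poly \<mu> (Suc s) = A_poly (- \<mu>) (Suc s) + smult (2 * \<mu>) (div_z (B_poly (- \<mu>) s))"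

definition b_poly :: "complex \<Rightarrow> nat \<Rightarrow> complex poly" where
  "b_poly \<mu> s = B_poly (- \<mu>) s"

section \<open>The defining properties of the coefficient polynomials\<close>

lemma coeff_antideriv0:
  "coeff (antideriv0 p) n = (if n = 0 then 0 else coeff p (n - 1) / of_nat n)"
proof (cases n)
  case 0
  then show ?thesis by (simp add: antideriv0_def coeff_sum)
next
  case (Suc m)
  have "coeff (antideriv0 p) n =
        (\<Sum>i\<le>degree p. if i = m then coeff p i / of_nat (Suc i) else 0)"
    unfolding antideriv0_def coeff_sum using Suc by (intro sum.cong) auto
  also have "\<dots> = coeff p m / of_nat (Suc m)"
    by (auto simp: coeff_eq_0)
  finally show ?thesis using Suc by simp
qed

lemma pderiv_antideriv0: "pderiv (antideriv0 p) = p"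
  by (intro poly_eqI) (simp add: coeff_pderiv coeff_antideriv0 del: of_nat_Suc)

lemma poly_antideriv0_0: "poly (antideriv0 p) 0 = 0"
  by (simp add: poly_0_coeff_0 coeff_antideriv0)

lemma coeff_div_z: "coeff (div_z p) n = coeff p (Suc n)"
proof (cases p)
  case (pCons c q)
  have "p = q * [:0, 1:] + [:c:]" using pCons by simp
  then have "div_z p = (q * [:0, 1:] + [:c:]) div [:0, 1:]" by simp
  also have "\<dots> = q + [:c:] div [:0, 1:]"
    by (subst div_mult_self3) auto
  also have "[:c:] div [:0, 1:] = 0" by (simp add: div_poly_less)
  finally show ?thesis using pCons by simp
qed

lemma poly_div_z:
  assumes "coeff p 0 = 0" "z \<noteq> 0"
  shows "poly (div_z p) z = poly p z / z"
proof -
  have "p = pCons 0 (div_z p)"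
    using assms(1) by (intro poly_eqI) (simp add: coeff_pCons coeff_div_z split: nat.split)
  then have "poly p z = poly (pCons 0 (div_z p)) z" by simp
  then show ?thesis using assms(2) by (simp add: field_simps)
qed

lemma coeff_f_poly_mult:
  "coeff (pCons 0 (pCons 0 p)) n = (if n < 2 then 0 else coeff p (n - 2))"
  by (auto simp: coeff_pCons split: nat.split)

lemma B_of_A_odd:
  assumes "\<And>n. odd n \<Longrightarrow> coeff p n = 0" "even n"
  shows "coeff (B_of_A \<mu> p) n = 0"
  using assms(2)
  by (auto simp: B_of_A_def coeff_pderiv coeff_antideriv0 coeff_div_z coeff_f_poly_mult assms(1))

lemma A_of_B_even:
  assumes "\<And>n. even n \<Longrightarrow> coeff q n = 0" "odd n"
  shows "coeff (A_of_B \<mu> q) n = 0"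
proof -
  have "n \<noteq> 0" using assms(2) by (rule contrapos_pn) simp
  then have "coeff [:c:] n = 0" for c :: complex by (cases n) auto
  then show ?thesis using assms(2)
    by (auto simp: A_of_B_def Let_def coeff_pderiv coeff_antideriv0 coeff_div_z
        coeff_f_poly_mult assms(1))
qed

lemma A_poly_even: "odd n \<Longrightarrow> coeff (A_poly \<mu> s) n = 0"
proof (induction s arbitrary: n)
  case 0
  then show ?case by (cases n) (auto simp: one_pCons)
next
  case (Suc s)
  show ?case unfolding A_poly.simps
    by (rule A_of_B_even[OF B_of_A_odd[OF Suc.IH] Suc.prems])
qed

lemma B_poly_odd: "even n \<Longrightarrow> coeff (B_poly \<mu> s) n = 0"
  unfolding B_poly_def by (rule B_of_A_odd[OF A_poly_even])

lemma A_poly_Suc_at_0: "poly (A_poly \<mu> (Suc s)) 0 = 0"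
  by (simp add: poly_0_coeff_0 A_of_B_def Let_def)

lemma B_poly_recursion:
  "2 * poly (B_poly \<mu> s) z = - poly (pderiv (A_poly \<mu> s)) z +
     contour_integral (linepath 0 z)
       (\<lambda>t. t\<^sup>2 * poly (A_poly \<mu> s) t - (2 * \<mu> + 1) / t * poly (pderiv (A_poly \<mu> s)) t)"
proof (cases "z = 0")
  case True
  then show ?thesis
    using B_poly_odd[of 0 \<mu> s] A_poly_even[of 1 \<mu> s]
    by (simp add: poly_0_coeff_0 coeff_pderiv)
next
  case False
  define p where "p = A_poly \<mu> s"
  define r where "r = f_poly * p - smult (2 * \<mu> + 1) (div_z (pderiv p))"
  define g where "g = (\<lambda>t. t\<^sup>2 * poly p t - (2 * \<mu> + 1) / t * poly (pderiv p) t)"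
  have c0: "coeff (pderiv p) 0 = 0"
    using A_poly_even[of 1 \<mu> s] by (simp add: p_def coeff_pderiv)
  have rg: "poly r t = g t" if "t \<noteq> 0" for t
    using that by (simp add: r_def g_def poly_div_z[OF c0] power2_eq_square)
  have "(poly r has_contour_integral
          (poly (antideriv0 r) (pathfinish (linepath 0 z))
           - poly (antideriv0 r) (pathstart (linepath 0 z)))) (linepath 0 z)"
  proof (rule contour_integral_primitive[where S = UNIV])
    show "(poly (antideriv0 r) has_field_derivative poly r x) (at x within UNIV)" for x
      using poly_DERIV[of "antideriv0 r" x] by (simp add: pderiv_antideriv0)
  qed (use valid_path_linepath in blast)+
  then have "(poly r has_contour_integral poly (antideriv0 r) z) (linepath 0 z)"
    by (simp add: poly_antideriv0_0)
  then have "((\<lambda>x. poly r (linepath 0 z x) * (z - 0)) has_integral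
               poly (antideriv0 r) z) {0..1}"
    by (simp only: has_contour_integral_linepath)
  then have "((\<lambda>x. g (linepath 0 z x) * (z - 0)) has_integral
               poly (antideriv0 r) z) {0..1}"
    by (rule has_integral_spike_finite[rotated 2, where S = "{0}"])
       (use False in \<open>auto simp: rg linepath_def\<close>)
  then have "(g has_contour_integral poly (antideriv0 r) z) (linepath 0 z)"
    by (simp only: has_contour_integral_linepath)
  then have "contour_integral (linepath 0 z) g = poly (antideriv0 r) z"
    by (rule contour_integral_unique)
  then show ?thesis
    by (simp add: B_poly_def B_of_A_def g_def r_def p_def)
qed

lemma A_poly_recursion:
  "\<exists>F. pderiv F = f_poly * B_poly \<mu> s \<and>
     (\<forall>z. z \<noteq> 0 \<longrightarrow> 2 * poly (A_poly \<mu> (Suc s)) z =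
        (2 * \<mu> + 1) / z * poly (B_poly \<mu> s) z - poly (pderiv (B_poly \<mu> s)) z + poly F z)"
proof -
  define q where "q = B_poly \<mu> s"
  define r where "r = smult (2 * \<mu> + 1) (div_z q) - pderiv q + antideriv0 (f_poly * q)"
  have q0: "coeff q 0 = 0" unfolding q_def by (rule B_poly_odd) simp
  have "A_poly \<mu> (Suc s) = smult (1/2) (r - [:coeff r 0:])"
    by (simp add: r_def q_def B_poly_def A_of_B_def Let_def)
  then have "2 * poly (A_poly \<mu> (Suc s)) z =
      (2 * \<mu> + 1) / z * poly q z - poly (pderiv q) z
        + poly (antideriv0 (f_poly * q) - [:coeff r 0:]) z" if "z \<noteq> 0" for z
    using that by (simp add: r_def poly_div_z[OF q0])
  moreover have "pderiv (antideriv0 (f_poly * q) - [:coeff r 0:]) = f_poly * q"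
    by (simp only: pderiv_diff pderiv_antideriv0) (simp add: pderiv_pCons)
  ultimately show ?thesis unfolding q_def by blast
qed

lemma poly_a_poly_Suc:
  "z \<noteq> 0 \<Longrightarrow> poly (a_poly \<mu> (Suc s)) z =
     poly (A_poly (- \<mu>) (Suc s)) z + 2 * \<mu> / z * poly (B_poly (- \<mu>) s) z"
  by (simp add: poly_div_z[OF B_poly_odd])

end

theory Submission
  imports Defs
begin

text \<open>
  Put \<open>\<eta> = 1 / u\<^sup>2\<close> and \<open>s = u\<^sup>2 z\<^sup>2 / 4\<close>. Requiring the representation with unknown functions \<open>F\<close>, \<open>z H\<close>
  in place of the two brackets to hold both for the \<open>U\<close>-function (with \<open>K\<close>-functions) and for the regular
  Kummer function (with \<open>I\<close>-functions) determines \<open>F\<close> and \<open>H\<close>, thanks to the Wronskian of the Bessel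
  series, as explicit combinations of Bessel and Kummer series that are entire in \<open>z\<^sup>2\<close>. They satisfy a linear
  differential system which, read on Taylor coefficients, is the recursion of \<open>A\<^sub>s\<close>, \<open>B\<^sub>s\<close> with a factor
  \<open>u\<^sup>-\<^sup>2\<close> per round. Hence a bound on \<open>F\<close> and \<open>H\<close> that is merely polynomial in \<open>u\<close> on every disc upgrades itself
  to the full expansion. Such a bound follows by writing \<open>F\<close> and \<open>H\<close> as combinations of products of a dominant and a
  recessive solution on the half plane \<open>Re x \<ge> 0\<close>, \<open>x = u z\<close>: growth of the dominant one comes from an energy
  estimate, decay of the recessive one from the Laplace integral for \<open>U\<close> on the positive axis and the same
  energy estimate off it.

  All constants are uniform in \<open>b\<close> on bounded sets with \<open>Re b \<notin> \<int>\<close>. The remaining \<open>b\<close> follow by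
  compactness, the removable singularities of \<open>K\<close> and \<open>U\<close> being the only difficulty. Part (ii) is part (i) at
  \<open>2 - b\<close>, rewritten by \<open>K\<^sub>2\<^sub>-\<^sub>b = K\<^sub>b - 2 (b - 1) / x K\<^sub>b\<^sub>-\<^sub>1\<close>.
\<close>

section \<open>Entire power series\<close>

text \<open>The argument of \<open>z\<close> is unrestricted because \<open>F\<close> and
  \<open>H\<close> depend on \<open>x = u z\<close> only through \<open>x\<^sup>2\<close>: a bound
  on the half plane \<open>Re x \<ge> 0\<close> covers a full circle in
  \<open>s = x\<^sup>2 / 4\<close>, and Cauchy's estimate turns it into a bound for all Taylor
  coefficients. The energy estimate tolerates the perturbation
  \<open>\<eta>\<^sup>2 * x\<^sup>2\<close> only while
  \<open>\<eta>\<^sup>2 * norm x ^ 3 \<le> 1\<close>; with \<open>\<eta> = 1 / u\<^sup>2\<close> and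
  \<open>norm x\<close> proportional to \<open>u\<close> this just asks for large \<open>u\<close>.
  Inverting the Wronskian puts \<open>1 / sin (pi * b)\<close> into \<open>F\<close> and
  \<open>H\<close>. Every recessive bound therefore keeps an explicit factor
  \<open>sin (pi * b)\<close>; the two cancel, and this is what makes the constants survive the
  passage to integral \<open>b\<close>. The exclusion concerns \<open>Re b\<close> and not only
  \<open>b\<close>, since the Laplace integral is identified with \<open>U\<close> on the strip
  \<open>0 < Re b < 1\<close> and integer shifts of it never reach the lines of integral real part.
  The Bessel functions get no integral representation of their own: their bound is the limit
  \<open>\<eta> \<rightarrow> 0\<close> of the Kummer bound, whose constants are uniform in
  \<open>\<eta>\<close>.\<close>

abbreviation entire_fps :: "complex fps \<Rightarrow> bool" where
  "entire_fps f \<equiv> fps_conv_radius f = \<infinity>"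

lemma entire_fps_add: "entire_fps f \<Longrightarrow> entire_fps g \<Longrightarrow> entire_fps (f + g)"
  using fps_conv_radius_add[of f g] by simp

lemma entire_fps_diff: "entire_fps f \<Longrightarrow> entire_fps g \<Longrightarrow> entire_fps (f - g)"
  using fps_conv_radius_diff[of f g] by simp

lemma entire_fps_mult: "entire_fps f \<Longrightarrow> entire_fps g \<Longrightarrow> entire_fps (f * g)"
  using fps_conv_radius_mult[of f g] by simp

lemma entire_fps_deriv: "entire_fps f \<Longrightarrow> entire_fps (fps_deriv f)"
  using fps_conv_radius_deriv[of f] by simp

lemmas entire_fps_intros =
  entire_fps_add entire_fps_diff entire_fps_mult entire_fps_deriv
  fps_conv_radius_const fps_conv_radius_fps_X fps_conv_radius_exp

text \<open>Decay faster than every geometric sequence: on the circle of radius \<open>r\<close> it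
  is used with \<open>L = 1 / (2 * r)\<close>, which leaves a convergent series in powers of
  1/2.\<close>

lemma entire_fpsI:
  assumes "\<And>L::real. L > 0 \<Longrightarrow> \<exists>C. \<forall>n. norm (fps_nth f n) \<le> C * L ^ n"
  shows "entire_fps f"
proof -
  have "fps_conv_radius f \<ge> \<infinity>"
    unfolding fps_conv_radius_def
  proof (rule conv_radius_geI_ex)
    fix r :: real assume "r > 0"
    obtain C where C: "\<And>n. norm (fps_nth f n) \<le> C * (1 / (2 * r)) ^ n"
      using assms[of "1 / (2 * r)"] \<open>r > 0\<close> by auto
    have "summable (\<lambda>n. fps_nth f n * complex_of_real r ^ n)"
    proof (rule summable_comparison_test'[where N = 0])
      show "summable (\<lambda>n. C * (1/2) ^ n :: real)"
        by (intro summable_mult summable_geometric) simp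
      show "norm (fps_nth f n * complex_of_real r ^ n) \<le> C * (1/2) ^ n" for n
      proof -
        have "norm (fps_nth f n * complex_of_real r ^ n) \<le> C * (1 / (2 * r)) ^ n * r ^ n"
          using C[of n] \<open>r > 0\<close> by (simp add: norm_mult norm_power mult_right_mono)
        also have "\<dots> = C * (1/2) ^ n"
          using \<open>r > 0\<close> by (simp add: power_mult_distrib [symmetric] mult.assoc)
        finally show ?thesis .
      qed
    qed
    then show "\<exists>z::complex. norm z = r \<and> summable (\<lambda>n. fps_nth f n * z ^ n)"
      using \<open>r > 0\<close> by (intro exI[of _ "of_real r"]) auto
  qed
  then show ?thesis by simp
qed

lemma eval_fps_deriv_entire:
  "entire_fps f \<Longrightarrow> (eval_fps f has_field_derivative eval_fps (fps_deriv f) z) (at z within A)"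
  by (rule has_field_derivative_eval_fps) simp

lemma eval_fps_chain_entire [derivative_intros]:
  assumes "entire_fps f" "(g has_field_derivative g') (at z within A)"
  shows "((\<lambda>z. eval_fps f (g z)) has_field_derivative eval_fps (fps_deriv f) (g z) * g') (at z within A)"
  by (rule DERIV_chain2[OF eval_fps_deriv_entire[OF assms(1)] assms(2)])

lemma isCont_eval_fps_entire [continuous_intros]:
  "entire_fps f \<Longrightarrow> continuous (at z within A) (eval_fps f)"
  using eval_fps_deriv_entire DERIV_continuous by blast

lemma
  assumes "entire_fps f" "entire_fps g"
  shows eval_add_entire: "eval_fps (f + g) z = eval_fps f z + eval_fps g z"
    and eval_diff_entire: "eval_fps (f - g) z = eval_fps f z - eval_fps g z"
    and eval_mult_entire: "eval_fps (f * g) z = eval_fps f z * eval_fps g z"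
  using assms by (auto intro: eval_fps_add eval_fps_diff eval_fps_mult)

lemmas eval_entire = eval_add_entire eval_diff_entire eval_mult_entire

lemma eval_fps_bound:
  assumes "\<And>n. norm (fps_nth f n) * r ^ n \<le> C / 2 ^ n" "norm z \<le> r" "C \<ge> 0"
  shows "norm (eval_fps f z) \<le> 2 * C"
proof -
  have *: "norm (fps_nth f n * z ^ n) \<le> C * (1/2) ^ n" for n
  proof -
    have "norm (fps_nth f n * z ^ n) \<le> norm (fps_nth f n) * r ^ n"
      using assms(2) by (auto simp: norm_mult norm_power intro!: mult_left_mono power_mono)
    also have "\<dots> \<le> C * (1/2) ^ n" using assms(1)[of n] by (simp add: power_divide)
    finally show ?thesis .
  qed
  have s: "summable (\<lambda>n. C * (1/2) ^ n :: real)" by (intro summable_mult summable_geometric) simp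
  have "norm (eval_fps f z) \<le> (\<Sum>n. C * (1/2) ^ n)"
    unfolding eval_fps_def
    by (rule norm_suminf_le[OF * s])
  also have "\<dots> = 2 * C" using suminf_geometric[of "1/2::real"] s
    by (subst suminf_mult) (auto intro!: summable_geometric)
  finally show ?thesis .
qed

section \<open>Confluent hypergeometric series\<close>

text \<open>Both the Kummer series (\<open>p = a\<close>, \<open>q = 1\<close>) and the Bessel series (\<open>p = 1\<close>, \<open>q = 0\<close>).\<close>

definition hyp :: "complex \<Rightarrow> complex \<Rightarrow> complex \<Rightarrow> complex fps" where
  "hyp p q b = Abs_fps (\<lambda>n. (\<Prod>j<n. p + q * of_nat j) * rGamma (b + of_nat n) / fact n)"

lemma hyp_nth: "fps_nth (hyp p q b) n = (\<Prod>j<n. p + q * of_nat j) * rGamma (b + of_nat n) / fact n"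
  by (simp add: hyp_def)

text \<open>The product \<open>p (p + q) ... (p + n q)\<close>, split off at its first and at its
  last factor. No division by \<open>p\<close> occurs, so the contiguous relations below include
  \<open>p = 0\<close>.\<close>

lemma prod_shift_hyp:
  fixes p q :: complex
  shows "p * (\<Prod>j<n. p + q + q * of_nat j) = (\<Prod>j<n. p + q * of_nat j) * (p + q * of_nat n)"
proof -
  have "p * (\<Prod>j<n. p + q + q * of_nat j) = (\<Prod>j<Suc n. p + q * of_nat j)"
    by (subst prod.lessThan_Suc_shift) (simp add: algebra_simps)
  then show ?thesis by simp
qed

lemma hyp_deriv: "fps_deriv (hyp p q b) = fps_const p * hyp (p + q) q (b + 1)"
proof (rule fps_ext)
  fix n
  have "fps_nth (fps_deriv (hyp p q b)) n =
      (\<Prod>j<Suc n. p + q * of_nat j) * rGamma (b + of_nat (Suc n)) * (of_nat (Suc n) / fact (Suc n))"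
    by (simp add: hyp_nth algebra_simps del: prod.lessThan_Suc fact_Suc of_nat_Suc)
  also have "of_nat (Suc n) / fact (Suc n) = (1 / fact n :: complex)"
    by (simp add: divide_simps del: of_nat_Suc)
  also have "(\<Prod>j<Suc n. p + q * of_nat j) = p * (\<Prod>j<n. p + q + q * of_nat j)"
    using prod_shift_hyp[of p q n] by simp
  finally show "fps_nth (fps_deriv (hyp p q b)) n = fps_nth (fps_const p * hyp (p + q) q (b + 1)) n"
    by (simp add: hyp_nth algebra_simps)
qed

text \<open>The Euler operator multiplies the n-th coefficient by \<open>n\<close>, and
  \<open>(b - 1 + n) * rGamma (b + n) = rGamma (b - 1 + n)\<close>. With the reciprocal Gamma
  normalization no value of \<open>b\<close> is exceptional.\<close>

lemma hyp_lower: "fps_X * fps_deriv (hyp p q b) + fps_const (b - 1) * hyp p q b = hyp p q (b - 1)"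
proof (rule fps_ext)
  fix n
  have r: "(b - 1 + of_nat n) * rGamma (b + of_nat n) = rGamma (b - 1 + of_nat n)"
    using rGamma_plus1[of "b - 1 + of_nat n"] by (simp add: algebra_simps)
  have "fps_nth (fps_X * fps_deriv (hyp p q b)) n = of_nat n * fps_nth (hyp p q b) n"
    by (cases n) (simp_all add: fps_mult_fps_X_deriv_shift)
  then have "fps_nth (fps_X * fps_deriv (hyp p q b) + fps_const (b - 1) * hyp p q b) n
     = (of_nat n + (b - 1)) * fps_nth (hyp p q b) n"
    by (simp add: algebra_simps)
  also have "\<dots> = (\<Prod>j<n. p + q * of_nat j) / fact n * ((b - 1 + of_nat n) * rGamma (b + of_nat n))"
    by (simp add: hyp_nth)
  finally have "fps_nth (fps_X * fps_deriv (hyp p q b) + fps_const (b - 1) * hyp p q b) n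
     = (\<Prod>j<n. p + q * of_nat j) / fact n * ((b - 1 + of_nat n) * rGamma (b + of_nat n))" .
  then show "fps_nth (fps_X * fps_deriv (hyp p q b) + fps_const (b - 1) * hyp p q b) n =
    fps_nth (hyp p q (b - 1)) n" unfolding r by (simp add: hyp_nth)
qed

lemma hyp_raise: "fps_const p * hyp (p + q) q b = fps_const p * hyp p q b + fps_const q * fps_X * fps_deriv (hyp p q b)"
proof (rule fps_ext)
  fix n
  have "fps_nth (fps_const q * fps_X * fps_deriv (hyp p q b)) n = q * of_nat n * fps_nth (hyp p q b) n"
    by (cases n) (simp_all add: fps_mult_fps_X_deriv_shift mult.assoc)
  then have "fps_nth (fps_const p * hyp p q b + fps_const q * fps_X * fps_deriv (hyp p q b)) n
     = ((\<Prod>j<n. p + q * of_nat j) * (p + q * of_nat n)) * rGamma (b + of_nat n) / fact n"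
    by (simp add: hyp_nth algebra_simps add_divide_distrib)
  then show "fps_nth (fps_const p * hyp (p + q) q b) n =
    fps_nth (fps_const p * hyp p q b + fps_const q * fps_X * fps_deriv (hyp p q b)) n"
    unfolding prod_shift_hyp[symmetric] by (simp add: hyp_nth)
qed

text \<open>Differentiation moves \<open>(p, b)\<close> to \<open>(p + q, b + 1)\<close>;
  \<open>hyp_lower\<close> brings \<open>b + 1\<close> back to \<open>b\<close>, and
  \<open>hyp_raise\<close> expresses \<open>p + q\<close> through \<open>p\<close>. For
  \<open>q = 1\<close> this is Kummer's equation, for \<open>p = 1\<close>, \<open>q = 0\<close> the
  Bessel equation in the variable \<open>s\<close>.\<close>

lemma hyp_ode:
  "fps_X * fps_deriv (fps_deriv (hyp p q b)) + fps_const b * fps_deriv (hyp p q b) =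
   fps_const p * hyp p q b + fps_const q * fps_X * fps_deriv (hyp p q b)"
proof -
  have "fps_X * fps_deriv (fps_deriv (hyp p q b)) + fps_const b * fps_deriv (hyp p q b)
    = fps_const p * (fps_X * fps_deriv (hyp (p + q) q (b + 1)) + fps_const (b + 1 - 1) * hyp (p + q) q (b + 1))"
    by (simp add: hyp_deriv algebra_simps)
  also have "\<dots> = fps_const p * hyp (p + q) q b"
    by (subst hyp_lower) simp
  finally show ?thesis unfolding hyp_raise .
qed

text \<open>From \<open>rGamma z = z * rGamma (z + 1)\<close>: as soon as
  \<open>norm (b + n) \<ge> 1 / L\<close>, each further step gains a factor \<open>L\<close>. The
  finitely many earlier indices are controlled by compactness, uniformly in
  \<open>b\<close>.\<close>

lemma rGamma_decay:
  fixes B L :: real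
  assumes "L > 0"
  obtains C where "C > 0" "\<And>b n. norm b \<le> B \<Longrightarrow> norm (rGamma (b + of_nat n) :: complex) \<le> C * L ^ n"
proof -
  obtain n0 :: nat where n0: "of_nat n0 \<ge> B + 1 / L" using real_arch_simple by blast
  have "compact ((rGamma :: complex \<Rightarrow> complex) ` cball 0 (B + n0))"
    by (intro compact_continuous_image continuous_on_rGamma) auto
  then have "bounded ((rGamma :: complex \<Rightarrow> complex) ` cball 0 (B + n0))" by (rule compact_imp_bounded)
  then obtain C0 where C0: "C0 > 0" "\<And>z. norm z \<le> B + n0 \<Longrightarrow> norm (rGamma z :: complex) \<le> C0"
    unfolding bounded_pos by (auto simp: dist_norm)
  \<comment> \<open>Chosen so that \<open>D * L ^ n \<ge> 1\<close> for all
    \<open>n \<le> n0\<close>; the constant compactness bound then already has the required form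
    there, also when \<open>L\<close> is small.\<close>
  define D where "D = max 1 ((1 / L) ^ n0)"
  have D: "1 \<le> D * L ^ n" if "n \<le> n0" for n
  proof (cases "L \<le> 1")
    case True
    have "1 = (1 / L) ^ n * L ^ n" using assms by (simp add: power_divide)
    also have "\<dots> \<le> (1 / L) ^ n0 * L ^ n" using that True assms
      by (intro mult_right_mono power_increasing) auto
    also have "\<dots> \<le> D * L ^ n" using assms by (intro mult_right_mono) (auto simp: D_def)
    finally show ?thesis .
  next
    case False
    have "1 * 1 \<le> D * L ^ n" using False assms by (intro mult_mono one_le_power) (auto simp: D_def)
    then show ?thesis by simp
  qed
  have small: "norm (rGamma (b + of_nat n) :: complex) \<le> C0 * D * L ^ n" if "norm b \<le> B" "n \<le> n0" for b n
  proof -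
    have "norm (b + of_nat n) \<le> B + n0"
      using norm_triangle_ineq[of b "of_nat n"] that by simp
    then have "norm (rGamma (b + of_nat n) :: complex) \<le> C0 * 1" using C0 by simp
    also have "\<dots> \<le> C0 * (D * L ^ n)" using D that C0 by (intro mult_left_mono) auto
    finally show ?thesis by (simp add: mult.assoc)
  qed
  have "norm (rGamma (b + of_nat n) :: complex) \<le> C0 * D * L ^ n" if b: "norm b \<le> B" for b n
  proof (induction n)
    case 0 then show ?case using small[OF b, of 0] by simp
  next
    case (Suc n)
    show ?case
    proof (cases "Suc n \<le> n0")
      case True then show ?thesis using small[OF b] by blast
    next
      case False
      then have n: "real n \<ge> B + 1 / L" using n0 by linarith
      have "1 / L \<le> norm (b + of_nat n)"
        using norm_triangle_ineq2[of "of_nat n" "- b"] b n by (simp add: add.commute)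
      moreover have "rGamma (b + of_nat n) = (b + of_nat n) * rGamma (b + of_nat (Suc n))"
        using rGamma_plus1[of "b + of_nat n"] by (simp add: algebra_simps)
      ultimately have "(1 / L) * norm (rGamma (b + of_nat (Suc n))) \<le> norm (rGamma (b + of_nat n))"
        using mult_right_mono[of "1 / L" "norm (b + of_nat n)" "norm (rGamma (b + of_nat (Suc n)))"]
        by (simp add: norm_mult del: of_nat_Suc)
      also note Suc
      finally show ?thesis using assms by (simp add: field_simps)
    qed
  qed
  moreover have "C0 * D > 0" using C0 by (simp add: D_def)
  ultimately show ?thesis using that by blast
qed

lemma hyp_prod_bound:
  fixes p q :: complex
  assumes "norm p \<le> L" "norm q \<le> L"
  shows "norm (\<Prod>j<n. p + q * of_nat j) \<le> L ^ n * fact n"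
proof (induction n)
  case (Suc n)
  have L: "L \<ge> 0" using assms(1) norm_ge_zero order_trans by blast
  have "norm (p + q * of_nat n) \<le> L + L * real n"
    using norm_triangle_ineq[of p "q * of_nat n"] assms mult_right_mono[OF assms(2), of "real n"]
    by (simp add: norm_mult)
  then have "norm (p + q * of_nat n) \<le> L * real (Suc n)" by (simp add: algebra_simps)
  then have "norm (\<Prod>j<Suc n. p + q * of_nat j) \<le> (L ^ n * fact n) * (L * real (Suc n))"
    using Suc L by (auto simp: norm_mult simp del: of_nat_Suc intro!: mult_mono)
  also have "\<dots> = L ^ Suc n * fact (Suc n)" by (simp add: algebra_simps)
  finally show ?case .
qed auto

lemma hyp_nth_bound:
  fixes B L r :: real
  assumes "L \<ge> 0" "r > 0"
  obtains C where "C > 0" "\<And>p q b n. norm p \<le> L \<Longrightarrow> norm q \<le> L \<Longrightarrow> norm b \<le> B \<Longrightarrow>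
     norm (fps_nth (hyp p q b) n) \<le> C * r ^ n"
proof -
  \<comment> \<open>In the product bound \<open>(L + 1) ^ n * fact n\<close> the factorial cancels
    against the one of the series, and the power is absorbed by letting \<open>rGamma\<close> decay
    at rate \<open>r / (L + 1)\<close>. The shift by 1 keeps the denominator positive for
    \<open>L = 0\<close>.\<close>
  obtain C where C: "C > 0" "\<And>b n. norm b \<le> B \<Longrightarrow> norm (rGamma (b + of_nat n) :: complex) \<le> C * (r / (L + 1)) ^ n"
    using rGamma_decay[of "r / (L + 1)" B] assms by auto
  show ?thesis
  proof (rule that[OF C(1)])
    fix p q b :: complex and n
    assume *: "norm p \<le> L" "norm q \<le> L" "norm b \<le> B"
    have "norm (fps_nth (hyp p q b) n) = norm (\<Prod>j<n. p + q * of_nat j) * norm (rGamma (b + of_nat n)) / fact n"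
      by (simp add: hyp_nth norm_mult norm_divide)
    also have "\<dots> \<le> ((L + 1) ^ n * fact n) * (C * (r / (L + 1)) ^ n) / fact n"
      using * assms by (intro divide_right_mono mult_mono C hyp_prod_bound) auto
    also have "\<dots> = C * r ^ n" using assms by (simp add: power_divide)
    finally show "norm (fps_nth (hyp p q b) n) \<le> C * r ^ n" .
  qed
qed

lemma entire_hyp: "entire_fps (hyp p q b)"
proof (rule entire_fpsI)
  fix L :: real assume "L > 0"
  then show "\<exists>C. \<forall>n. norm (fps_nth (hyp p q b) n) \<le> C * L ^ n"
    by (rule_tac hyp_nth_bound[of "max (norm p) (norm q)" L "norm b"])
      (simp_all add: le_max_iff_disj, blast intro: max.cobounded1 max.cobounded2)
qed

lemma hyp_bounded:
  fixes B L r :: real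
  assumes "L \<ge> 0"
  obtains C where "C > 0" "\<And>p q b z. norm p \<le> L \<Longrightarrow> norm q \<le> L \<Longrightarrow> norm b \<le> B \<Longrightarrow> norm z \<le> r \<Longrightarrow>
     norm (eval_fps (hyp p q b) z) \<le> C"
proof -
  define r' where "r' = \<bar>r\<bar> + 1"
  have "1 / (2 * r') > 0" by (simp add: r'_def add_nonneg_pos)
  then obtain C where C: "C > 0" "\<And>p q b n. norm p \<le> L \<Longrightarrow> norm q \<le> L \<Longrightarrow> norm b \<le> B \<Longrightarrow>
     norm (fps_nth (hyp p q b) n) \<le> C * (1 / (2 * r')) ^ n"
    using hyp_nth_bound[OF assms, of "1 / (2 * r')" B] by blast
  show ?thesis
  proof (rule that[of "2 * C"])
    fix p q b z :: complex
    assume *: "norm p \<le> L" "norm q \<le> L" "norm b \<le> B" "norm z \<le> r"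
    have r': "r' > 0" by (simp add: r'_def add_nonneg_pos)
    show "norm (eval_fps (hyp p q b) z) \<le> 2 * C"
    proof (rule eval_fps_bound)
      show "norm z \<le> r'" using * by (simp add: r'_def)
      show "norm (fps_nth (hyp p q b) n) * r' ^ n \<le> C / 2 ^ n" for n
      proof -
        have "norm (fps_nth (hyp p q b) n) * r' ^ n \<le> C * (1 / (2 * r')) ^ n * r' ^ n"
          using C * r' by (intro mult_right_mono) auto
        also have "\<dots> = C / 2 ^ n" using r' by (simp add: power_divide power_mult_distrib)
        finally show ?thesis .
      qed
    qed (use C in auto)
  qed (use C in auto)
qed

text \<open>
  With \<open>u\<^sup>2 = 1 / \<eta>\<close>, \<open>y = z\<^sup>2\<close> and \<open>s = u\<^sup>2 z\<^sup>2 / 4\<close> this is the series in \<open>s\<close> of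
  \<open>exp (- y / 2) M(u\<^sup>2/4 + b/2, b, y) / \<Gamma>(b)\<close>; for \<open>\<eta> = 0\<close> it degenerates to the Bessel series.
\<close>

definition kum :: "complex \<Rightarrow> complex \<Rightarrow> complex fps" where
  "kum \<eta> b = fps_exp (- 2 * \<eta>) * hyp (1 + 2 * b * \<eta>) (4 * \<eta>) b"

abbreviation bes :: "complex \<Rightarrow> complex fps" where "bes b \<equiv> hyp 1 0 b"

lemma kum_0: "kum 0 b = bes b" by (simp add: kum_def)

lemma entire_kum: "entire_fps (kum \<eta> b)"
  unfolding kum_def by (intro entire_fps_intros entire_hyp)

lemma eval_kum: "eval_fps (kum \<eta> b) s = exp (- 2 * \<eta> * s) * eval_fps (hyp (1 + 2 * b * \<eta>) (4 * \<eta>) b) s"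
  unfolding kum_def by (subst eval_mult_entire) (auto intro: entire_hyp fps_conv_radius_exp)

text \<open>Conjugation by \<open>exp (- 2 * \<eta> * s)\<close> removes both terms of Kummer's
  equation that are linear in \<open>\<eta>\<close>. Only \<open>4 * \<eta>\<^sup>2 * s\<close>
  remains; in terms of \<open>z\<close>, after multiplication by \<open>u\<^sup>2\<close>, the right
  side becomes \<open>u\<^sup>2 + z\<^sup>2\<close>, which is where \<open>f(z) = z\<^sup>2\<close>
  comes from.\<close>

lemma kum_ode:
  "fps_X * fps_deriv (fps_deriv (kum \<eta> b)) + fps_const b * fps_deriv (kum \<eta> b) =
   (1 + fps_const (4 * \<eta>\<^sup>2) * fps_X) * kum \<eta> b"
proof -
  define C where "C = hyp (1 + 2 * b * \<eta>) (4 * \<eta>) b"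
  define e where "e = fps_exp (- 2 * \<eta>)"
  define h where "h = fps_const \<eta>"
  have h0: "fps_deriv h = 0" by (simp add: h_def)
  have e1: "fps_deriv e = - (fps_const 2 * h * e)"
    by (simp add: e_def h_def fps_const_neg[symmetric] del: fps_const_neg)
  have e2: "fps_const (1 + 2 * b * \<eta>) = 1 + fps_const 2 * fps_const b * h" "fps_const (4 * \<eta>) = fps_const 4 * h"
     "fps_const (4 * \<eta>\<^sup>2) = fps_const 4 * h * h"
    unfolding fps_const_1_eq_1[symmetric] by (simp_all add: h_def power2_eq_square)
  have ode: "fps_X * fps_deriv (fps_deriv C) + fps_const b * fps_deriv C =
     (1 + fps_const 2 * fps_const b * h) * C + fps_const 4 * h * fps_X * fps_deriv C"
    unfolding C_def hyp_ode e2 ..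
  have k: "kum \<eta> b = e * C" by (simp add: kum_def e_def C_def)
  have c4: "fps_const 4 = fps_const 2 * fps_const (2::complex)" "fps_const 2 = 1 + (1::complex fps)"
    by (simp_all add: fps_const_1_eq_1[symmetric] del: fps_const_1_eq_1)
  have d: "fps_deriv (e * C) = e * (fps_deriv C - fps_const 2 * h * C)"
    by (simp add: e1 algebra_simps)
  have dd: "fps_deriv (fps_deriv (e * C)) =
     e * (fps_deriv (fps_deriv C) - fps_const 4 * h * fps_deriv C + fps_const 4 * h * h * C)"
    unfolding d unfolding c4 by (simp add: e1 h0 c4 algebra_simps)
  have "fps_X * fps_deriv (fps_deriv (e * C)) + fps_const b * fps_deriv (e * C)
     = e * ((fps_X * fps_deriv (fps_deriv C) + fps_const b * fps_deriv C) - fps_const 4 * h * fps_X * fps_deriv C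
         + fps_const 4 * h * h * fps_X * C - fps_const 2 * fps_const b * h * C)"
    by (subst dd, subst d) (simp add: algebra_simps)
  also have "\<dots> = (1 + fps_const 4 * h * h * fps_X) * (e * C)"
    unfolding ode by (simp add: algebra_simps)
  finally show ?thesis unfolding k e2 .
qed

lemma bes_deriv: "fps_deriv (bes b) = bes (b + 1)"
  using hyp_deriv[of 1 0 b] by simp

lemma bes_lower: "fps_X * bes (b + 1) = bes (b - 1) - fps_const (b - 1) * bes b"
  using hyp_lower[of 1 0 b] unfolding bes_deriv by (simp add: algebra_simps)

text \<open>The Wronskian of \<open>I\<close> of orders \<open>b - 1\<close> and
  \<open>1 - b\<close> with the powers stripped off. Its derivative vanishes by the Bessel
  recurrences, and its constant term is given by the reflection formula.\<close>

lemma bes_wronskian: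
  "bes b * bes (1 - b) - fps_X * bes (b + 1) * bes (2 - b) = fps_const (sin (of_real pi * b) / of_real pi)"
proof -
  define B0 B1 C0 C1 where "B0 = bes b" and "B1 = bes (b + 1)" and "C0 = bes (1 - b)" and "C1 = bes (2 - b)"
  have d0: "fps_deriv B0 = B1" "fps_deriv C0 = C1"
    unfolding B0_def B1_def C0_def C1_def using bes_deriv[of b] bes_deriv[of "1 - b"]
    by (simp_all add: algebra_simps)
  have d1: "fps_X * fps_deriv B1 = B0 - fps_const b * B1"
     "fps_X * fps_deriv C1 = C0 - fps_const (1 - b) * C1"
    unfolding B0_def B1_def C0_def C1_def bes_deriv
    using bes_lower[of "b + 1"] bes_lower[of "2 - b"] by (simp_all add: algebra_simps)
  have cc: "fps_const (1 - b) = 1 - fps_const b" by (simp add: fps_const_1_eq_1[symmetric] del: fps_const_1_eq_1)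
  have "fps_deriv (B0 * C0 - fps_X * B1 * C1) = B0 * C1 + B1 * C0 - B1 * C1
      - (fps_X * fps_deriv B1) * C1 - B1 * (fps_X * fps_deriv C1)"
    by (simp add: d0 algebra_simps)
  also have "\<dots> = 0" unfolding d1 cc by (simp add: algebra_simps)
  finally have "B0 * C0 - fps_X * B1 * C1 = fps_const (fps_nth (B0 * C0 - fps_X * B1 * C1) 0)"
    by (simp only: fps_deriv_eq_0_iff)
  also have "fps_nth (B0 * C0 - fps_X * B1 * C1) 0 = rGamma b * rGamma (1 - b)"
    by (simp add: B0_def C0_def hyp_nth mult.assoc)
  also have "\<dots> = sin (of_real pi * b) / of_real pi" by (rule rGamma_reflection_complex)
  finally show ?thesis unfolding B0_def B1_def C0_def C1_def .
qed

section \<open>The differential system of the coefficient functions\<close>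

text \<open>
  The system for \<open>(F, G)\<close> that makes \<open>z K\<^sub>\<mu>(u z) F - (z/u) K\<^sub>\<mu>\<^sub>+\<^sub>1(u z) G\<close> a solution of
  the equation of the Kummer side, written in \<open>s = u\<^sup>2 z\<^sup>2 / 4\<close> for \<open>F\<close> and \<open>H = (2 / u\<^sup>2) G / z\<close>.
\<close>

definition slow_system :: "complex \<Rightarrow> complex \<Rightarrow> complex fps \<Rightarrow> complex fps \<Rightarrow> bool" where
  "slow_system \<eta> b F H \<longleftrightarrow>
     fps_const 2 * fps_X * fps_deriv H + H + fps_X * fps_deriv (fps_deriv F) + fps_const b * fps_deriv F
       = fps_const (4 * \<eta>\<^sup>2) * fps_X * F \<and>
     fps_const 2 * fps_deriv F + fps_X * fps_deriv (fps_deriv H) + fps_const (2 - b) * fps_deriv H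
       = fps_const (4 * \<eta>\<^sup>2) * fps_X * H"

lemma slow_system_add:
  assumes "slow_system \<eta> b F H" "slow_system \<eta> b F' H'"
  shows "slow_system \<eta> b (F + F') (H + H')"
proof -
  let ?l1 = "\<lambda>F H. fps_const 2 * fps_X * fps_deriv H + H + fps_X * fps_deriv (fps_deriv F) + fps_const b * fps_deriv F"
  let ?l2 = "\<lambda>F H. fps_const 2 * fps_deriv F + fps_X * fps_deriv (fps_deriv H) + fps_const (2 - b) * fps_deriv H"
  have "?l1 (F + F') (H + H') = ?l1 F H + ?l1 F' H'" "?l2 (F + F') (H + H') = ?l2 F H + ?l2 F' H'"
    by (simp_all add: algebra_simps)
  then show ?thesis using assms unfolding slow_system_def by (simp only: distrib_left)
qed

lemma slow_system_cmult:
  assumes "slow_system \<eta> b F H"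
  shows "slow_system \<eta> b (fps_const c * F) (fps_const c * H)"
proof -
  have "fps_const c * (fps_const 2 * fps_X * fps_deriv H + H + fps_X * fps_deriv (fps_deriv F) + fps_const b * fps_deriv F)
       = fps_const c * (fps_const (4 * \<eta>\<^sup>2) * fps_X * F)"
    "fps_const c * (fps_const 2 * fps_deriv F + fps_X * fps_deriv (fps_deriv H) + fps_const (2 - b) * fps_deriv H)
       = fps_const c * (fps_const (4 * \<eta>\<^sup>2) * fps_X * H)"
    using assms unfolding slow_system_def by simp_all
  moreover have "fps_deriv (fps_const c * g) = fps_const c * fps_deriv g" for g by simp
  ultimately show ?thesis unfolding slow_system_def
    by (simp only: distrib_left mult.assoc mult.left_commute[of "fps_const c"])
qed

text \<open>Up to the Wronskian factor this is the solution of the linear equations concluded in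
  \<open>slow_inverse\<close> when only the right side built from \<open>kum \<eta> b\<close> is
  present.\<close>

lemma slow_system_piece1:
  "slow_system \<eta> b (bes (1 - b) * kum \<eta> b) (- bes (2 - b) * kum \<eta> b)"
proof -
  define X where "X = (fps_X :: complex fps)"
  define j k e e1 e2 where "j = bes (1 - b)" and "k = bes (2 - b)" and "e = kum \<eta> b"
    and "e1 = fps_deriv e" and "e2 = fps_deriv e1"
  define \<beta> where "\<beta> = fps_const b"
  define w where "w = fps_const (4 * \<eta>\<^sup>2)"
  define k1 k2 where "k1 = fps_deriv k" and "k2 = fps_deriv k1"
  have c: "fps_const (1 - b) = 1 - \<beta>" "fps_const (2 - b) = 2 - \<beta>" "fps_const 2 = (2 :: complex fps)"
    by (simp_all add: \<beta>_def fps_const_1_eq_1[symmetric] numeral_fps_const del: fps_const_1_eq_1)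
  have j1: "fps_deriv j = k" unfolding j_def k_def using bes_deriv[of "1 - b"] by simp
  have Xk1: "X * k1 = j - (1 - \<beta>) * k"
    unfolding k1_def k_def j_def bes_deriv c(1)[symmetric] X_def using bes_lower[of "2 - b"] by (simp add: algebra_simps)
  \<comment> \<open>The second derivative is obtained by differentiating the first order relation,
    since the power series cannot be divided by \<open>X\<close>.\<close>
  have "fps_deriv (X * k1) = fps_deriv (j - (1 - \<beta>) * k)" unfolding Xk1 ..
  then have Xk2: "X * k2 = k - (2 - \<beta>) * k1"
    by (simp add: X_def k2_def k1_def[symmetric] j1 \<beta>_def algebra_simps)
  have Xe2: "X * e2 = (1 + w * X) * e - \<beta> * e1"
    using kum_ode[of \<eta> b] by (simp add: X_def e_def e1_def e2_def w_def \<beta>_def algebra_simps)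
  have d: "fps_deriv (j * e) = k * e + j * e1" "fps_deriv (k * e) = k1 * e + k * e1"
    by (simp_all add: j1 e1_def k1_def algebra_simps)
  have dd: "fps_deriv (fps_deriv (j * e)) = k1 * e + 2 * k * e1 + j * e2"
     "fps_deriv (fps_deriv (k * e)) = k2 * e + 2 * k1 * e1 + k * e2"
    unfolding d by (simp_all add: j1 e1_def[symmetric] e2_def[symmetric] k1_def[symmetric] k2_def[symmetric] algebra_simps)
  have m: "fps_deriv (- k * e) = - fps_deriv (k * e)" "fps_deriv (- fps_deriv (k * e)) = - fps_deriv (fps_deriv (k * e))"
    by simp_all
  \<comment> \<open>The terms are grouped so that \<open>X * k1\<close> and \<open>X * e2\<close>
    appear as units; after substituting the relations for them the claim is a polynomial
    identity.\<close>
  have "2 * X * (k1 * e + k * e1) + k * e = 2 * (X * k1) * e + 2 * X * k * e1 + k * e" by algebra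
  moreover have "X * (k1 * e + 2 * k * e1 + j * e2) + \<beta> * (k * e + j * e1)
      = (X * k1) * e + 2 * X * k * e1 + j * (X * e2) + \<beta> * (k * e + j * e1)" by algebra
  ultimately have 1: "2 * X * (- (k1 * e + k * e1)) + - k * e + X * (k1 * e + 2 * k * e1 + j * e2) + \<beta> * (k * e + j * e1)
      = w * X * (j * e)"
    unfolding Xk1 Xe2 by algebra
  have "X * (k2 * e + 2 * k1 * e1 + k * e2) + (2 - \<beta>) * (k1 * e + k * e1) =
     (X * k2) * e + 2 * (X * k1) * e1 + k * (X * e2) + (2 - \<beta>) * (k1 * e + k * e1)" by algebra
  then have 2: "2 * (k * e + j * e1) + X * (- (k2 * e + 2 * k1 * e1 + k * e2)) + (2 - \<beta>) * (- (k1 * e + k * e1))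
     = w * X * (- k * e)"
    unfolding Xk1 Xk2 Xe2 by algebra
  show ?thesis unfolding slow_system_def j_def[symmetric] k_def[symmetric] e_def[symmetric]
    X_def[symmetric] c w_def[symmetric] \<beta>_def[symmetric] m dd unfolding d using 1 2 by blast
qed

text \<open>The complementary solution, for the right side built from
  \<open>kum \<eta> (2 - b)\<close> alone.\<close>

lemma slow_system_piece2:
  "slow_system \<eta> b (- fps_X * bes (b + 1) * kum \<eta> (2 - b)) (bes b * kum \<eta> (2 - b))"
proof -
  define X where "X = (fps_X :: complex fps)"
  define m n e e1 e2 where "m = bes b" and "n = bes (b + 1)" and "e = kum \<eta> (2 - b)"
    and "e1 = fps_deriv e" and "e2 = fps_deriv e1"
  define \<beta> where "\<beta> = fps_const b"
  define w where "w = fps_const (4 * \<eta>\<^sup>2)"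
  define n1 where "n1 = fps_deriv n"
  define N where "N = X * n"
  have c: "fps_const (2 - b) = 2 - \<beta>" "fps_const 2 = (2 :: complex fps)"
    by (simp_all add: \<beta>_def numeral_fps_const)
  have m1: "fps_deriv m = n" unfolding m_def n_def by (rule bes_deriv)
  have Xn1: "X * n1 = m - \<beta> * n"
    unfolding n1_def m_def n_def bes_deriv \<beta>_def X_def using bes_lower[of "b + 1"] by (simp add: algebra_simps)
  have Xe2: "X * e2 = (1 + w * X) * e - (2 - \<beta>) * e1"
    using kum_ode[of \<eta> "2 - b"] unfolding c by (simp add: X_def e_def e1_def e2_def w_def algebra_simps)
  have N1: "fps_deriv N = m + (1 - \<beta>) * n"
  proof -
    have "fps_deriv N = n + X * n1" by (simp add: N_def X_def n1_def)
    then show ?thesis unfolding Xn1 by (simp add: algebra_simps)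
  qed
  have N2: "fps_deriv (fps_deriv N) = n + (1 - \<beta>) * n1"
    unfolding N1 by (simp add: m1 n1_def \<beta>_def algebra_simps)
  have d: "fps_deriv (N * e) = (m + (1 - \<beta>) * n) * e + N * e1" "fps_deriv (m * e) = n * e + m * e1"
    unfolding N1[symmetric] by (simp_all add: m1 e1_def algebra_simps)
  have "fps_deriv (fps_deriv (N * e)) = fps_deriv (fps_deriv N) * e + 2 * fps_deriv N * e1 + N * e2"
    by (simp add: e1_def[symmetric] e2_def[symmetric] algebra_simps)
  then have dd1: "fps_deriv (fps_deriv (N * e)) = (n + (1 - \<beta>) * n1) * e + 2 * (m + (1 - \<beta>) * n) * e1 + N * e2"
    unfolding N2 unfolding N1 by (simp only: mult.assoc)
  have dd2: "fps_deriv (fps_deriv (m * e)) = n1 * e + 2 * n * e1 + m * e2"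
    unfolding d by (simp add: m1 e1_def[symmetric] e2_def[symmetric] n1_def[symmetric] algebra_simps)
  note dd = dd1 dd2
  have mm: "fps_deriv (- (N * e)) = - fps_deriv (N * e)" "fps_deriv (- fps_deriv (N * e)) = - fps_deriv (fps_deriv (N * e))"
    by simp_all
  have "X * ((n + (1 - \<beta>) * n1) * e + 2 * (m + (1 - \<beta>) * n) * e1 + N * e2) =
      (N + (1 - \<beta>) * (X * n1)) * e + 2 * X * (m + (1 - \<beta>) * n) * e1 + N * (X * e2)"
    unfolding N_def by algebra
  then have 1: "2 * X * (n * e + m * e1) + m * e + X * (- ((n + (1 - \<beta>) * n1) * e + 2 * (m + (1 - \<beta>) * n) * e1 + N * e2))
      + \<beta> * (- ((m + (1 - \<beta>) * n) * e + N * e1)) = w * X * (- (N * e))"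
    unfolding Xn1 Xe2 N_def by algebra
  have "X * (n1 * e + 2 * n * e1 + m * e2) = (X * n1) * e + 2 * X * n * e1 + m * (X * e2)" by algebra
  then have 2: "2 * (- ((m + (1 - \<beta>) * n) * e + N * e1)) + X * (n1 * e + 2 * n * e1 + m * e2)
      + (2 - \<beta>) * (n * e + m * e1) = w * X * (m * e)"
    unfolding Xn1 Xe2 N_def by algebra
  have F: "- X * n * e = - (N * e)" by (simp add: N_def)
  show ?thesis unfolding slow_system_def m_def[symmetric] n_def[symmetric] e_def[symmetric]
    X_def[symmetric] F c w_def[symmetric] \<beta>_def[symmetric] mm dd unfolding d using 1 2 by blast
qed

text \<open>Cramer's rule: the prefactor is the reciprocal of the determinant in
  \<open>bes_wronskian\<close>. The weight \<open>\<rho>\<close> of the second Kummer solution is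
  left free, because the system is linear and holds for every \<open>\<rho>\<close>.\<close>

definition slowF :: "complex \<Rightarrow> complex \<Rightarrow> complex \<Rightarrow> complex fps" where
  "slowF \<rho> \<eta> b = fps_const (of_real pi / sin (of_real pi * b)) *
     (bes (1 - b) * kum \<eta> b + fps_const \<rho> * (- fps_X * bes (b + 1) * kum \<eta> (2 - b)))"

definition slowH :: "complex \<Rightarrow> complex \<Rightarrow> complex \<Rightarrow> complex fps" where
  "slowH \<rho> \<eta> b = fps_const (of_real pi / sin (of_real pi * b)) *
     (- bes (2 - b) * kum \<eta> b + fps_const \<rho> * (bes b * kum \<eta> (2 - b)))"

lemma slow_system_slow: "slow_system \<eta> b (slowF \<rho> \<eta> b) (slowH \<rho> \<eta> b)"
  unfolding slowF_def slowH_def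
  by (intro slow_system_cmult slow_system_add slow_system_piece1 slow_system_piece2)

lemma slow_system_coeffs:
  assumes "slow_system \<eta> b F H"
  shows "(2 * of_nat k + 1) * fps_nth H k + of_nat (Suc k) * (of_nat k + b) * fps_nth F (Suc k)
       = 4 * \<eta>\<^sup>2 * (if k = 0 then 0 else fps_nth F (k - 1))"
    and "2 * of_nat (Suc k) * fps_nth F (Suc k) + of_nat (Suc k) * (of_nat k + 2 - b) * fps_nth H (Suc k)
       = 4 * \<eta>\<^sup>2 * (if k = 0 then 0 else fps_nth H (k - 1))"
proof -
  have X: "fps_nth (fps_X * fps_deriv g) k = of_nat k * fps_nth g k" for g :: "complex fps"
    by (cases k) simp_all
  have X': "fps_nth (fps_const c * fps_X * g) k = c * (if k = 0 then 0 else fps_nth g (k - 1))" for c :: complex and g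
    by (cases k) (simp_all add: mult.assoc)
  have X'': "fps_nth (fps_const c * fps_X * fps_deriv g) k = c * of_nat k * fps_nth g k" for c :: complex and g
    by (cases k) (simp_all add: mult.assoc)
  have "fps_nth (fps_const 2 * fps_X * fps_deriv H + H + fps_X * fps_deriv (fps_deriv F) + fps_const b * fps_deriv F) k
      = fps_nth (fps_const (4 * \<eta>\<^sup>2) * fps_X * F) k"
    using assms unfolding slow_system_def by simp
  then show "(2 * of_nat k + 1) * fps_nth H k + of_nat (Suc k) * (of_nat k + b) * fps_nth F (Suc k)
       = 4 * \<eta>\<^sup>2 * (if k = 0 then 0 else fps_nth F (k - 1))"
    unfolding fps_add_nth X'' unfolding X X' by (simp add: algebra_simps)
  have "fps_nth (fps_const 2 * fps_deriv F + fps_X * fps_deriv (fps_deriv H) + fps_const (2 - b) * fps_deriv H) k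
      = fps_nth (fps_const (4 * \<eta>\<^sup>2) * fps_X * H) k"
    using assms unfolding slow_system_def by simp
  then show "2 * of_nat (Suc k) * fps_nth F (Suc k) + of_nat (Suc k) * (of_nat k + 2 - b) * fps_nth H (Suc k)
       = 4 * \<eta>\<^sup>2 * (if k = 0 then 0 else fps_nth H (k - 1))"
    unfolding fps_add_nth X X' by (simp add: algebra_simps)
qed

section \<open>Coefficients of the polynomials\<close>

definition acoef :: "nat \<Rightarrow> complex \<Rightarrow> nat \<Rightarrow> complex" where
  "acoef s b k = coeff (A_poly (b - 1) s) (2 * k)"

text \<open>\<open>B_s\<close> is odd; the numbering is that of \<open>B_s(z) / z\<close> in powers
  of \<open>z\<^sup>2\<close>, the form in which the second bracket occurs, its remainder being
  \<open>z * h2\<close>.\<close>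

definition bcoef :: "nat \<Rightarrow> complex \<Rightarrow> nat \<Rightarrow> complex" where
  "bcoef s b k = coeff (B_poly (b - 1) s) (2 * k + 1)"

lemma acoef_0: "acoef 0 b k = (if k = 0 then 1 else 0)"
  by (simp add: acoef_def)

lemma acoef_Suc_0: "acoef (Suc s) b 0 = 0"
  using A_poly_Suc_at_0[of "b - 1" s] by (simp add: acoef_def poly_0_coeff_0)

text \<open>The derivative contributes \<open>(2k + 2)(2k + 1)\<close> and the term with
  \<open>2 \<mu> + 1 = 2 b - 1\<close> contributes \<open>(2k + 2)(2b - 1)\<close>; together they
  give \<open>4 (k + 1)(k + b)\<close>. This is the shape of the first relation in
  \<open>slow_system_coeffs\<close>.\<close>

lemma bcoef_rec:
  "2 * (2 * of_nat k + 1) * bcoef s b k = (if k = 0 then 0 else acoef s b (k - 1))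
     - 4 * of_nat (Suc k) * (of_nat k + b) * acoef s b (Suc k)"
proof -
  define p where "p = A_poly (b - 1) s"
  have n0: "(2 * of_nat k + 1 :: complex) \<noteq> 0"
    using of_nat_neq_0[of "2 * k", where 'a = complex] by (simp add: add.commute)
  have sh: "coeff (pCons 0 (pCons 0 p)) (2 * k) = (if k = 0 then 0 else coeff p (2 * (k - 1)))"
    by (cases k) (simp_all add: coeff_pCons)
  have fr: "D * x = D * P + Q" if "x = P + Q / D" "D \<noteq> 0" for D x P Q :: complex
    using that by (simp add: field_simps)
  have "2 * coeff (B_poly (b - 1) s) (2 * k + 1) =
     - (of_nat (2 * k + 2) * coeff p (2 * k + 2)) + ((if k = 0 then 0 else coeff p (2 * (k - 1)))
       - (2 * (b - 1) + 1) * (of_nat (2 * k + 2) * coeff p (2 * k + 2))) / (2 * of_nat k + 1)"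
    unfolding B_poly_def B_of_A_def p_def[symmetric]
    by (simp add: coeff_pderiv coeff_antideriv0 coeff_div_z sh)
      (simp add: algebra_simps add_divide_distrib diff_divide_distrib)
  then have "(2 * of_nat k + 1) * (2 * coeff (B_poly (b - 1) s) (2 * k + 1)) =
     (2 * of_nat k + 1) * - (of_nat (2 * k + 2) * coeff p (2 * k + 2)) + ((if k = 0 then 0 else coeff p (2 * (k - 1)))
       - (2 * (b - 1) + 1) * (of_nat (2 * k + 2) * coeff p (2 * k + 2)))"
    using n0 by (rule fr)
  then show ?thesis unfolding bcoef_def acoef_def p_def[symmetric]
    by (simp add: algebra_simps)
qed

text \<open>Here \<open>(2 b - 1) - (2k + 3) = - 2 (k + 2 - b)\<close>. The relation reaches only
  the coefficients of positive index; the constant one is fixed separately by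
  \<open>acoef_Suc_0\<close>.\<close>

lemma acoef_rec:
  "4 * of_nat (Suc k) * acoef (Suc s) b (Suc k) = (if k = 0 then 0 else bcoef s b (k - 1))
     - 4 * of_nat (Suc k) * (of_nat k + 2 - b) * bcoef s b (Suc k)"
proof -
  define q where "q = B_poly (b - 1) s"
  have n0: "(2 * of_nat k + 2 :: complex) \<noteq> 0"
    using of_nat_neq_0[of "2 * k + 1", where 'a = complex] by (simp add: add.commute)
  have c0: "coeff [:c:] (Suc (Suc (2 * k))) = 0" for c :: complex by (simp add: coeff_pCons)
  have sh: "coeff (pCons 0 q) (2 * k) = (if k = 0 then 0 else coeff q (2 * (k - 1) + 1))"
    by (cases k) (simp_all add: coeff_pCons)
  have fr: "D * x = D * P + Q" if "x = P + Q / D" "D \<noteq> 0" for D x P Q :: complex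
    using that by (simp add: field_simps)
  have A: "A_poly (b - 1) (Suc s) = A_of_B (b - 1) q" by (simp add: q_def B_poly_def)
  have "2 * coeff (A_poly (b - 1) (Suc s)) (2 * k + 2) =
     (2 * (b - 1) + 1) * coeff q (Suc (2 * k + 2)) - of_nat (Suc (2 * k + 2)) * coeff q (Suc (2 * k + 2))
     + (if k = 0 then 0 else coeff q (2 * (k - 1) + 1)) / (2 * of_nat k + 2)"
    unfolding A A_of_B_def Let_def
    by (simp add: coeff_pderiv coeff_antideriv0 coeff_div_z sh c0)
      (simp add: algebra_simps add_divide_distrib diff_divide_distrib)
  then have "(2 * of_nat k + 2) * (2 * coeff (A_poly (b - 1) (Suc s)) (2 * k + 2)) =
     (2 * of_nat k + 2) * ((2 * (b - 1) + 1) * coeff q (Suc (2 * k + 2)) - of_nat (Suc (2 * k + 2)) * coeff q (Suc (2 * k + 2)))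
     + (if k = 0 then 0 else coeff q (2 * (k - 1) + 1))"
    using n0 by (rule fr)
  then show ?thesis unfolding bcoef_def acoef_def q_def[symmetric]
    by (simp add: algebra_simps eval_nat_numeral)
qed

section \<open>Bootstrapping\<close>

text \<open>
  \<open>poly_order D p g\<close>: the power series with coefficients \<open>g u b k\<close> is \<open>O(u\<^sup>p)\<close> on every disc,
  uniformly in \<open>b \<in> D\<close>.
\<close>

definition poly_order :: "complex set \<Rightarrow> int \<Rightarrow> (real \<Rightarrow> complex \<Rightarrow> nat \<Rightarrow> complex) \<Rightarrow> bool" where
  "poly_order D p g \<longleftrightarrow> (\<forall>R>0. \<exists>C u0. u0 \<ge> 1 \<and>
     (\<forall>u\<ge>u0. \<forall>b\<in>D. \<forall>k. norm (g u b k) * R ^ k \<le> C * u powi p))"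

section \<open>Closure properties of the uniform growth classes\<close>

lemma poly_orderE:
  assumes "poly_order D p g" "R > 0"
  obtains C u0 where "u0 \<ge> 1" "C \<ge> 0" "\<forall>u b k. u \<ge> u0 \<longrightarrow> b \<in> D \<longrightarrow> norm (g u b k) * R ^ k \<le> C * u powi p"
proof -
  obtain C u0 where *: "u0 \<ge> 1" "\<And>u b k. u \<ge> u0 \<Longrightarrow> b \<in> D \<Longrightarrow> norm (g u b k) * R ^ k \<le> C * u powi p"
    using assms unfolding poly_order_def by meson
  show ?thesis
  proof (rule that[of u0 "max C 0"], goal_cases)
    case 3
    show ?case
    proof (intro allI impI)
    fix u b k assume "u \<ge> u0" "b \<in> D"
    then have "norm (g u b k) * R ^ k \<le> C * u powi p" using * by blast
    also have "\<dots> \<le> max C 0 * u powi p" using \<open>u \<ge> u0\<close> * by (intro mult_right_mono) auto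
    finally show "norm (g u b k) * R ^ k \<le> max C 0 * u powi p" .
    qed
  qed (use * in auto)
qed

lemma poly_order_add:
  assumes "poly_order D p g" "poly_order D p h"
  shows "poly_order D p (\<lambda>u b k. g u b k + h u b k)"
  unfolding poly_order_def
proof (intro allI impI)
  fix R :: real assume R: "R > 0"
  obtain C u0 where 1: "u0 \<ge> 1" "C \<ge> 0" "\<forall>u b k. u \<ge> u0 \<longrightarrow> b \<in> D \<longrightarrow> norm (g u b k) * R ^ k \<le> C * u powi p"
    using poly_orderE[OF assms(1) R] by metis
  note 1 = 1(1,2) 1(3)[rule_format]
  obtain C' u0' where 2: "u0' \<ge> 1" "C' \<ge> 0" "\<forall>u b k. u \<ge> u0' \<longrightarrow> b \<in> D \<longrightarrow> norm (h u b k) * R ^ k \<le> C' * u powi p"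
    using poly_orderE[OF assms(2) R] by metis
  note 2 = 2(1,2) 2(3)[rule_format]
  show "\<exists>C u0. u0 \<ge> 1 \<and> (\<forall>u\<ge>u0. \<forall>b\<in>D. \<forall>k. norm (g u b k + h u b k) * R ^ k \<le> C * u powi p)"
  proof (rule exI[of _ "C + C'"], rule exI[of _ "max u0 u0'"], intro conjI allI ballI impI)
    fix u b k assume *: "u \<ge> max u0 u0'" "b \<in> D"
    have "norm (g u b k + h u b k) * R ^ k \<le> norm (g u b k) * R ^ k + norm (h u b k) * R ^ k"
      using R norm_triangle_ineq[of "g u b k" "h u b k"] by (simp add: distrib_right[symmetric] mult_right_mono)
    also have "\<dots> \<le> (C + C') * u powi p" using 1(3)[of u b k] 2(3)[of u b k] * by (simp add: distrib_right)
    finally show "norm (g u b k + h u b k) * R ^ k \<le> (C + C') * u powi p" .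
  qed (use 1 in auto)
qed

text \<open>Multipliers may grow quadratically in \<open>k\<close>: since
  \<open>(k + 1)\<^sup>2 \<le> 4 ^ k\<close>, it suffices to use the hypothesis on the disc of
  radius \<open>4 * R\<close>. This is why \<open>poly_order\<close> quantifies over all
  radii.\<close>

lemma poly_order_mult:
  fixes p q :: int
  assumes "poly_order D p g"
    and "\<And>u b k. u \<ge> 1 \<Longrightarrow> b \<in> D \<Longrightarrow> norm (c u b k) \<le> K * (real k + 1)\<^sup>2 * u powi q"
  shows "poly_order D (p + q) (\<lambda>u b k. c u b k * g u b k)"
  unfolding poly_order_def
proof (intro allI impI)
  fix R :: real assume R: "R > 0"
  have R4: "4 * R > 0" using R by simp
  obtain C u0 where 1: "u0 \<ge> 1" "C \<ge> 0" "\<forall>u b k. u \<ge> u0 \<longrightarrow> b \<in> D \<longrightarrow> norm (g u b k) * (4 * R) ^ k \<le> C * u powi p"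
    using poly_orderE[OF assms(1) R4] by metis
  note 1 = 1(1,2) 1(3)[rule_format]
  show "\<exists>C u0. u0 \<ge> 1 \<and> (\<forall>u\<ge>u0. \<forall>b\<in>D. \<forall>k. norm (c u b k * g u b k) * R ^ k \<le> C * u powi (p + q))"
  proof (rule exI[of _ "\<bar>K\<bar> * C"], rule exI[of _ u0], intro conjI allI ballI impI)
    fix u b k assume *: "u \<ge> u0" "b \<in> D"
    then have u: "u \<ge> 1" "u > 0" using 1 by auto
    have "real k + 1 \<le> 2 ^ k" using less_exp[of k]
      by (metis Suc_leI of_nat_Suc of_nat_le_iff of_nat_numeral of_nat_power add.commute)
    then have "(real k + 1)\<^sup>2 \<le> (2 ^ k)\<^sup>2" by (intro power_mono) auto
    then have k2: "(real k + 1)\<^sup>2 \<le> 4 ^ k" by (simp flip: power_mult_distrib add: power2_eq_square)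
    have "norm (c u b k * g u b k) * R ^ k = norm (c u b k) * (norm (g u b k) * R ^ k)"
      by (simp add: norm_mult)
    also have "norm (c u b k) \<le> \<bar>K\<bar> * 4 ^ k * u powi q"
    proof -
      have "norm (c u b k) \<le> K * (real k + 1)\<^sup>2 * u powi q" using assms(2) u * by blast
      also have "\<dots> \<le> \<bar>K\<bar> * 4 ^ k * u powi q" using k2 u
        by (intro mult_right_mono mult_mono) auto
      finally show ?thesis .
    qed
    also have "(\<bar>K\<bar> * 4 ^ k * u powi q) * (norm (g u b k) * R ^ k) =
       (\<bar>K\<bar> * u powi q) * (norm (g u b k) * (4 * R) ^ k)"
      by (simp add: power_mult_distrib)
    also have "\<dots> \<le> (\<bar>K\<bar> * u powi q) * (C * u powi p)"
      using 1(3) * u by (intro mult_left_mono) auto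
    also have "\<dots> = \<bar>K\<bar> * C * u powi (p + q)" using u by (simp add: power_int_add)
    finally show "norm (c u b k * g u b k) * R ^ k \<le> \<bar>K\<bar> * C * u powi (p + q)"
      using R by (simp add: mult_right_mono)
  qed (use 1 in auto)
qed

text \<open>A shift of the coefficients costs one power of the radius, which goes into the constant
  and leaves the order in \<open>u\<close> untouched.\<close>

lemma poly_order_Suc:
  assumes "poly_order D p g"
  shows "poly_order D p (\<lambda>u b k. g u b (Suc k))"
  unfolding poly_order_def
proof (intro allI impI)
  fix R :: real assume R: "R > 0"
  obtain C u0 where 1: "u0 \<ge> 1" "C \<ge> 0" "\<forall>u b k. u \<ge> u0 \<longrightarrow> b \<in> D \<longrightarrow> norm (g u b k) * R ^ k \<le> C * u powi p"
    using poly_orderE[OF assms(1) R] by metis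
  note 1 = 1(1,2) 1(3)[rule_format]
  show "\<exists>C u0. u0 \<ge> 1 \<and> (\<forall>u\<ge>u0. \<forall>b\<in>D. \<forall>k. norm (g u b (Suc k)) * R ^ k \<le> C * u powi p)"
  proof (rule exI[of _ "C / R"], rule exI[of _ u0], intro conjI allI ballI impI)
    fix u b k assume "u \<ge> u0" "b \<in> D"
    then show "norm (g u b (Suc k)) * R ^ k \<le> C / R * u powi p"
      using 1(3)[of u b "Suc k"] R by (simp add: field_simps)
  qed (use 1 in auto)
qed

lemma poly_order_pred:
  assumes "poly_order D p g"
  shows "poly_order D p (\<lambda>u b k. if k = 0 then 0 else g u b (k - 1))"
  unfolding poly_order_def
proof (intro allI impI)
  fix R :: real assume R: "R > 0"
  obtain C u0 where 1: "u0 \<ge> 1" "C \<ge> 0" "\<forall>u b k. u \<ge> u0 \<longrightarrow> b \<in> D \<longrightarrow> norm (g u b k) * R ^ k \<le> C * u powi p"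
    using poly_orderE[OF assms(1) R] by metis
  note 1 = 1(1,2) 1(3)[rule_format]
  show "\<exists>C u0. u0 \<ge> 1 \<and> (\<forall>u\<ge>u0. \<forall>b\<in>D. \<forall>k. norm (if k = 0 then 0 else g u b (k - 1)) * R ^ k \<le> C * u powi p)"
  proof (rule exI[of _ "C * R"], rule exI[of _ u0], intro conjI allI ballI impI)
    fix u b k assume "u \<ge> u0" "b \<in> D"
    then show "norm (if k = 0 then 0 else g u b (k - 1)) * R ^ k \<le> C * R * u powi p"
      using 1(1,2) 1(3)[of u b "k - 1"] R by (cases k) (auto simp: field_simps)
  qed (use 1 in auto)
qed

lemma poly_order_cong:
  assumes "poly_order D p g" "\<And>u b k. u \<ge> 1 \<Longrightarrow> b \<in> D \<Longrightarrow> h u b k = g u b k"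
  shows "poly_order D p h"
  unfolding poly_order_def
proof (intro allI impI)
  fix R :: real assume R: "R > 0"
  obtain C u0 where 1: "u0 \<ge> 1" "C \<ge> 0" "\<forall>u b k. u \<ge> u0 \<longrightarrow> b \<in> D \<longrightarrow> norm (g u b k) * R ^ k \<le> C * u powi p"
    using poly_orderE[OF assms(1) R] by metis
  then have "norm (h u b k) * R ^ k \<le> C * u powi p" if "u \<ge> u0" "b \<in> D" for u b k
    using assms(2)[of u b k] that by simp
  then show "\<exists>C u0. u0 \<ge> 1 \<and> (\<forall>u\<ge>u0. \<forall>b\<in>D. \<forall>k. norm (h u b k) * R ^ k \<le> C * u powi p)"
    using 1(1) by blast
qed

lemma poly_order_from_Suc:
  assumes "poly_order D p (\<lambda>u b k. g u b (Suc k))" "\<And>u b. u \<ge> 1 \<Longrightarrow> b \<in> D \<Longrightarrow> g u b 0 = 0"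
  shows "poly_order D p g"
proof -
  have "poly_order D p (\<lambda>u b k. if k = 0 then 0 else g u b (Suc (k - 1)))"
    by (rule poly_order_pred[OF assms(1)])
  then show ?thesis
    by (rule poly_order_cong) (use assms(2) in \<open>auto simp: gr0_conv_Suc\<close>)
qed

lemma poly_order_mono:
  assumes "poly_order D p g" "p \<le> q"
  shows "poly_order D q g"
proof -
  have "poly_order D (p + (q - p)) (\<lambda>u b k. 1 * g u b k)"
  proof (rule poly_order_mult[OF assms(1), where K = 1])
    fix u :: real and b k assume "u \<ge> 1"
    then have "1 * 1 \<le> (real k + 1)\<^sup>2 * u powi (q - p)"
      using assms(2) by (intro mult_mono) (auto simp: power_int_def)
    then show "norm (1::complex) \<le> 1 * (real k + 1)\<^sup>2 * u powi (q - p)" by simp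
  qed
  then show ?thesis by simp
qed

lemma poly_order_diff:
  assumes "poly_order D p g" "poly_order D p h"
  shows "poly_order D p (\<lambda>u b k. g u b k - h u b k)"
proof -
  have "poly_order D (p + 0) (\<lambda>u b k. (- 1) * h u b k)"
    by (rule poly_order_mult[OF assms(2), where K = 1]) simp
  then have "poly_order D p (\<lambda>u b k. - h u b k)" by simp
  from poly_order_add[OF assms(1) this] show ?thesis by simp
qed

text \<open>Solved for \<open>h\<close>, the recursion has multipliers free of \<open>u\<close> and
  of polynomial growth in \<open>k\<close>, so the order is preserved.\<close>

lemma poly_order_step_h:
  assumes B: "D \<subseteq> cball 0 B" and g: "poly_order D p g"
    and rec: "\<And>u b k. u \<ge> 1 \<Longrightarrow> b \<in> D \<Longrightarrow> 2 * (2 * of_nat k + 1) * h u b k =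
       (if k = 0 then 0 else g u b (k - 1)) - 4 * of_nat (Suc k) * (of_nat k + b) * g u b (Suc k)"
  shows "poly_order D p h"
proof -
  have 1: "poly_order D (p + 0) (\<lambda>u b k. (1 / (2 * (2 * of_nat k + 1))) * (if k = 0 then 0 else g u b (k - 1)))"
  proof (rule poly_order_mult[OF poly_order_pred[OF g], where K = 1])
    fix u :: real and b :: complex and k :: nat
    have "norm (2 * (2 * of_nat k + 1) :: complex) = norm (of_nat (4 * k + 2) :: complex)"
      by (rule arg_cong[of _ _ norm]) simp
    then have n: "norm (2 * (2 * of_nat k + 1) :: complex) = 4 * real k + 2"
      unfolding norm_of_nat by simp
    have "1 / (4 * real k + 2) \<le> 1" by simp
    also have "\<dots> \<le> (real k + 1)\<^sup>2" by simp
    finally show "norm (1 / (2 * (2 * of_nat k + 1)) :: complex) \<le> 1 * (real k + 1)\<^sup>2 * u powi 0"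
      unfolding norm_divide n by simp
  qed
  have 2: "poly_order D (p + 0) (\<lambda>u b k. (2 * of_nat (Suc k) * (of_nat k + b) / (2 * of_nat k + 1)) * g u b (Suc k))"
  proof (rule poly_order_mult[OF poly_order_Suc[OF g], where K = "2 * (1 + \<bar>B\<bar>)"])
    fix u :: real and b :: complex and k :: nat
    assume "b \<in> D"
    then have b: "norm b \<le> \<bar>B\<bar>" using B by auto
    have "norm (2 * of_nat k + 1 :: complex) = norm (of_nat (2 * k + 1) :: complex)"
      by (rule arg_cong[of _ _ norm]) simp
    then have n: "norm (2 * of_nat k + 1 :: complex) \<ge> 1"
      by (simp only: norm_of_nat)
    have "norm (of_nat k + b) \<le> real k + \<bar>B\<bar>" using norm_triangle_ineq[of "of_nat k" b] b by simp
    also have "\<dots> \<le> (real k + 1) * (1 + \<bar>B\<bar>)" by (simp add: algebra_simps)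
    finally have *: "norm (of_nat k + b) \<le> (real k + 1) * (1 + \<bar>B\<bar>)" .
    have "norm (2 * of_nat (Suc k) * (of_nat k + b) / (2 * of_nat k + 1)) \<le> norm (2 * of_nat (Suc k) * (of_nat k + b)) / 1"
      unfolding norm_divide using n by (intro divide_left_mono) auto
    also have "\<dots> \<le> 2 * (real k + 1) * ((real k + 1) * (1 + \<bar>B\<bar>))"
      using * by (simp add: norm_mult mult_left_mono add.commute del: of_nat_Suc) (simp add: mult_left_mono add.commute)
    finally show "norm (2 * of_nat (Suc k) * (of_nat k + b) / (2 * of_nat k + 1)) \<le> 2 * (1 + \<bar>B\<bar>) * (real k + 1)\<^sup>2 * u powi 0"
      by (simp add: power2_eq_square algebra_simps)
  qed
  show ?thesis
  proof (rule poly_order_cong)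
    show "poly_order D p (\<lambda>u b k. (1 / (2 * (2 * of_nat k + 1))) * (if k = 0 then 0 else g u b (k - 1))
       - (2 * of_nat (Suc k) * (of_nat k + b) / (2 * of_nat k + 1)) * g u b (Suc k))"
      using poly_order_diff[OF 1 2] by simp
    fix u :: real and b :: complex and k :: nat
    assume *: "u \<ge> 1" "b \<in> D"
    have n0: "(2 * of_nat k + 1 :: complex) \<noteq> 0"
      using of_nat_neq_0[of "2 * k", where 'a = complex] by (simp add: add.commute)
    have fr: "x = 1 / (2 * D) * P - (2 * Q * R / D) * S" if "2 * D * x = P - 4 * Q * R * S" "D \<noteq> 0" for x D P Q R S :: complex
      using that by (simp add: field_simps)
    show "h u b k = (1 / (2 * (2 * of_nat k + 1))) * (if k = 0 then 0 else g u b (k - 1))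
       - (2 * of_nat (Suc k) * (of_nat k + b) / (2 * of_nat k + 1)) * g u b (Suc k)"
      by (rule fr[OF rec[OF *] n0])
  qed
qed

text \<open>The parameter \<open>q\<close> lets one statement serve twice: \<open>q = 0\<close> for
  the coefficient polynomials and \<open>q = - 2\<close> for the exact functions, where each round
  gains \<open>1 / u\<^sup>2\<close>. The coefficient of index 0 is invisible to the recursion and
  has to be supplied by \<open>g0\<close>.\<close>

lemma poly_order_step_f:
  assumes B: "D \<subseteq> cball 0 B" and h: "poly_order D p h"
    and rec: "\<And>u b k. u \<ge> 1 \<Longrightarrow> b \<in> D \<Longrightarrow> 4 * of_nat (Suc k) * of_real u powi (- q) * g u b (Suc k) =
       (if k = 0 then 0 else h u b (k - 1)) - 4 * of_nat (Suc k) * (of_nat k + 2 - b) * h u b (Suc k)"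
    and g0: "\<And>u b. u \<ge> 1 \<Longrightarrow> b \<in> D \<Longrightarrow> g u b 0 = 0"
  shows "poly_order D (p + q) g"
proof (rule poly_order_from_Suc)
  show "g u b 0 = 0" if "u \<ge> 1" "b \<in> D" for u b using that by (rule g0)
next
  have 1: "poly_order D (p + q) (\<lambda>u b k. (of_real u powi q / (4 * of_nat (Suc k))) * (if k = 0 then 0 else h u b (k - 1)))"
  proof (rule poly_order_mult[OF poly_order_pred[OF h], where K = 1])
    fix u :: real and b :: complex and k :: nat
    assume u: "u \<ge> 1"
    have "norm (of_real u powi q / (4 * of_nat (Suc k)) :: complex) = u powi q / (4 * real (Suc k))"
      using u by (simp add: norm_divide norm_mult norm_power_int del: of_nat_Suc)
    also have "\<dots> \<le> u powi q / 1" using u by (intro divide_left_mono) auto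
    also have "\<dots> \<le> (real k + 1)\<^sup>2 * u powi q" using u mult_right_mono[of 1 "(real k + 1)\<^sup>2" "u powi q"] by simp
    finally show "norm (of_real u powi q / (4 * of_nat (Suc k)) :: complex) \<le> 1 * (real k + 1)\<^sup>2 * u powi q" by simp
  qed
  have 2: "poly_order D (p + q) (\<lambda>u b k. (of_real u powi q * (of_nat k + 2 - b)) * h u b (Suc k))"
  proof (rule poly_order_mult[OF poly_order_Suc[OF h], where K = "2 + \<bar>B\<bar>"])
    fix u :: real and b :: complex and k :: nat
    assume u: "u \<ge> 1" and "b \<in> D"
    then have b: "norm b \<le> \<bar>B\<bar>" using B by auto
    have "norm (of_nat k + 2 - b) \<le> norm (of_nat (k + 2) :: complex) + norm b"
      using norm_triangle_ineq4[of "of_nat (k + 2)" b] by (simp add: add.commute add.left_commute)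
    also have "\<dots> \<le> real k + 2 + \<bar>B\<bar>" using b unfolding norm_of_nat by simp
    also have "\<dots> \<le> (2 + \<bar>B\<bar>) * (real k + 1)" by (simp add: algebra_simps)
    also have "\<dots> \<le> (2 + \<bar>B\<bar>) * (real k + 1)\<^sup>2" by (intro mult_left_mono) (auto simp: power2_eq_square algebra_simps)
    finally show "norm (of_real u powi q * (of_nat k + 2 - b)) \<le> (2 + \<bar>B\<bar>) * (real k + 1)\<^sup>2 * u powi q"
      using u by (simp add: norm_mult norm_power_int mult_right_mono mult.commute)
  qed
  show "poly_order D (p + q) (\<lambda>u b k. g u b (Suc k))"
  proof (rule poly_order_cong)
    show "poly_order D (p + q) (\<lambda>u b k. (of_real u powi q / (4 * of_nat (Suc k))) * (if k = 0 then 0 else h u b (k - 1))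
       - (of_real u powi q * (of_nat k + 2 - b)) * h u b (Suc k))"
      by (rule poly_order_diff[OF 1 2])
    fix u :: real and b :: complex and k :: nat
    assume *: "u \<ge> 1" "b \<in> D"
    have n0: "(of_nat (Suc k) :: complex) \<noteq> 0" by (rule of_nat_neq_0)
    have uu: "of_real u powi q * of_real u powi (- q) = (1::complex)"
      using * by (simp add: power_int_minus)
    have fr: "x = (U / (4 * D)) * P - (U * R) * S" if "4 * D * V * x = P - 4 * D * R * S" "D \<noteq> 0" "U * V = 1" for x D P U V R S :: complex
    proof -
      have "x = (U * V) * x" using that by simp
      also have "\<dots> = U * (4 * D * V * x) / (4 * D)" using that(2) by simp
      also have "\<dots> = (U / (4 * D)) * P - (U * R) * S" unfolding that(1) using that(2) by (simp add: field_simps)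
      finally show ?thesis .
    qed
    show "g u b (Suc k) = (of_real u powi q / (4 * of_nat (Suc k))) * (if k = 0 then 0 else h u b (k - 1))
       - (of_real u powi q * (of_nat k + 2 - b)) * h u b (Suc k)"
      by (rule fr[OF rec[OF *] n0 uu])
  qed
qed

lemma poly_order_coefs:
  assumes "D \<subseteq> cball 0 B"
  shows "poly_order D 0 (\<lambda>u b k. acoef s b k) \<and> poly_order D 0 (\<lambda>u b k. bcoef s b k)"
proof (induction s)
  case 0
  have a: "poly_order D 0 (\<lambda>u b k. acoef 0 b k)"
    unfolding poly_order_def acoef_0
    by (intro allI impI exI[of _ 1]) auto
  show ?case using poly_order_step_h[OF assms a bcoef_rec] a by blast
next
  case (Suc s)
  have a: "poly_order D (0 + 0) (\<lambda>u b k. acoef (Suc s) b k)"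
    by (rule poly_order_step_f[OF assms conjunct2[OF Suc]]) (simp_all add: acoef_rec acoef_Suc_0 del: of_nat_Suc)
  then have a: "poly_order D 0 (\<lambda>u b k. acoef (Suc s) b k)" by simp
  show ?case using poly_order_step_h[OF assms a bcoef_rec] a by blast
qed

text \<open>
  Polynomial growth in \<open>u\<close> already suffices for the full asymptotic expansion: the recursion expresses
  the derivative of each function through the other one with a gain of \<open>u\<^sup>-\<^sup>2\<close> per round.
\<close>

lemma slow_expansion:
  fixes f h :: "real \<Rightarrow> complex \<Rightarrow> nat \<Rightarrow> complex"
  assumes B: "D \<subseteq> cball 0 B"
    and grow: "poly_order D (int m) f" "poly_order D (int m) h"
    and f0: "\<And>u b. u \<ge> 1 \<Longrightarrow> b \<in> D \<Longrightarrow> f u b 0 = 1"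
    and rec1: "\<And>u b k. u \<ge> 1 \<Longrightarrow> b \<in> D \<Longrightarrow> 2 * (2 * of_nat k + 1) * h u b k =
       (if k = 0 then 0 else f u b (k - 1)) - 4 * of_nat (Suc k) * (of_nat k + b) * f u b (Suc k)"
    and rec2: "\<And>u b k. u \<ge> 1 \<Longrightarrow> b \<in> D \<Longrightarrow> 4 * of_nat (Suc k) * of_real u ^ 2 * f u b (Suc k) =
       (if k = 0 then 0 else h u b (k - 1)) - 4 * of_nat (Suc k) * (of_nat k + 2 - b) * h u b (Suc k)"
  shows "poly_order D (- 2 * int N) (\<lambda>u b k. f u b k - (\<Sum>s<N. acoef s b k / of_real u ^ (2 * s)))"
    and "poly_order D (- 2 * int N) (\<lambda>u b k. h u b k - (\<Sum>s<N. bcoef s b k / of_real u ^ (2 * s)))"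
proof -
  define F where "F = (\<lambda>n u b k. f u b k - (\<Sum>s<n. acoef s b k / of_real u ^ (2 * s)))"
  define H where "H = (\<lambda>n u b k. h u b k - (\<Sum>s<n. bcoef s b k / of_real u ^ (2 * s)))"
  \<comment> \<open>The polynomials satisfy the same relation term by term, so it passes to the
    remainders; here both remainders have the same length.\<close>
  have F_rec: "2 * (2 * of_nat k + 1) * H n u b k =
       (if k = 0 then 0 else F n u b (k - 1)) - 4 * of_nat (Suc k) * (of_nat k + b) * F n u b (Suc k)"
    if "u \<ge> 1" "b \<in> D" for n u b k
  proof -
    have "2 * (2 * of_nat k + 1) * (\<Sum>s<n. bcoef s b k / of_real u ^ (2 * s))
        = (\<Sum>s<n. (2 * (2 * of_nat k + 1) * bcoef s b k) / of_real u ^ (2 * s))"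
      by (simp add: sum_distrib_left)
    also have "\<dots> = (\<Sum>s<n. (if k = 0 then 0 else acoef s b (k - 1) / of_real u ^ (2 * s))
        - 4 * of_nat (Suc k) * (of_nat k + b) * (acoef s b (Suc k) / of_real u ^ (2 * s)))"
      unfolding bcoef_rec by (intro sum.cong) (auto simp: diff_divide_distrib)
    also have "\<dots> = (if k = 0 then 0 else (\<Sum>s<n. acoef s b (k - 1) / of_real u ^ (2 * s)))
        - 4 * of_nat (Suc k) * (of_nat k + b) * (\<Sum>s<n. acoef s b (Suc k) / of_real u ^ (2 * s))"
      by (simp add: sum_subtractf sum_distrib_left)
    finally show ?thesis using rec1[OF that, of k] unfolding F_def H_def
      by (simp only: right_diff_distrib split: if_split) (auto simp: algebra_simps)
  qed
  \<comment> \<open>\<open>A_(s+1)\<close> is built from \<open>B_s\<close>, so the remainder of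
    \<open>f\<close> is one term longer than that of \<open>h\<close>. Multiplication by
    \<open>u\<^sup>2\<close> shifts the index, and the term \<open>s = 0\<close> drops out because
    \<open>A_0\<close> is constant.\<close>
  have H_rec: "4 * of_nat (Suc k) * of_real u ^ 2 * F (Suc n) u b (Suc k) =
       (if k = 0 then 0 else H n u b (k - 1)) - 4 * of_nat (Suc k) * (of_nat k + 2 - b) * H n u b (Suc k)"
    if "u \<ge> 1" "b \<in> D" for n u b k
  proof -
    have pw: "of_real u ^ 2 * (x / of_real u ^ (2 * Suc s)) = x / of_real u ^ (2 * s)" for x :: complex and s
      using that by (simp add: power_add power2_eq_square)
    have "4 * of_nat (Suc k) * of_real u ^ 2 * (\<Sum>s<Suc n. acoef s b (Suc k) / of_real u ^ (2 * s))
      = 4 * of_nat (Suc k) * (of_real u ^ 2 * (\<Sum>s<n. acoef (Suc s) b (Suc k) / of_real u ^ (2 * Suc s)))"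
      by (subst sum.lessThan_Suc_shift) (simp add: acoef_0 mult.assoc)
    also have "\<dots> = (\<Sum>s<n. (4 * of_nat (Suc k) * acoef (Suc s) b (Suc k)) / of_real u ^ (2 * s))"
      unfolding sum_distrib_left pw by (simp add: mult.assoc)
    also have "\<dots> = (\<Sum>s<n. (if k = 0 then 0 else bcoef s b (k - 1) / of_real u ^ (2 * s))
        - 4 * of_nat (Suc k) * (of_nat k + 2 - b) * (bcoef s b (Suc k) / of_real u ^ (2 * s)))"
      unfolding acoef_rec by (intro sum.cong) (auto simp: diff_divide_distrib)
    also have "\<dots> = (if k = 0 then 0 else (\<Sum>s<n. bcoef s b (k - 1) / of_real u ^ (2 * s)))
        - 4 * of_nat (Suc k) * (of_nat k + 2 - b) * (\<Sum>s<n. bcoef s b (Suc k) / of_real u ^ (2 * s))"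
      by (simp add: sum_subtractf sum_distrib_left)
    finally show ?thesis using rec2[OF that, of k] unfolding F_def H_def
      by (simp only: right_diff_distrib split: if_split) (auto simp: algebra_simps)
  qed
  \<comment> \<open>The normalization of the antiderivatives enters here: \<open>A_0(0) = 1\<close>
    cancels \<open>f u b 0\<close>, and all later \<open>A_s(0)\<close> vanish.\<close>
  have F0: "F (Suc n) u b 0 = 0" if "u \<ge> 1" "b \<in> D" for n u b
    unfolding F_def by (subst sum.lessThan_Suc_shift) (simp add: acoef_0 acoef_Suc_0 f0[OF that])
  have main: "poly_order D (int m - 2 * int n) (F n) \<and> poly_order D (int m - 2 * int n) (H n)" for n
  proof (induction n)
    case 0
    show ?case using grow by (simp add: F_def H_def)
  next
    case (Suc n)
    have "poly_order D (int m - 2 * int n + (- 2)) (F (Suc n))"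
    proof (rule poly_order_step_f[OF B conjunct2[OF Suc]])
      fix u :: real and b :: complex and k assume "u \<ge> 1" "b \<in> D"
      then show "4 * of_nat (Suc k) * of_real u powi (- (- 2)) * F (Suc n) u b (Suc k) =
        (if k = 0 then 0 else H n u b (k - 1)) - 4 * of_nat (Suc k) * (of_nat k + 2 - b) * H n u b (Suc k)"
        using H_rec by (simp add: power_int_def)
    qed (rule F0)
    then have 1: "poly_order D (int m - 2 * int (Suc n)) (F (Suc n))" by (simp add: algebra_simps)
    show ?case using poly_order_step_h[OF B 1 F_rec] 1 by blast
  qed
  \<comment> \<open>To compensate the initial order \<open>m\<close>, \<open>N + m\<close> rounds
    are carried out, giving order \<open>m - 2 * (N + m) \<le> - 2 * N\<close>. The \<open>m\<close>
    surplus terms of the sum are of order \<open>- 2 * N\<close> themselves and are added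
    back.\<close>
  have tail: "poly_order D (- 2 * int N) (\<lambda>u b k. (\<Sum>s\<in>{N..<N+m}. c s b k / of_real u ^ (2 * s)))"
    if c: "\<And>s. poly_order D 0 (\<lambda>u b k. c s b k)" for c :: "nat \<Rightarrow> complex \<Rightarrow> nat \<Rightarrow> complex"
  proof (induction m)
    case 0
    show ?case by (auto simp: poly_order_def intro!: exI[of _ 1])
  next
    case (Suc m)
    have "poly_order D (0 + - 2 * int N) (\<lambda>u b k. (1 / of_real u ^ (2 * (N + m))) * c (N + m) b k)"
    proof (rule poly_order_mult[OF c, where K = 1])
      fix u :: real and b :: complex and k :: nat assume u: "u \<ge> 1"
      have "norm (1 / of_real u ^ (2 * (N + m)) :: complex) = 1 / u ^ (2 * (N + m))"
        using u by (simp add: norm_divide norm_power)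
      also have "\<dots> \<le> 1 / u ^ (2 * N)" using u by (intro divide_left_mono power_increasing) auto
      also have "\<dots> = u powi (- 2 * int N)"
        using u by (simp add: power_int_def nat_mult_distrib field_simps)
      also have "\<dots> \<le> (real k + 1)\<^sup>2 * u powi (- 2 * int N)"
        using u mult_right_mono[of 1 "(real k + 1)\<^sup>2" "u powi (- 2 * int N)"] by simp
      finally show "norm (1 / of_real u ^ (2 * (N + m)) :: complex) \<le> 1 * (real k + 1)\<^sup>2 * u powi (- 2 * int N)"
        by simp
    qed
    then have "poly_order D (- 2 * int N) (\<lambda>u b k. c (N + m) b k / of_real u ^ (2 * (N + m)))" by simp
    from poly_order_add[OF Suc this] show ?case by simp
  qed
  have e: "int m - 2 * int (N + m) \<le> - 2 * int N" by simp
  have split: "(\<Sum>s<N + m. g s) = (\<Sum>s<N. g s) + (\<Sum>s\<in>{N..<N+m}. g s)" for g :: "nat \<Rightarrow> complex"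
    using sum.atLeastLessThan_concat[of 0 N "N + m" g] by (simp add: lessThan_atLeast0)
  have cf: "poly_order D 0 (\<lambda>u b k. acoef s b k)" "poly_order D 0 (\<lambda>u b k. bcoef s b k)" for s
    using poly_order_coefs[OF B] by auto
  have mF: "poly_order D (- 2 * int N) (F (N + m))" and mH: "poly_order D (- 2 * int N) (H (N + m))"
    using main[of "N + m"] poly_order_mono[OF _ e] by blast+
  show "poly_order D (- 2 * int N) (\<lambda>u b k. f u b k - (\<Sum>s<N. acoef s b k / of_real u ^ (2 * s)))"
    using poly_order_add[OF mF tail[of acoef, OF cf(1)]] unfolding F_def split by (simp add: algebra_simps)
  show "poly_order D (- 2 * int N) (\<lambda>u b k. h u b k - (\<Sum>s<N. bcoef s b k / of_real u ^ (2 * s)))"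
    using poly_order_add[OF mH tail[of bcoef, OF cf(2)]] unfolding H_def split by (simp add: algebra_simps)
qed

section \<open>An integral representation of the Kummer function\<close>

text \<open>
  The Laplace integral \<open>\<Gamma>(a) U(a, b, \<zeta>) = \<integral> exp (- \<zeta> t) t\<^sup>a\<^sup>-\<^sup>1 (1 + t)\<^sup>b\<^sup>-\<^sup>a\<^sup>-\<^sup>1 dt\<close> after the
  substitution \<open>t = s / (1 - s)\<close>.
\<close>

definition kkern :: "complex \<Rightarrow> complex \<Rightarrow> complex \<Rightarrow> real \<Rightarrow> complex" where
  "kkern a b \<zeta> s = exp (- (\<zeta> * of_real (s / (1 - s))) + (a - 1) * of_real (ln s) - b * of_real (ln (1 - s)))"

definition kint :: "complex \<Rightarrow> complex \<Rightarrow> complex \<Rightarrow> complex" where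
  "kint a b \<zeta> = (LBINT s:{0<..<1}. kkern a b \<zeta> s)"

lemma kkern_measurable [measurable]: "kkern a b \<zeta> \<in> borel_measurable borel"
proof -
  have "(\<lambda>s. - (\<zeta> * of_real (s / (1 - s))) + (a - 1) * of_real (ln s) - b * of_real (ln (1 - s))) \<in> borel_measurable borel"
    by (intro borel_measurable_add borel_measurable_diff borel_measurable_uminus borel_measurable_times
        borel_measurable_const measurable_compose[OF _ borel_measurable_of_real] borel_measurable_divide
        borel_measurable_ln measurable_ident_sets refl)
  from measurable_compose[OF this borel_measurable_exp] show ?thesis unfolding kkern_def[abs_def] .
qed

lemma norm_kkern:
  "norm (kkern a b \<zeta> s) = exp (- (Re \<zeta> * (s / (1 - s))) + (Re a - 1) * ln s - Re b * ln (1 - s))"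
  by (simp add: kkern_def norm_exp_eq_Re)

text \<open>The power \<open>(1 + x) ^ n\<close> is dominated by keeping only the n-th term of the
  exponential series at \<open>\<epsilon> * (1 + x)\<close>.\<close>

lemma ln_bound_exp:
  fixes r \<epsilon> x :: real
  assumes "x \<ge> 0" "\<epsilon> > 0" "r \<le> real n"
  shows "exp (r * ln (1 + x)) \<le> fact n / \<epsilon> ^ n * exp \<epsilon> * exp (\<epsilon> * x)"
proof -
  have e: "(\<epsilon> * (1 + x)) ^ n / fact n \<le> exp (\<epsilon> * (1 + x))"
  proof -
    have s: "(\<lambda>i. (\<epsilon> * (1 + x)) ^ i /\<^sub>R fact i) sums exp (\<epsilon> * (1 + x))" by (rule exp_converges)
    have "(\<Sum>i\<in>{n}. (\<epsilon> * (1 + x)) ^ i /\<^sub>R fact i) \<le> (\<Sum>i. (\<epsilon> * (1 + x)) ^ i /\<^sub>R fact i)"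
      using assms by (intro sum_le_suminf sums_summable[OF s]) auto
    then show ?thesis unfolding sums_unique[OF s, symmetric] by (simp add: divide_inverse mult.commute)
  qed
  have "exp (r * ln (1 + x)) \<le> exp (real n * ln (1 + x))"
    using assms by (simp add: mult_right_mono)
  also have "\<dots> = (1 + x) ^ n" using assms(1) by (simp add: exp_of_nat_mult)
  also have "\<dots> = fact n / \<epsilon> ^ n * ((\<epsilon> * (1 + x)) ^ n / fact n)"
    using assms(2) by (simp add: power_mult_distrib)
  also have "\<dots> \<le> fact n / \<epsilon> ^ n * exp (\<epsilon> * (1 + x))"
    using e assms(2) by (intro mult_left_mono) auto
  also have "\<dots> = fact n / \<epsilon> ^ n * exp \<epsilon> * exp (\<epsilon> * x)" by (simp add: exp_add[symmetric] algebra_simps)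
  finally show ?thesis .
qed

text \<open>With \<open>x = s / (1 - s)\<close> the singular factor \<open>(1 - s)\<close> to the
  power \<open>- b\<close> is \<open>(1 + x)\<close> to the power \<open>b\<close>, which the
  exponential absorbs. For \<open>Re a \<ge> 1\<close> the kernel is therefore bounded on the unit
  interval.\<close>

lemma kkern_bound:
  assumes "s \<in> {0<..<1}" "Re a \<ge> 1" "Re \<zeta> > 0" "Re b \<le> real n"
  shows "norm (kkern a b \<zeta> s) \<le> fact n / Re \<zeta> ^ n * exp (Re \<zeta>)"
proof -
  have s1: "1 / (1 - s) = 1 + s / (1 - s)" using assms(1) by (simp add: field_simps)
  have l: "- ln (1 - s) = ln (1 + s / (1 - s))" using assms(1) unfolding s1[symmetric] by (simp add: ln_div)
  have "norm (kkern a b \<zeta> s) \<le> exp (- (Re \<zeta> * (s / (1 - s))) + Re b * ln (1 + s / (1 - s)))"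
    unfolding norm_kkern l[symmetric] using assms by (simp add: mult_nonneg_nonpos)
  also have "\<dots> = exp (- (Re \<zeta> * (s / (1 - s)))) * exp (Re b * ln (1 + s / (1 - s)))"
    by (rule exp_add)
  also have "\<dots> \<le> exp (- (Re \<zeta> * (s / (1 - s)))) * (fact n / Re \<zeta> ^ n * exp (Re \<zeta>) * exp (Re \<zeta> * (s / (1 - s))))"
    using assms by (intro mult_left_mono ln_bound_exp) auto
  also have "\<dots> = fact n / Re \<zeta> ^ n * exp (Re \<zeta>)" by (simp add: exp_minus)
  finally show ?thesis .
qed

lemma kkern_integrable:
  assumes "Re a \<ge> 1" "Re \<zeta> > 0"
  shows "set_integrable lborel {0<..<1} (kkern a b \<zeta>)"
proof -
  obtain n :: nat where "Re b \<le> real n" using real_arch_simple by blast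
  then show ?thesis unfolding set_integrable_def
    by (intro integrableI_bounded_set_indicator[where B = "fact n / Re \<zeta> ^ n * exp (Re \<zeta>)"] AE_I2 impI
        kkern_bound assms) auto
qed

lemma kkern_shift:
  assumes "s \<in> {0<..<1}"
  shows "kkern (a + 1) b \<zeta> s = of_real s * kkern a b \<zeta> s"
    "kkern a (b - 1) \<zeta> s = of_real (1 - s) * kkern a b \<zeta> s"
    "kkern (a + 1) (b + 1) \<zeta> s = of_real (s / (1 - s)) * kkern a b \<zeta> s"
proof -
  have e: "exp (of_real (ln s)) = (of_real s :: complex)" "exp (of_real (ln (1 - s))) = (of_real (1 - s) :: complex)"
    using assms by (simp_all add: exp_of_real)
  show "kkern (a + 1) b \<zeta> s = of_real s * kkern a b \<zeta> s"
    unfolding kkern_def e(1)[symmetric] exp_add[symmetric] by (rule arg_cong[of _ _ exp]) (simp add: algebra_simps)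
  show "kkern a (b - 1) \<zeta> s = of_real (1 - s) * kkern a b \<zeta> s"
    unfolding kkern_def e(2)[symmetric] exp_add[symmetric] by (rule arg_cong[of _ _ exp]) (simp add: algebra_simps)
  have "of_real (s / (1 - s)) = exp (of_real (ln s)) * exp (- (of_real (ln (1 - s)) :: complex))"
    unfolding e exp_minus by (simp add: divide_inverse)
  then show "kkern (a + 1) (b + 1) \<zeta> s = of_real (s / (1 - s)) * kkern a b \<zeta> s"
    unfolding kkern_def exp_add[symmetric]
    by (simp only: exp_add[symmetric]) (rule arg_cong[of _ _ exp], simp add: algebra_simps)
qed

text \<open>Multiplying the kernel by \<open>s\<close> raises \<open>a\<close>, multiplying it by
  \<open>1 - s\<close> lowers \<open>b\<close>; the relation is the integrated form of
  \<open>1 - s = 1 - (s)\<close>.\<close>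

lemma kint_lower:
  assumes "Re a \<ge> 1" "Re \<zeta> > 0"
  shows "kint a (b - 1) \<zeta> = kint a b \<zeta> - kint (a + 1) b \<zeta>"
proof -
  have "kint a b \<zeta> - kint (a + 1) b \<zeta> = (LBINT s:{0<..<1}. kkern a b \<zeta> s - kkern (a + 1) b \<zeta> s)"
    unfolding kint_def using assms by (intro set_integral_diff(2)[symmetric] kkern_integrable) auto
  also have "\<dots> = kint a (b - 1) \<zeta>"
    unfolding kint_def
    by (intro set_lebesgue_integral_cong allI impI, simp, simp only: kkern_shift(1,2)) (simp add: algebra_simps)
  finally show ?thesis ..
qed

lemma has_field_derivative_quadratic:
  fixes f :: "complex \<Rightarrow> complex"
  assumes "\<delta> > 0" "\<And>h. norm h < \<delta> \<Longrightarrow> norm (f (z + h) - f z - h * D) \<le> C * (norm h)\<^sup>2"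
  shows "(f has_field_derivative D) (at z)"
  unfolding DERIV_def
proof (rule LIM_offset_zero_cancel, rule LIM_zero_cancel, simp, rule Lim_null_comparison)
  have "\<forall>\<^sub>F h in at 0. norm h < \<delta> \<and> h \<noteq> (0::complex)"
    using assms(1) by (auto simp: eventually_at dist_norm)
  then show "\<forall>\<^sub>F h in at 0. norm ((f (z + h) - f z) / h - D) \<le> C * norm h"
  proof eventually_elim
    case (elim h)
    have "norm ((f (z + h) - f z) / h - D) = norm (f (z + h) - f z - h * D) / norm h"
      using elim by (simp add: norm_divide[symmetric] diff_divide_distrib)
    also have "\<dots> \<le> C * (norm h)\<^sup>2 / norm h" using assms(2)[of h] elim by (intro divide_right_mono) auto
    finally show ?case using elim by (simp add: power2_eq_square)
  qed
  show "((\<lambda>h. C * norm h) \<longlongrightarrow> 0) (at (0::complex))"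
    by (rule tendsto_eq_intros refl | simp)+
qed

text \<open>Differentiation under the integral with a quadratic remainder. Half of the decay in
  \<open>\<zeta>\<close> pays for \<open>exp (norm h * t)\<close>, as
  \<open>norm h < Re \<zeta> / 2\<close>, and the factor \<open>t\<^sup>2\<close> of the remainder
  is the double shift to \<open>(a + 2, b + 2)\<close>; hence the kernel at
  \<open>\<zeta> / 2\<close> as majorant.\<close>

lemma kint_deriv:
  assumes "Re a \<ge> 1" "Re \<zeta> > 0"
  shows "(kint a b has_field_derivative - kint (a + 1) (b + 1) \<zeta>) (at \<zeta>)"
proof (rule has_field_derivative_quadratic)
  define C where "C = (LBINT s:{0<..<1}. norm (kkern (a + 2) (b + 2) (\<zeta> / 2) s))"
  show "Re \<zeta> / 2 > 0" using assms by simp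
  fix h :: complex assume h: "norm h < Re \<zeta> / 2"
  have rh: "Re (\<zeta> + h) > 0" using h complex_Re_le_cmod[of "- h"] assms by simp
  have int2: "set_integrable lborel {0<..<1} (kkern (a + 2) (b + 2) (\<zeta> / 2))"
    using assms by (intro kkern_integrable) auto
  have int: "set_integrable lborel {0<..<1} (kkern a b (\<zeta> + h))" "set_integrable lborel {0<..<1} (kkern a b \<zeta>)"
    "set_integrable lborel {0<..<1} (kkern (a + 1) (b + 1) \<zeta>)"
    using assms rh by (auto intro!: kkern_integrable)
  have eq: "kint a b (\<zeta> + h) - kint a b \<zeta> - h * - kint (a + 1) (b + 1) \<zeta>
     = (LBINT s:{0<..<1}. kkern a b (\<zeta> + h) s - kkern a b \<zeta> s + h * kkern (a + 1) (b + 1) \<zeta> s)"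
    unfolding kint_def using int
    by (simp add: set_integral_diff set_integral_add)
  have "norm (LBINT s:{0<..<1}. kkern a b (\<zeta> + h) s - kkern a b \<zeta> s + h * kkern (a + 1) (b + 1) \<zeta> s)
     \<le> (LBINT s:{0<..<1}. (norm h)\<^sup>2 * norm (kkern (a + 2) (b + 2) (\<zeta> / 2) s))"
    unfolding set_lebesgue_integral_def
  proof (rule Bochner_Integration.integral_norm_bound_integral)
    show "integrable lborel (\<lambda>s. indicat_real {0<..<1} s *\<^sub>R (kkern a b (\<zeta> + h) s - kkern a b \<zeta> s + h * kkern (a + 1) (b + 1) \<zeta> s))"
      using set_integral_add(1)[OF set_integral_diff(1)[OF int(1,2)] set_integrable_mult_right[where a = h, OF int(3)]]
      unfolding set_integrable_def by simp
    show "integrable lborel (\<lambda>s. indicat_real {0<..<1} s *\<^sub>R ((norm h)\<^sup>2 * norm (kkern (a + 2) (b + 2) (\<zeta> / 2) s)))"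
      using set_integrable_mult_right[where a = "(norm h)\<^sup>2", OF set_integrable_norm[OF int2]]
      unfolding set_integrable_def by simp
    fix s :: real
    have "norm (kkern a b (\<zeta> + h) s - kkern a b \<zeta> s + h * kkern (a + 1) (b + 1) \<zeta> s) \<le>
        (norm h)\<^sup>2 * norm (kkern (a + 2) (b + 2) (\<zeta> / 2) s)" if s: "s \<in> {0<..<1}"
    proof -
      define t where "t = s / (1 - s)"
      have t: "t \<ge> 0" using s by (simp add: t_def)
      have 1: "kkern a b (\<zeta> + h) s = exp (- h * of_real t) * kkern a b \<zeta> s"
        unfolding kkern_def exp_add[symmetric] t_def[symmetric] by (rule arg_cong[of _ _ exp]) (simp add: algebra_simps)
      have 2: "kkern (a + 1) (b + 1) \<zeta> s = of_real t * kkern a b \<zeta> s"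
        using kkern_shift(3)[OF s] by (simp add: t_def)
      have 3: "kkern (a + 2) (b + 2) (\<zeta> / 2) s = of_real t * (of_real t * kkern a b (\<zeta> / 2) s)"
        using kkern_shift(3)[OF s, of a b "\<zeta> / 2"] kkern_shift(3)[OF s, of "a + 1" "b + 1" "\<zeta> / 2"]
        by (simp add: t_def add.assoc)
      have 4: "norm (kkern a b \<zeta> s) = exp (- (Re \<zeta> / 2 * t)) * norm (kkern a b (\<zeta> / 2) s)"
        unfolding norm_kkern exp_add[symmetric] t_def[symmetric] by (rule arg_cong[of _ _ exp]) (simp add: algebra_simps)
      have "norm (exp (- h * of_real t) - (1 + (- h * of_real t))) \<le> exp (norm h * t) * (norm h * t)\<^sup>2"
        using Taylor_exp_field[of "- h * of_real t" 1] t
        by (simp add: norm_mult eval_nat_numeral)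
      also have "\<dots> \<le> exp (Re \<zeta> / 2 * t) * (norm h * t)\<^sup>2"
        using mult_right_mono[of "norm h" "Re \<zeta> / 2" t] h t by (intro mult_right_mono) auto
      finally have *: "norm (exp (- h * of_real t) - 1 + h * of_real t) \<le> exp (Re \<zeta> / 2 * t) * (norm h * t)\<^sup>2"
        by (simp add: algebra_simps)
      have "kkern a b (\<zeta> + h) s - kkern a b \<zeta> s + h * kkern (a + 1) (b + 1) \<zeta> s
         = (exp (- h * of_real t) - 1 + h * of_real t) * kkern a b \<zeta> s"
        unfolding 1 2 by (simp add: algebra_simps)
      also have "norm \<dots> \<le> (exp (Re \<zeta> / 2 * t) * (norm h * t)\<^sup>2) * (exp (- (Re \<zeta> / 2 * t)) * norm (kkern a b (\<zeta> / 2) s))"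
        unfolding norm_mult 4 using * by (intro mult_right_mono) auto
      also have "\<dots> = (norm h * t)\<^sup>2 * norm (kkern a b (\<zeta> / 2) s)"
        by (simp add: exp_minus)
      also have "\<dots> = (norm h)\<^sup>2 * norm (kkern (a + 2) (b + 2) (\<zeta> / 2) s)"
        unfolding 3 norm_mult using t by (simp add: power2_eq_square)
      finally show ?thesis .
    qed
    then show "norm (indicat_real {0<..<1} s *\<^sub>R (kkern a b (\<zeta> + h) s - kkern a b \<zeta> s + h * kkern (a + 1) (b + 1) \<zeta> s))
        \<le> indicat_real {0<..<1} s *\<^sub>R ((norm h)\<^sup>2 * norm (kkern (a + 2) (b + 2) (\<zeta> / 2) s))"
      by (auto simp: indicator_def)
  qed
  then show "norm (kint a b (\<zeta> + h) - kint a b \<zeta> - h * - kint (a + 1) (b + 1) \<zeta>) \<le> C * (norm h)\<^sup>2"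
    unfolding eq C_def by (simp add: mult.commute)
qed

text \<open>A primitive for the by-parts identity: the factor \<open>s * (1 - s)\<close> makes it
  vanish at both end points, and its derivative is a combination of three shifted kernels.\<close>

lemma kkern_deriv:
  assumes "s \<in> {0<..<1}"
  shows "((\<lambda>s. of_real (s * (1 - s)) * kkern a (b + 1) \<zeta> s) has_vector_derivative
     (- \<zeta> * kkern (a + 1) (b + 2) \<zeta> s + a * kkern a b \<zeta> s + b * kkern (a + 1) (b + 1) \<zeta> s)) (at s)"
proof -
  have s: "0 < s" "s < 1" using assms by auto
  define E where "E = (\<lambda>s. - (\<zeta> * of_real (s / (1 - s))) + (a - 1) * of_real (ln s) - (b + 1) * of_real (ln (1 - s)))"
  have "(E has_vector_derivative (- (\<zeta> * of_real (1 / (1 - s)\<^sup>2)) + (a - 1) * of_real (1 / s) - (b + 1) * of_real (- 1 / (1 - s)))) (at s)"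
    unfolding E_def
    by (intro has_vector_derivative_diff has_vector_derivative_add has_vector_derivative_minus
        has_vector_derivative_mult_right has_vector_derivative_of_real)
      (use s in \<open>auto intro!: derivative_eq_intros simp: has_real_derivative_iff_has_vector_derivative[symmetric] field_simps power2_eq_square\<close>)
  from field_vector_diff_chain_at[OF this DERIV_exp]
  have dk: "(kkern a (b + 1) \<zeta> has_vector_derivative (- (\<zeta> * of_real (1 / (1 - s)\<^sup>2)) + (a - 1) * of_real (1 / s) - (b + 1) * of_real (- 1 / (1 - s))) * kkern a (b + 1) \<zeta> s) (at s)"
    unfolding kkern_def E_def o_def .
  have dp: "((\<lambda>s. of_real (s * (1 - s)) :: complex) has_vector_derivative of_real (1 - 2 * s)) (at s)"
    by (intro has_vector_derivative_of_real)
      (auto intro!: derivative_eq_intros simp: has_real_derivative_iff_has_vector_derivative[symmetric])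
  define k where "k = kkern a (b + 1) \<zeta> s"
  define S where "S = complex_of_real s"
  define T where "T = 1 - S"
  have ST: "S \<noteq> 0" "T \<noteq> 0" "of_real (1 - s) = T" using s by (auto simp: S_def T_def)
  have w: "of_real (s * (1 - s)) = S * T" "of_real (1 / (1 - s)\<^sup>2) = 1 / T\<^sup>2" "of_real (1 / s) = 1 / S"
     "of_real (- 1 / (1 - s)) = - 1 / T" "of_real (1 - 2 * s) = T - S"
    by (simp_all add: T_def S_def)
  have k1: "kkern (a + 1) (b + 2) \<zeta> s = S / T * k" "kkern a b \<zeta> s = T * k" "kkern (a + 1) (b + 1) \<zeta> s = S * k"
    using kkern_shift(3)[OF assms, of a "b + 1" \<zeta>] kkern_shift(2)[OF assms, of a "b + 1" \<zeta>] kkern_shift(1)[OF assms, of a "b + 1" \<zeta>]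
    by (simp_all add: k_def S_def T_def add.assoc)
  have "((\<lambda>s. of_real (s * (1 - s)) * kkern a (b + 1) \<zeta> s) has_vector_derivative
    (of_real (s * (1 - s)) * ((- (\<zeta> * of_real (1 / (1 - s)\<^sup>2)) + (a - 1) * of_real (1 / s) - (b + 1) * of_real (- 1 / (1 - s))) * k)
      + of_real (1 - 2 * s) * k)) (at s)"
    using has_vector_derivative_mult[OF dp dk] unfolding k_def .
  also have "of_real (s * (1 - s)) * ((- (\<zeta> * of_real (1 / (1 - s)\<^sup>2)) + (a - 1) * of_real (1 / s) - (b + 1) * of_real (- 1 / (1 - s))) * k)
      + of_real (1 - 2 * s) * k = - \<zeta> * (S / T * k) + a * (T * k) + b * (S * k)"
    unfolding w using ST(1,2) by (simp add: field_simps power2_eq_square)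
  finally show ?thesis unfolding k1 .
qed

text \<open>The integral of the total derivative in \<open>kkern_deriv\<close> is zero, the boundary
  values being \<open>s * (1 - s)\<close> times a bounded kernel.\<close>

lemma kint_by_parts:
  assumes "Re a \<ge> 1" "Re \<zeta> > 0"
  shows "\<zeta> * kint (a + 1) (b + 2) \<zeta> = a * kint a b \<zeta> + b * kint (a + 1) (b + 1) \<zeta>"
proof -
  let ?F = "\<lambda>s. of_real (s * (1 - s)) * kkern a (b + 1) \<zeta> s"
  let ?f = "\<lambda>s. - \<zeta> * kkern (a + 1) (b + 2) \<zeta> s + a * kkern a b \<zeta> s + b * kkern (a + 1) (b + 1) \<zeta> s"
  obtain n :: nat where n: "Re (b + 1) \<le> real n" using real_arch_simple by blast
  define C where "C = fact n / Re \<zeta> ^ n * exp (Re \<zeta>)"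
  have bd: "norm (?F s) \<le> s * (1 - s) * C" if "s \<in> {0<..<1}" for s
    using kkern_bound[OF that assms n] that unfolding C_def[symmetric] norm_mult[of "of_real _"] norm_of_real
    by (simp add: mult_left_mono)
  have int: "set_integrable lborel {0<..<1} (kkern (a + 1) (b + 2) \<zeta>)" "set_integrable lborel {0<..<1} (kkern a b \<zeta>)"
    "set_integrable lborel {0<..<1} (kkern (a + 1) (b + 1) \<zeta>)"
    using assms by (auto intro!: kkern_integrable)
  have int': "set_integrable lborel {0<..<1} ?f"
    by (intro set_integral_add(1) set_integrable_mult_right int)
  have "(LBINT s=ereal 0..ereal 1. ?f s) = 0 - 0"
  proof (rule interval_integral_FTC_integrable)
    show "(?F has_vector_derivative ?f s) (at s)" if "ereal 0 < ereal s" "ereal s < ereal 1" for s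
      by (rule kkern_deriv) (use that in auto)
    show "isCont ?f s" if "ereal 0 < ereal s" "ereal s < ereal 1" for s
      unfolding kkern_def using that by (intro continuous_intros) auto
    show "set_integrable lborel (einterval (ereal 0) (ereal 1)) ?f" using int' by simp
    have l0: "(?F \<longlongrightarrow> 0) (at_right 0)"
    proof (rule Lim_null_comparison)
      show "\<forall>\<^sub>F s in at_right 0. norm (?F s) \<le> s * (1 - s) * C"
        by (rule eventually_at_rightI[of 0 1]) (use bd in auto)
      show "((\<lambda>s. s * (1 - s) * C) \<longlongrightarrow> 0) (at_right 0)"
        by (rule tendsto_eq_intros refl | simp)+
    qed
    have l1: "(?F \<longlongrightarrow> 0) (at_left 1)"
    proof (rule Lim_null_comparison)
      show "\<forall>\<^sub>F s in at_left 1. norm (?F s) \<le> s * (1 - s) * C"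
        by (rule eventually_at_leftI[of 0 1]) (use bd in auto)
      show "((\<lambda>s. s * (1 - s) * C) \<longlongrightarrow> 0) (at_left 1)"
        by (rule tendsto_eq_intros refl | simp)+
    qed
    show "((?F \<circ> real_of_ereal) \<longlongrightarrow> 0) (at_right (ereal 0))"
      using l0 by (simp add: ereal_tendsto_simps)
    show "((?F \<circ> real_of_ereal) \<longlongrightarrow> 0) (at_left (ereal 1))"
      using l1 by (simp add: ereal_tendsto_simps)
  qed simp
  then have "0 = (LBINT s:{0<..<1}. ?f s)"
    by (simp add: interval_lebesgue_integral_le_eq)
  also have "\<dots> = - \<zeta> * kint (a + 1) (b + 2) \<zeta> + a * kint a b \<zeta> + b * kint (a + 1) (b + 1) \<zeta>"
    unfolding kint_def using int
    by (simp add: set_integral_add set_integrable_mult_right)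
  finally show ?thesis by (simp add: algebra_simps)
qed

section \<open>Kummer functions as solutions of the confluent equation\<close>

text \<open>\<open>kV a b \<zeta>\<close> is \<open>\<Gamma>(a) U(a, b, \<zeta>)\<close>, and \<open>kN\<close> is the second solution of exponent \<open>1 - b\<close> at \<open>0\<close>.\<close>

abbreviation kM :: "complex \<Rightarrow> complex \<Rightarrow> complex \<Rightarrow> complex" where
  "kM a b \<equiv> eval_fps (hyp a 1 b)"

definition kN :: "complex \<Rightarrow> complex \<Rightarrow> complex \<Rightarrow> complex" where
  "kN a b \<zeta> = exp ((1 - b) * Ln \<zeta>) * kM (a - b + 1) (2 - b) \<zeta>"

definition kV :: "complex \<Rightarrow> complex \<Rightarrow> complex \<Rightarrow> complex" where
  "kV a b \<zeta> = of_real pi / sin (of_real pi * b) * (Gamma a * rGamma (a - b + 1) * kM a b \<zeta> - kN a b \<zeta>)"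

section \<open>Contiguous relations and derivatives of the Kummer solutions\<close>

lemma kM_lower: "kM a (b - 1) \<zeta> = \<zeta> * (a * kM (a + 1) (b + 1) \<zeta>) + (b - 1) * kM a b \<zeta>"
  unfolding hyp_lower[symmetric] hyp_deriv
  by (simp add: eval_entire entire_hyp entire_fps_mult entire_fps_add)

lemma kM_raise: "a * kM (a + 1) b \<zeta> = a * kM a b \<zeta> + \<zeta> * (a * kM (a + 1) (b + 1) \<zeta>)"
proof -
  have "eval_fps (fps_const a * hyp (a + 1) 1 b) \<zeta> =
      eval_fps (fps_const a * hyp a 1 b + fps_const 1 * fps_X * (fps_const a * hyp (a + 1) 1 (b + 1))) \<zeta>"
    using hyp_raise[of a 1 b] hyp_deriv[of a 1 b] by argo
  then show ?thesis by (simp add: eval_entire entire_hyp entire_fps_mult entire_fps_add)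
qed

text \<open>Unlike \<open>hyp_raise\<close> it carries no factor \<open>p\<close> on both sides.
  \<open>kV_lower\<close> needs this form for the first parameter \<open>a - b + 1\<close>, which
  may vanish.\<close>

lemma hyp_raise': "hyp (p + q) q b = hyp p q b + fps_const q * fps_X * hyp (p + q) q (b + 1)"
proof (rule fps_ext)
  fix n
  show "fps_nth (hyp (p + q) q b) n = fps_nth (hyp p q b + fps_const q * fps_X * hyp (p + q) q (b + 1)) n"
  proof (cases n)
    case 0 then show ?thesis by (simp add: hyp_nth mult.assoc)
  next
    case (Suc m)
    define P where "P = (\<Prod>j<m. p + q + q * of_nat j)"
    define r where "r = rGamma (b + of_nat (Suc m))"
    have 1: "(\<Prod>j<Suc m. p + q * of_nat j) = p * P"
      unfolding P_def using prod_shift_hyp[of p q m] by simp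
    have 2: "fps_nth (fps_const q * fps_X * hyp (p + q) q (b + 1)) n = q * (P * r / fact m)"
      by (simp add: Suc hyp_nth mult.assoc P_def r_def add.assoc)
    have f: "P * r / fact m = of_nat (Suc m) * (P * r / fact (Suc m))"
      by (simp add: field_simps del: of_nat_Suc)
    have "fps_nth (hyp (p + q) q b) n = P * (p + q + q * of_nat m) * r / fact (Suc m)"
      unfolding Suc hyp_nth P_def r_def by simp
    also have "\<dots> = p * P * r / fact (Suc m) + q * (P * r / fact m)"
      unfolding f by (simp add: algebra_simps add_divide_distrib)
    also have "p * P * r / fact (Suc m) = fps_nth (hyp p q b) n"
      unfolding Suc hyp_nth 1 r_def ..
    finally show ?thesis unfolding fps_add_nth 2 .
  qed
qed

lemma kM_raise': "kM (a + 1) b \<zeta> = kM a b \<zeta> + \<zeta> * kM (a + 1) (b + 1) \<zeta>"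
  by (subst hyp_raise') (simp add: eval_entire entire_hyp entire_fps_mult entire_fps_add)

lemma kM_deriv: "(kM a b has_field_derivative a * kM (a + 1) (b + 1) \<zeta>) (at \<zeta> within A)"
proof -
  have "eval_fps (fps_deriv (hyp a 1 b)) \<zeta> = a * kM (a + 1) (b + 1) \<zeta>"
    unfolding hyp_deriv by (simp add: eval_entire entire_hyp)
  then show ?thesis using eval_fps_deriv_entire[OF entire_hyp, of a 1 b \<zeta> A] by simp
qed

lemma right_half_plane_not_nonpos: "Re \<zeta> > 0 \<Longrightarrow> \<zeta> \<notin> \<real>\<^sub>\<le>\<^sub>0"
  by (auto simp: complex_nonpos_Reals_iff)

lemma exp_cmul_Ln_shift: "\<zeta> \<noteq> 0 \<Longrightarrow> exp ((c + 1) * Ln \<zeta>) = \<zeta> * exp (c * Ln \<zeta>)"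
  by (simp add: distrib_right exp_add)

lemma kN_deriv:
  assumes "Re \<zeta> > 0"
  shows "(kN a b has_field_derivative kN (a + 1) (b + 1) \<zeta>) (at \<zeta>)"
proof -
  have z: "\<zeta> \<noteq> 0" "\<zeta> \<notin> \<real>\<^sub>\<le>\<^sub>0" using assms right_half_plane_not_nonpos by auto
  have d: "((\<lambda>\<zeta>. exp ((1 - b) * Ln \<zeta>)) has_field_derivative exp ((1 - b) * Ln \<zeta>) * ((1 - b) / \<zeta>)) (at \<zeta>)"
    using z by (auto intro!: derivative_eq_intros simp: divide_inverse algebra_simps)
  have "exp ((1 - b) * Ln \<zeta>) * ((1 - b) / \<zeta>) * kM (a - b + 1) (2 - b) \<zeta>
     + ((a - b + 1) * kM (a - b + 1 + 1) (2 - b + 1) \<zeta>) * exp ((1 - b) * Ln \<zeta>)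
    = exp (- b * Ln \<zeta>) * kM (a - b + 1) (2 - b - 1) \<zeta>"
    unfolding kM_lower using exp_cmul_Ln_shift[OF z(1), of "- b"] z(1) by (simp add: algebra_simps diff_divide_distrib)
  also have "\<dots> = kN (a + 1) (b + 1) \<zeta>" by (simp add: kN_def algebra_simps)
  finally show ?thesis using DERIV_mult[OF d kM_deriv[of "a - b + 1" "2 - b" \<zeta> UNIV]] unfolding kN_def[abs_def] by simp
qed

lemma sin_pi_add1: "sin (of_real pi * (b + 1)) = - sin (of_real pi * b :: complex)"
  by (simp add: distrib_left sin_add)

text \<open>The shift leaves \<open>a - b + 1\<close> unchanged, the factor \<open>a\<close> of the
  derivative is absorbed by \<open>Gamma (a + 1) = a * Gamma a\<close>, and the minus sign comes
  from the sine.\<close>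

lemma kV_deriv:
  assumes "Re \<zeta> > 0" "Re a \<ge> 1"
  shows "(kV a b has_field_derivative - kV (a + 1) (b + 1) \<zeta>) (at \<zeta>)"
proof -
  have a: "a \<notin> \<int>\<^sub>\<le>\<^sub>0" using assms(2) by (auto elim!: nonpos_Ints_cases)
  have "(kV a b has_field_derivative of_real pi / sin (of_real pi * b) * (Gamma a * rGamma (a - b + 1) * (a * kM (a + 1) (b + 1) \<zeta>) - kN (a + 1) (b + 1) \<zeta>)) (at \<zeta>)"
    unfolding kV_def by (intro derivative_intros DERIV_cmult kM_deriv kN_deriv assms)
  also have "of_real pi / sin (of_real pi * b) * (Gamma a * rGamma (a - b + 1) * (a * kM (a + 1) (b + 1) \<zeta>) - kN (a + 1) (b + 1) \<zeta>)
     = - kV (a + 1) (b + 1) \<zeta>"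
    unfolding kV_def sin_pi_add1 Gamma_plus1[OF a] by (simp add: algebra_simps)
  finally show ?thesis .
qed

lemma kV_lower:
  assumes "Re \<zeta> > 0" "Re a \<ge> 1"
  shows "kV a (b - 1) \<zeta> = kV a b \<zeta> - kV (a + 1) b \<zeta>"
proof -
  have a: "a \<notin> \<int>\<^sub>\<le>\<^sub>0" using assms(2) by (auto elim!: nonpos_Ints_cases)
  have z: "\<zeta> \<noteq> 0" using assms by auto
  define c g where "c = a - b + 1" and "g = rGamma (c + 1)"
  have g: "rGamma c = c * g" using rGamma_plus1[of c] by (simp add: g_def)
  have g': "rGamma (a - b + 1) = c * g" "rGamma (a + 1 - b + 1) = g"
    using g unfolding c_def g_def by (simp_all add: algebra_simps)
  have s: "sin (of_real pi * b) = - sin (of_real pi * (b - 1))" using sin_pi_add1[of "b - 1"] by simp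
  have M: "kM a (b - 1) \<zeta> = a * kM (a + 1) b \<zeta> - c * kM a b \<zeta>"
    using kM_raise[of a b \<zeta>] kM_lower[of a b \<zeta>] c_def by algebra
  have "kM (c + 1) (2 - b) \<zeta> = kM c (2 - b) \<zeta> + \<zeta> * kM (c + 1) (2 - b + 1) \<zeta>" by (rule kM_raise')
  moreover have "exp ((2 - b) * Ln \<zeta>) = \<zeta> * exp ((1 - b) * Ln \<zeta>)"
    using exp_cmul_Ln_shift[OF z, of "1 - b"] by (simp add: algebra_simps)
  ultimately have N: "kN a (b - 1) \<zeta> = kN (a + 1) b \<zeta> - kN a b \<zeta>"
    unfolding kN_def c_def by (simp add: algebra_simps)
  have "kV a b \<zeta> - kV (a + 1) b \<zeta> = of_real pi / sin (of_real pi * b) *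
     (Gamma a * g * (c * kM a b \<zeta> - a * kM (a + 1) b \<zeta>) + kN (a + 1) b \<zeta> - kN a b \<zeta>)"
    unfolding kV_def Gamma_plus1[OF a] g' by (simp add: algebra_simps)
  also have "\<dots> = of_real pi / sin (of_real pi * b) * (- (Gamma a * g * kM a (b - 1) \<zeta>) + kN a (b - 1) \<zeta>)"
    unfolding M N by (simp add: algebra_simps)
  also have "\<dots> = kV a (b - 1) \<zeta>"
    unfolding s kV_def g_def c_def by (simp add: algebra_simps minus_divide_left[symmetric])
  finally show ?thesis ..
qed

lemma kM_ode:
  "\<zeta> * (a * ((a + 1) * kM (a + 2) (b + 2) \<zeta>)) = a * kM a b \<zeta> - (b - \<zeta>) * (a * kM (a + 1) (b + 1) \<zeta>)"
proof -
  have 1: "kM (a + 1) b \<zeta> = \<zeta> * ((a + 1) * kM (a + 2) (b + 2) \<zeta>) + b * kM (a + 1) (b + 1) \<zeta>"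
    using kM_lower[of "a + 1" "b + 1" \<zeta>] by (simp add: add.assoc)
  show ?thesis using kM_raise[of a b \<zeta>] unfolding 1 by (simp add: algebra_simps)
qed

lemma kN_ode:
  assumes "\<zeta> \<noteq> 0"
  shows "\<zeta> * kN (a + 2) (b + 2) \<zeta> = a * kN a b \<zeta> - (b - \<zeta>) * kN (a + 1) (b + 1) \<zeta>"
proof -
  define c e where "c = a - b + 1" and "e = exp (- b * Ln \<zeta>)"
  define P0 P1 P2 where "P0 = kM c (2 - b) \<zeta>" and "P1 = kM c (1 - b) \<zeta>" and "P2 = kM c (- b) \<zeta>"
  have e1: "exp ((1 - b) * Ln \<zeta>) = \<zeta> * e" and e2: "\<zeta> * exp ((- 1 - b) * Ln \<zeta>) = e"
    unfolding e_def using exp_cmul_Ln_shift[OF assms, of "- b"] exp_cmul_Ln_shift[OF assms, of "- 1 - b"]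
    by (simp_all add: add.commute)
  have s: "a + 1 - (b + 1) + 1 = c" "a + 2 - (b + 2) + 1 = c" "2 - (b + 1) = 1 - b" "2 - (b + 2) = - b"
     "1 - (b + 1) = - b" "1 - (b + 2) = - 1 - b" by (simp_all add: c_def)
  have "kN a b \<zeta> = \<zeta> * e * P0" unfolding kN_def e1 P0_def c_def ..
  moreover have "kN (a + 1) (b + 1) \<zeta> = e * P1" unfolding kN_def s P1_def e_def ..
  moreover have "\<zeta> * kN (a + 2) (b + 2) \<zeta> = e * P2" unfolding kN_def s P2_def e2[symmetric] by (simp only: mult.assoc)
  ultimately have N: "kN a b \<zeta> = \<zeta> * e * P0" "kN (a + 1) (b + 1) \<zeta> = e * P1" "\<zeta> * kN (a + 2) (b + 2) \<zeta> = e * P2" .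
  have 1: "P1 = \<zeta> * (c * kM (c + 1) (3 - b) \<zeta>) + (1 - b) * P0"
    using kM_lower[of c "2 - b" \<zeta>] by (simp add: P0_def P1_def algebra_simps)
  have 2: "P2 = \<zeta> * (c * kM (c + 1) (2 - b) \<zeta>) - b * P1"
    using kM_lower[of c "1 - b" \<zeta>] by (simp add: P2_def P1_def algebra_simps)
  have 3: "c * kM (c + 1) (2 - b) \<zeta> = c * P0 + \<zeta> * (c * kM (c + 1) (3 - b) \<zeta>)"
    using kM_raise[of c "2 - b" \<zeta>] by (simp add: P0_def algebra_simps)
  \<comment> \<open>Elimination of the series with second parameter \<open>3 - b\<close>, using
    \<open>c + b - 1 = a\<close>.\<close>
  have "P2 + b * P1 = \<zeta> * (P1 + a * P0)"
    using 1 2 3 c_def by algebra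
  then have "e * P2 = a * (\<zeta> * e * P0) - (b - \<zeta>) * (e * P1)" by algebra
  then show ?thesis unfolding N .
qed

lemma kint_ode:
  assumes "Re \<zeta> > 0" "Re a \<ge> 1"
  shows "\<zeta> * kint (a + 2) (b + 2) \<zeta> = a * kint a b \<zeta> - (b - \<zeta>) * (- kint (a + 1) (b + 1) \<zeta>)"
proof -
  have e: "b + 2 - 1 = b + 1" "a + 1 + 1 = a + 2" by simp_all
  have "kint (a + 1) (b + 1) \<zeta> = kint (a + 1) (b + 2) \<zeta> - kint (a + 2) (b + 2) \<zeta>"
    using kint_lower[of "a + 1" \<zeta> "b + 2"] assms unfolding e by simp
  then show ?thesis using kint_by_parts[OF assms(2,1), of b] by algebra
qed

text \<open>Kummer's equation \<open>\<zeta> y'' + (b - \<zeta>) y' = a y\<close> on the right half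
  plane, written as a first order system so that the derivative can be given by an explicit
  formula.\<close>

definition kode :: "complex \<Rightarrow> complex \<Rightarrow> (complex \<Rightarrow> complex) \<Rightarrow> (complex \<Rightarrow> complex) \<Rightarrow> bool" where
  "kode a b y y' \<longleftrightarrow> (\<forall>\<zeta>. Re \<zeta> > 0 \<longrightarrow> (y has_field_derivative y' \<zeta>) (at \<zeta>) \<and>
     (y' has_field_derivative (a * y \<zeta> - (b - \<zeta>) * y' \<zeta>) / \<zeta>) (at \<zeta>))"

lemma kode_kM: "kode a b (kM a b) (\<lambda>\<zeta>. a * kM (a + 1) (b + 1) \<zeta>)"
  unfolding kode_def
proof (intro allI impI conjI)
  fix \<zeta> :: complex assume "Re \<zeta> > 0"
  then have z: "\<zeta> \<noteq> 0" by auto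
  have "((\<lambda>\<zeta>. a * kM (a + 1) (b + 1) \<zeta>) has_field_derivative a * ((a + 1) * kM (a + 1 + 1) (b + 1 + 1) \<zeta>)) (at \<zeta>)"
    by (intro DERIV_cmult kM_deriv)
  also have "a * ((a + 1) * kM (a + 1 + 1) (b + 1 + 1) \<zeta>) = (a * kM a b \<zeta> - (b - \<zeta>) * (a * kM (a + 1) (b + 1) \<zeta>)) / \<zeta>"
    unfolding kM_ode[symmetric] using z by (simp add: add.assoc)
  finally show "((\<lambda>\<zeta>. a * kM (a + 1) (b + 1) \<zeta>) has_field_derivative (a * kM a b \<zeta> - (b - \<zeta>) * (a * kM (a + 1) (b + 1) \<zeta>)) / \<zeta>) (at \<zeta>)" .
qed (rule kM_deriv)

lemma kode_kN: "kode a b (kN a b) (kN (a + 1) (b + 1))"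
  unfolding kode_def
proof (intro allI impI conjI)
  fix \<zeta> :: complex assume r: "Re \<zeta> > 0"
  then have z: "\<zeta> \<noteq> 0" by auto
  show "(kN a b has_field_derivative kN (a + 1) (b + 1) \<zeta>) (at \<zeta>)" by (rule kN_deriv[OF r])
  have "(kN (a + 1) (b + 1) has_field_derivative kN (a + 1 + 1) (b + 1 + 1) \<zeta>) (at \<zeta>)" by (rule kN_deriv[OF r])
  also have "kN (a + 1 + 1) (b + 1 + 1) \<zeta> = (a * kN a b \<zeta> - (b - \<zeta>) * kN (a + 1) (b + 1) \<zeta>) / \<zeta>"
    unfolding kN_ode[OF z, symmetric] using z by (simp add: add.assoc)
  finally show "(kN (a + 1) (b + 1) has_field_derivative (a * kN a b \<zeta> - (b - \<zeta>) * kN (a + 1) (b + 1) \<zeta>) / \<zeta>) (at \<zeta>)" .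
qed

lemma kode_kint:
  assumes "Re a \<ge> 1"
  shows "kode a b (kint a b) (\<lambda>\<zeta>. - kint (a + 1) (b + 1) \<zeta>)"
  unfolding kode_def
proof (intro allI impI conjI)
  fix \<zeta> :: complex assume r: "Re \<zeta> > 0"
  then have z: "\<zeta> \<noteq> 0" by auto
  show "(kint a b has_field_derivative - kint (a + 1) (b + 1) \<zeta>) (at \<zeta>)" by (rule kint_deriv[OF assms r])
  have "((\<lambda>\<zeta>. - kint (a + 1) (b + 1) \<zeta>) has_field_derivative - (- kint (a + 1 + 1) (b + 1 + 1) \<zeta>)) (at \<zeta>)"
    by (intro DERIV_minus kint_deriv) (use assms r in auto)
  also have "- (- kint (a + 1 + 1) (b + 1 + 1) \<zeta>) = (a * kint a b \<zeta> - (b - \<zeta>) * - kint (a + 1) (b + 1) \<zeta>) / \<zeta>"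
    unfolding kint_ode[OF r assms, symmetric] using z by (simp add: add.assoc)
  finally show "((\<lambda>\<zeta>. - kint (a + 1) (b + 1) \<zeta>) has_field_derivative (a * kint a b \<zeta> - (b - \<zeta>) * - kint (a + 1) (b + 1) \<zeta>) / \<zeta>) (at \<zeta>)" .
qed

lemma kode_cmult:
  assumes "kode a b y y'"
  shows "kode a b (\<lambda>\<zeta>. c * y \<zeta>) (\<lambda>\<zeta>. c * y' \<zeta>)"
  unfolding kode_def
proof (intro allI impI)
  fix \<zeta> :: complex assume "Re \<zeta> > 0"
  then have d: "(y has_field_derivative y' \<zeta>) (at \<zeta>)"
     "(y' has_field_derivative (a * y \<zeta> - (b - \<zeta>) * y' \<zeta>) / \<zeta>) (at \<zeta>)"
    using assms unfolding kode_def by auto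
  have e: "(a * (c * y \<zeta>) - (b - \<zeta>) * (c * y' \<zeta>)) / \<zeta> = c * ((a * y \<zeta> - (b - \<zeta>) * y' \<zeta>) / \<zeta>)"
    by (simp add: algebra_simps diff_divide_distrib)
  show "((\<lambda>\<zeta>. c * y \<zeta>) has_field_derivative c * y' \<zeta>) (at \<zeta>) \<and>
     ((\<lambda>\<zeta>. c * y' \<zeta>) has_field_derivative (a * (c * y \<zeta>) - (b - \<zeta>) * (c * y' \<zeta>)) / \<zeta>) (at \<zeta>)"
    unfolding e by (intro conjI DERIV_cmult d)
qed

lemma kode_diff:
  assumes "kode a b y y'" "kode a b w w'"
  shows "kode a b (\<lambda>\<zeta>. y \<zeta> - w \<zeta>) (\<lambda>\<zeta>. y' \<zeta> - w' \<zeta>)"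
  unfolding kode_def
proof (intro allI impI)
  fix \<zeta> :: complex assume "Re \<zeta> > 0"
  then have d: "(y has_field_derivative y' \<zeta>) (at \<zeta>)" "(w has_field_derivative w' \<zeta>) (at \<zeta>)"
     "(y' has_field_derivative (a * y \<zeta> - (b - \<zeta>) * y' \<zeta>) / \<zeta>) (at \<zeta>)"
     "(w' has_field_derivative (a * w \<zeta> - (b - \<zeta>) * w' \<zeta>) / \<zeta>) (at \<zeta>)"
    using assms unfolding kode_def by auto
  have e: "(a * (y \<zeta> - w \<zeta>) - (b - \<zeta>) * (y' \<zeta> - w' \<zeta>)) / \<zeta> =
      (a * y \<zeta> - (b - \<zeta>) * y' \<zeta>) / \<zeta> - (a * w \<zeta> - (b - \<zeta>) * w' \<zeta>) / \<zeta>"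
    by (simp add: right_diff_distrib diff_divide_distrib)
  show "((\<lambda>\<zeta>. y \<zeta> - w \<zeta>) has_field_derivative y' \<zeta> - w' \<zeta>) (at \<zeta>) \<and>
     ((\<lambda>\<zeta>. y' \<zeta> - w' \<zeta>) has_field_derivative (a * (y \<zeta> - w \<zeta>) - (b - \<zeta>) * (y' \<zeta> - w' \<zeta>)) / \<zeta>) (at \<zeta>)"
    unfolding e by (intro conjI DERIV_diff d)
qed

text \<open>Abel's formula: the integrating factor is \<open>\<zeta>\<close> to the power
  \<open>b\<close> times \<open>exp (- \<zeta>)\<close>.\<close>

lemma kode_wronskian:
  assumes "kode a b y y'" "kode a b w w'"
  obtains c where "\<And>\<zeta>. Re \<zeta> > 0 \<Longrightarrow> exp (b * Ln \<zeta> - \<zeta>) * (y \<zeta> * w' \<zeta> - y' \<zeta> * w \<zeta>) = c"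
proof -
  have cv: "convex {\<zeta>::complex. Re \<zeta> > 0}" by (rule convex_halfspace_Re_gt)
  have "\<exists>c. \<forall>\<zeta>\<in>{\<zeta>. Re \<zeta> > 0}. exp (b * Ln \<zeta> - \<zeta>) * (y \<zeta> * w' \<zeta> - y' \<zeta> * w \<zeta>) = c"
  proof (rule has_field_derivative_zero_constant[OF cv])
    fix \<zeta> :: complex assume "\<zeta> \<in> {\<zeta>. Re \<zeta> > 0}"
    then have r: "Re \<zeta> > 0" by simp
    then have z: "\<zeta> \<noteq> 0" "\<zeta> \<notin> \<real>\<^sub>\<le>\<^sub>0" using right_half_plane_not_nonpos by auto
    have d: "(y has_field_derivative y' \<zeta>) (at \<zeta>)" "(w has_field_derivative w' \<zeta>) (at \<zeta>)"
       "(y' has_field_derivative (a * y \<zeta> - (b - \<zeta>) * y' \<zeta>) / \<zeta>) (at \<zeta>)"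
       "(w' has_field_derivative (a * w \<zeta> - (b - \<zeta>) * w' \<zeta>) / \<zeta>) (at \<zeta>)"
      using assms r unfolding kode_def by auto
    have "((\<lambda>\<zeta>. exp (b * Ln \<zeta> - \<zeta>) * (y \<zeta> * w' \<zeta> - y' \<zeta> * w \<zeta>)) has_field_derivative
       exp (b * Ln \<zeta> - \<zeta>) * (b / \<zeta> - 1) * (y \<zeta> * w' \<zeta> - y' \<zeta> * w \<zeta>)
       + exp (b * Ln \<zeta> - \<zeta>) * (y' \<zeta> * w' \<zeta> + y \<zeta> * ((a * w \<zeta> - (b - \<zeta>) * w' \<zeta>) / \<zeta>)
          - (((a * y \<zeta> - (b - \<zeta>) * y' \<zeta>) / \<zeta>) * w \<zeta> + y' \<zeta> * w' \<zeta>))) (at \<zeta>)"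
      using z by (auto intro!: derivative_eq_intros d simp: algebra_simps divide_inverse)
    also have "exp (b * Ln \<zeta> - \<zeta>) * (b / \<zeta> - 1) * (y \<zeta> * w' \<zeta> - y' \<zeta> * w \<zeta>)
       + exp (b * Ln \<zeta> - \<zeta>) * (y' \<zeta> * w' \<zeta> + y \<zeta> * ((a * w \<zeta> - (b - \<zeta>) * w' \<zeta>) / \<zeta>)
          - (((a * y \<zeta> - (b - \<zeta>) * y' \<zeta>) / \<zeta>) * w \<zeta> + y' \<zeta> * w' \<zeta>)) = 0"
      using z(1) by (simp add: field_simps)
    finally show "((\<lambda>\<zeta>. exp (b * Ln \<zeta> - \<zeta>) * (y \<zeta> * w' \<zeta> - y' \<zeta> * w \<zeta>)) has_field_derivative 0) (at \<zeta> within {\<zeta>. Re \<zeta> > 0})"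
      by (rule has_field_derivative_at_within)
  qed
  then show ?thesis using that by blast
qed

section \<open>The Laplace integral equals the Kummer function\<close>

lemma gamma_integral_lborel:
  assumes "Re b > 0"
  shows "set_integrable lborel {0<..} (\<lambda>v. exp (- of_real v + (b - 1) * of_real (ln v)))"
    and "(LBINT v:{0<..}. exp (- of_real v + (b - 1) * of_real (ln v))) = Gamma b"
proof -
  let ?g = "\<lambda>v. exp (- of_real v + (b - 1) * of_real (ln v)) :: complex"
  have eq: "?g v = of_real v powr (b - 1) / of_real (exp v)" if "v \<in> {0<..}" for v
  proof -
    have "?g v = exp (- of_real v) * exp ((b - 1) * of_real (ln v))" by (rule exp_add)
    then show ?thesis using that
      by (simp add: powr_def Ln_of_real exp_minus exp_of_real divide_inverse mult.commute)
  qed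
  have "(\<lambda>v. - of_real v + (b - 1) * of_real (ln v)) \<in> borel_measurable borel"
    by (intro borel_measurable_add borel_measurable_uminus borel_measurable_times
        borel_measurable_const measurable_compose[OF _ borel_measurable_of_real]
        borel_measurable_ln measurable_ident_sets refl)
  from measurable_compose[OF this borel_measurable_exp]
  have m: "?g \<in> borel_measurable borel" .
  have "?g absolutely_integrable_on {0<..}"
    by (rule set_integrable_cong[THEN iffD1, OF refl refl _ absolutely_integrable_Gamma_integral'[OF assms]])
      (use eq in auto)
  then show int: "set_integrable lborel {0<..} ?g"
    unfolding set_integrable_def
    by (subst (asm) integrable_completion) (use m in measurable)
  have "(LBINT v:{0<..}. ?g v) = integral {0<..} ?g"
    by (rule set_borel_integral_eq_integral(2)[OF int])
  also have "\<dots> = Gamma b"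
    by (rule integral_unique, rule has_integral_eq[OF _ Gamma_integral_complex'[OF assms]])
      (use eq in auto)
  finally show "(LBINT v:{0<..}. ?g v) = Gamma b" .
qed

text \<open>The substitution \<open>s = v / (v + \<zeta>)\<close>, that is
  \<open>t = v / \<zeta>\<close>, extracts the power \<open>- b\<close> of \<open>\<zeta>\<close>.
  The last claim is a majorant independent of \<open>\<zeta>\<close>; it uses
  \<open>v / (v + \<zeta>) \<le> 1\<close> and \<open>Re b < 1\<close>.\<close>

lemma kint_small_arg_eq:
  assumes \<zeta>: "\<zeta> > 0" and a: "Re a \<ge> 1" and b: "0 < Re b" "Re b < 1"
  shows "exp (b * of_real (ln \<zeta>)) * kint (a + 1) (b + 1) (of_real \<zeta>) =
    (LBINT v:{0<..}. exp (- of_real v + a * of_real (ln (v / (v + \<zeta>))) + (b - 1) * of_real (ln (v + \<zeta>))))"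
    and "set_integrable lborel {0<..} (\<lambda>v. exp (- of_real v + a * of_real (ln (v / (v + \<zeta>))) + (b - 1) * of_real (ln (v + \<zeta>))))"
    and "v > 0 \<Longrightarrow> norm (exp (- of_real v + a * of_real (ln (v / (v + \<zeta>))) + (b - 1) * of_real (ln (v + \<zeta>))))
      \<le> norm (exp (- of_real v + (b - 1) * of_real (ln v)))"
proof -
  define G where "G = (\<lambda>v. exp (- of_real v + a * of_real (ln (v / (v + \<zeta>))) + (b - 1) * of_real (ln (v + \<zeta>))))"
  define g where "g = (\<lambda>v. v / (v + \<zeta>))"
  define g' where "g' = (\<lambda>v. \<zeta> / (v + \<zeta>)\<^sup>2)"
  have bound: "norm (G v) \<le> norm (exp (- of_real v + (b - 1) * of_real (ln v)))" if "v > 0" for v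
  proof -
    have "v / (v + \<zeta>) \<le> 1" using that \<zeta> by simp
    then have "ln (v / (v + \<zeta>)) \<le> 0" using that \<zeta> by (subst ln_le_zero_iff) auto
    then have "Re a * ln (v / (v + \<zeta>)) \<le> 0" using a by (intro mult_nonneg_nonpos) auto
    moreover have "(Re b - 1) * ln (v + \<zeta>) \<le> (Re b - 1) * ln v"
      using that \<zeta> b by (intro mult_left_mono_neg) auto
    ultimately show ?thesis unfolding G_def by (simp add: norm_exp_eq_Re)
  qed
  then show "v > 0 \<Longrightarrow> norm (exp (- of_real v + a * of_real (ln (v / (v + \<zeta>))) + (b - 1) * of_real (ln (v + \<zeta>))))
      \<le> norm (exp (- of_real v + (b - 1) * of_real (ln v)))" unfolding G_def .
  have "(\<lambda>v. - of_real v + a * of_real (ln (v / (v + \<zeta>))) + (b - 1) * of_real (ln (v + \<zeta>))) \<in> borel_measurable borel"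
    by (intro borel_measurable_add borel_measurable_uminus borel_measurable_times borel_measurable_divide
        borel_measurable_const measurable_compose[OF _ borel_measurable_of_real]
        borel_measurable_ln measurable_ident_sets refl)
  from measurable_compose[OF this borel_measurable_exp]
  have m: "G \<in> borel_measurable borel" unfolding G_def .
  have int: "set_integrable lborel {0<..} G"
    by (rule set_integrable_bound[OF gamma_integral_lborel(1)[OF b(1)]])
      (use m bound in \<open>auto simp: set_borel_measurable_def intro!: AE_I2\<close>)
  then show "set_integrable lborel {0<..} (\<lambda>v. exp (- of_real v + a * of_real (ln (v / (v + \<zeta>))) + (b - 1) * of_real (ln (v + \<zeta>))))"
    unfolding G_def .
  have eq: "g' v *\<^sub>R kkern (a + 1) (b + 1) (of_real \<zeta>) (g v) = exp (- b * of_real (ln \<zeta>)) * G v" if v: "v > 0" for v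
  proof -
    have 0: "1 - g v = \<zeta> / (v + \<zeta>)" using v \<zeta> by (simp add: g_def field_simps)
    have "g v / (\<zeta> / (v + \<zeta>)) = v / \<zeta>" using v \<zeta> by (simp add: g_def)
    note 1 = 0 this
    have l: "ln (\<zeta> / (v + \<zeta>)) = ln \<zeta> - ln (v + \<zeta>)" using v \<zeta> by (simp add: ln_div)
    have "g' v = exp (ln \<zeta> - 2 * ln (v + \<zeta>))"
      using v \<zeta> by (simp add: g'_def exp_diff exp_double)
    then have "g' v *\<^sub>R kkern (a + 1) (b + 1) (of_real \<zeta>) (g v) =
      exp (of_real (ln \<zeta> - 2 * ln (v + \<zeta>))) * kkern (a + 1) (b + 1) (of_real \<zeta>) (g v)"
      by (simp only: scaleR_conv_of_real exp_of_real)
    also have "\<dots> = exp (- b * of_real (ln \<zeta>)) * G v"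
      unfolding kkern_def G_def 1 unfolding l g_def exp_add[symmetric]
      by (rule arg_cong[of _ _ exp]) (use \<zeta> in \<open>simp add: algebra_simps\<close>)
    finally show ?thesis .
  qed
  have "(LBINT s=ereal 0..ereal 1. kkern (a + 1) (b + 1) (of_real \<zeta>) s)
      = (LBINT v=ereal 0..\<infinity>. g' v *\<^sub>R kkern (a + 1) (b + 1) (of_real \<zeta>) (g v))"
  proof (rule interval_integral_substitution_integrable)
    fix v assume "ereal 0 < ereal v"
    then have v: "v > 0" by simp
    show "DERIV g v :> g' v" unfolding g_def g'_def using v \<zeta>
      by (auto intro!: derivative_eq_intros simp: power2_eq_square)
    have "0 < g v" "g v < 1" using v \<zeta> by (auto simp: g_def)
    then show "isCont (kkern (a + 1) (b + 1) (of_real \<zeta>)) (g v)"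
      unfolding kkern_def by (intro continuous_intros) auto
    show "isCont g' v" unfolding g'_def using v \<zeta> by (intro continuous_intros) auto
  next
    fix v assume "ereal 0 \<le> ereal v"
    then show "0 \<le> g' v" using \<zeta> by (simp add: g'_def)
  next
    have "(g \<longlongrightarrow> 0) (at_right 0)"
      unfolding g_def using \<zeta> by (auto intro!: tendsto_eq_intros)
    then show "((ereal \<circ> g \<circ> real_of_ereal) \<longlongrightarrow> ereal 0) (at_right (ereal 0))"
      by (simp add: ereal_tendsto_simps)
    have "(g \<longlongrightarrow> 1) at_top"
    proof (rule Lim_transform_eventually)
      have "filterlim (\<lambda>v. v + \<zeta>) at_top at_top"
        using filterlim_tendsto_add_at_top[OF tendsto_const[of \<zeta>] filterlim_ident] by (simp add: add.commute)
      then have "((\<lambda>v. 1 - \<zeta> / (v + \<zeta>)) \<longlongrightarrow> 1 - 0) at_top"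
        by (intro tendsto_diff tendsto_const tendsto_divide_0[OF tendsto_const] filterlim_at_top_imp_at_infinity)
      then show "((\<lambda>v. 1 - \<zeta> / (v + \<zeta>)) \<longlongrightarrow> 1) at_top" by simp
      show "\<forall>\<^sub>F v in at_top. 1 - \<zeta> / (v + \<zeta>) = g v"
        using eventually_gt_at_top[of 0] by eventually_elim (use \<zeta> in \<open>simp add: g_def field_simps\<close>)
    qed
    then show "((ereal \<circ> g \<circ> real_of_ereal) \<longlongrightarrow> ereal 1) (at_left \<infinity>)"
      by (simp add: ereal_tendsto_simps)
    show "set_integrable lborel (einterval (ereal 0) \<infinity>) (\<lambda>v. g' v *\<^sub>R kkern (a + 1) (b + 1) (of_real \<zeta>) (g v))"
    proof -
      have "set_integrable lborel {0<..} (\<lambda>v. exp (- b * of_real (ln \<zeta>)) * G v)"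
        by (rule set_integrable_mult_right[OF int])
      then show ?thesis unfolding einterval_eq
        by (subst set_integrable_cong[OF refl refl eq]) auto
    qed
    show "set_integrable lborel (einterval (ereal 0) (ereal 1)) (kkern (a + 1) (b + 1) (of_real \<zeta>))"
      unfolding einterval_eq by (rule kkern_integrable) (use a \<zeta> in auto)
  qed simp
  then have "kint (a + 1) (b + 1) (of_real \<zeta>) = (LBINT v:{0<..}. g' v *\<^sub>R kkern (a + 1) (b + 1) (of_real \<zeta>) (g v))"
    by (simp add: interval_lebesgue_integral_le_eq kint_def)
  also have "\<dots> = (LBINT v:{0<..}. exp (- b * of_real (ln \<zeta>)) * G v)"
    by (intro set_lebesgue_integral_cong allI impI) (use eq in auto)
  also have "\<dots> = exp (- b * of_real (ln \<zeta>)) * (LBINT v:{0<..}. G v)"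
    by (rule set_integral_mult_right)
  finally have "exp (b * of_real (ln \<zeta>)) * kint (a + 1) (b + 1) (of_real \<zeta>) = (LBINT v:{0<..}. G v)"
    by (simp add: exp_minus)
  then show "exp (b * of_real (ln \<zeta>)) * kint (a + 1) (b + 1) (of_real \<zeta>) =
    (LBINT v:{0<..}. exp (- of_real v + a * of_real (ln (v / (v + \<zeta>))) + (b - 1) * of_real (ln (v + \<zeta>))))"
    unfolding G_def .
qed

text \<open>Since \<open>- kint (a + 1) (b + 1)\<close> is the derivative of
  \<open>kint a b\<close>, this gives the singularity of that derivative at 0, one of the two data
  that single out the solution.\<close>

lemma kint_small_arg_limit:
  fixes \<zeta> :: "nat \<Rightarrow> real"
  assumes \<zeta>: "\<And>n. \<zeta> n > 0" "\<zeta> \<longlonglongrightarrow> 0" and a: "Re a \<ge> 1" and b: "0 < Re b" "Re b < 1"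
  shows "(\<lambda>n. exp (b * of_real (ln (\<zeta> n))) * kint (a + 1) (b + 1) (of_real (\<zeta> n))) \<longlonglongrightarrow> Gamma b"
  unfolding kint_small_arg_eq(1)[OF \<zeta>(1) a b] gamma_integral_lborel(2)[OF b(1), symmetric]
  unfolding set_lebesgue_integral_def
proof (rule integral_dominated_convergence)
  show "integrable lborel (\<lambda>v. indicat_real {0<..} v *\<^sub>R norm (exp (- of_real v + (b - 1) * of_real (ln v) :: complex)))"
    using set_integrable_norm[OF gamma_integral_lborel(1)[OF b(1)]] unfolding set_integrable_def .
  show "(\<lambda>v. indicat_real {0<..} v *\<^sub>R exp (- of_real v + (b - 1) * of_real (ln v) :: complex)) \<in> borel_measurable lborel"
    using gamma_integral_lborel(1)[OF b(1)] unfolding set_integrable_def by (rule borel_measurable_integrable)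
  show "(\<lambda>v. indicat_real {0<..} v *\<^sub>R exp (- of_real v + a * of_real (ln (v / (v + \<zeta> n))) + (b - 1) * of_real (ln (v + \<zeta> n)))) \<in> borel_measurable lborel" for n
    using kint_small_arg_eq(2)[OF \<zeta>(1) a b] unfolding set_integrable_def by (rule borel_measurable_integrable)
  show "AE v in lborel. norm (indicat_real {0<..} v *\<^sub>R exp (- of_real v + a * of_real (ln (v / (v + \<zeta> n))) + (b - 1) * of_real (ln (v + \<zeta> n))))
     \<le> indicat_real {0<..} v *\<^sub>R norm (exp (- of_real v + (b - 1) * of_real (ln v) :: complex))" for n
    by (rule AE_I2) (use kint_small_arg_eq(3)[OF \<zeta>(1) a b] in \<open>auto simp: indicator_def\<close>)
  show "AE v in lborel. (\<lambda>n. indicat_real {0<..} v *\<^sub>R exp (- of_real v + a * of_real (ln (v / (v + \<zeta> n))) + (b - 1) * of_real (ln (v + \<zeta> n))))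
     \<longlonglongrightarrow> indicat_real {0<..} v *\<^sub>R exp (- of_real v + (b - 1) * of_real (ln v) :: complex)"
  proof (rule AE_I2)
    fix v :: real
    show "(\<lambda>n. indicat_real {0<..} v *\<^sub>R exp (- of_real v + a * of_real (ln (v / (v + \<zeta> n))) + (b - 1) * of_real (ln (v + \<zeta> n))))
     \<longlonglongrightarrow> indicat_real {0<..} v *\<^sub>R exp (- of_real v + (b - 1) * of_real (ln v) :: complex)"
    proof (cases "v > 0")
      case True
      have "(\<lambda>n. v + \<zeta> n) \<longlonglongrightarrow> v + 0" by (intro tendsto_intros \<zeta>)
      then have 1: "(\<lambda>n. v + \<zeta> n) \<longlonglongrightarrow> v" by simp
      then have "(\<lambda>n. v / (v + \<zeta> n)) \<longlonglongrightarrow> v / v" by (intro tendsto_intros) (use True in auto)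
      then have 2: "(\<lambda>n. ln (v / (v + \<zeta> n))) \<longlonglongrightarrow> ln 1" by (intro tendsto_ln) (use True in auto)
      have 3: "(\<lambda>n. ln (v + \<zeta> n)) \<longlonglongrightarrow> ln v" by (intro tendsto_ln 1) (use True in auto)
      have "(\<lambda>n. - of_real v + a * of_real (ln (v / (v + \<zeta> n))) + (b - 1) * of_real (ln (v + \<zeta> n)))
         \<longlonglongrightarrow> - of_real v + a * of_real (ln 1) + (b - 1) * (of_real (ln v) :: complex)"
        by (intro tendsto_intros 2 3)
      then have "(\<lambda>n. exp (- of_real v + a * of_real (ln (v / (v + \<zeta> n))) + (b - 1) * of_real (ln (v + \<zeta> n))))
         \<longlonglongrightarrow> exp (- of_real v + (b - 1) * (of_real (ln v) :: complex))"
        using tendsto_exp by fastforce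
      then show ?thesis by (intro tendsto_scaleR tendsto_const)
    qed simp
  qed
qed

text \<open>Euler's beta integral with parameters \<open>a\<close> and \<open>1 - b\<close>; it is
  the limit of the Laplace integral at \<open>\<zeta> = 0\<close> and the other datum at the
  origin.\<close>

definition kbeta :: "complex \<Rightarrow> complex \<Rightarrow> complex" where
  "kbeta a b = (LBINT s:{0<..<1}. kkern a b 0 s)"

lemma kkern_0_integrable:
  assumes "Re a \<ge> 1" "Re b < 1"
  shows "set_integrable lborel {0<..<1} (kkern a b 0)"
proof (rule set_integrable_bound)
  have "set_integrable lborel {0..1} (\<lambda>t. t powr (Re a - 1) * (1 - t) powr ((1 - Re b) - 1))"
    by (rule integrable_Beta) (use assms in auto)
  then show "set_integrable lborel {0<..<1} (\<lambda>t. t powr (Re a - 1) * (1 - t) powr ((1 - Re b) - 1))"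
    by (rule set_integrable_subset) auto
  show "set_borel_measurable lborel {0<..<1} (kkern a b 0)"
    unfolding set_borel_measurable_def by (intro borel_measurable_scaleR borel_measurable_indicator) auto
  show "AE s in lborel. s \<in> {0<..<1} \<longrightarrow> norm (kkern a b 0 s) \<le> norm (s powr (Re a - 1) * (1 - s) powr ((1 - Re b) - 1))"
    by (rule AE_I2) (auto simp: norm_kkern powr_def exp_add[symmetric])
qed

lemma kint_zero_limit:
  fixes \<zeta> :: "nat \<Rightarrow> real"
  assumes \<zeta>: "\<And>n. \<zeta> n > 0" "\<zeta> \<longlonglongrightarrow> 0" and a: "Re a \<ge> 1" and b: "Re b < 1"
  shows "(\<lambda>n. kint a b (of_real (\<zeta> n))) \<longlonglongrightarrow> kbeta a b"
  unfolding kint_def kbeta_def set_lebesgue_integral_def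
proof (rule integral_dominated_convergence)
  show "integrable lborel (\<lambda>s. indicat_real {0<..<1} s *\<^sub>R norm (kkern a b 0 s))"
    using set_integrable_norm[OF kkern_0_integrable[OF a b]] unfolding set_integrable_def .
  show "(\<lambda>s. indicat_real {0<..<1} s *\<^sub>R kkern a b 0 s) \<in> borel_measurable lborel"
     "(\<lambda>s. indicat_real {0<..<1} s *\<^sub>R kkern a b (of_real (\<zeta> n)) s) \<in> borel_measurable lborel" for n
    by (intro borel_measurable_scaleR borel_measurable_indicator; simp)+
  show "AE s in lborel. norm (indicat_real {0<..<1} s *\<^sub>R kkern a b (of_real (\<zeta> n)) s)
     \<le> indicat_real {0<..<1} s *\<^sub>R norm (kkern a b 0 s)" for n
  proof (rule AE_I2)
    fix s :: real
    have "\<zeta> n * (s / (1 - s)) \<ge> 0" if "0 < s" "s < 1" using that \<zeta>(1)[of n] by simp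
    then show "norm (indicat_real {0<..<1} s *\<^sub>R kkern a b (of_real (\<zeta> n)) s)
     \<le> indicat_real {0<..<1} s *\<^sub>R norm (kkern a b 0 s)"
      by (simp add: norm_kkern indicator_def)
  qed
  show "AE s in lborel. (\<lambda>n. indicat_real {0<..<1} s *\<^sub>R kkern a b (of_real (\<zeta> n)) s)
     \<longlonglongrightarrow> indicat_real {0<..<1} s *\<^sub>R kkern a b 0 s"
  proof (rule AE_I2)
    fix s :: real
    have "(\<lambda>n. complex_of_real (\<zeta> n)) \<longlonglongrightarrow> of_real 0" by (intro tendsto_of_real \<zeta>)
    then have "(\<lambda>n. complex_of_real (\<zeta> n)) \<longlonglongrightarrow> 0" by simp
    then show "(\<lambda>n. indicat_real {0<..<1} s *\<^sub>R kkern a b (of_real (\<zeta> n)) s)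
     \<longlonglongrightarrow> indicat_real {0<..<1} s *\<^sub>R kkern a b 0 s"
      unfolding kkern_def by (intro tendsto_intros)
  qed
qed

lemma exp_ln_tendsto_0:
  fixes \<zeta> :: "nat \<Rightarrow> real"
  assumes \<zeta>: "\<And>n. \<zeta> n > 0" "\<zeta> \<longlonglongrightarrow> 0" and c: "Re c > 0"
  shows "(\<lambda>n. exp (c * of_real (ln (\<zeta> n)))) \<longlonglongrightarrow> 0"
proof (rule tendsto_norm_zero_cancel)
  have "filterlim \<zeta> (at_right 0) sequentially"
    using \<zeta> by (intro tendsto_imp_filterlim_at_right) auto
  then have "filterlim (\<lambda>n. ln (\<zeta> n)) at_bot sequentially" by (rule filterlim_compose[OF ln_at_0])
  then have "filterlim (\<lambda>n. Re c * ln (\<zeta> n)) at_bot sequentially"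
    using c by (rule_tac filterlim_tendsto_pos_mult_at_bot[OF tendsto_const])
  then have "(\<lambda>n. exp (Re c * ln (\<zeta> n))) \<longlonglongrightarrow> 0" by (rule filterlim_compose[OF exp_at_bot])
  then show "(\<lambda>n. norm (exp (c * of_real (ln (\<zeta> n))))) \<longlonglongrightarrow> 0" by (simp add: norm_exp_eq_Re)
qed

text \<open>The limit \<open>\<zeta> \<rightarrow> 0\<close> of the by-parts identity at
  \<open>b - 1\<close>: its left side is \<open>\<zeta>\<close> to the power \<open>1 - b\<close>
  times a convergent factor and vanishes because \<open>Re b < 1\<close>. The contiguous relation
  then eliminates \<open>b - 1\<close>.\<close>

lemma kbeta_rec:
  assumes a: "Re a \<ge> 1" and b: "0 < Re b" "Re b < 1"
  shows "(a + 1 - b) * kbeta (a + 1) b = a * kbeta a b"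
proof -
  define \<zeta> where "\<zeta> = (\<lambda>n. inverse (real (Suc n)))"
  have \<zeta>: "\<And>n. \<zeta> n > 0" "\<zeta> \<longlonglongrightarrow> 0" unfolding \<zeta>_def by (simp, rule LIMSEQ_inverse_real_of_nat)
  have s: "b - 1 + 2 = b + 1" "b - 1 + 1 = b" by simp_all
  have eq: "a * kint a (b - 1) (of_real (\<zeta> n)) + (b - 1) * kint (a + 1) b (of_real (\<zeta> n)) =
     exp ((1 - b) * of_real (ln (\<zeta> n))) * (exp (b * of_real (ln (\<zeta> n))) * kint (a + 1) (b + 1) (of_real (\<zeta> n)))" for n
  proof -
    have "of_real (\<zeta> n) * kint (a + 1) (b + 1) (of_real (\<zeta> n)) =
      a * kint a (b - 1) (of_real (\<zeta> n)) + (b - 1) * kint (a + 1) b (of_real (\<zeta> n))"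
      using kint_by_parts[OF a, of "of_real (\<zeta> n)" "b - 1"] \<zeta>(1)[of n] unfolding s by simp
    moreover have "of_real (\<zeta> n) = exp ((1 - b) * of_real (ln (\<zeta> n))) * exp (b * (of_real (ln (\<zeta> n)) :: complex))"
      using \<zeta>(1)[of n] unfolding exp_add[symmetric] by (simp add: algebra_simps exp_of_real)
    ultimately show ?thesis by (simp add: mult.assoc)
  qed
  have "(\<lambda>n. a * kint a (b - 1) (of_real (\<zeta> n)) + (b - 1) * kint (a + 1) b (of_real (\<zeta> n)))
      \<longlonglongrightarrow> a * kbeta a (b - 1) + (b - 1) * kbeta (a + 1) b"
    by (intro tendsto_intros kint_zero_limit \<zeta>) (use a b in auto)
  moreover have "(\<lambda>n. a * kint a (b - 1) (of_real (\<zeta> n)) + (b - 1) * kint (a + 1) b (of_real (\<zeta> n))) \<longlonglongrightarrow> 0 * Gamma b"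
    unfolding eq by (intro tendsto_mult kint_small_arg_limit exp_ln_tendsto_0 \<zeta>) (use a b in auto)
  ultimately have "a * kbeta a (b - 1) + (b - 1) * kbeta (a + 1) b = 0"
    using LIMSEQ_unique by fastforce
  moreover have "kbeta a (b - 1) = kbeta a b - kbeta (a + 1) b"
  proof -
    have "kbeta a b - kbeta (a + 1) b = (LBINT s:{0<..<1}. kkern a b 0 s - kkern (a + 1) b 0 s)"
      unfolding kbeta_def using a b by (intro set_integral_diff(2)[symmetric] kkern_0_integrable) auto
    also have "\<dots> = kbeta a (b - 1)"
      unfolding kbeta_def
      by (intro set_lebesgue_integral_cong allI impI, simp, simp only: kkern_shift(1,2)) (simp add: algebra_simps)
    finally show ?thesis ..
  qed
  ultimately show ?thesis by (simp add: algebra_simps)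
qed

text \<open>The substitution \<open>s = 1 - v / n\<close> turns the power of \<open>s\<close> into
  \<open>(1 - v / n) ^ n\<close>, which tends to \<open>exp (- v)\<close> and is dominated by it;
  what is left is the Gamma integral at \<open>1 - b\<close>.\<close>

lemma kbeta_asymptotics:
  assumes a: "Re a \<ge> 1" and b: "0 < Re b" "Re b < 1"
  shows "(\<lambda>n. exp ((1 - b) * of_real (ln (real n))) * kbeta (a + of_nat n) b) \<longlonglongrightarrow> Gamma (1 - b)"
proof -
  define K where "K = (\<lambda>n v. exp ((a - 1 + of_nat n) * of_real (ln (1 - v / real n)) - b * of_real (ln v)))"
  define I where "I = (\<lambda>n v. indicat_real {0<..<real n} v *\<^sub>R K n v)"
  have b1: "Re (1 - b) > 0" using b by simp
  have eq: "exp ((1 - b) * of_real (ln (real n))) * kbeta (a + of_nat n) b = (LBINT v. I n v)" if n: "n > 0" for n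
  proof -
    define c where "c = - 1 / real n"
    have c: "c \<noteq> 0" "\<bar>c\<bar> = 1 / real n" using n by (simp_all add: c_def)
    define X where "X = (\<lambda>v. indicat_real {0<..<1} (1 + c * v) *\<^sub>R kkern (a + of_nat n) b 0 (1 + c * v))"
    have k: "kbeta (a + of_nat n) b = \<bar>c\<bar> *\<^sub>R (LBINT v. X v)"
      unfolding kbeta_def set_lebesgue_integral_def X_def by (rule lborel_integral_real_affine[OF c(1)])
    have "exp ((1 - b) * of_real (ln (real n))) * kbeta (a + of_nat n) b =
       (LBINT v. exp ((1 - b) * of_real (ln (real n))) * (\<bar>c\<bar> *\<^sub>R X v))"
      unfolding k integral_mult_right_zero integral_scaleR_right ..
    also have "\<dots> = (LBINT v. I n v)"
    proof (rule Bochner_Integration.integral_cong[OF refl])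
      fix v :: real
      have cv: "1 + c * v = 1 - v / real n" "1 - (1 + c * v) = v / real n" by (simp_all add: c_def)
      have mem: "1 + c * v \<in> {0<..<1} \<longleftrightarrow> v \<in> {0<..<real n}"
        unfolding cv(1) greaterThanLessThan_iff using n by (simp add: zero_less_divide_iff conj_commute)
      show "exp ((1 - b) * of_real (ln (real n))) * (\<bar>c\<bar> *\<^sub>R X v) = I n v"
      proof (cases "v \<in> {0<..<real n}")
        case True
        then have ind: "indicat_real {0<..<1} (1 + c * v) = 1" "indicat_real {0<..<real n} v = 1"
          using mem by simp_all
        have l: "ln (v / real n) = ln v - ln (real n)" using True n by (simp add: ln_div)
        have cn: "complex_of_real \<bar>c\<bar> = exp (- of_real (ln (real n)))"
          using n c by (simp add: exp_minus exp_of_real divide_inverse)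
        have "exp ((1 - b) * of_real (ln (real n))) * (exp (- of_real (ln (real n))) * kkern (a + of_nat n) b 0 (1 + c * v)) = K n v"
          unfolding kkern_def K_def cv(2) l unfolding cv(1) exp_add[symmetric]
          by (rule arg_cong[of _ _ exp]) (simp add: algebra_simps)
        then show ?thesis unfolding I_def X_def ind by (simp add: scaleR_conv_of_real cn)
      next
        case False
        then have "indicat_real {0<..<1} (1 + c * v) = 0" "indicat_real {0<..<real n} v = 0"
          using mem by simp_all
        then show ?thesis by (simp add: I_def X_def)
      qed
    qed
    finally show ?thesis .
  qed
  have mK: "K n \<in> borel_measurable borel" for n
  proof -
    have "(\<lambda>v. (a - 1 + of_nat n) * of_real (ln (1 - v / real n)) - b * of_real (ln v)) \<in> borel_measurable borel"
      by (intro borel_measurable_add borel_measurable_diff borel_measurable_uminus borel_measurable_times borel_measurable_divide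
        borel_measurable_const measurable_compose[OF _ borel_measurable_of_real]
        borel_measurable_ln measurable_ident_sets refl)
    from measurable_compose[OF this borel_measurable_exp] show ?thesis unfolding K_def .
  qed
  have pow: "exp (of_nat n * of_real (ln (1 - v / real n))) = (of_real ((1 - v / real n) ^ n) :: complex)"
    if "0 < v" "v < real n" for n v
  proof -
    have "0 < 1 - v / real n" using that by simp
    then have "exp (real n * ln (1 - v / real n)) = (1 - v / real n) ^ n" by (simp add: exp_of_nat_mult)
    then show ?thesis by (metis exp_of_real of_real_mult of_real_of_nat_eq)
  qed
  have "(\<lambda>n. LBINT v. I n v) \<longlonglongrightarrow> (LBINT v. indicat_real {0<..} v *\<^sub>R exp (- of_real v + ((1 - b) - 1) * of_real (ln v)))"
  proof (rule integral_dominated_convergence)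
    show "integrable lborel (\<lambda>v. indicat_real {0<..} v *\<^sub>R norm (exp (- of_real v + ((1 - b) - 1) * of_real (ln v))))"
      using set_integrable_norm[OF gamma_integral_lborel(1)[OF b1]] unfolding set_integrable_def .
    show "(\<lambda>v. indicat_real {0<..} v *\<^sub>R exp (- of_real v + ((1 - b) - 1) * of_real (ln v))) \<in> borel_measurable lborel"
      using gamma_integral_lborel(1)[OF b1] unfolding set_integrable_def by (rule borel_measurable_integrable)
    show "I n \<in> borel_measurable lborel" for n
      unfolding I_def using mK by (intro borel_measurable_scaleR borel_measurable_indicator) auto
    show "AE v in lborel. norm (I n v) \<le> indicat_real {0<..} v *\<^sub>R norm (exp (- of_real v + ((1 - b) - 1) * of_real (ln v)))" for n
    proof (rule AE_I2)
      fix v :: real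
      show "norm (I n v) \<le> indicat_real {0<..} v *\<^sub>R norm (exp (- of_real v + ((1 - b) - 1) * of_real (ln v)))"
      proof (cases "v \<in> {0<..<real n}")
        case True
        then have v: "0 < v" "v < real n" by auto
        have l: "ln (1 - v / real n) \<le> - (v / real n)" using ln_le_minus_one[of "1 - v / real n"] v by simp
        then have "ln (1 - v / real n) \<le> 0" using v by (meson divide_pos_pos less_imp_le neg_le_0_iff_le of_nat_0_less_iff order.trans order.strict_trans)
        then have "(Re a - 1) * ln (1 - v / real n) \<le> 0" using a by (intro mult_nonneg_nonpos) auto
        moreover have "real n * ln (1 - v / real n) \<le> real n * - (v / real n)" using l by (intro mult_left_mono) auto
        moreover have "real n * - (v / real n) = - v" using v by simp
        ultimately have "(Re a - 1 + real n) * ln (1 - v / real n) \<le> - v"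
          unfolding distrib_right by linarith
        then show ?thesis using v by (simp add: I_def K_def norm_exp_eq_Re)
      qed (auto simp: I_def indicator_def)
    qed
    show "AE v in lborel. (\<lambda>n. I n v) \<longlonglongrightarrow> indicat_real {0<..} v *\<^sub>R exp (- of_real v + ((1 - b) - 1) * of_real (ln v))"
    proof (rule AE_I2)
      fix v :: real
      show "(\<lambda>n. I n v) \<longlonglongrightarrow> indicat_real {0<..} v *\<^sub>R exp (- of_real v + ((1 - b) - 1) * of_real (ln v))"
      proof (cases "v > 0")
        case True
        have "(\<lambda>n. v / real n) \<longlonglongrightarrow> 0" by (rule lim_const_over_n)
        then have "(\<lambda>n. 1 - v / real n) \<longlonglongrightarrow> 1 - 0" by (intro tendsto_intros)
        then have l: "(\<lambda>n. ln (1 - v / real n)) \<longlonglongrightarrow> ln 1" by (intro tendsto_ln) auto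
        have e: "(\<lambda>n. (1 - v / real n) ^ n) \<longlonglongrightarrow> exp (- v)"
          using tendsto_exp_limit_sequentially[of "- v"] by simp
        have "(\<lambda>n. of_real ((1 - v / real n) ^ n) * exp ((a - 1) * of_real (ln (1 - v / real n)) - b * of_real (ln v)))
           \<longlonglongrightarrow> of_real (exp (- v)) * exp ((a - 1) * of_real (ln 1) - b * (of_real (ln v) :: complex))"
          by (intro tendsto_intros e l)
        also have "of_real (exp (- v)) * exp ((a - 1) * of_real (ln 1) - b * (of_real (ln v) :: complex)) =
           exp (- of_real v + ((1 - b) - 1) * of_real (ln v))"
          unfolding exp_of_real[symmetric] exp_add[symmetric] by (rule arg_cong[of _ _ exp]) simp
        finally have lim: "(\<lambda>n. of_real ((1 - v / real n) ^ n) * exp ((a - 1) * of_real (ln (1 - v / real n)) - b * of_real (ln v)))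
           \<longlonglongrightarrow> exp (- of_real v + ((1 - b) - 1) * of_real (ln v))" .
        have "\<forall>\<^sub>F n in sequentially. real n > v"
          using filterlim_real_sequentially unfolding filterlim_at_top_dense by blast
        then have "\<forall>\<^sub>F n in sequentially. of_real ((1 - v / real n) ^ n) * exp ((a - 1) * of_real (ln (1 - v / real n)) - b * of_real (ln v)) = I n v"
        proof eventually_elim
          case (elim n)
          show ?case unfolding pow[OF True elim, symmetric] exp_add[symmetric] I_def K_def
            using True elim by (simp add: algebra_simps)
        qed
        from Lim_transform_eventually[OF lim this] show ?thesis using True by simp
      next
        case False
        then have "I n v = 0" for n by (auto simp: I_def)
        then show ?thesis using False by simp
      qed
    qed
  qed
  then have "(\<lambda>n. LBINT v. I n v) \<longlonglongrightarrow> Gamma (1 - b)"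
    using gamma_integral_lborel(2)[OF b1] unfolding set_lebesgue_integral_def by simp
  moreover have "\<forall>\<^sub>F n in sequentially. (LBINT v. I n v) = exp ((1 - b) * of_real (ln (real n))) * kbeta (a + of_nat n) b"
    using eventually_gt_at_top[of 0] by eventually_elim (use eq in simp)
  ultimately show ?thesis by (rule Lim_transform_eventually)
qed

text \<open>Recurrence and asymptotics determine the beta integral: \<open>n + 1\<close> steps of
  the recurrence produce the two Pochhammer products of Euler's limit formula for
  \<open>rGamma\<close>, and the limit closes the computation.\<close>

lemma kbeta_eq:
  assumes a: "Re a \<ge> 1" and b: "0 < Re b" "Re b < 1"
  shows "kbeta a b = Gamma a * rGamma (a - b + 1) * Gamma (1 - b)"
proof -
  have it: "pochhammer a n * kbeta a b = pochhammer (a + 1 - b) n * kbeta (a + of_nat n) b" for n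
  proof (induction n)
    case (Suc n)
    have "(a + of_nat n + 1 - b) * kbeta (a + of_nat n + 1) b = (a + of_nat n) * kbeta (a + of_nat n) b"
      by (rule kbeta_rec) (use a b in auto)
    moreover have "pochhammer a (Suc n) = pochhammer a n * (a + of_nat n)"
      "pochhammer (a + 1 - b) (Suc n) = pochhammer (a + 1 - b) n * (a + 1 - b + of_nat n)"
      "a + of_nat (Suc n) = a + of_nat n + 1"
      by (simp_all add: pochhammer_Suc)
    ultimately show ?case using Suc by algebra
  qed simp
  have eq: "\<forall>\<^sub>F n in sequentially. rGamma_series (a + 1 - b) n * (exp ((1 - b) * of_real (ln (real n))) * kbeta (a + 1 + of_nat n) b)
      = rGamma_series a n * kbeta a b"
    using eventually_gt_at_top[of 0]
  proof eventually_elim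
    case (elim n)
    define L where "L = complex_of_real (ln (real n))"
    have "exp ((a + 1 - b) * L) = exp (a * L) * exp ((1 - b) * L)"
      unfolding exp_add[symmetric] by (rule arg_cong[of _ _ exp]) (simp add: algebra_simps)
    moreover have "pochhammer a (n + 1) * kbeta a b = pochhammer (a + 1 - b) (n + 1) * kbeta (a + 1 + of_nat n) b"
      using it[of "n + 1"] by (simp add: algebra_simps)
    moreover have "P2 / (F * (E1 * E3)) * (E3 * K') = P1 / (F * E1) * K"
      if "P1 * K = P2 * K'" "E1 \<noteq> 0" "E3 \<noteq> 0" "F \<noteq> 0" for P1 P2 K K' E1 E3 F :: complex
      using that by (simp add: field_simps)
    ultimately show ?case unfolding rGamma_series_def L_def[symmetric] by simp
  qed
  have "(\<lambda>n. rGamma_series (a + 1 - b) n * (exp ((1 - b) * of_real (ln (real n))) * kbeta (a + 1 + of_nat n) b))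
      \<longlonglongrightarrow> rGamma (a + 1 - b) * Gamma (1 - b)"
    by (intro tendsto_mult rGamma_series_LIMSEQ kbeta_asymptotics) (use a b in auto)
  from Lim_transform_eventually[OF this eq]
  have "(\<lambda>n. rGamma_series a n * kbeta a b) \<longlonglongrightarrow> rGamma (a + 1 - b) * Gamma (1 - b)" .
  moreover have "(\<lambda>n. rGamma_series a n * kbeta a b) \<longlonglongrightarrow> rGamma a * kbeta a b"
    by (intro tendsto_intros)
  ultimately have "rGamma a * kbeta a b = rGamma (a + 1 - b) * Gamma (1 - b)" by (rule LIMSEQ_unique[rotated])
  moreover have "Gamma a * rGamma a = 1"
  proof -
    have "a \<notin> \<int>\<^sub>\<le>\<^sub>0" using a by (auto elim!: nonpos_Ints_cases)
    then show ?thesis by (simp add: rGamma_inverse_Gamma Gamma_eq_zero_iff)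
  qed
  ultimately have "kbeta a b = Gamma a * (rGamma (a + 1 - b) * Gamma (1 - b))" by (metis mult.assoc mult_1)
  then show ?thesis by (simp add: algebra_simps)
qed

text \<open>The difference \<open>D\<close> solves Kummer's equation, and its Wronskians with
  \<open>M\<close> and \<open>N\<close> are constant. Evaluated along a positive sequence tending to
  0 both vanish, while \<open>M\<close> and \<open>N\<close> have a nonzero Wronskian; so
  \<open>D = 0\<close>.\<close>

lemma kV_eq_kint_strip:
  assumes a: "Re a \<ge> 1" and b: "0 < Re b" "Re b < 1" and r: "Re \<zeta> > 0"
  shows "kV a b \<zeta> = kint a b \<zeta>"
proof -
  define c2 where "c2 = of_real pi / sin (of_real pi * b)"
  define c1 where "c1 = c2 * (Gamma a * rGamma (a - b + 1))"
  have c2: "c2 = Gamma b * Gamma (1 - b)"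
    unfolding c2_def by (rule Gamma_reflection_complex[symmetric])
  have bn: "b \<notin> \<int>\<^sub>\<le>\<^sub>0" "1 - b \<notin> \<int>\<^sub>\<le>\<^sub>0" using b by (auto elim!: nonpos_Ints_cases simp: complex_eq_iff)
  then have g: "Gamma b * rGamma b = 1" "Gamma (1 - b) * rGamma (1 - b) = 1"
    by (simp_all add: rGamma_inverse_Gamma Gamma_eq_zero_iff)
  define M N M' N' where "M = kM a b" and "N = kN a b" and "M' = (\<lambda>\<zeta>. a * kM (a + 1) (b + 1) \<zeta>)" and "N' = kN (a + 1) (b + 1)"
  define D where "D = (\<lambda>\<zeta>. c1 * M \<zeta> - c2 * N \<zeta> - kint a b \<zeta>)"
  define D' where "D' = (\<lambda>\<zeta>. c1 * M' \<zeta> - c2 * N' \<zeta> - - kint (a + 1) (b + 1) \<zeta>)"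
  have kM: "kode a b M M'" unfolding M_def M'_def by (rule kode_kM)
  have kN: "kode a b N N'" unfolding N_def N'_def by (rule kode_kN)
  have kD: "kode a b D D'" unfolding D_def D'_def
    by (intro kode_diff kode_cmult kM kN kode_kint a)
  define p where "p = (\<lambda>\<zeta>. exp (b * Ln \<zeta> - \<zeta>))"
  obtain w1 where w1: "\<And>\<zeta>. Re \<zeta> > 0 \<Longrightarrow> p \<zeta> * (D \<zeta> * M' \<zeta> - D' \<zeta> * M \<zeta>) = w1"
    using kode_wronskian[OF kD kM] unfolding p_def by blast
  obtain w2 where w2: "\<And>\<zeta>. Re \<zeta> > 0 \<Longrightarrow> p \<zeta> * (D \<zeta> * N' \<zeta> - D' \<zeta> * N \<zeta>) = w2"
    using kode_wronskian[OF kD kN] unfolding p_def by blast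
  obtain w3 where w3: "\<And>\<zeta>. Re \<zeta> > 0 \<Longrightarrow> p \<zeta> * (M \<zeta> * N' \<zeta> - M' \<zeta> * N \<zeta>) = w3"
    using kode_wronskian[OF kM kN] unfolding p_def by blast
  define x where "x = (\<lambda>n. inverse (real (Suc n)))"
  define z where "z = (\<lambda>n. complex_of_real (x n))"
  have x: "\<And>n. x n > 0" "x \<longlonglongrightarrow> 0" unfolding x_def by (simp, rule LIMSEQ_inverse_real_of_nat)
  have rz: "Re (z n) > 0" for n using x(1) by (simp add: z_def)
  have Lz: "Ln (z n) = of_real (ln (x n))" for n using x(1)[of n] by (simp add: z_def Ln_of_real)
  have "z \<longlonglongrightarrow> of_real 0" unfolding z_def by (intro tendsto_of_real x)
  then have z0: "z \<longlonglongrightarrow> 0" by simp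
  have kMl: "(\<lambda>n. kM a b (z n)) \<longlonglongrightarrow> rGamma b" for a b
  proof -
    have "(\<lambda>n. kM a b (z n)) \<longlonglongrightarrow> kM a b 0"
      using isCont_eval_fps_entire[OF entire_hyp] z0 by (intro isCont_tendsto_compose[where g = "kM a b"]) auto
    then show ?thesis by (simp add: eval_fps_at_0 hyp_nth)
  qed
  have ez: "(\<lambda>n. exp (- z n)) \<longlonglongrightarrow> 1" using tendsto_exp[OF tendsto_minus[OF z0]] by simp
  have pz: "p (z n) = exp (b * of_real (ln (x n))) * exp (- z n)" for n
    unfolding p_def Lz by (simp add: exp_diff exp_minus divide_inverse)
  have Ml: "(\<lambda>n. M (z n)) \<longlonglongrightarrow> rGamma b" unfolding M_def by (rule kMl)
  have Nl: "(\<lambda>n. N (z n)) \<longlonglongrightarrow> 0 * rGamma (2 - b)"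
    unfolding N_def kN_def Lz by (intro tendsto_mult kMl exp_ln_tendsto_0 x) (use b in auto)
  have pl: "(\<lambda>n. p (z n)) \<longlonglongrightarrow> 0 * 1"
    unfolding pz by (intro tendsto_mult ez exp_ln_tendsto_0 x) (use b in auto)
  have pMl: "(\<lambda>n. p (z n) * M' (z n)) \<longlonglongrightarrow> (0 * 1) * (a * rGamma (b + 1))"
    unfolding M'_def by (intro tendsto_mult[OF pl] tendsto_mult tendsto_const kMl)
  have pN: "p (z n) * N' (z n) = exp (- z n) * kM (a - b + 1) (1 - b) (z n)" for n
  proof -
    have "exp (b * of_real (ln (x n))) * exp ((1 - (b + 1)) * of_real (ln (x n))) = (1 :: complex)"
      unfolding exp_add[symmetric] by simp
    then have e: "exp (b * of_real (ln (x n))) * (exp ((1 - (b + 1)) * of_real (ln (x n))) * w) = w" for w :: complex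
      by (simp only: mult.assoc[symmetric] mult_1)
    have s: "a + 1 - (b + 1) + 1 = a - b + 1" "2 - (b + 1) = 1 - b" by simp_all
    show ?thesis unfolding N'_def kN_def Lz pz s
      using e[of "exp (- z n) * kM (a - b + 1) (1 - b) (z n)"] by (simp only: mult_ac)
  qed
  have pNl: "(\<lambda>n. p (z n) * N' (z n)) \<longlonglongrightarrow> 1 * rGamma (1 - b)"
    unfolding pN by (intro tendsto_mult ez kMl)
  have pJl: "(\<lambda>n. p (z n) * kint (a + 1) (b + 1) (z n)) \<longlonglongrightarrow> 1 * Gamma b"
  proof -
    have "(\<lambda>n. exp (- z n) * (exp (b * of_real (ln (x n))) * kint (a + 1) (b + 1) (z n))) \<longlonglongrightarrow> 1 * Gamma b"
      using kint_small_arg_limit[OF x a b] unfolding z_def[symmetric] by (intro tendsto_mult ez) (simp add: z_def)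
    then show ?thesis unfolding pz by (simp only: mult_ac)
  qed
  have Dl: "(\<lambda>n. D (z n)) \<longlonglongrightarrow> c1 * rGamma b - c2 * (0 * rGamma (2 - b)) - kbeta a b"
    unfolding D_def by (intro tendsto_diff tendsto_mult tendsto_const Ml Nl)
      (use kint_zero_limit[OF x a b(2)] in \<open>simp add: z_def\<close>)
  \<comment> \<open>Value at the origin: \<open>N\<close> contributes nothing, and
    \<open>c1 * rGamma b\<close> is the beta value since
    \<open>c2 = Gamma b * Gamma (1 - b)\<close>.\<close>
  have D0: "c1 * rGamma b - c2 * (0 * rGamma (2 - b)) - kbeta a b = 0"
    unfolding kbeta_eq[OF a b] c1_def c2 using g by algebra
  \<comment> \<open>The singularities of \<open>N'\<close> and of the derivative of the integral
    cancel, because \<open>c2 * rGamma (1 - b) = Gamma b\<close>.\<close>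
  have "(\<lambda>n. c1 * (p (z n) * M' (z n)) - c2 * (p (z n) * N' (z n)) + p (z n) * kint (a + 1) (b + 1) (z n))
     \<longlonglongrightarrow> c1 * ((0 * 1) * (a * rGamma (b + 1))) - c2 * (1 * rGamma (1 - b)) + 1 * Gamma b"
    by (intro tendsto_intros pMl pNl pJl)
  moreover have "c1 * ((0 * 1) * (a * rGamma (b + 1))) - c2 * (1 * rGamma (1 - b)) + 1 * Gamma b = 0"
    unfolding c2 using g by algebra
  ultimately have pDl: "(\<lambda>n. p (z n) * D' (z n)) \<longlonglongrightarrow> 0"
    unfolding D'_def by (simp add: algebra_simps)
  have "(\<lambda>n. D (z n) * (p (z n) * M' (z n)) - (p (z n) * D' (z n)) * M (z n)) \<longlonglongrightarrow> 0 * ((0 * 1) * (a * rGamma (b + 1))) - 0 * rGamma b"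
    by (intro tendsto_intros Dl[unfolded D0] pMl pDl Ml)
  moreover have "D (z n) * (p (z n) * M' (z n)) - (p (z n) * D' (z n)) * M (z n) = w1" for n
    using w1[OF rz[of n]] by (simp add: algebra_simps)
  ultimately have w1_0: "w1 = 0" by (simp add: LIMSEQ_const_iff)
  have "(\<lambda>n. D (z n) * (p (z n) * N' (z n)) - (p (z n) * D' (z n)) * N (z n)) \<longlonglongrightarrow> 0 * (1 * rGamma (1 - b)) - 0 * (0 * rGamma (2 - b))"
    by (intro tendsto_intros Dl[unfolded D0] pNl pDl Nl)
  moreover have "D (z n) * (p (z n) * N' (z n)) - (p (z n) * D' (z n)) * N (z n) = w2" for n
    using w2[OF rz[of n]] by (simp add: algebra_simps)
  ultimately have w2_0: "w2 = 0" by (simp add: LIMSEQ_const_iff)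
  have "(\<lambda>n. M (z n) * (p (z n) * N' (z n)) - (p (z n) * M' (z n)) * N (z n)) \<longlonglongrightarrow> rGamma b * (1 * rGamma (1 - b)) - ((0 * 1) * (a * rGamma (b + 1))) * (0 * rGamma (2 - b))"
    by (intro tendsto_intros Ml pNl pMl Nl)
  moreover have "M (z n) * (p (z n) * N' (z n)) - (p (z n) * M' (z n)) * N (z n) = w3" for n
    using w3[OF rz[of n]] by (simp add: algebra_simps)
  ultimately have "w3 = rGamma b * rGamma (1 - b)" by (simp add: LIMSEQ_const_iff)
  then have w3_0: "w3 \<noteq> 0" using bn by (simp add: rGamma_eq_zero_iff)
  \<comment> \<open>Cramer's identity recovers the function \<open>D\<close> from its two
    Wronskians.\<close>
  have "D \<zeta> * w3 = M \<zeta> * w2 - N \<zeta> * w1"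
    unfolding w1[OF r, symmetric] w2[OF r, symmetric] w3[OF r, symmetric] by (simp add: algebra_simps)
  then have "D \<zeta> = 0" using w3_0 w1_0 w2_0 by simp
  then show ?thesis unfolding kV_def D_def M_def N_def c1_def c2_def by (simp add: algebra_simps)
qed

text \<open>
  Differentiation shifts \<open>(a, b)\<close> to \<open>(a + 1, b + 1)\<close>, and the contiguous relation lowers \<open>b\<close>, so the
  strip \<open>0 < Re b < 1\<close> suffices.
\<close>

lemma kV_eq_kint_up:
  assumes "0 < Re b" "Re b < 1" "Re a \<ge> 1 + real n" "Re \<zeta> > 0"
  shows "kV (a) (b + of_nat n) \<zeta> = kint a (b + of_nat n) \<zeta>"
  using assms
proof (induction n arbitrary: a \<zeta>)
  case 0
  then show ?case using kV_eq_kint_strip by simp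
next
  case (Suc n)
  define a' where "a' = a - 1"
  have a': "Re a' \<ge> 1 + real n" "Re a' \<ge> 1" using Suc.prems by (auto simp: a'_def)
  have "(kV a' (b + of_nat n) has_field_derivative - kint (a' + 1) (b + of_nat n + 1) \<zeta>) (at \<zeta>)"
  proof (rule has_field_derivative_transform_within_open)
    show "(kint a' (b + of_nat n) has_field_derivative - kint (a' + 1) (b + of_nat n + 1) \<zeta>) (at \<zeta>)"
      by (rule kint_deriv) (use a' Suc.prems in auto)
    show "open {\<zeta>. Re \<zeta> > 0}" by (rule open_halfspace_Re_gt)
    show "\<zeta> \<in> {\<zeta>. Re \<zeta> > 0}" using Suc.prems by simp
    show "kint a' (b + of_nat n) \<xi> = kV a' (b + of_nat n) \<xi>" if "\<xi> \<in> {\<zeta>. Re \<zeta> > 0}" for \<xi>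
      using Suc.IH[OF Suc.prems(1,2) a'(1), of \<xi>] that by simp
  qed
  moreover have "(kV a' (b + of_nat n) has_field_derivative - kV (a' + 1) (b + of_nat n + 1) \<zeta>) (at \<zeta>)"
    by (rule kV_deriv) (use a' Suc.prems in auto)
  ultimately have "- kint (a' + 1) (b + of_nat n + 1) \<zeta> = - kV (a' + 1) (b + of_nat n + 1) \<zeta>"
    by (rule DERIV_unique)
  then show ?case by (simp add: a'_def add.assoc add.commute[of 1])
qed

lemma kV_eq_kint_down:
  assumes "0 < Re b" "Re b < 1" "Re a \<ge> 1" "Re \<zeta> > 0"
  shows "kV a (b - of_nat n) \<zeta> = kint a (b - of_nat n) \<zeta>"
  using assms
proof (induction n arbitrary: a)
  case 0
  then show ?case using kV_eq_kint_strip by simp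
next
  case (Suc n)
  have "kV a (b - of_nat n) \<zeta> = kint a (b - of_nat n) \<zeta>" "kV (a + 1) (b - of_nat n) \<zeta> = kint (a + 1) (b - of_nat n) \<zeta>"
    using Suc by auto
  then have "kV a (b - of_nat n - 1) \<zeta> = kint a (b - of_nat n - 1) \<zeta>"
    using kV_lower[of \<zeta> a "b - of_nat n"] kint_lower[of a \<zeta> "b - of_nat n"] Suc.prems by simp
  then show ?case by (simp add: algebra_simps)
qed

text \<open>Integer shifts of the strip reach exactly the \<open>b\<close> with nonintegral real
  part. Each upward shift lowers \<open>a\<close> by 1 in the induction, hence the lower bound on
  \<open>Re a\<close>.\<close>

lemma kV_eq_kint:
  assumes "Re b \<notin> \<int>" "Re a \<ge> 1 + \<bar>Re b\<bar>" "Re \<zeta> > 0"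
  shows "kV a b \<zeta> = kint a b \<zeta>"
proof -
  define m where "m = \<lfloor>Re b\<rfloor>"
  define b' where "b' = b - of_int m"
  have "Re b' \<noteq> 0" using assms(1) by (auto simp: b'_def)
  moreover have "0 \<le> Re b'" "Re b' < 1" using floor_correct[of "Re b"] unfolding b'_def m_def minus_complex.simps complex_Re_of_int
    by linarith+
  ultimately have b': "0 < Re b'" "Re b' < 1" by auto
  show ?thesis
  proof (cases "m \<ge> 0")
    case True
    then have "b = b' + of_nat (nat m)" by (simp add: b'_def)
    moreover have "real (nat m) \<le> \<bar>Re b\<bar>" using True floor_correct[of "Re b"] of_nat_nat[OF True, where 'a = real] unfolding m_def by linarith
    ultimately show ?thesis using kV_eq_kint_up[OF b', of "nat m" a \<zeta>] assms by simp
  next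
    case False
    then have "b = b' - of_nat (nat (- m))" by (simp add: b'_def)
    then show ?thesis using kV_eq_kint_down[OF b', of a \<zeta> "nat (- m)"] assms by simp
  qed
qed

section \<open>Exponential growth along segments\<close>

text \<open>
  The energy \<open>|g'|\<^sup>2 + |g|\<^sup>2\<close> of a solution of \<open>g'' = P g' + (1 + Q) g\<close> grows along a segment in
  direction \<open>d\<close> at the sharp rate \<open>2 |Re d|\<close>, up to the effect of \<open>P\<close> and \<open>Q\<close>. Used outwards it
  bounds dominant solutions, used along decreasing real parts it bounds recessive ones.
\<close>

lemma energy_segment:
  fixes g g1 P Q :: "complex \<Rightarrow> complex" and p d :: complex and k K :: "real \<Rightarrow> real"
  assumes g: "\<And>t. 0 \<le> t \<Longrightarrow> t \<le> 1 \<Longrightarrow> (g has_field_derivative g1 (p + of_real t * d)) (at (p + of_real t * d))"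
    and g1: "\<And>t. 0 \<le> t \<Longrightarrow> t \<le> 1 \<Longrightarrow> (g1 has_field_derivative
       P (p + of_real t * d) * g1 (p + of_real t * d) + (1 + Q (p + of_real t * d)) * g (p + of_real t * d)) (at (p + of_real t * d))"
    and k: "\<And>t. 0 \<le> t \<Longrightarrow> t \<le> 1 \<Longrightarrow> norm d * (2 * norm (P (p + of_real t * d)) + norm (Q (p + of_real t * d))) \<le> k t"
    and K: "\<And>t. 0 \<le> t \<Longrightarrow> t \<le> 1 \<Longrightarrow> (K has_real_derivative k t) (at t)"
  shows "(norm (g1 (p + d)))\<^sup>2 + (norm (g (p + d)))\<^sup>2 \<le>
     ((norm (g1 p))\<^sup>2 + (norm (g p))\<^sup>2) * exp (2 * \<bar>Re d\<bar> + K 1 - K 0)"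
proof -
  define \<gamma> where "\<gamma> = (\<lambda>t. p + of_real t * d)"
  define \<Phi> where "\<Phi> = (\<lambda>t. (norm (g1 (\<gamma> t)))\<^sup>2 + (norm (g (\<gamma> t)))\<^sup>2)"
  \<comment> \<open>The energy divided by its claimed growth; it remains to see that the quotient
    does not increase.\<close>
  define \<psi> where "\<psi> = (\<lambda>t. \<Phi> t * exp (- (2 * \<bar>Re d\<bar> * t + K t)))"
  have "\<psi> 1 \<le> \<psi> 0"
  proof (rule DERIV_nonpos_imp_nonincreasing[where f = \<psi> and a = 0 and b = 1])
    fix t :: real assume t: "0 \<le> t" "t \<le> 1"
    define A B P' Q' where "A = g1 (\<gamma> t)" and "B = g (\<gamma> t)" and "P' = P (\<gamma> t)" and "Q' = Q (\<gamma> t)"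
    define A' B' where "A' = d * (P' * A + (1 + Q') * B)" and "B' = d * A"
    have dg: "(\<gamma> has_vector_derivative d) (at t)"
      unfolding \<gamma>_def by (auto intro!: derivative_eq_intros simp: has_vector_derivative_def scaleR_conv_of_real)
    have dA: "((\<lambda>t. g1 (\<gamma> t)) has_vector_derivative A') (at t)"
    proof -
      have "(g1 has_field_derivative P' * A + (1 + Q') * B) (at (\<gamma> t))"
        using g1[OF t] unfolding \<gamma>_def A_def B_def P'_def Q'_def .
      from field_vector_diff_chain_at[OF dg this] show ?thesis unfolding o_def A'_def .
    qed
    have dB: "((\<lambda>t. g (\<gamma> t)) has_vector_derivative B') (at t)"
    proof -
      have "(g has_field_derivative A) (at (\<gamma> t))" using g[OF t] unfolding \<gamma>_def A_def .
      from field_vector_diff_chain_at[OF dg this] show ?thesis unfolding o_def B'_def .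
    qed
    have re: "((\<lambda>t. Re (f t)) has_real_derivative Re f') (at t)" "((\<lambda>t. Im (f t)) has_real_derivative Im f') (at t)"
      if "(f has_vector_derivative f') (at t)" for f f'
      using bounded_linear.has_vector_derivative[OF bounded_linear_Re that]
        bounded_linear.has_vector_derivative[OF bounded_linear_Im that]
      by (simp_all add: has_real_derivative_iff_has_vector_derivative)
    have d\<Phi>: "(\<Phi> has_real_derivative (2 * Re (cnj A * A') + 2 * Re (cnj B * B'))) (at t)"
      unfolding \<Phi>_def cmod_power2
      by (rule derivative_eq_intros re[OF dA] re[OF dB] refl)+ (simp add: A_def B_def algebra_simps)
    have d\<psi>: "(\<psi> has_real_derivative ((2 * Re (cnj A * A') + 2 * Re (cnj B * B')) - (2 * \<bar>Re d\<bar> + k t) * \<Phi> t) * exp (- (2 * \<bar>Re d\<bar> * t + K t))) (at t)"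
      unfolding \<psi>_def
      by (rule derivative_eq_intros d\<Phi> K[OF t] refl)+ (simp add: algebra_simps)
    have \<Phi>t: "\<Phi> t = (norm A)\<^sup>2 + (norm B)\<^sup>2" by (simp add: \<Phi>_def A_def B_def)
    have AB: "2 * (norm A * norm B) \<le> \<Phi> t"
      using sum_squares_bound[of "norm A" "norm B"] unfolding \<Phi>t by (simp add: mult.assoc)
    \<comment> \<open>The two coupling terms combine to \<open>d\<close> times the real number
      \<open>2 * Re (cnj A * B)\<close>, so only \<open>Re d\<close> survives. This is the source of
      the sharp rate; bounding them separately would give \<open>norm d\<close>.\<close>
    have split: "2 * Re (cnj A * A') + 2 * Re (cnj B * B')
       = 2 * Re (cnj A * d * P' * A) + 2 * Re (cnj A * d * Q' * B) + 4 * (Re d * Re (cnj A * B))"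
      unfolding A'_def B'_def by (simp add: algebra_simps)
    have 1: "2 * Re (cnj A * d * P' * A) \<le> 2 * norm d * norm P' * \<Phi> t"
    proof -
      have "Re (cnj A * d * P' * A) \<le> norm (cnj A * d * P' * A)" by (rule complex_Re_le_cmod)
      also have "\<dots> = norm d * norm P' * (norm A)\<^sup>2" by (simp add: norm_mult power2_eq_square)
      also have "\<dots> \<le> norm d * norm P' * \<Phi> t" unfolding \<Phi>t by (intro mult_left_mono) auto
      finally show ?thesis by simp
    qed
    have 2: "2 * Re (cnj A * d * Q' * B) \<le> norm d * norm Q' * \<Phi> t"
    proof -
      have "2 * Re (cnj A * d * Q' * B) \<le> 2 * norm (cnj A * d * Q' * B)"
        using complex_Re_le_cmod[of "cnj A * d * Q' * B"] by simp
      also have "\<dots> = norm d * norm Q' * (2 * (norm A * norm B))" by (simp add: norm_mult)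
      also have "\<dots> \<le> norm d * norm Q' * \<Phi> t" using AB by (intro mult_left_mono) auto
      finally show ?thesis .
    qed
    have 3: "4 * (Re d * Re (cnj A * B)) \<le> 2 * \<bar>Re d\<bar> * \<Phi> t"
    proof -
      have "4 * (Re d * Re (cnj A * B)) \<le> 4 * (\<bar>Re d\<bar> * \<bar>Re (cnj A * B)\<bar>)"
        by (metis abs_ge_self abs_mult mult_left_mono zero_le_numeral)
      also have "\<dots> \<le> 4 * (\<bar>Re d\<bar> * (norm A * norm B))"
        using abs_Re_le_cmod[of "cnj A * B"] by (intro mult_left_mono) (auto simp: norm_mult)
      also have "\<dots> = 2 * \<bar>Re d\<bar> * (2 * (norm A * norm B))" by simp
      also have "\<dots> \<le> 2 * \<bar>Re d\<bar> * \<Phi> t" using AB by (intro mult_left_mono) auto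
      finally show ?thesis .
    qed
    have "norm d * (2 * norm P' + norm Q') * \<Phi> t \<le> k t * \<Phi> t"
      using k[OF t] unfolding P'_def Q'_def \<gamma>_def by (intro mult_right_mono) (auto simp: \<Phi>_def)
    then have "2 * Re (cnj A * A') + 2 * Re (cnj B * B') \<le> (2 * \<bar>Re d\<bar> + k t) * \<Phi> t"
      unfolding split using 1 2 3 by (simp add: algebra_simps)
    then have "((2 * Re (cnj A * A') + 2 * Re (cnj B * B')) - (2 * \<bar>Re d\<bar> + k t) * \<Phi> t) * exp (- (2 * \<bar>Re d\<bar> * t + K t)) \<le> 0"
      by (intro mult_nonpos_nonneg) auto
    with d\<psi> show "\<exists>y. (\<psi> has_real_derivative y) (at t) \<and> y \<le> 0" by blast
  qed simp
  then have "\<Phi> 1 \<le> \<Phi> 0 * exp (- K 0) * exp (2 * \<bar>Re d\<bar> + K 1)"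
    using mult_right_mono[of "\<psi> 1" "\<psi> 0" "exp (2 * \<bar>Re d\<bar> + K 1)"]
    unfolding \<psi>_def by (simp add: mult.assoc exp_add[symmetric])
  also have "\<dots> = \<Phi> 0 * exp (2 * \<bar>Re d\<bar> + K 1 - K 0)"
    by (simp add: mult.assoc exp_add[symmetric])
  finally show ?thesis unfolding \<Phi>_def \<gamma>_def by simp
qed

text \<open>For \<open>\<eta> = 1 / u\<^sup>2\<close> and \<open>x = u * z\<close> this is
  \<open>exp (- z\<^sup>2 / 2)\<close> times the regularized Kummer function with parameters
  \<open>u\<^sup>2 / 4 + b / 2\<close> and \<open>b\<close> at \<open>z\<^sup>2\<close>; for
  \<open>\<eta> = 0\<close> it is the Bessel series.\<close>

definition kumR :: "real \<Rightarrow> complex \<Rightarrow> complex \<Rightarrow> complex" where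
  "kumR \<eta> b x = eval_fps (kum (of_real \<eta>) b) (x\<^sup>2 / 4)"

definition kumR' :: "real \<Rightarrow> complex \<Rightarrow> complex \<Rightarrow> complex" where
  "kumR' \<eta> b x = x / 2 * eval_fps (fps_deriv (kum (of_real \<eta>) b)) (x\<^sup>2 / 4)"

lemma kumR_deriv: "(kumR \<eta> b has_field_derivative kumR' \<eta> b x) (at x)"
proof -
  have "((\<lambda>x :: complex. x\<^sup>2 / 4) has_field_derivative x / 2) (at x)" by (auto intro!: derivative_eq_intros)
  from eval_fps_chain_entire[OF entire_kum this] show ?thesis
    unfolding kumR_def[abs_def] kumR'_def by (simp add: mult.commute)
qed

text \<open>The substitution \<open>s = x\<^sup>2 / 4\<close> in \<open>kum_ode\<close> normalizes
  the leading part to \<open>g'' = g\<close>, as the energy estimate requires; the rest is a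
  \<open>1 / x\<close> drift and the perturbation \<open>\<eta>\<^sup>2 * x\<^sup>2\<close>.\<close>

lemma kumR'_deriv:
  assumes "x \<noteq> 0"
  shows "(kumR' \<eta> b has_field_derivative (1 - 2 * b) / x * kumR' \<eta> b x + (1 + of_real (\<eta>\<^sup>2) * x\<^sup>2) * kumR \<eta> b x) (at x)"
proof -
  define E where "E = kum (of_real \<eta>) b"
  define E0 E1 E2 where "E0 = eval_fps E (x\<^sup>2 / 4)" and "E1 = eval_fps (fps_deriv E) (x\<^sup>2 / 4)"
    and "E2 = eval_fps (fps_deriv (fps_deriv E)) (x\<^sup>2 / 4)"
  have en: "entire_fps E" "entire_fps (fps_deriv E)" "entire_fps (fps_deriv (fps_deriv E))"
    unfolding E_def by (intro entire_fps_deriv entire_kum)+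
  have "eval_fps (fps_X * fps_deriv (fps_deriv E) + fps_const b * fps_deriv E) (x\<^sup>2 / 4)
     = eval_fps ((1 + fps_const (4 * (of_real \<eta>)\<^sup>2) * fps_X) * E) (x\<^sup>2 / 4)"
    unfolding E_def kum_ode ..
  then have ode: "x\<^sup>2 / 4 * E2 + b * E1 = (1 + of_real (\<eta>\<^sup>2) * x\<^sup>2) * E0"
    using en unfolding E0_def E1_def E2_def
    by (simp add: eval_entire entire_fps_mult entire_fps_add)
  have "((\<lambda>x. x / 2 * eval_fps (fps_deriv E) (x\<^sup>2 / 4)) has_field_derivative (1 / 2 * E1 + x\<^sup>2 / 4 * E2)) (at x)"
  proof (rule DERIV_cong)
    have "((\<lambda>x :: complex. x\<^sup>2 / 4) has_field_derivative x / 2) (at x)" by (auto intro!: derivative_eq_intros)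
    from eval_fps_chain_entire[OF en(2) this]
    have e: "((\<lambda>x. eval_fps (fps_deriv E) (x\<^sup>2 / 4)) has_field_derivative E2 * (x / 2)) (at x)" unfolding E2_def .
    have h: "((\<lambda>x :: complex. x / 2) has_field_derivative 1 / 2) (at x)" by (auto intro!: derivative_eq_intros)
    show "((\<lambda>x. x / 2 * eval_fps (fps_deriv E) (x\<^sup>2 / 4)) has_field_derivative
        1 / 2 * eval_fps (fps_deriv E) (x\<^sup>2 / 4) + E2 * (x / 2) * (x / 2)) (at x)"
      by (rule DERIV_mult[OF h e])
  qed (simp add: E1_def power2_eq_square)
  also have "1 / 2 * E1 + x\<^sup>2 / 4 * E2 = (1 - 2 * b) / x * (x / 2 * E1) + (1 + of_real (\<eta>\<^sup>2) * x\<^sup>2) * E0"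
    unfolding ode[symmetric] using assms by (simp add: field_simps)
  finally show ?thesis unfolding kumR_def kumR'_def[abs_def] E_def E0_def E1_def .
qed

lemma kum_bounded:
  fixes B r :: real
  assumes "B \<ge> 0"
  obtains C where "C > 0"
    "\<And>\<eta> b s. 0 \<le> \<eta> \<Longrightarrow> \<eta> \<le> 1 \<Longrightarrow> norm b \<le> B \<Longrightarrow> norm s \<le> r \<Longrightarrow> norm (eval_fps (kum (of_real \<eta>) b) s) \<le> C"
    "\<And>\<eta> b s. 0 \<le> \<eta> \<Longrightarrow> \<eta> \<le> 1 \<Longrightarrow> norm b \<le> B \<Longrightarrow> norm s \<le> r \<Longrightarrow> norm (eval_fps (fps_deriv (kum (of_real \<eta>) b)) s) \<le> C"
proof -
  \<comment> \<open>Bounds \<open>1 + 2 * b * \<eta> + 4 * \<eta>\<close>, the first parameter of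
    the differentiated series.\<close>
  define L where "L = 5 + 2 * B"
  obtain C0 where C0: "C0 > 0" "\<And>p q b z. norm p \<le> L \<Longrightarrow> norm q \<le> L \<Longrightarrow> norm b \<le> B + 1 \<Longrightarrow> norm z \<le> r \<Longrightarrow>
     norm (eval_fps (hyp p q b) z) \<le> C0"
    using hyp_bounded[of L "B + 1" r] assms by (auto simp: L_def)
  define C where "C = exp (2 * \<bar>r\<bar>) * C0"
  have L: "norm (1 + 2 * b * of_real \<eta>) \<le> 1 + 2 * B" "norm (4 * complex_of_real \<eta>) \<le> 4"
     "norm (1 + 2 * b * of_real \<eta> + 4 * of_real \<eta>) \<le> L"
    if "0 \<le> \<eta>" "\<eta> \<le> 1" "norm b \<le> B" for \<eta> :: real and b :: complex
  proof -
    have "norm b * \<eta> \<le> B * 1" using that assms by (intro mult_mono) auto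
    then have "norm (2 * b * of_real \<eta>) \<le> 2 * B" using that by (simp add: norm_mult)
    then show 1: "norm (1 + 2 * b * of_real \<eta>) \<le> 1 + 2 * B"
      using norm_triangle_ineq[of 1 "2 * b * of_real \<eta>"] by simp
    show 2: "norm (4 * complex_of_real \<eta>) \<le> 4" using that by (simp add: norm_mult)
    show "norm (1 + 2 * b * of_real \<eta> + 4 * of_real \<eta>) \<le> L"
      using norm_triangle_ineq[of "1 + 2 * b * of_real \<eta>" "4 * of_real \<eta>"] 1 2 by (simp add: L_def)
  qed
  have e: "norm (exp (- 2 * of_real \<eta> * s)) \<le> exp (2 * \<bar>r\<bar>)" if "0 \<le> \<eta>" "\<eta> \<le> 1" "norm s \<le> r" for \<eta> :: real and s :: complex
  proof -
    have "norm (exp (- 2 * of_real \<eta> * s)) \<le> exp (norm (- 2 * of_real \<eta> * s))" by (rule norm_exp)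
    also have "norm (- 2 * of_real \<eta> * s) = 2 * \<eta> * norm s" using that by (simp add: norm_mult)
    also have "2 * \<eta> * norm s \<le> 2 * 1 * \<bar>r\<bar>" using that by (intro mult_mono) auto
    finally show ?thesis by simp
  qed
  have 0: "norm (eval_fps (kum (of_real \<eta>) b) s) \<le> C" if *: "0 \<le> \<eta>" "\<eta> \<le> 1" "norm b \<le> B" "norm s \<le> r" for \<eta> b s
    unfolding eval_kum norm_mult C_def using L[OF *(1-3)] * assms
    by (intro mult_mono e C0) (auto simp: L_def)
  have 1: "norm (eval_fps (fps_deriv (kum (of_real \<eta>) b)) s) \<le> 2 * C + (1 + 2 * B) * C"
    if *: "0 \<le> \<eta>" "\<eta> \<le> 1" "norm b \<le> B" "norm s \<le> r" for \<eta> b s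
  proof -
    define p q e1 where "p = 1 + 2 * b * of_real \<eta>" and "q = 4 * complex_of_real \<eta>" and "e1 = fps_exp (- 2 * complex_of_real \<eta>)"
    have k: "kum (of_real \<eta>) b = e1 * hyp p q b" by (simp add: kum_def p_def q_def e1_def)
    have "fps_deriv (kum (of_real \<eta>) b) = fps_const (- 2 * of_real \<eta>) * (e1 * hyp p q b) + e1 * (fps_const p * hyp (p + q) q (b + 1))"
      unfolding k fps_deriv_mult hyp_deriv by (simp add: e1_def mult.assoc)
    then have "eval_fps (fps_deriv (kum (of_real \<eta>) b)) s = - 2 * of_real \<eta> * eval_fps (kum (of_real \<eta>) b) s
        + exp (- 2 * of_real \<eta> * s) * (p * eval_fps (hyp (p + q) q (b + 1)) s)"
      unfolding k e1_def by (simp add: eval_entire entire_fps_mult entire_fps_add entire_hyp)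
    also have "norm \<dots> \<le> norm (- 2 * of_real \<eta> * eval_fps (kum (of_real \<eta>) b) s) + norm (exp (- 2 * of_real \<eta> * s) * (p * eval_fps (hyp (p + q) q (b + 1)) s))"
      by (rule norm_triangle_ineq)
    also have "norm (- 2 * of_real \<eta> * eval_fps (kum (of_real \<eta>) b) s) \<le> 2 * C"
    proof -
      have "\<eta> * norm (eval_fps (kum (of_real \<eta>) b) s) \<le> 1 * C" using * 0[OF *] by (intro mult_mono) auto
      then show ?thesis using * by (simp add: norm_mult)
    qed
    also have "norm (exp (- 2 * of_real \<eta> * s) * (p * eval_fps (hyp (p + q) q (b + 1)) s)) \<le> exp (2 * \<bar>r\<bar>) * ((1 + 2 * B) * C0)"
    proof -
      have "norm (b + 1) \<le> B + 1" using norm_triangle_ineq[of b 1] * by simp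
      then have "norm (eval_fps (hyp (p + q) q (b + 1)) s) \<le> C0"
        using L[OF *(1-3)] * assms by (intro C0) (auto simp: p_def q_def L_def)
      then have "norm (p * eval_fps (hyp (p + q) q (b + 1)) s) \<le> (1 + 2 * B) * C0"
        unfolding norm_mult using L(1)[OF *(1-3)] assms C0(1) by (intro mult_mono) (auto simp: p_def)
      then show ?thesis unfolding norm_mult[of "exp _"] using e[OF *(1,2,4)] by (intro mult_mono) auto
    qed
    also have "exp (2 * \<bar>r\<bar>) * ((1 + 2 * B) * C0) = (1 + 2 * B) * C" by (simp add: C_def)
    finally show ?thesis by simp
  qed
  have C: "C > 0" using C0 by (simp add: C_def)
  show ?thesis
  proof (rule that[of "C + (2 * C + (1 + 2 * B) * C)"])
    have p: "2 * C + (1 + 2 * B) * C \<ge> 0" using C assms by simp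
    then show "C + (2 * C + (1 + 2 * B) * C) > 0" using C by linarith
    show "norm (eval_fps (kum (of_real \<eta>) b) s) \<le> C + (2 * C + (1 + 2 * B) * C)"
      if *: "0 \<le> \<eta>" "\<eta> \<le> 1" "norm b \<le> B" "norm s \<le> r" for \<eta> b s
      using 0[OF *] p by linarith
    show "norm (eval_fps (fps_deriv (kum (of_real \<eta>) b)) s) \<le> C + (2 * C + (1 + 2 * B) * C)"
      if *: "0 \<le> \<eta>" "\<eta> \<le> 1" "norm b \<le> B" "norm s \<le> r" for \<eta> b s
      using 1[OF *] C by linarith
  qed
qed

lemma sq2: "2 * x\<^sup>2 \<le> (2 * x)\<^sup>2" for x :: real
  by (simp add: power_mult_distrib)

text \<open>A radial energy estimate starting on the unit circle, where the data are bounded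
  uniformly in \<open>\<eta>\<close> and \<open>b\<close>. The \<open>1 / x\<close> drift integrates
  to a logarithm, hence to a power of \<open>norm x\<close>; the perturbation integrates to
  \<open>\<eta>\<^sup>2 * norm x ^ 3 / 3\<close>, which the last hypothesis keeps bounded.\<close>

lemma kumR_growth:
  fixes B :: real
  assumes "B \<ge> 0"
  obtains C :: real and m :: nat where "C > 0"
    "\<And>\<eta> b x. 0 \<le> \<eta> \<Longrightarrow> \<eta> \<le> 1 \<Longrightarrow> norm b \<le> B \<Longrightarrow> norm x \<ge> 1 \<Longrightarrow> Re x \<ge> 0 \<Longrightarrow> \<eta>\<^sup>2 * norm x ^ 3 \<le> 1 \<Longrightarrow>
       norm (kumR \<eta> b x) \<le> C * norm x ^ m * exp (Re x)"
proof -
  obtain C0 where C0: "C0 > 0"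
    "\<And>\<eta> b s. 0 \<le> \<eta> \<Longrightarrow> \<eta> \<le> 1 \<Longrightarrow> norm b \<le> B \<Longrightarrow> norm s \<le> 1 \<Longrightarrow> norm (eval_fps (kum (of_real \<eta>) b) s) \<le> C0"
    "\<And>\<eta> b s. 0 \<le> \<eta> \<Longrightarrow> \<eta> \<le> 1 \<Longrightarrow> norm b \<le> B \<Longrightarrow> norm s \<le> 1 \<Longrightarrow> norm (eval_fps (fps_deriv (kum (of_real \<eta>) b)) s) \<le> C0"
    using kum_bounded[OF assms, of 1] by metis
  \<comment> \<open>\<open>1 + 2 * B\<close> bounds \<open>norm (1 - 2 * b)\<close>; it becomes the
    exponent once the square root of the energy is taken.\<close>
  obtain m :: nat where m: "1 + 2 * B \<le> real m" using real_arch_simple by blast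
  show ?thesis
  proof (rule that[of "2 * C0 * exp 1" m])
    show "2 * C0 * exp 1 > 0" using C0 by simp
    fix \<eta> :: real and b x :: complex
    assume *: "0 \<le> \<eta>" "\<eta> \<le> 1" "norm b \<le> B" "norm x \<ge> 1" "Re x \<ge> 0" "\<eta>\<^sup>2 * norm x ^ 3 \<le> 1"
    define L where "L = norm x"
    define x0 where "x0 = x / of_real L"
    define d where "d = x - x0"
    have L: "L \<ge> 1" "L > 0" using * by (auto simp: L_def)
    have x: "x = of_real L * x0" using L by (simp add: x0_def)
    have n0: "norm x0 = 1" using L by (simp add: x0_def norm_divide L_def)
    have d: "d = of_real (L - 1) * x0" unfolding d_def by (subst x) (simp add: algebra_simps)
    have nd: "norm d = L - 1" unfolding d norm_mult n0 norm_of_real using L by simp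
    define r where "r = (\<lambda>t. 1 + t * (L - 1))"
    have r: "r t \<ge> 1" if "t \<ge> 0" for t using that L by (simp add: r_def)
    have pt: "x0 + of_real t * d = of_real (r t) * x0" for t by (simp add: d r_def algebra_simps)
    have npt: "norm (x0 + of_real t * d) = r t" if "t \<ge> 0" for t
      unfolding pt using n0 r[OF that] by (simp add: norm_mult)
    define k where "k = (\<lambda>t. (L - 1) * (2 * ((1 + 2 * B) / r t) + \<eta>\<^sup>2 * (r t)\<^sup>2))"
    define K where "K = (\<lambda>t. 2 * (1 + 2 * B) * ln (r t) + \<eta>\<^sup>2 * (r t) ^ 3 / 3)"
    have "(norm (kumR' \<eta> b (x0 + d)))\<^sup>2 + (norm (kumR \<eta> b (x0 + d)))\<^sup>2 \<le>
       ((norm (kumR' \<eta> b x0))\<^sup>2 + (norm (kumR \<eta> b x0))\<^sup>2) * exp (2 * \<bar>Re d\<bar> + K 1 - K 0)"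
    proof (rule energy_segment[where P = "\<lambda>x. (1 - 2 * b) / x" and Q = "\<lambda>x. of_real (\<eta>\<^sup>2) * x\<^sup>2" and k = k])
      fix t :: real assume t: "0 \<le> t" "t \<le> 1"
      have nz: "x0 + of_real t * d \<noteq> 0" using npt[OF t(1)] r[OF t(1)] by auto
      show "(kumR \<eta> b has_field_derivative kumR' \<eta> b (x0 + of_real t * d)) (at (x0 + of_real t * d))" by (rule kumR_deriv)
      show "(kumR' \<eta> b has_field_derivative (1 - 2 * b) / (x0 + of_real t * d) * kumR' \<eta> b (x0 + of_real t * d)
         + (1 + of_real (\<eta>\<^sup>2) * (x0 + of_real t * d)\<^sup>2) * kumR \<eta> b (x0 + of_real t * d)) (at (x0 + of_real t * d))"
        by (rule kumR'_deriv[OF nz])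
      have "norm (1 - 2 * b) \<le> 1 + 2 * B" using norm_triangle_ineq4[of 1 "2 * b"] * by (simp add: norm_mult)
      then show "norm d * (2 * norm ((1 - 2 * b) / (x0 + of_real t * d)) + norm (of_real (\<eta>\<^sup>2) * (x0 + of_real t * d)\<^sup>2)) \<le> k t"
        unfolding k_def nd norm_divide norm_mult norm_power[of _ 2] npt[OF t(1)] norm_of_real using L r[OF t(1)]
        by (intro mult_left_mono add_mono divide_right_mono) auto
      have "(r has_real_derivative (L - 1)) (at t)" unfolding r_def by (auto intro!: derivative_eq_intros)
      then show "(K has_real_derivative k t) (at t)"
        unfolding K_def k_def using r[OF t(1)] L
        by (auto intro!: derivative_eq_intros simp: field_simps power2_eq_square power3_eq_cube)
    qed
    also have "x0 + d = x" by (simp add: d_def)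
    also have "((norm (kumR' \<eta> b x0))\<^sup>2 + (norm (kumR \<eta> b x0))\<^sup>2) * exp (2 * \<bar>Re d\<bar> + K 1 - K 0)
       \<le> (2 * C0)\<^sup>2 * (L ^ m * exp 1 * exp (Re x))\<^sup>2"
    proof (rule mult_mono)
      have n4: "norm (x0\<^sup>2 / 4) \<le> 1" using n0 by (simp add: norm_power norm_divide)
      have "norm (kumR' \<eta> b x0) \<le> 1 / 2 * C0"
        unfolding kumR'_def norm_mult using C0 * n4 n0 by (intro mult_mono) (auto simp: norm_divide)
      then have "norm (kumR' \<eta> b x0) \<le> C0" using C0(1) by linarith
      then have "(norm (kumR' \<eta> b x0))\<^sup>2 \<le> C0\<^sup>2" by (intro power_mono) auto
      moreover have "norm (kumR \<eta> b x0) \<le> C0"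
        unfolding kumR_def using C0 * n4 by auto
      then have "(norm (kumR \<eta> b x0))\<^sup>2 \<le> C0\<^sup>2" by (intro power_mono) auto
      ultimately show "(norm (kumR' \<eta> b x0))\<^sup>2 + (norm (kumR \<eta> b x0))\<^sup>2 \<le> (2 * C0)\<^sup>2"
        using sq2[of C0] by linarith
      have Red: "\<bar>Re d\<bar> \<le> Re x"
      proof -
        have "Re x0 \<ge> 0" using * L by (simp add: x0_def)
        then have "Re d \<ge> 0" using L by (simp add: d)
        moreover have "Re x0 \<ge> 0" by fact
        ultimately show ?thesis by (simp add: d_def)
      qed
      have K0: "K 0 \<ge> 0" by (simp add: K_def r_def)
      have K1: "K 1 \<le> 2 * (real m * ln L) + 1"
      proof -
        have "K 1 = 2 * ((1 + 2 * B) * ln L) + \<eta>\<^sup>2 * L ^ 3 / 3" by (simp add: K_def r_def)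
        moreover have "(1 + 2 * B) * ln L \<le> real m * ln L" using m L by (intro mult_right_mono) auto
        moreover have "\<eta>\<^sup>2 * L ^ 3 / 3 \<le> 1" using *(6) by (simp add: L_def)
        ultimately show ?thesis by linarith
      qed
      have "2 * \<bar>Re d\<bar> + K 1 - K 0 \<le> 2 * Re x + 2 * (real m * ln L) + 2" using Red K0 K1 by linarith
      then have "exp (2 * \<bar>Re d\<bar> + K 1 - K 0) \<le> exp (2 * (real m * ln L + 1 + Re x))" by simp
      also have "\<dots> = (L ^ m * exp 1 * exp (Re x))\<^sup>2"
        unfolding exp_double exp_add exp_of_nat_mult using L by simp
      finally show "exp (2 * \<bar>Re d\<bar> + K 1 - K 0) \<le> (L ^ m * exp 1 * exp (Re x))\<^sup>2" .
    qed (use C0 in auto)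
    finally have "(norm (kumR \<eta> b x))\<^sup>2 \<le> (2 * C0 * (L ^ m * exp 1 * exp (Re x)))\<^sup>2"
      unfolding power_mult_distrib[of "2 * C0"] using zero_le_power2[of "norm (kumR' \<eta> b x)"] by linarith
    then have "norm (kumR \<eta> b x) \<le> 2 * C0 * (L ^ m * exp 1 * exp (Re x))"
      using C0(1) L by (intro power2_le_imp_le[of "norm (kumR \<eta> b x)"]) auto
    then show "norm (kumR \<eta> b x) \<le> 2 * C0 * exp 1 * norm x ^ m * exp (Re x)"
      by (simp add: L_def mult_ac)
  qed
qed

text \<open>For \<open>\<rho> = 1\<close>, \<open>\<eta> = 0\<close> it is a multiple of
  \<open>K\<close> of order \<open>b - 1\<close> times the power \<open>1 - b\<close> of
  \<open>x / 2\<close>; for \<open>\<rho> = rho \<eta> b\<close> it is the corresponding multiple of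
  the \<open>U\<close>-function. These are the recessive solutions.\<close>

definition sol :: "complex \<Rightarrow> real \<Rightarrow> complex \<Rightarrow> complex \<Rightarrow> complex" where
  "sol \<rho> \<eta> b x = kumR \<eta> b x - \<rho> * (exp ((2 - 2 * b) * Ln (x / 2)) * kumR \<eta> (2 - b) x)"

definition sol' :: "complex \<Rightarrow> real \<Rightarrow> complex \<Rightarrow> complex \<Rightarrow> complex" where
  "sol' \<rho> \<eta> b x = kumR' \<eta> b x - \<rho> * (exp ((2 - 2 * b) * Ln (x / 2)) *
     ((2 - 2 * b) / x * kumR \<eta> (2 - b) x + kumR' \<eta> (2 - b) x))"

lemma half_not_nonpos: "Re x \<ge> 0 \<Longrightarrow> x \<noteq> 0 \<Longrightarrow> x / 2 \<notin> \<real>\<^sub>\<le>\<^sub>0"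
  by (auto simp: complex_nonpos_Reals_iff complex_eq_iff)

lemma
  assumes "Re x \<ge> 0" "x \<noteq> 0"
  shows sol_deriv: "(sol \<rho> \<eta> b has_field_derivative sol' \<rho> \<eta> b x) (at x)"
    and sol'_deriv: "(sol' \<rho> \<eta> b has_field_derivative (1 - 2 * b) / x * sol' \<rho> \<eta> b x + (1 + of_real (\<eta>\<^sup>2) * x\<^sup>2) * sol \<rho> \<eta> b x) (at x)"
proof -
  note h = half_not_nonpos[OF assms]
  define c where "c = 2 - 2 * b"
  define f f' where "f = kumR \<eta> (2 - b)" and "f' = kumR' \<eta> (2 - b)"
  have df: "(f has_field_derivative f' x) (at x)" unfolding f_def f'_def by (rule kumR_deriv)
  have df': "(f' has_field_derivative (1 - 2 * (2 - b)) / x * f' x + (1 + of_real (\<eta>\<^sup>2) * x\<^sup>2) * f x) (at x)"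
    unfolding f_def f'_def by (rule kumR'_deriv[OF assms(2)])
  have de: "((\<lambda>x. exp (c * Ln (x / 2))) has_field_derivative exp (c * Ln (x / 2)) * (c / x)) (at x)"
    using h assms(2) by (auto intro!: derivative_eq_intros simp: field_simps)
  show "(sol \<rho> \<eta> b has_field_derivative sol' \<rho> \<eta> b x) (at x)"
    unfolding sol_def[abs_def] sol'_def c_def[symmetric] f_def[symmetric] f'_def[symmetric]
    by (rule DERIV_cong[OF DERIV_diff[OF kumR_deriv DERIV_cmult[OF DERIV_mult[OF de df]]]])
      (simp add: algebra_simps)
  have dinv: "((\<lambda>x. c / x * f x + f' x) has_field_derivative
      - c / x\<^sup>2 * f x + c / x * f' x + ((1 - 2 * (2 - b)) / x * f' x + (1 + of_real (\<eta>\<^sup>2) * x\<^sup>2) * f x)) (at x)"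
    using assms(2) by (auto intro!: derivative_eq_intros df df' simp: field_simps power2_eq_square)
  \<comment> \<open>The power \<open>2 - 2 * b\<close> of \<open>x\<close> intertwines the equation
    with parameter \<open>2 - b\<close> and the one with parameter \<open>b\<close>.\<close>
  have alg: "(c / x * f x + f' x) * (c / x) + (- c / x\<^sup>2 * f x + c / x * f' x + ((1 - 2 * (2 - b)) / x * f' x + W * f x))
     = (1 - 2 * b) / x * (c / x * f x + f' x) + W * f x" for W
    using assms(2) unfolding c_def by (simp add: field_simps power2_eq_square)
  show "(sol' \<rho> \<eta> b has_field_derivative (1 - 2 * b) / x * sol' \<rho> \<eta> b x + (1 + of_real (\<eta>\<^sup>2) * x\<^sup>2) * sol \<rho> \<eta> b x) (at x)"
  proof (rule DERIV_cong)
    show "(sol' \<rho> \<eta> b has_field_derivative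
      ((1 - 2 * b) / x * kumR' \<eta> b x + (1 + of_real (\<eta>\<^sup>2) * x\<^sup>2) * kumR \<eta> b x)
      - \<rho> * (exp (c * Ln (x / 2)) * (c / x) * (c / x * f x + f' x) +
          (- c / x\<^sup>2 * f x + c / x * f' x + ((1 - 2 * (2 - b)) / x * f' x + (1 + of_real (\<eta>\<^sup>2) * x\<^sup>2) * f x)) * exp (c * Ln (x / 2)))) (at x)"
      unfolding sol'_def[abs_def] c_def[symmetric] f_def[symmetric] f'_def[symmetric]
      by (intro DERIV_diff DERIV_cmult DERIV_mult de dinv kumR'_deriv assms(2))
    have fac: "e * k * g + h * e = e * (g * k + h)" for e k g h :: complex by (simp add: algebra_simps)
    have "exp (c * Ln (x / 2)) * (c / x) * (c / x * f x + f' x) +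
          (- c / x\<^sup>2 * f x + c / x * f' x + ((1 - 2 * (2 - b)) / x * f' x + (1 + of_real (\<eta>\<^sup>2) * x\<^sup>2) * f x)) * exp (c * Ln (x / 2))
       = exp (c * Ln (x / 2)) * ((c / x * f x + f' x) * (c / x) + (- c / x\<^sup>2 * f x + c / x * f' x + ((1 - 2 * (2 - b)) / x * f' x + (1 + of_real (\<eta>\<^sup>2) * x\<^sup>2) * f x)))"
      by (rule fac)
    also have "\<dots> = exp (c * Ln (x / 2)) * ((1 - 2 * b) / x * (c / x * f x + f' x) + (1 + of_real (\<eta>\<^sup>2) * x\<^sup>2) * f x)"
      unfolding alg ..
    finally have ze: "exp (c * Ln (x / 2)) * (c / x) * (c / x * f x + f' x) +
          (- c / x\<^sup>2 * f x + c / x * f' x + ((1 - 2 * (2 - b)) / x * f' x + (1 + of_real (\<eta>\<^sup>2) * x\<^sup>2) * f x)) * exp (c * Ln (x / 2))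
       = exp (c * Ln (x / 2)) * ((1 - 2 * b) / x * (c / x * f x + f' x) + (1 + of_real (\<eta>\<^sup>2) * x\<^sup>2) * f x)" .
    have lin: "(V * k' + W * k) - \<rho> * (e * (V * g' + W * g)) = V * (k' - \<rho> * (e * g')) + W * (k - \<rho> * (e * g))"
      for V W k k' e g g' :: complex by (simp add: algebra_simps)
    show "((1 - 2 * b) / x * kumR' \<eta> b x + (1 + of_real (\<eta>\<^sup>2) * x\<^sup>2) * kumR \<eta> b x)
      - \<rho> * (exp (c * Ln (x / 2)) * (c / x) * (c / x * f x + f' x) +
          (- c / x\<^sup>2 * f x + c / x * f' x + ((1 - 2 * (2 - b)) / x * f' x + (1 + of_real (\<eta>\<^sup>2) * x\<^sup>2) * f x)) * exp (c * Ln (x / 2)))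
      = (1 - 2 * b) / x * sol' \<rho> \<eta> b x + (1 + of_real (\<eta>\<^sup>2) * x\<^sup>2) * sol \<rho> \<eta> b x"
      unfolding sol_def sol'_def c_def[symmetric] f_def[symmetric] f'_def[symmetric] ze by (rule lin)
  qed
qed

text \<open>The bound is carried from the positive axis to \<open>x\<close> along the chord of the
  circle. The real part drops from \<open>L\<close> to \<open>Re x\<close>, so the energy grows by
  \<open>exp (2 * (L - Re x))\<close> and exactly the decay of the recessive solution is lost. The
  chord stays away from 0, so the \<open>1 / x\<close> drift costs only a constant.\<close>

lemma sol_chord:
  fixes B L A :: real
  assumes x: "norm x = L" "Re x \<ge> 0" and L: "L \<ge> 1" and b: "norm b \<le> B"
    and \<eta>: "\<eta>\<^sup>2 * L ^ 3 \<le> 1"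
    and A: "norm (sol \<rho> \<eta> b (of_real L)) \<le> A" "norm (sol' \<rho> \<eta> b (of_real L)) \<le> A"
  shows "norm (sol \<rho> \<eta> b x) \<le> 2 * A * exp (3 + 4 * B) * exp (L - Re x)"
proof -
  define d where "d = x - of_real L"
  \<comment> \<open>Drift and perturbation together: \<open>norm d\<close> is at most twice the
    modulus of each point of the chord, giving \<open>2 * 2 * (1 + 2 * B)\<close>, and
    \<open>\<eta>\<^sup>2 * L ^ 3 \<le> 1\<close> bounds the rest by 2. Half of \<open>k0\<close> is
    the exponent \<open>3 + 4 * B\<close> of the claim.\<close>
  define k0 where "k0 = 4 * (1 + 2 * B) + 2"
  have A0: "A \<ge> 0" using A(1) norm_ge_zero order.trans by blast
  have B0: "B \<ge> 0" using b norm_ge_zero order.trans by blast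
  have xx: "(Re x)\<^sup>2 + (Im x)\<^sup>2 = L\<^sup>2" using x(1) cmod_power2[of x] by simp
  have RL: "Re x \<le> L" using complex_Re_le_cmod[of x] x by simp
  have nd2: "(norm d)\<^sup>2 \<le> 2 * L\<^sup>2"
  proof -
    have "(norm d)\<^sup>2 = 2 * L\<^sup>2 - 2 * L * Re x"
      unfolding cmod_power2 d_def using xx by (simp add: power2_eq_square algebra_simps)
    then show ?thesis using L x by simp
  qed
  \<comment> \<open>The hypothesis \<open>Re x \<ge> 0\<close> makes the cross term nonnegative, and
    \<open>(1 - t)\<^sup>2 + t\<^sup>2 \<ge> 1 / 2\<close> keeps the squared modulus above
    \<open>L\<^sup>2 / 2\<close>.\<close>
  have pt: "norm (of_real L + of_real t * d) \<le> L" "L\<^sup>2 \<le> 2 * (norm (of_real L + of_real t * d))\<^sup>2" if t: "0 \<le> t" "t \<le> 1" for t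
  proof -
    have e: "of_real L + of_real t * d = of_real ((1 - t) * L) + of_real t * x" by (simp add: d_def algebra_simps)
    have "norm (of_real L + of_real t * d) \<le> (1 - t) * L + t * L"
      unfolding e by (rule order.trans[OF norm_triangle_ineq])
        (use t L x in \<open>simp add: norm_mult abs_mult del: of_real_mult of_real_diff\<close>)
    then show "norm (of_real L + of_real t * d) \<le> L" by (simp add: algebra_simps)
    have "(norm (of_real L + of_real t * d))\<^sup>2 = ((1 - t)\<^sup>2 + t\<^sup>2) * L\<^sup>2 + 2 * (t * (1 - t) * L * Re x)"
      unfolding e cmod_power2 using xx by (simp add: power2_eq_square algebra_simps) (simp add: distrib_left[symmetric])?
    moreover have "t * (1 - t) * L * Re x \<ge> 0" using t L x by simp
    moreover have "1 / 2 * L\<^sup>2 \<le> ((1 - t)\<^sup>2 + t\<^sup>2) * L\<^sup>2"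
    proof (rule mult_right_mono)
      have "(1 - t)\<^sup>2 + t\<^sup>2 - 1 / 2 = 2 * (t - 1 / 2)\<^sup>2" by (simp add: power2_eq_square algebra_simps)
      then show "1 / 2 \<le> (1 - t)\<^sup>2 + t\<^sup>2" using zero_le_power2[of "t - 1 / 2"] by linarith
    qed simp
    ultimately show "L\<^sup>2 \<le> 2 * (norm (of_real L + of_real t * d))\<^sup>2" by linarith
  qed
  have dp: "norm d \<le> 2 * norm (of_real L + of_real t * d)" if t: "0 \<le> t" "t \<le> 1" for t
  proof (rule power2_le_imp_le)
    show "(norm d)\<^sup>2 \<le> (2 * norm (of_real L + of_real t * d))\<^sup>2"
      using nd2 pt(2)[OF t] by (simp add: power_mult_distrib)
  qed auto
  have d2L: "norm d \<le> 2 * L"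
  proof (rule power2_le_imp_le)
    show "(norm d)\<^sup>2 \<le> (2 * L)\<^sup>2"
    proof -
      have "(2 * L)\<^sup>2 = 4 * L\<^sup>2" by (simp add: power_mult_distrib)
      then show ?thesis using nd2 zero_le_power2[of L] by linarith
    qed
  qed (use L in simp)
  have "(norm (sol' \<rho> \<eta> b (of_real L + d)))\<^sup>2 + (norm (sol \<rho> \<eta> b (of_real L + d)))\<^sup>2 \<le>
     ((norm (sol' \<rho> \<eta> b (of_real L)))\<^sup>2 + (norm (sol \<rho> \<eta> b (of_real L)))\<^sup>2) * exp (2 * \<bar>Re d\<bar> + k0 * 1 - k0 * 0)"
  proof (rule energy_segment[where P = "\<lambda>x. (1 - 2 * b) / x" and Q = "\<lambda>x. of_real (\<eta>\<^sup>2) * x\<^sup>2" and k = "\<lambda>_. k0" and K = "\<lambda>t. k0 * t"])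
    fix t :: real assume t: "0 \<le> t" "t \<le> 1"
    have e: "of_real L + of_real t * d = of_real ((1 - t) * L) + of_real t * x" by (simp add: d_def algebra_simps)
    have re: "Re (of_real L + of_real t * d) \<ge> 0" unfolding e using t L x by simp
    have "norm (of_real L + of_real t * d) > 0" using pt(2)[OF t] L
      by (metis less_eq_real_def linorder_not_le mult_zero_right norm_le_zero_iff not_one_le_zero norm_zero power_eq_0_iff zero_less_norm_iff zero_power2 power2_less_eq_zero_iff)
    then have nz: "of_real L + of_real t * d \<noteq> 0" by auto
    show "(sol \<rho> \<eta> b has_field_derivative sol' \<rho> \<eta> b (of_real L + of_real t * d)) (at (of_real L + of_real t * d))"
      by (rule sol_deriv[OF re nz])
    show "(sol' \<rho> \<eta> b has_field_derivative (1 - 2 * b) / (of_real L + of_real t * d) * sol' \<rho> \<eta> b (of_real L + of_real t * d)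
         + (1 + of_real (\<eta>\<^sup>2) * (of_real L + of_real t * d)\<^sup>2) * sol \<rho> \<eta> b (of_real L + of_real t * d)) (at (of_real L + of_real t * d))"
      by (rule sol'_deriv[OF re nz])
    have lin: "n * (2 * p + q) \<le> k0" if "n * p \<le> (1 + 2 * B) * 2" "n * q \<le> 2" for n p q :: real
    proof -
      have "n * (2 * p + q) = 2 * (n * p) + n * q" by (simp add: algebra_simps)
      then show ?thesis using that unfolding k0_def by linarith
    qed
    have b2: "norm (1 - 2 * b) \<le> 1 + 2 * B" using norm_triangle_ineq4[of 1 "2 * b"] b by (simp add: norm_mult)
    have "norm d * norm ((1 - 2 * b) / (of_real L + of_real t * d)) = norm (1 - 2 * b) * (norm d / norm (of_real L + of_real t * d))"
      by (simp add: norm_divide)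
    also have "\<dots> \<le> (1 + 2 * B) * 2"
      using b2 dp[OF t] nz B0 by (intro mult_mono) (auto simp: divide_le_eq)
    finally have 1: "norm d * norm ((1 - 2 * b) / (of_real L + of_real t * d)) \<le> (1 + 2 * B) * 2" .
    have "norm d * norm (of_real (\<eta>\<^sup>2) * (of_real L + of_real t * d)\<^sup>2) = \<eta>\<^sup>2 * (norm d * (norm (of_real L + of_real t * d))\<^sup>2)"
      by (simp add: norm_mult norm_power)
    also have "\<dots> \<le> \<eta>\<^sup>2 * (2 * L * L\<^sup>2)"
      using d2L pt(1)[OF t] L by (intro mult_left_mono mult_mono power_mono) auto
    also have "\<dots> \<le> 2" using \<eta> by (simp add: power2_eq_square power3_eq_cube mult_ac)
    finally have 2: "norm d * norm (of_real (\<eta>\<^sup>2) * (of_real L + of_real t * d)\<^sup>2) \<le> 2" .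
    show "norm d * (2 * norm ((1 - 2 * b) / (of_real L + of_real t * d)) + norm (of_real (\<eta>\<^sup>2) * (of_real L + of_real t * d)\<^sup>2)) \<le> k0"
      by (rule lin[OF 1 2])
    show "((\<lambda>t. k0 * t) has_real_derivative k0) (at t)" by (auto intro!: derivative_eq_intros)
  qed
  also have "of_real L + d = x" by (simp add: d_def)
  also have "((norm (sol' \<rho> \<eta> b (of_real L)))\<^sup>2 + (norm (sol \<rho> \<eta> b (of_real L)))\<^sup>2) * exp (2 * \<bar>Re d\<bar> + k0 * 1 - k0 * 0)
     \<le> (2 * A)\<^sup>2 * (exp (3 + 4 * B) * exp (L - Re x))\<^sup>2"
  proof (rule mult_mono)
    have "(norm (sol' \<rho> \<eta> b (of_real L)))\<^sup>2 \<le> A\<^sup>2" "(norm (sol \<rho> \<eta> b (of_real L)))\<^sup>2 \<le> A\<^sup>2"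
      using A by (auto intro!: power_mono)
    then show "(norm (sol' \<rho> \<eta> b (of_real L)))\<^sup>2 + (norm (sol \<rho> \<eta> b (of_real L)))\<^sup>2 \<le> (2 * A)\<^sup>2"
      using sq2[of A] by linarith
    have "\<bar>Re d\<bar> = L - Re x" using RL by (simp add: d_def)
    then have "2 * \<bar>Re d\<bar> + k0 * 1 - k0 * 0 = 2 * ((3 + 4 * B) + (L - Re x))" by (simp add: k0_def)
    then show "exp (2 * \<bar>Re d\<bar> + k0 * 1 - k0 * 0) \<le> (exp (3 + 4 * B) * exp (L - Re x))\<^sup>2"
      by (simp only: exp_double exp_add)
  qed auto
  finally have "(norm (sol \<rho> \<eta> b x))\<^sup>2 \<le> (2 * A * (exp (3 + 4 * B) * exp (L - Re x)))\<^sup>2"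
    unfolding power_mult_distrib[of "2 * A"] using zero_le_power2[of "norm (sol' \<rho> \<eta> b x)"] by linarith
  then have "norm (sol \<rho> \<eta> b x) \<le> 2 * A * (exp (3 + 4 * B) * exp (L - Re x))"
    by (rule power2_le_imp_le) (use A0 in simp)
  then show ?thesis by (simp add: mult.assoc)
qed

section \<open>Bounds for the recessive solutions\<close>

text \<open>Tannery's theorem with the majorant of \<open>hyp_nth_bound\<close>. The general filter
  serves both sequences of parameters and joint continuity at a point.\<close>

lemma hyp_tendsto:
  assumes pp: "(pp \<longlongrightarrow> p) F" "(qq \<longlongrightarrow> q) F" "(bb \<longlongrightarrow> b) F" and F: "F \<noteq> bot"
  shows "((\<lambda>n. eval_fps (hyp (pp n) (qq n) (bb n)) z) \<longlongrightarrow> eval_fps (hyp p q b) z) F"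
proof -
  define L where "L = max (norm p) (norm q) + 1"
  define r where "r = 1 / (2 * (norm z + 1))"
  have z1: "norm z + 1 > 0" by (simp add: add_nonneg_pos)
  then have r: "r > 0" by (simp add: r_def)
  have L: "L \<ge> 0" by (simp add: L_def add_nonneg_nonneg le_max_iff_disj)
  obtain C where C: "C > 0" "\<And>p q b' n. norm p \<le> L \<Longrightarrow> norm q \<le> L \<Longrightarrow> norm b' \<le> norm b + 1 \<Longrightarrow>
     norm (fps_nth (hyp p q b') n) \<le> C * r ^ n"
    using hyp_nth_bound[OF L r, of "norm b + 1"] by metis
  have "\<forall>\<^sub>F n in F. norm (pp n) < L" "\<forall>\<^sub>F n in F. norm (qq n) < L" "\<forall>\<^sub>F n in F. norm (bb n) < norm b + 1"
    by (rule order_tendstoD(2)[OF tendsto_norm[OF pp(1)]], simp add: L_def,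
        rule order_tendstoD(2)[OF tendsto_norm[OF pp(2)]], simp add: L_def,
        rule order_tendstoD(2)[OF tendsto_norm[OF pp(3)]], simp)
  then have ev: "\<forall>\<^sub>F n in F. norm (pp n) \<le> L \<and> norm (qq n) \<le> L \<and> norm (bb n) \<le> norm b + 1"
    by eventually_elim auto
  have "((\<lambda>n. \<Sum>k. fps_nth (hyp (pp n) (qq n) (bb n)) k * z ^ k) \<longlongrightarrow> (\<Sum>k. fps_nth (hyp p q b) k * z ^ k)) F"
  proof (rule conjunct2[OF conjunct2[OF tannerys_theorem[where M = "\<lambda>k. C * (1 / 2) ^ k"]]])
    show "((\<lambda>n. fps_nth (hyp (pp n) (qq n) (bb n)) k * z ^ k) \<longlongrightarrow> fps_nth (hyp p q b) k * z ^ k) F" for k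
    proof -
      have "isCont (rGamma :: complex \<Rightarrow> complex) w" for w
        using continuous_on_rGamma[of "UNIV :: complex set"] by (simp add: continuous_on_eq_continuous_at)
      then have "((\<lambda>n. rGamma (bb n + of_nat k)) \<longlongrightarrow> rGamma (b + of_nat k)) F"
        by (rule isCont_tendsto_compose) (intro tendsto_intros pp)
      then show ?thesis unfolding hyp_nth by (intro tendsto_intros pp) auto
    qed
    show "summable (\<lambda>k. C * (1 / 2) ^ k)" by (intro summable_mult summable_geometric) simp
    have "norm (fps_nth (hyp (pp n) (qq n) (bb n)) k * z ^ k) \<le> C * (1 / 2) ^ k"
      if "norm (pp n) \<le> L \<and> norm (qq n) \<le> L \<and> norm (bb n) \<le> norm b + 1" for n k
    proof -
      have "norm (fps_nth (hyp (pp n) (qq n) (bb n)) k * z ^ k) \<le> (C * r ^ k) * (norm z + 1) ^ k"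
        unfolding norm_mult norm_power using that C r by (intro mult_mono C power_mono) auto
      also have "\<dots> = C * (r * (norm z + 1)) ^ k" by (simp add: power_mult_distrib)
      also have "r * (norm z + 1) = 1 / 2" using z1 by (simp add: r_def)
      finally show ?thesis .
    qed
    then show "\<forall>\<^sub>F (k, n) in sequentially \<times>\<^sub>F F. norm (fps_nth (hyp (pp n) (qq n) (bb n)) k * z ^ k) \<le> C * (1 / 2) ^ k"
      unfolding eventually_prod_filter
      by (intro exI[of _ "\<lambda>_. True"] exI[of _ "\<lambda>n. norm (pp n) \<le> L \<and> norm (qq n) \<le> L \<and> norm (bb n) \<le> norm b + 1"] conjI ev)
        auto
  qed (rule F)
  then show ?thesis unfolding eval_fps_def .
qed

section \<open>The recessive combination as a Laplace integral on the positive axis\<close>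

lemma eval_hyp_scale: "eval_fps (hyp (c * p) (c * q) b) s = eval_fps (hyp p q b) (c * s)"
proof -
  have "(\<Prod>j<n. c * p + c * q * of_nat j) = c ^ n * (\<Prod>j<n. p + q * of_nat j)" for n
    using prod.distrib[of "\<lambda>_. c" "\<lambda>j. p + q * of_nat j" "{..<n}"] by (simp add: algebra_simps)
  then show ?thesis unfolding eval_fps_def hyp_nth by (simp add: power_mult_distrib mult_ac)
qed

lemma kumR_kM:
  assumes "\<eta> > 0"
  shows "kumR \<eta> b x = exp (- (of_real \<eta> * x\<^sup>2) / 2) * kM (1 / (4 * of_real \<eta>) + b / 2) b (of_real \<eta> * x\<^sup>2)"
proof -
  define c where "c = 4 * complex_of_real \<eta>"
  have c: "c \<noteq> 0" using assms by (simp add: c_def)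
  have p: "1 + 2 * b * of_real \<eta> = c * (1 / (4 * of_real \<eta>) + b / 2)" using assms by (simp add: c_def algebra_simps)
  have q: "4 * complex_of_real \<eta> = c * 1" by (simp add: c_def)
  have s: "c * (x\<^sup>2 / 4) = of_real \<eta> * x\<^sup>2" "- 2 * of_real \<eta> * (x\<^sup>2 / 4) = - (of_real \<eta> * x\<^sup>2) / 2"
    by (simp_all add: c_def)
  show ?thesis unfolding kumR_def eval_kum p s(2) unfolding q eval_hyp_scale s(1) ..
qed

text \<open>The factor that makes \<open>sol (rho \<eta> b) \<eta> b\<close> recessive; it tends to \<open>1\<close>, the value for Bessel functions.\<close>

definition rho :: "real \<Rightarrow> complex \<Rightarrow> complex" where
  "rho \<eta> b = Gamma (1 / (4 * of_real \<eta>) + 1 - b / 2) * rGamma (1 / (4 * of_real \<eta>) + b / 2) *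
     exp ((1 - b) * of_real (ln (4 * \<eta>)))"

lemma sin_pi_2_minus: "sin (of_real pi * (2 - b)) = - sin (of_real pi * b :: complex)"
proof -
  have "sin (of_real pi * 2) = (0 :: complex)" "cos (of_real pi * 2) = (1 :: complex)"
    using sin_of_real[of "2 * pi", where 'a = complex] cos_of_real[of "2 * pi", where 'a = complex]
    by (simp_all add: mult.commute)
  then show ?thesis by (simp add: right_diff_distrib sin_diff)
qed

text \<open>\<open>kV\<close> at \<open>2 - b\<close> combines the same two Kummer solutions with
  the sine reversed. The value of \<open>rho\<close> is forced: it is the ratio of the two
  connection coefficients once the power \<open>1 - b\<close> of
  \<open>\<zeta> = \<eta> * x\<^sup>2\<close> is split into those of \<open>4 * \<eta>\<close> and
  of \<open>(x / 2)\<^sup>2\<close>.\<close>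

lemma sol_real:
  assumes \<eta>: "\<eta> > 0" and x: "x > 0" and b: "sin (of_real pi * b) \<noteq> 0"
  shows "sol (rho \<eta> b) \<eta> b (of_real x) = sin (of_real pi * b) / of_real pi *
     (exp ((1 - b) * of_real (ln (\<eta> * x\<^sup>2))) * exp (- (of_real (\<eta> * x\<^sup>2)) / 2) *
        kV (1 / (4 * of_real \<eta>) + 1 - b / 2) (2 - b) (of_real (\<eta> * x\<^sup>2)))"
proof -
  define \<zeta> where "\<zeta> = \<eta> * x\<^sup>2"
  define a a1 where "a = 1 / (4 * complex_of_real \<eta>) + b / 2" and "a1 = 1 / (4 * complex_of_real \<eta>) + 1 - b / 2"
  have \<zeta>: "\<zeta> > 0" using \<eta> x by (simp add: \<zeta>_def)
  have Lx: "Ln (of_real x / 2) = of_real (ln (x / 2))"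
    using x Ln_of_real[of "x / 2"] by simp
  have LZ: "Ln (of_real \<zeta>) = of_real (ln \<zeta>)" using \<zeta> by (simp add: Ln_of_real)
  have s: "a1 - (2 - b) + 1 = a" "1 - (2 - b) = b - 1" "2 - (2 - b) = b" by (simp_all add: a_def a1_def)
  define e where "e = exp (- (complex_of_real \<zeta>) / 2)"
  define G where "G = Gamma a1 * rGamma a"
  have k: "kumR \<eta> b (of_real x) = e * kM a b (of_real \<zeta>)" "kumR \<eta> (2 - b) (of_real x) = e * kM a1 (2 - b) (of_real \<zeta>)"
    unfolding kumR_kM[OF \<eta>] e_def a_def a1_def \<zeta>_def by (simp_all add: diff_divide_distrib add_diff_eq)
  have ln4: "ln (4 * \<eta>) + 2 * ln (x / 2) = ln \<zeta>"
    using \<eta> x by (simp add: \<zeta>_def ln_mult ln_div ln_realpow) (simp add: ln_realpow[of 2 2, simplified])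
  have r: "rho \<eta> b * exp ((2 - 2 * b) * Ln (of_real x / 2)) = G * exp ((1 - b) * of_real (ln \<zeta>))"
    unfolding rho_def Lx G_def a_def a1_def ln4[symmetric] mult.assoc exp_add[symmetric]
    by (simp add: algebra_simps)
  have ee: "exp ((1 - b) * of_real (ln \<zeta>)) * exp ((b - 1) * of_real (ln \<zeta>)) = (1 :: complex)"
    unfolding exp_add[symmetric] by (simp add: algebra_simps)
  have V: "kV a1 (2 - b) (of_real \<zeta>) = - (of_real pi / sin (of_real pi * b)) *
     (G * kM a1 (2 - b) (of_real \<zeta>) - exp ((b - 1) * of_real (ln \<zeta>)) * kM a b (of_real \<zeta>))"
    unfolding kV_def kN_def s sin_pi_2_minus LZ G_def by simp
  have "sin (of_real pi * b) / of_real pi * (exp ((1 - b) * of_real (ln \<zeta>)) * e * kV a1 (2 - b) (of_real \<zeta>))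
     = - (exp ((1 - b) * of_real (ln \<zeta>)) * e * (G * kM a1 (2 - b) (of_real \<zeta>) - exp ((b - 1) * of_real (ln \<zeta>)) * kM a b (of_real \<zeta>)))"
    unfolding V using b by simp
  also have "\<dots> = (exp ((1 - b) * of_real (ln \<zeta>)) * exp ((b - 1) * of_real (ln \<zeta>))) * (e * kM a b (of_real \<zeta>))
      - (G * exp ((1 - b) * of_real (ln \<zeta>))) * (e * kM a1 (2 - b) (of_real \<zeta>))"
    by (simp add: algebra_simps)
  also have "\<dots> = sol (rho \<eta> b) \<eta> b (of_real x)"
    unfolding ee r[symmetric] sol_def k by simp
  finally show ?thesis unfolding \<zeta>_def e_def a1_def ..
qed

text \<open>The representation of \<open>sol\<close> is differentiated along the positive axis, so
  the derivative too is expressed by a Laplace integral and inherits its decay.\<close>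

lemma sol'_real:
  assumes \<eta>: "\<eta> > 0" and x: "x > 0" and b: "sin (of_real pi * b) \<noteq> 0"
    and a: "Re (1 / (4 * of_real \<eta>) + 1 - b / 2) \<ge> 1"
  shows "sol' (rho \<eta> b) \<eta> b (of_real x) = of_real (2 * \<eta> * x) * (((1 - b) / of_real (\<eta> * x\<^sup>2) - 1 / 2) * sol (rho \<eta> b) \<eta> b (of_real x)
     - sin (of_real pi * b) / of_real pi *
     (exp ((1 - b) * of_real (ln (\<eta> * x\<^sup>2))) * exp (- (of_real (\<eta> * x\<^sup>2)) / 2) *
        kV (1 / (4 * of_real \<eta>) + 1 - b / 2 + 1) (2 - b + 1) (of_real (\<eta> * x\<^sup>2))))"
proof -
  define c where "c = sin (of_real pi * b) / of_real pi"
  define a1 where "a1 = 1 / (4 * complex_of_real \<eta>) + 1 - b / 2"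
  define Z where "Z = (\<lambda>x. complex_of_real (\<eta> * x\<^sup>2))"
  define \<Sigma> where "\<Sigma> = (\<lambda>\<zeta>. c * (exp ((1 - b) * Ln \<zeta>) * exp (- \<zeta> / 2) * kV a1 (2 - b) \<zeta>))"
  define D where "D = c * (exp ((1 - b) * Ln (Z x)) * ((1 - b) / Z x) * exp (- Z x / 2) * kV a1 (2 - b) (Z x)
     + exp ((1 - b) * Ln (Z x)) * (exp (- Z x / 2) * (- 1 / 2)) * kV a1 (2 - b) (Z x)
     + exp ((1 - b) * Ln (Z x)) * exp (- Z x / 2) * (- kV (a1 + 1) (2 - b + 1) (Z x)))"
  have Zx: "Re (Z x) > 0" "Z x \<noteq> 0" "Z x \<notin> \<real>\<^sub>\<le>\<^sub>0"
  proof -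
    have "\<eta> * x\<^sup>2 > 0" using \<eta> x by simp
    then show "Re (Z x) > 0" unfolding Z_def by (simp only: Re_complex_of_real)
    then show "Z x \<noteq> 0" "Z x \<notin> \<real>\<^sub>\<le>\<^sub>0" using right_half_plane_not_nonpos by auto
  qed
  have LZ: "Ln (Z y) = of_real (ln (\<eta> * y\<^sup>2))" if "y > 0" for y
    using \<eta> that unfolding Z_def by (intro Ln_of_real) simp
  have dV: "(kV a1 (2 - b) has_field_derivative - kV (a1 + 1) (2 - b + 1) (Z x)) (at (Z x))"
    by (rule kV_deriv[OF Zx(1)]) (use a in \<open>simp add: a1_def\<close>)
  have dS: "(\<Sigma> has_field_derivative D) (at (Z x))"
  proof -
    have d1: "((\<lambda>\<zeta>. exp ((1 - b) * Ln \<zeta>)) has_field_derivative exp ((1 - b) * Ln (Z x)) * ((1 - b) / Z x)) (at (Z x))"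
      using Zx(2,3) by (auto intro!: derivative_eq_intros simp: divide_inverse algebra_simps)
    have d2: "((\<lambda>\<zeta> :: complex. exp (- \<zeta> / 2)) has_field_derivative exp (- Z x / 2) * (- 1 / 2)) (at (Z x))"
      by (auto intro!: derivative_eq_intros)
    show ?thesis unfolding \<Sigma>_def D_def
      by (rule DERIV_cong[OF DERIV_cmult[OF DERIV_mult[OF DERIV_mult[OF d1 d2] dV]]]) (simp add: algebra_simps)
  qed
  have dZ: "(Z has_vector_derivative of_real (2 * \<eta> * x)) (at x)"
    unfolding Z_def by (intro has_vector_derivative_of_real)
      (auto intro!: derivative_eq_intros simp: has_real_derivative_iff_has_vector_derivative[symmetric])
  have 1: "((\<lambda>x. \<Sigma> (Z x)) has_vector_derivative of_real (2 * \<eta> * x) * D) (at x)"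
    using field_vector_diff_chain_at[OF dZ dS] by (simp add: o_def)
  have "(complex_of_real has_vector_derivative 1) (at x)"
    using has_vector_derivative_of_real[of "\<lambda>x. x" 1 "at x"] by simp
  from field_vector_diff_chain_at[OF this sol_deriv[of "of_real x" "rho \<eta> b" \<eta> b]]
  have 2: "((\<lambda>x. sol (rho \<eta> b) \<eta> b (of_real x)) has_vector_derivative sol' (rho \<eta> b) \<eta> b (of_real x)) (at x)"
    using x by (simp add: o_def)
  have eq: "\<Sigma> (Z y) = sol (rho \<eta> b) \<eta> b (of_real y)" if "y > 0" for y
    unfolding sol_real[OF \<eta> that b] \<Sigma>_def c_def LZ[OF that] a1_def unfolding Z_def ..
  have "((\<lambda>x. sol (rho \<eta> b) \<eta> b (of_real x)) has_vector_derivative of_real (2 * \<eta> * x) * D) (at x)"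
    by (rule has_vector_derivative_transform_within_open[OF 1, of "{0<..}"]) (use x eq in auto)
  then have "sol' (rho \<eta> b) \<eta> b (of_real x) = of_real (2 * \<eta> * x) * D"
    by (rule vector_derivative_unique_at[OF 2])
  also have "D = ((1 - b) / Z x - 1 / 2) * \<Sigma> (Z x) - c * (exp ((1 - b) * Ln (Z x)) * exp (- Z x / 2) * kV (a1 + 1) (2 - b + 1) (Z x))"
    unfolding D_def \<Sigma>_def by (simp add: algebra_simps)
  finally show ?thesis unfolding eq[OF x] LZ[OF x] unfolding c_def a1_def Z_def .
qed

text \<open>The difference of the two sides has derivative
  \<open>(t - 1)\<^sup>2 / (t * (1 + t)\<^sup>2) \<ge> 0\<close> and vanishes at 1. The variable
  \<open>(1 - s) / (1 + s)\<close> is the one in which the exponential part of the kernel becomes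
  exact.\<close>

lemma ln_le_cayley:
  fixes s :: real
  assumes "0 < s" "s \<le> 1"
  shows "ln s \<le> - 2 * ((1 - s) / (1 + s))"
proof -
  define f where "f = (\<lambda>s::real. ln s + 2 * ((1 - s) / (1 + s)))"
  have "f s \<le> f 1"
  proof (rule DERIV_nonneg_imp_nondecreasing[where f = f, OF assms(2)])
    fix t :: real assume t: "s \<le> t" "t \<le> 1"
    then have t0: "t > 0" using assms by simp
    have 1: "((\<lambda>s. (1 - s) / (1 + s)) has_real_derivative ((0 - 1) * (1 + t) - (1 - t) * (0 + 1)) / ((1 + t) * (1 + t))) (at t)"
      using t0 by (intro DERIV_divide DERIV_diff DERIV_add DERIV_const DERIV_ident) auto
    have "(f has_real_derivative (t - 1)\<^sup>2 / (t * (1 + t)\<^sup>2)) (at t)"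
      unfolding f_def
    proof (rule DERIV_cong[OF DERIV_add[OF DERIV_ln[OF t0] DERIV_cmult[OF 1]]])
      show "inverse t + 2 * (((0 - 1) * (1 + t) - (1 - t) * (0 + 1)) / ((1 + t) * (1 + t))) = (t - 1)\<^sup>2 / (t * (1 + t)\<^sup>2)"
        using t0 by (simp add: divide_simps power2_eq_square) (simp add: algebra_simps)
    qed
    then show "\<exists>y. (f has_real_derivative y) (at t) \<and> 0 \<le> y" using t0 by (intro exI conjI) auto
  qed
  moreover have "f 1 = 0" by (simp add: f_def)
  ultimately show ?thesis unfolding f_def by linarith
qed

text \<open>\<open>ln y \<le> y - 1\<close> at \<open>v / (4 * B)\<close> and at
  \<open>1 / (2 * B * v)\<close>. The coefficients are chosen so that from
  \<open>(v + 1 / v) / 2\<close> the amount \<open>v / 4\<close> remains for the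
  integration.\<close>

lemma ln_abs_bound:
  fixes v B r :: real
  assumes "v > 0" "B \<ge> 1" "\<bar>r\<bar> \<le> B"
  shows "- r * ln v \<le> v / 4 + 1 / (2 * v) + B * ln (4 * B)"
proof -
  have "- r * ln v \<le> \<bar>r\<bar> * \<bar>ln v\<bar>" by (metis abs_ge_self abs_minus_cancel abs_mult)
  also have "\<dots> \<le> B * \<bar>ln v\<bar>" using assms by (intro mult_right_mono) auto
  finally have 0: "- r * ln v \<le> B * \<bar>ln v\<bar>" .
  have "ln (v / (4 * B)) \<le> v / (4 * B) - 1" using assms by (intro ln_le_minus_one) auto
  then have "ln v \<le> v / (4 * B) + ln (4 * B)" using assms by (simp add: ln_div)
  then have "B * ln v \<le> B * (v / (4 * B) + ln (4 * B))" using assms by (intro mult_left_mono) auto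
  then have 1: "B * ln v \<le> v / 4 + B * ln (4 * B)" using assms by (simp add: distrib_left)
  have "ln (1 / (v * (2 * B))) \<le> 1 / (v * (2 * B)) - 1" using assms by (intro ln_le_minus_one) auto
  then have "- ln v \<le> 1 / (v * (2 * B)) + ln (2 * B)" using assms by (simp add: ln_div ln_mult)
  moreover have "ln (2 * B) \<le> ln (4 * B)" using assms by simp
  ultimately have "- ln v \<le> 1 / (v * (2 * B)) + ln (4 * B)" by linarith
  then have "B * (- ln v) \<le> B * (1 / (v * (2 * B)) + ln (4 * B))" using assms by (intro mult_left_mono) auto
  then have 2: "B * (- ln v) \<le> 1 / (2 * v) + B * ln (4 * B)" using assms unfolding distrib_left by simp
  have p: "v / 4 \<ge> 0" "1 / (2 * v) \<ge> 0" using assms by auto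
  show ?thesis
  proof (cases "ln v \<ge> 0")
    case True
    then have "B * \<bar>ln v\<bar> = B * ln v" by simp
    then show ?thesis using 0 1 p by linarith
  next
    case False
    then have "B * \<bar>ln v\<bar> = B * (- ln v)" by simp
    then show ?thesis using 0 2 p by linarith
  qed
qed

text \<open>
  Saddle point bound: with \<open>\<theta> = (1 - s) / (1 + s)\<close> and \<open>v = \<theta> / (\<eta> x)\<close> the exponent is at most
  \<open>- (x / 2) (v + 1 / v) \<le> 1 - x - (v + 1 / v) / 2\<close>, uniformly in \<open>\<eta>\<close>.
\<close>

lemma kkern_estimate:
  fixes B \<eta> x :: real
  assumes B: "B \<ge> 1" and \<eta>: "\<eta> > 0" "4 * \<eta> * B \<le> 1" and x: "x \<ge> 1"
    and b: "\<bar>Re b\<bar> \<le> B" and a: "\<bar>Re a - 1 - 1 / (4 * \<eta>)\<bar> \<le> B" and s: "0 < s" "s < 1"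
  shows "exp ((Re b - 1) * ln (\<eta> * x\<^sup>2)) * exp (- (\<eta> * x\<^sup>2) / 2) * norm (kkern a b (of_real (\<eta> * x\<^sup>2)) s) \<le>
     exp (1 + 3 * B + B * ln (4 * B)) * exp (B * ln x) * exp (- x) * (1 / (\<eta> * x) * exp (- ((1 - s) / (8 * \<eta> * x))))"
proof -
  define r where "r = Re b"
  define \<theta> where "\<theta> = (1 - s) / (1 + s)"
  define v where "v = \<theta> / (\<eta> * x)"
  have \<theta>: "\<theta> > 0" "\<theta> \<le> 1" using s by (auto simp: \<theta>_def)
  have v: "v > 0" using \<theta> \<eta> x by (simp add: v_def)
  have lx: "ln x \<ge> 0" using x by simp
  \<comment> \<open>The factor \<open>exp (- \<zeta> / 2)\<close> is needed here:
    \<open>s / (1 - s) + 1 / 2 = 1 / (2 * \<theta>)\<close>.\<close>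
  have e1: "\<eta> * x\<^sup>2 * (s / (1 - s)) + \<eta> * x\<^sup>2 / 2 = x / (2 * v)"
  proof -
    have "s / (1 - s) + 1 / 2 = 1 / (2 * \<theta>)" using s by (simp add: \<theta>_def field_simps)
    then have "\<eta> * x\<^sup>2 * (s / (1 - s) + 1 / 2) = \<eta> * x\<^sup>2 * (1 / (2 * \<theta>))" by simp
    also have "\<dots> = x / (2 * v)" using \<eta> x \<theta> by (simp add: v_def field_simps power2_eq_square)
    finally show ?thesis by (simp add: distrib_left)
  qed
  \<comment> \<open>\<open>Re a - 1\<close> equals \<open>1 / (4 * \<eta>)\<close> up to
    \<open>B\<close>, and \<open>\<theta> / (2 * \<eta>) = x * v / 2\<close>; the deviation costs at
    most \<open>2 * B\<close> because \<open>\<theta> \<le> 1\<close>.\<close>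
  have e2: "(Re a - 1) * ln s \<le> - (x * v / 2) + 2 * B"
  proof -
    have ls: "ln s \<le> - 2 * \<theta>" unfolding \<theta>_def by (rule ln_le_cayley) (use s in auto)
    have c: "1 / (4 * \<eta>) - B \<ge> 0" using \<eta> by (simp add: field_simps)
    have "(Re a - 1) * ln s \<le> (1 / (4 * \<eta>) - B) * ln s"
      using a s by (intro mult_right_mono_neg) auto
    also have "\<dots> \<le> (1 / (4 * \<eta>) - B) * (- 2 * \<theta>)" using ls c by (intro mult_left_mono) auto
    also have "\<dots> = - (\<theta> / (2 * \<eta>)) + 2 * (B * \<theta>)" by (simp add: algebra_simps)
    also have "\<dots> \<le> - (\<theta> / (2 * \<eta>)) + 2 * B" using mult_left_mono[OF \<theta>(2), of B] B by simp
    also have "\<theta> / (2 * \<eta>) = x * v / 2" using \<eta> x by (simp add: v_def)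
    finally show ?thesis .
  qed
  have lex: "ln (\<eta> * x) = ln \<eta> + ln x" using \<eta> x by (simp add: ln_mult)
  have lv: "ln v = ln \<theta> - ln \<eta> - ln x" using \<theta> \<eta> x by (simp add: v_def ln_div ln_mult)
  have e3: "- r * ln (1 - s) \<le> - r * (ln v + ln \<eta> + ln x) + B"
  proof -
    have "1 - s = \<theta> * (1 + s)" using s by (simp add: \<theta>_def)
    then have "ln (1 - s) = ln \<theta> + ln (1 + s)" using \<theta> s by (simp add: ln_mult)
    moreover have "0 \<le> ln (1 + s)" "ln (1 + s) \<le> 1" using s ln_add_one_self_le_self[of s] by auto
    then have "- r * ln (1 + s) \<le> B * 1"
      using b unfolding r_def
      by (intro order.trans[OF mult_right_mono[of "- Re b" B "ln (1 + s)"] mult_left_mono]) auto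
    ultimately show ?thesis unfolding lv by (simp add: algebra_simps)
  qed
  have e4: "ln (\<eta> * x\<^sup>2) = ln \<eta> + 2 * ln x" using \<eta> x by (simp add: ln_mult ln_realpow)
  \<comment> \<open>Only the factor \<open>x - 1\<close> is spent on
    \<open>v + 1 / v \<ge> 2\<close>; the remaining unit of \<open>v + 1 / v\<close> controls the
    power of \<open>v\<close> and the integral over \<open>s\<close>.\<close>
  have e5: "x / (2 * v) + x * v / 2 \<ge> (x - 1) + 1 / (2 * v) + v / 2"
  proof -
    define w where "w = 1 / v"
    have "2 \<le> v + w" using v sum_squares_bound[of 1 v] by (simp add: w_def field_simps power2_eq_square)
    then have "(x - 1) * 2 \<le> (x - 1) * (v + w)" using x by (intro mult_left_mono) auto
    then have "2 * x + v + w \<le> 2 + x * w + x * v" by (simp add: algebra_simps)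
    moreover have "x / (2 * v) = x * w / 2" "1 / (2 * v) = w / 2" by (simp_all add: w_def)
    ultimately show ?thesis by simp
  qed
  have e6: "- r * ln v \<le> v / 4 + 1 / (2 * v) + B * ln (4 * B)"
    using ln_abs_bound[OF v B] b by (simp add: r_def)
  have e7: "v / 4 \<ge> (1 - s) / (8 * \<eta> * x)"
  proof -
    have "\<theta> \<ge> (1 - s) / 2" using s unfolding \<theta>_def by (intro divide_left_mono) auto
    then have "\<theta> / (4 * (\<eta> * x)) \<ge> ((1 - s) / 2) / (4 * (\<eta> * x))" using \<eta> x by (intro divide_right_mono) auto
    then show ?thesis using \<eta> x by (simp add: v_def)
  qed
  have e8: "(r - 2) * ln x \<le> B * ln x - ln x"
  proof -
    have "(r - 2) * ln x \<le> (B - 1) * ln x" using b lx by (intro mult_right_mono) (auto simp: r_def)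
    then show ?thesis by (simp add: algebra_simps)
  qed
  \<comment> \<open>The exponents of \<open>\<eta>\<close> that depend on \<open>r\<close> cancel.
    What remains is \<open>1 / \<eta>\<close>, and with one power of \<open>x\<close> from
    \<open>e8\<close> the factor \<open>1 / (\<eta> * x)\<close>.\<close>
  have "(r - 1) * (ln \<eta> + 2 * ln x) + - r * (ln v + ln \<eta> + ln x) = - r * ln v - ln \<eta> + (r - 2) * ln x"
    by (simp add: algebra_simps)
  then have ineq: "(r - 1) * ln (\<eta> * x\<^sup>2) + - (\<eta> * x\<^sup>2) / 2 + (- (\<eta> * x\<^sup>2 * (s / (1 - s))) + (Re a - 1) * ln s - r * ln (1 - s))
    \<le> 1 + 3 * B + B * ln (4 * B) + B * ln x + - x + (- ln (\<eta> * x) + - ((1 - s) / (8 * \<eta> * x)))"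
    unfolding e4 lex using e1 e2 e3 e5 e6 e7 e8 by linarith
  have mono: "exp p1 * exp p2 * exp p3 \<le> exp q1 * exp q2 * exp q3 * (exp q4 * exp q5)"
    if "p1 + p2 + p3 \<le> q1 + q2 + q3 + (q4 + q5)" for p1 p2 p3 q1 q2 q3 q4 q5 :: real
    using that by (simp flip: exp_add)
  have "exp (- ln (\<eta> * x)) = 1 / (\<eta> * x)"
    using \<eta>(1) x by (simp add: exp_minus inverse_eq_divide)
  then show ?thesis using mono[OF ineq] unfolding norm_kkern r_def[symmetric] Re_complex_of_real by simp
qed

text \<open>The last factor of the kernel bound, \<open>1 / (\<eta> * x)\<close> times
  \<open>exp (- (1 - s) / (8 * \<eta> * x))\<close>, integrates to at most 8 whatever
  \<open>\<eta>\<close> and \<open>x\<close> are.\<close>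

lemma kint_estimate:
  fixes B \<eta> x :: real
  assumes B: "B \<ge> 1" and \<eta>: "\<eta> > 0" "4 * \<eta> * B \<le> 1" and x: "x \<ge> 1"
    and b: "\<bar>Re b\<bar> \<le> B" and a: "\<bar>Re a - 1 - 1 / (4 * \<eta>)\<bar> \<le> B" "Re a \<ge> 1"
  shows "exp ((Re b - 1) * ln (\<eta> * x\<^sup>2)) * exp (- (\<eta> * x\<^sup>2) / 2) * norm (kint a b (of_real (\<eta> * x\<^sup>2))) \<le>
     8 * exp (1 + 3 * B + B * ln (4 * B)) * exp (B * ln x) * exp (- x)"
proof -
  define K where "K = exp ((Re b - 1) * ln (\<eta> * x\<^sup>2)) * exp (- (\<eta> * x\<^sup>2) / 2)"
  define D where "D = exp (1 + 3 * B + B * ln (4 * B)) * exp (B * ln x) * exp (- x)"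
  define c where "c = 1 / (8 * \<eta> * x)"
  have c: "c > 0" using \<eta> x by (simp add: c_def)
  have K: "K > 0" by (simp add: K_def)
  have \<zeta>: "Re (of_real (\<eta> * x\<^sup>2)) > 0" using \<eta> x by simp
  define g where "g = (\<lambda>s. D / K * (1 / (\<eta> * x)) * exp (- (c * (1 - s))))"
  define G where "G = (\<lambda>s. D / K * (1 / (\<eta> * x)) * (exp (- (c * (1 - s))) / c))"
  have hb: "has_bochner_integral lborel (\<lambda>s. indicator {0..1} s *\<^sub>R g s) (G 1 - G 0)"
  proof (rule has_bochner_integral_FTC_Icc)
    show "(G has_vector_derivative g s) (at s within {0..1})" for s
      unfolding G_def g_def has_real_derivative_iff_has_vector_derivative[symmetric]
      using c K \<eta> x by (auto intro!: derivative_eq_intros)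
    show "continuous_on {0..1} g" unfolding g_def by (intro continuous_intros)
  qed simp
  have pw: "norm (kkern a b (of_real (\<eta> * x\<^sup>2)) s) \<le> g s" if "0 < s" "s < 1" for s
  proof -
    have "K * norm (kkern a b (of_real (\<eta> * x\<^sup>2)) s) \<le> D * (1 / (\<eta> * x) * exp (- ((1 - s) / (8 * \<eta> * x))))"
      using kkern_estimate[OF B \<eta> x b a(1) that] unfolding K_def[symmetric] D_def[symmetric] .
    then have "norm (kkern a b (of_real (\<eta> * x\<^sup>2)) s) \<le> D * (1 / (\<eta> * x) * exp (- ((1 - s) / (8 * \<eta> * x)))) / K"
      using K by (simp only: pos_le_divide_eq mult.commute)
    then show ?thesis unfolding g_def c_def by (simp add: mult_ac)
  qed
  have g0: "g s \<ge> 0" for s using K \<eta> x unfolding g_def D_def by (intro mult_nonneg_nonneg) auto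
  have "norm (kint a b (of_real (\<eta> * x\<^sup>2))) \<le> (LBINT s. indicator {0..1} s *\<^sub>R g s)"
    unfolding kint_def set_lebesgue_integral_def
  proof (rule Bochner_Integration.integral_norm_bound_integral)
    show "integrable lborel (\<lambda>s. indicat_real {0<..<1} s *\<^sub>R kkern a b (of_real (\<eta> * x\<^sup>2)) s)"
      using kkern_integrable[OF a(2) \<zeta>] unfolding set_integrable_def .
    show "integrable lborel (\<lambda>s. indicat_real {0..1} s *\<^sub>R g s)" using hb by (rule integrable.intros)
    show "norm (indicat_real {0<..<1} s *\<^sub>R kkern a b (of_real (\<eta> * x\<^sup>2)) s) \<le> indicat_real {0..1} s *\<^sub>R g s" for s
      using pw[of s] g0[of s] by (auto simp: indicator_def)
  qed
  also have "\<dots> = G 1 - G 0" using hb by (rule has_bochner_integral_integral_eq)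
  also have "\<dots> \<le> G 1"
    using K \<eta> x c unfolding G_def D_def by simp
  also have "G 1 = 8 * D / K" using \<eta> x by (simp add: G_def c_def)
  finally have "K * norm (kint a b (of_real (\<eta> * x\<^sup>2))) \<le> 8 * D" using K by (simp add: field_simps)
  then show ?thesis unfolding K_def D_def by (simp add: mult.assoc)
qed

text \<open>Function and derivative are both needed as initial data for the chord. The sine is kept
  in the bound because it has to cancel the prefactor of \<open>slowF\<close> and
  \<open>slowH\<close> later.\<close>

lemma sol_real_bound:
  fixes B :: real
  assumes "B \<ge> 0"
  obtains C \<eta>0 :: real and m :: nat where "C > 0" "0 < \<eta>0" "\<eta>0 \<le> 1"
    "\<And>\<eta> b x. 0 < \<eta> \<Longrightarrow> \<eta> \<le> \<eta>0 \<Longrightarrow> norm b \<le> B \<Longrightarrow> Re b \<notin> \<int> \<Longrightarrow> x \<ge> 1 \<Longrightarrow> \<eta> * x \<le> 1 \<Longrightarrow>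
       norm (sol (rho \<eta> b) \<eta> b (of_real x)) \<le> C * norm (sin (of_real pi * b)) * x ^ m * exp (- x) \<and>
       norm (sol' (rho \<eta> b) \<eta> b (of_real x)) \<le> C * norm (sin (of_real pi * b)) * x ^ m * exp (- x)"
proof -
  \<comment> \<open>Large enough for \<open>1 + \<bar>Re (3 - b)\<bar>\<close>, the worst of the
    parameters that occur.\<close>
  define A where "A = B + 4"
  have A: "A \<ge> 1" "A \<ge> 4" using assms by (auto simp: A_def)
  define E where "E = 8 * exp (1 + 3 * A + A * ln (4 * A))"
  have E: "E > 0" by (simp add: E_def)
  obtain m :: nat where m: "A \<le> real m" using real_arch_simple by blast
  \<comment> \<open>Guarantees \<open>1 / (4 * \<eta>) \<ge> 2 * A\<close>, hence a real part of the
    first parameter that suffices both for \<open>kV_eq_kint\<close> and for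
    \<open>kint_estimate\<close>.\<close>
  define \<eta>0 where "\<eta>0 = 1 / (4 * (2 * A))"
  have \<eta>0: "0 < \<eta>0" "\<eta>0 \<le> 1" using A by (auto simp: \<eta>0_def)
  define C where "C = E + (2 * (1 + B) + 1) * E + 2 * E"
  have C: "C > 0" using E assms unfolding C_def by (intro add_nonneg_pos add_nonneg_nonneg) auto
  show ?thesis
  proof (rule that[OF C \<eta>0, of m])
    fix \<eta> :: real and b :: complex and x :: real
    assume *: "0 < \<eta>" "\<eta> \<le> \<eta>0" "norm b \<le> B" "Re b \<notin> \<int>" "x \<ge> 1" "\<eta> * x \<le> 1"
    have x: "x > 0" using * by simp
    have e8: "4 * \<eta> * (2 * A) \<le> 1" using *(2) A unfolding \<eta>0_def by (simp add: field_simps)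
    then have e4: "4 * \<eta> * A \<le> 1" using mult_nonneg_nonneg[of \<eta> A] A * by simp
    have inv: "1 / (4 * \<eta>) \<ge> 2 * A" using e8 * by (simp add: field_simps)
    have rb: "\<bar>Re b\<bar> \<le> B" using abs_Re_le_cmod[of b] * by linarith
    define S where "S = sin (of_real pi * b)"
    have S: "S \<noteq> 0"
    proof
      assume "S = 0"
      then obtain n :: int where "of_real pi * b = of_real (of_int n * pi)" unfolding S_def sin_eq_0 by auto
      then have "b = of_int n" by simp
      then show False using *(4) by simp
    qed
    define a1 where "a1 = 1 / (4 * complex_of_real \<eta>) + 1 - b / 2"
    have "Re (1 / (4 * complex_of_real \<eta>)) = 1 / (4 * \<eta>)"
      using Re_complex_of_real[of "1 / (4 * \<eta>)"] by simp
    then have ra: "Re a1 = 1 / (4 * \<eta>) + 1 - Re b / 2" by (simp add: a1_def)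
    define \<zeta> where "\<zeta> = \<eta> * x\<^sup>2"
    have \<zeta>: "\<zeta> > 0" using * x by (simp add: \<zeta>_def)
    have xm: "exp (A * ln x) \<le> x ^ m"
    proof -
      have "A * ln x \<le> real m * ln x" using m * by (intro mult_right_mono) auto
      then have "exp (A * ln x) \<le> exp (real m * ln x)" by simp
      then show ?thesis using x by (simp add: exp_of_nat_mult)
    qed
    have up: "E * exp (A * ln x) * exp (- x) \<le> E * (x ^ m * exp (- x))"
      using xm E by (simp add: mult.assoc mult_right_mono)
    have V1: "kV a1 (2 - b) (of_real \<zeta>) = kint a1 (2 - b) (of_real \<zeta>)"
    proof (rule kV_eq_kint)
      show "Re (2 - b) \<notin> \<int>" using *(4) Ints_diff[of 2 "2 - Re b"] by auto
      show "1 + \<bar>Re (2 - b)\<bar> \<le> Re a1" using inv rb A unfolding ra A_def minus_complex.simps by (simp add: abs_le_iff)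
      show "0 < Re (of_real \<zeta>)" using \<zeta> by simp
    qed
    have V2: "kV (a1 + 1) (2 - b + 1) (of_real \<zeta>) = kint (a1 + 1) (2 - b + 1) (of_real \<zeta>)"
    proof (rule kV_eq_kint)
      show "Re (2 - b + 1) \<notin> \<int>" using *(4) Ints_diff[of 3 "3 - Re b"] by auto
      show "1 + \<bar>Re (2 - b + 1)\<bar> \<le> Re (a1 + 1)" using inv rb A unfolding A_def plus_complex.simps minus_complex.simps ra by (simp add: abs_le_iff)
      show "0 < Re (of_real \<zeta>)" using \<zeta> by simp
    qed
    have K1: "exp ((1 - Re b) * ln \<zeta>) * exp (- \<zeta> / 2) * norm (kint a1 (2 - b) (of_real \<zeta>)) \<le> E * (x ^ m * exp (- x))"
    proof -
      have "\<bar>Re (2 - b)\<bar> \<le> A" "\<bar>Re a1 - 1 - 1 / (4 * \<eta>)\<bar> \<le> A" "Re a1 \<ge> 1"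
        using rb inv A unfolding ra A_def by auto
      from kint_estimate[OF A(1) *(1) e4 *(5) this]
      have "exp ((Re (2 - b) - 1) * ln \<zeta>) * exp (- \<zeta> / 2) * norm (kint a1 (2 - b) (of_real \<zeta>)) \<le> E * exp (A * ln x) * exp (- x)"
        unfolding E_def \<zeta>_def .
      moreover have "Re (2 - b) - 1 = 1 - Re b" by simp
      ultimately show ?thesis using up by simp
    qed
    \<comment> \<open>The raised parameter \<open>3 - b\<close> costs a factor
      \<open>1 / \<zeta>\<close>. It is harmless: the outer factor in \<open>sol'_real\<close> is
      \<open>2 * \<eta> * x\<close>, and \<open>2 * \<eta> * x / \<zeta> = 2 / x\<close>.\<close>
    have K2: "exp ((1 - Re b) * ln \<zeta>) * exp (- \<zeta> / 2) * norm (kint (a1 + 1) (2 - b + 1) (of_real \<zeta>)) \<le> E * (x ^ m * exp (- x)) / \<zeta>"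
    proof -
      have "\<bar>Re (2 - b + 1)\<bar> \<le> A" "\<bar>Re (a1 + 1) - 1 - 1 / (4 * \<eta>)\<bar> \<le> A" "Re (a1 + 1) \<ge> 1"
        using rb inv A unfolding plus_complex.simps ra A_def by auto
      from kint_estimate[OF A(1) *(1) e4 *(5) this]
      have "exp ((Re (2 - b + 1) - 1) * ln \<zeta>) * exp (- \<zeta> / 2) * norm (kint (a1 + 1) (2 - b + 1) (of_real \<zeta>)) \<le> E * exp (A * ln x) * exp (- x)"
        unfolding E_def \<zeta>_def .
      moreover have "Re (2 - b + 1) - 1 = (1 - Re b) + 1" by simp
      moreover have "exp (((1 - Re b) + 1) * ln \<zeta>) = \<zeta> * exp ((1 - Re b) * ln \<zeta>)"
        using \<zeta> by (subst distrib_right, subst exp_add) simp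
      ultimately have "\<zeta> * (exp ((1 - Re b) * ln \<zeta>) * exp (- \<zeta> / 2) * norm (kint (a1 + 1) (2 - b + 1) (of_real \<zeta>))) \<le> E * (x ^ m * exp (- x))"
        using up by (simp only: mult.assoc)
      then show ?thesis using \<zeta> by (simp only: pos_le_divide_eq mult.commute[of _ \<zeta>])
    qed
    have ne: "norm (exp ((1 - b) * of_real (ln \<zeta>)) * exp (- (of_real \<zeta>) / 2)) = exp ((1 - Re b) * ln \<zeta>) * exp (- \<zeta> / 2)"
      by (simp add: norm_mult norm_exp_eq_Re)
    have s1: "norm (sol (rho \<eta> b) \<eta> b (of_real x)) \<le> E * norm S * x ^ m * exp (- x)"
    proof -
      have "norm (sol (rho \<eta> b) \<eta> b (of_real x)) = norm S / pi * (exp ((1 - Re b) * ln \<zeta>) * exp (- \<zeta> / 2) * norm (kint a1 (2 - b) (of_real \<zeta>)))"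
        unfolding sol_real[OF *(1) x S[unfolded S_def]] a1_def[symmetric] \<zeta>_def[symmetric] V1 S_def[symmetric]
          norm_mult[of "S / of_real pi"] norm_mult[of "exp _ * exp _"] ne by (simp add: norm_divide)
      also have "\<dots> \<le> norm S * (E * (x ^ m * exp (- x)))"
      proof (rule mult_mono)
        show "norm S / pi \<le> norm S" using pi_ge_two by (simp add: divide_le_eq) (metis mult_left_mono norm_ge_zero mult.right_neutral one_le_numeral order.trans)
      qed (use K1 E x in auto)
      finally show ?thesis by (simp add: mult_ac)
    qed
    define T where "T = norm S * x ^ m * exp (- x)"
    have T: "T \<ge> 0" using x by (simp add: T_def)
    have s1': "norm (sol (rho \<eta> b) \<eta> b (of_real x)) \<le> E * T" using s1 by (simp add: T_def mult_ac)
    have a1r: "Re a1 \<ge> 1" using rb inv A unfolding ra A_def by auto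
    have s2: "norm (sol' (rho \<eta> b) \<eta> b (of_real x)) \<le> (2 * (1 + B) + 1) * (E * T) + 2 * E * T"
    proof -
      define W where "W = S / of_real pi * (exp ((1 - b) * of_real (ln \<zeta>)) * exp (- (of_real \<zeta>) / 2) * kint (a1 + 1) (2 - b + 1) (of_real \<zeta>))"
      have "sol' (rho \<eta> b) \<eta> b (of_real x) = of_real (2 * \<eta> * x) * (((1 - b) / of_real \<zeta> - 1 / 2) * sol (rho \<eta> b) \<eta> b (of_real x) - W)"
        unfolding sol'_real[OF *(1) x S[unfolded S_def] a1r[unfolded a1_def]] a1_def[symmetric] \<zeta>_def[symmetric] V2 S_def[symmetric] W_def ..
      also have "\<dots> = (2 * (1 - b) / of_real x - of_real (\<eta> * x)) * sol (rho \<eta> b) \<eta> b (of_real x) - of_real (2 * \<eta> * x) * W"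
      proof -
        have "of_real (2 * \<eta> * x) * ((1 - b) / of_real \<zeta> - 1 / 2) = 2 * (1 - b) / of_real x - of_real (\<eta> * x)"
          using *(1) x by (simp add: \<zeta>_def field_simps power2_eq_square)
        then show ?thesis by (simp only: right_diff_distrib mult.assoc[symmetric])
      qed
      also have "norm \<dots> \<le> norm (2 * (1 - b) / of_real x - of_real (\<eta> * x)) * norm (sol (rho \<eta> b) \<eta> b (of_real x)) + norm (of_real (2 * \<eta> * x) * W)"
        using norm_triangle_ineq4 by (metis norm_mult)
      also have "\<dots> \<le> (2 * (1 + B) + 1) * (E * T) + 2 * E * T"
      proof (rule add_mono)
        have "norm (2 * (1 - b) / of_real x) = 2 * norm (1 - b) / x" unfolding norm_divide norm_mult using x by simp
        also have "\<dots> \<le> 2 * norm (1 - b) / 1" using * by (intro divide_left_mono) auto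
        also have "\<dots> \<le> 2 * (1 + B)" using norm_triangle_ineq4[of 1 b] * by simp
        finally have "norm (2 * (1 - b) / of_real x) \<le> 2 * (1 + B)" .
        moreover have "norm (complex_of_real (\<eta> * x)) \<le> 1" using * x unfolding norm_of_real by simp
        ultimately have "norm (2 * (1 - b) / of_real x - of_real (\<eta> * x)) \<le> 2 * (1 + B) + 1"
          using norm_triangle_ineq4[of "2 * (1 - b) / of_real x" "of_real (\<eta> * x)"] by linarith
        then show "norm (2 * (1 - b) / of_real x - of_real (\<eta> * x)) * norm (sol (rho \<eta> b) \<eta> b (of_real x)) \<le> (2 * (1 + B) + 1) * (E * T)"
          using s1' assms by (intro mult_mono) auto
        have "norm W \<le> norm S * (E * (x ^ m * exp (- x)) / \<zeta>)"
        proof -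
          have "norm W = norm S / pi * (exp ((1 - Re b) * ln \<zeta>) * exp (- \<zeta> / 2) * norm (kint (a1 + 1) (2 - b + 1) (of_real \<zeta>)))"
            unfolding W_def norm_mult[of "S / of_real pi"] norm_mult[of "exp _ * exp _"] ne by (simp add: norm_divide)
          also have "\<dots> \<le> norm S * (E * (x ^ m * exp (- x)) / \<zeta>)"
          proof (rule mult_mono)
            show "norm S / pi \<le> norm S" using pi_ge_two by (simp add: divide_le_eq) (metis mult_left_mono norm_ge_zero mult.right_neutral one_le_numeral order.trans)
          qed (use K2 E x \<zeta> in auto)
          finally show ?thesis .
        qed
        then have "norm (of_real (2 * \<eta> * x) * W) \<le> 2 * \<eta> * x * (norm S * (E * (x ^ m * exp (- x)) / \<zeta>))"
        proof -
          assume a: "norm W \<le> norm S * (E * (x ^ m * exp (- x)) / \<zeta>)"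
          have "norm (of_real (2 * \<eta> * x) * W) = 2 * \<eta> * x * norm W"
            unfolding norm_mult[of "of_real _"] norm_of_real using * x by simp
          then show ?thesis using mult_left_mono[OF a, of "2 * \<eta> * x"] * x by simp
        qed
        also have "\<dots> = 2 * E * T / x"
          using *(1) x by (simp add: T_def \<zeta>_def field_simps power2_eq_square)
        also have "\<dots> \<le> 2 * E * T / 1" using * E T by (intro divide_left_mono) auto
        finally show "norm (of_real (2 * \<eta> * x) * W) \<le> 2 * E * T" by simp
      qed
      finally show ?thesis .
    qed
    have ET: "E * T \<ge> 0" using E T by simp
    have CT: "C * norm S * x ^ m * exp (- x) = E * T + (2 * (1 + B) + 1) * (E * T) + 2 * E * T"
      by (simp add: C_def T_def algebra_simps)
    have "(2 * (1 + B) + 1) * (E * T) \<ge> 0" "2 * E * T \<ge> 0" using ET assms E T by auto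
    then show "norm (sol (rho \<eta> b) \<eta> b (of_real x)) \<le> C * norm (sin (of_real pi * b)) * x ^ m * exp (- x) \<and>
       norm (sol' (rho \<eta> b) \<eta> b (of_real x)) \<le> C * norm (sin (of_real pi * b)) * x ^ m * exp (- x)"
      unfolding S_def[symmetric] CT using s1' s2 ET by linarith
  qed
qed

text \<open>For \<open>\<eta> = 1 / (4 * n)\<close> the Gamma quotient has arguments
  \<open>z1 + n + 1\<close> and \<open>z2 + n + 1\<close>, so it is a quotient of two Euler limit
  sequences for \<open>rGamma\<close>; the power of \<open>n\<close> left over is the exponential in
  \<open>rho\<close>. Only the limit along this sequence is required.\<close>

lemma rho_tendsto_1:
  assumes b: "Re b \<notin> \<int>"
  shows "(\<lambda>n. rho (1 / (4 * real n)) b) \<longlonglongrightarrow> 1"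
proof -
  define z1 z2 where "z1 = - b / 2" and "z2 = b / 2 - 1"
  have ni: "b / 2 \<notin> \<int>"
  proof
    assume "b / 2 \<in> \<int>"
    then obtain k :: int where "b / 2 = of_int k" by (auto elim: Ints_cases)
    then have "b = of_int (2 * k)" by (simp add: field_simps)
    then show False using b by simp
  qed
  have "z1 \<notin> \<int>" "z2 \<notin> \<int>"
    using ni Ints_minus[of z1] Ints_add[of z2 1] by (auto simp: z1_def z2_def)
  then have z: "z1 \<notin> \<int>\<^sub>\<le>\<^sub>0" "z2 \<notin> \<int>\<^sub>\<le>\<^sub>0" using nonpos_Ints_Int by blast+
  then have rz: "rGamma z1 \<noteq> 0" "rGamma z2 \<noteq> 0" by (simp_all add: rGamma_eq_zero_iff)
  have "(\<lambda>n. (rGamma_series z1 n / rGamma z1) / (rGamma_series z2 n / rGamma z2)) \<longlonglongrightarrow> (rGamma z1 / rGamma z1) / (rGamma z2 / rGamma z2)"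
    by (intro tendsto_divide rGamma_series_LIMSEQ tendsto_const) (use rz in auto)
  then have l: "(\<lambda>n. (rGamma_series z1 n / rGamma z1) / (rGamma_series z2 n / rGamma z2)) \<longlonglongrightarrow> 1" using rz by simp
  show ?thesis
  proof (rule Lim_transform_eventually[OF l])
    show "\<forall>\<^sub>F n in sequentially. (rGamma_series z1 n / rGamma z1) / (rGamma_series z2 n / rGamma z2) = rho (1 / (4 * real n)) b"
      using eventually_gt_at_top[of 0]
    proof eventually_elim
      case (elim n)
      define L where "L = complex_of_real (ln (real n))"
      define P1 P2 where "P1 = pochhammer z1 (n + 1)" and "P2 = pochhammer z2 (n + 1)"
      define g1 g2 where "g1 = rGamma (z1 + of_nat (n + 1))" and "g2 = rGamma (z2 + of_nat (n + 1))"
      have p: "rGamma z1 = P1 * g1" "rGamma z2 = P2 * g2"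
        unfolding P1_def P2_def g1_def g2_def by (rule pochhammer_rGamma)+
      have nz: "P1 \<noteq> 0" "g1 \<noteq> 0" "P2 \<noteq> 0" "g2 \<noteq> 0" using p rz by auto
      have n4: "1 / (4 * complex_of_real (1 / (4 * real n))) = of_nat n" by simp
      have a: "of_nat n + 1 - b / 2 = z1 + of_nat (n + 1)" "of_nat n + b / 2 = z2 + of_nat (n + 1)"
        by (simp_all add: z1_def z2_def)
      have l4: "complex_of_real (ln (4 * (1 / (4 * real n)))) = - L" using elim by (simp add: L_def ln_div)
      have "rho (1 / (4 * real n)) b = inverse g1 * g2 * exp ((1 - b) * - L)"
        unfolding rho_def n4 a l4 g1_def g2_def by (simp add: rGamma_inverse_Gamma)
      moreover have "rGamma_series z1 n = P1 / (fact n * exp (z1 * L))" "rGamma_series z2 n = P2 / (fact n * exp (z2 * L))"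
        by (simp_all add: rGamma_series_def P1_def P2_def L_def)
      moreover have "exp (z2 * L) = exp (z1 * L) * exp ((1 - b) * - L)"
        unfolding exp_add[symmetric] by (rule arg_cong[of _ _ exp]) (simp add: z1_def z2_def algebra_simps)
      moreover have "(P1 / (f * E1) / (P1 * g1)) / (P2 / (f * (E1 * E)) / (P2 * g2)) = inverse g1 * g2 * E"
        if "f \<noteq> 0" "E1 \<noteq> 0" "E \<noteq> 0" for f E1 E :: complex
        using that nz by (simp add: field_simps)
      ultimately show ?case unfolding p by simp
    qed
  qed
qed

lemma kumR_tendsto_bes:
  fixes \<eta> :: "nat \<Rightarrow> real"
  assumes "\<eta> \<longlonglongrightarrow> 0"
  shows "(\<lambda>n. kumR (\<eta> n) b x) \<longlonglongrightarrow> kumR 0 b x"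
proof -
  have e: "(\<lambda>n. complex_of_real (\<eta> n)) \<longlonglongrightarrow> of_real 0" by (intro tendsto_of_real assms)
  have "(\<lambda>n. exp (- 2 * of_real (\<eta> n) * (x\<^sup>2 / 4)) * eval_fps (hyp (1 + 2 * b * of_real (\<eta> n)) (4 * of_real (\<eta> n)) b) (x\<^sup>2 / 4))
     \<longlonglongrightarrow> exp (- 2 * of_real 0 * (x\<^sup>2 / 4)) * eval_fps (hyp (1 + 2 * b * of_real 0) (4 * of_real 0) b) (x\<^sup>2 / 4)"
    by (intro tendsto_mult tendsto_exp hyp_tendsto tendsto_add tendsto_const e sequentially_bot)
  then show ?thesis unfolding kumR_def eval_kum .
qed

lemma sol'_bes_aux:
  fixes h :: complex
  shows "h * B1 - e * ((h * c) * P0 + h * (P - c * P0)) = h * (B1 - e * P)"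
  by (simp add: algebra_simps)

text \<open>The rule for differentiating a Bessel \<open>K\<close> divided by the power of its
  order; the minus sign is hidden in the sine. It reduces the derivative to the function at
  \<open>b + 1\<close>, so no limit of derivatives has to be taken.\<close>

lemma sol'_bes:
  assumes "x > 0"
  shows "sol' 1 0 b (of_real x) = of_real x / 2 * sol 1 0 (b + 1) (of_real x)"
proof -
  define X where "X = complex_of_real x"
  have X: "X \<noteq> 0" using assms by (simp add: X_def)
  define s where "s = X\<^sup>2 / 4"
  define e where "e = exp ((2 - 2 * (b + 1)) * Ln (X / 2))"
  have k: "kumR 0 c X = eval_fps (bes c) s" "kumR' 0 c X = X / 2 * eval_fps (bes (c + 1)) s" for c
    by (simp_all add: kumR_def kumR'_def kum_0 bes_deriv s_def)
  have "exp (((2 - 2 * (b + 1)) + 2) * Ln (X / 2)) = e * exp (2 * Ln (X / 2))"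
    unfolding e_def exp_add[symmetric] by (rule arg_cong[of _ _ exp]) (simp add: algebra_simps)
  moreover have "exp (2 * Ln (X / 2)) = s" using X by (simp add: exp_double s_def power_divide)
  ultimately have e2: "exp ((2 - 2 * b) * Ln (X / 2)) = s * e" by (simp add: mult.commute)
  have "eval_fps (fps_X * bes (2 - b + 1)) s = eval_fps (bes (2 - b - 1) - fps_const (2 - b - 1) * bes (2 - b)) s"
    unfolding bes_lower ..
  then have l: "s * eval_fps (bes (2 - b + 1)) s = eval_fps (bes (2 - (b + 1))) s - (1 - b) * eval_fps (bes (2 - b)) s"
    by (simp add: eval_entire entire_hyp entire_fps_mult algebra_simps)
  have x2: "(2 - 2 * b) / X * s = X / 2 * (1 - b)" using X by (simp add: s_def power2_eq_square)
  have "sol' 1 0 b X = X / 2 * eval_fps (bes (b + 1)) s - e * (((2 - 2 * b) / X * s) * eval_fps (bes (2 - b)) s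
      + X / 2 * (s * eval_fps (bes (2 - b + 1)) s))"
    unfolding sol'_def k e2 by (simp add: algebra_simps)
  also have "\<dots> = X / 2 * (eval_fps (bes (b + 1)) s - e * eval_fps (bes (2 - (b + 1))) s)"
    unfolding l x2 by (rule sol'_bes_aux)
  also have "\<dots> = X / 2 * sol 1 0 (b + 1) X" unfolding sol_def k e_def by simp
  finally show ?thesis unfolding X_def .
qed

text \<open>The limit \<open>\<eta> = 1 / (4 * n) \<rightarrow> 0\<close> in
  \<open>sol_real_bound\<close>. For fixed \<open>x\<close> the condition
  \<open>\<eta> * x \<le> 1\<close> holds eventually, and the constants do not depend on
  \<open>\<eta>\<close>.\<close>

lemma bes_sol_bound:
  fixes B :: real
  assumes "B \<ge> 0"
  obtains C :: real and m :: nat where "C > 0"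
    "\<And>b x. norm b \<le> B \<Longrightarrow> Re b \<notin> \<int> \<Longrightarrow> x \<ge> 1 \<Longrightarrow>
       norm (sol 1 0 b (of_real x)) \<le> C * norm (sin (of_real pi * b)) * x ^ m * exp (- x)"
proof -
  obtain C \<eta>0 m where C: "C > 0" "0 < \<eta>0"
    "\<And>\<eta> b x. 0 < \<eta> \<Longrightarrow> \<eta> \<le> \<eta>0 \<Longrightarrow> norm b \<le> B \<Longrightarrow> Re b \<notin> \<int> \<Longrightarrow> x \<ge> 1 \<Longrightarrow> \<eta> * x \<le> 1 \<Longrightarrow>
       norm (sol (rho \<eta> b) \<eta> b (of_real x)) \<le> C * norm (sin (of_real pi * b)) * x ^ m * exp (- x) \<and>
       norm (sol' (rho \<eta> b) \<eta> b (of_real x)) \<le> C * norm (sin (of_real pi * b)) * x ^ m * exp (- x)"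
    using sol_real_bound[OF assms] by metis
  show ?thesis
  proof (rule that[OF C(1)])
    fix b :: complex and x :: real
    assume *: "norm b \<le> B" "Re b \<notin> \<int>" "x \<ge> 1"
    define \<eta> where "\<eta> = (\<lambda>n. 1 / (4 * real n))"
    have \<eta>: "\<eta> \<longlonglongrightarrow> 0" using lim_const_over_n[of "1/4::real"] by (simp add: \<eta>_def)
    have lim: "(\<lambda>n. sol (rho (\<eta> n) b) (\<eta> n) b (of_real x)) \<longlonglongrightarrow> sol 1 0 b (of_real x)"
      unfolding sol_def by (intro tendsto_diff tendsto_mult tendsto_const kumR_tendsto_bes \<eta>)
        (use rho_tendsto_1[OF *(2)] in \<open>simp add: \<eta>_def\<close>)
    have p: "min \<eta>0 (1 / x) > 0" using C * by simp
    have "\<forall>\<^sub>F n in sequentially. \<eta> n < min \<eta>0 (1 / x)" by (rule order_tendstoD(2)[OF \<eta> p])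
    moreover have "\<forall>\<^sub>F n in sequentially. \<eta> n > 0"
      using eventually_gt_at_top[of 0] by eventually_elim (simp add: \<eta>_def)
    ultimately have "\<forall>\<^sub>F n in sequentially. norm (sol (rho (\<eta> n) b) (\<eta> n) b (of_real x)) \<le> C * norm (sin (of_real pi * b)) * x ^ m * exp (- x)"
    proof eventually_elim
      case (elim n)
      then have "\<eta> n * x \<le> 1" using * by (simp add: field_simps)
      then show ?case using C(3)[of "\<eta> n" b x] elim * by simp
    qed
    then show "norm (sol 1 0 b (of_real x)) \<le> C * norm (sin (of_real pi * b)) * x ^ m * exp (- x)"
      by (rule tendsto_upperbound[OF tendsto_norm[OF lim]]) simp
  qed
qed

text \<open>The factor \<open>exp (- L)\<close> on the axis and the growth
  \<open>exp (L - Re x)\<close> along the chord multiply to \<open>exp (- Re x)\<close>.\<close>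

lemma recessive_bound:
  fixes B :: real
  assumes "B \<ge> 0"
  obtains C \<eta>0 :: real and m :: nat where "C > 0" "0 < \<eta>0" "\<eta>0 \<le> 1"
    "\<And>\<eta> b x. 0 < \<eta> \<Longrightarrow> \<eta> \<le> \<eta>0 \<Longrightarrow> norm b \<le> B \<Longrightarrow> Re b \<notin> \<int> \<Longrightarrow> norm x \<ge> 1 \<Longrightarrow> Re x \<ge> 0 \<Longrightarrow>
       \<eta> * norm x \<le> 1 \<Longrightarrow> \<eta>\<^sup>2 * norm x ^ 3 \<le> 1 \<Longrightarrow>
       norm (sol (rho \<eta> b) \<eta> b x) \<le> C * norm (sin (of_real pi * b)) * norm x ^ m * exp (- Re x) \<and>
       norm (sol 1 0 b x) \<le> C * norm (sin (of_real pi * b)) * norm x ^ m * exp (- Re x)"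
proof -
  obtain C \<eta>0 m where C: "C > 0" "0 < \<eta>0" "\<eta>0 \<le> 1"
    "\<And>\<eta> b x. 0 < \<eta> \<Longrightarrow> \<eta> \<le> \<eta>0 \<Longrightarrow> norm b \<le> B \<Longrightarrow> Re b \<notin> \<int> \<Longrightarrow> x \<ge> 1 \<Longrightarrow> \<eta> * x \<le> 1 \<Longrightarrow>
       norm (sol (rho \<eta> b) \<eta> b (of_real x)) \<le> C * norm (sin (of_real pi * b)) * x ^ m * exp (- x) \<and>
       norm (sol' (rho \<eta> b) \<eta> b (of_real x)) \<le> C * norm (sin (of_real pi * b)) * x ^ m * exp (- x)"
    using sol_real_bound[OF assms] by metis
  have "B + 1 \<ge> 0" using assms by simp
  then obtain C' m' where C': "C' > 0"
    "\<And>b x. norm b \<le> B + 1 \<Longrightarrow> Re b \<notin> \<int> \<Longrightarrow> x \<ge> 1 \<Longrightarrow>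
       norm (sol 1 0 b (of_real x)) \<le> C' * norm (sin (of_real pi * b)) * x ^ m' * exp (- x)"
    using bes_sol_bound[of "B + 1"] by metis
  \<comment> \<open>The extra power belongs to the factor \<open>x / 2\<close> in
    \<open>sol'_bes\<close>.\<close>
  define M where "M = max m (m' + 1)"
  define D where "D = max C C'"
  have D: "D > 0" "C \<le> D" "C' \<le> D" using C by (auto simp: D_def)
  show ?thesis
  proof (rule that[of "2 * D * exp (3 + 4 * B)" \<eta>0 M])
    show "2 * D * exp (3 + 4 * B) > 0" "0 < \<eta>0" "\<eta>0 \<le> 1" using D C by auto
    fix \<eta> :: real and b x :: complex
    assume *: "0 < \<eta>" "\<eta> \<le> \<eta>0" "norm b \<le> B" "Re b \<notin> \<int>" "norm x \<ge> 1" "Re x \<ge> 0" "\<eta> * norm x \<le> 1" "\<eta>\<^sup>2 * norm x ^ 3 \<le> 1"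
    define L where "L = norm x"
    define S where "S = norm (sin (of_real pi * b))"
    define A where "A = D * S * L ^ M * exp (- L)"
    have L: "L \<ge> 1" using * by (simp add: L_def)
    have S: "S \<ge> 0" by (simp add: S_def)
    have mono: "c * S * L ^ k * exp (- L) \<le> A" if "c \<le> D" "0 \<le> c" "k \<le> M" for c k
      unfolding A_def using that L S D by (intro mult_right_mono mult_mono power_increasing) auto
    have res: "2 * A * exp (3 + 4 * B) * exp (L - Re x) = 2 * D * exp (3 + 4 * B) * S * norm x ^ M * exp (- Re x)"
    proof -
      have "exp (- L) * exp (L - Re x) = exp (- Re x)" unfolding exp_add[symmetric] by simp
      moreover have "2 * (D * S * P * e1) * E * e2 = 2 * D * E * S * P * (e1 * e2)" for P e1 e2 E :: real by simp
      ultimately show ?thesis unfolding A_def L_def by metis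
    qed
    have 1: "norm (sol (rho \<eta> b) \<eta> b x) \<le> 2 * A * exp (3 + 4 * B) * exp (L - Re x)"
    proof (rule sol_chord)
      have "norm (sol (rho \<eta> b) \<eta> b (of_real L)) \<le> C * S * L ^ m * exp (- L)"
        "norm (sol' (rho \<eta> b) \<eta> b (of_real L)) \<le> C * S * L ^ m * exp (- L)"
        using C(4)[of \<eta> b L] * L by (auto simp: L_def S_def)
      moreover have "C * S * L ^ m * exp (- L) \<le> A" using D C by (intro mono) (auto simp: M_def)
      ultimately show "norm (sol (rho \<eta> b) \<eta> b (of_real L)) \<le> A" "norm (sol' (rho \<eta> b) \<eta> b (of_real L)) \<le> A" by linarith+
    qed (use * in \<open>auto simp: L_def\<close>)
    have b1: "norm (b + 1) \<le> B + 1" using norm_triangle_ineq[of b 1] * by simp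
    have b1': "Re (b + 1) \<notin> \<int>" using *(4) Ints_diff[of "Re b + 1" 1] by auto
    have S1: "norm (sin (of_real pi * (b + 1))) = S" unfolding sin_pi_add1 S_def by simp
    have 2: "norm (sol 1 0 b x) \<le> 2 * A * exp (3 + 4 * B) * exp (L - Re x)"
    proof (rule sol_chord)
      have "norm (sol 1 0 b (of_real L)) \<le> C' * S * L ^ m' * exp (- L)"
        using C'(2)[of b L] * L by (simp add: S_def)
      also have "\<dots> \<le> A" using D C' by (intro mono) (auto simp: M_def)
      finally show "norm (sol 1 0 b (of_real L)) \<le> A" .
      have "norm (sol' 1 0 b (of_real L)) = L / 2 * norm (sol 1 0 (b + 1) (of_real L))"
        using L by (subst sol'_bes) (auto simp: norm_mult)
      also have "\<dots> \<le> L * (C' * S * L ^ m' * exp (- L))"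
        using C'(2)[OF b1 b1' L] L unfolding S1 by (intro mult_mono) auto
      also have "\<dots> = C' * S * L ^ (m' + 1) * exp (- L)" by simp
      also have "\<dots> \<le> A" using D C' by (intro mono) (auto simp: M_def)
      finally show "norm (sol' 1 0 b (of_real L)) \<le> A" .
    qed (use * in \<open>auto simp: L_def\<close>)
    show "norm (sol (rho \<eta> b) \<eta> b x) \<le> 2 * D * exp (3 + 4 * B) * norm (sin (of_real pi * b)) * norm x ^ M * exp (- Re x) \<and>
       norm (sol 1 0 b x) \<le> 2 * D * exp (3 + 4 * B) * norm (sin (of_real pi * b)) * norm x ^ M * exp (- Re x)"
      using 1 2 unfolding res S_def[symmetric] by blast
  qed
qed

section \<open>Asymptotic expansion of the coefficient functions\<close>

text \<open>The constant 5 exceeds \<open>ln 2 + pi\<close>, the contributions of the halving and of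
  the argument to the principal logarithm.\<close>

lemma norm_exp_Ln_half_le:
  assumes "norm x \<ge> 1" "norm c \<le> real n"
  shows "norm (exp (c * Ln (x / 2))) \<le> exp (5 * real n) * norm x ^ n"
proof -
  have x0: "x / 2 \<noteq> 0" using assms by auto
  have "\<bar>Re (Ln (x / 2))\<bar> \<le> ln (norm x) + ln 2"
    using assms x0 ln_ge_zero[of "norm x"] ln_ge_zero[of "2 :: real"] by (simp add: Re_Ln norm_divide ln_div abs_le_iff)
  moreover have "\<bar>Im (Ln (x / 2))\<bar> \<le> pi"
    using mpi_less_Im_Ln[OF x0] Im_Ln_le_pi[OF x0] by linarith
  ultimately have "norm (Ln (x / 2)) \<le> ln (norm x) + 5"
    using cmod_le[of "Ln (x / 2)"] ln_2_less_1 pi_less_4 by linarith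
  then have "norm (c * Ln (x / 2)) \<le> real n * (ln (norm x) + 5)"
    unfolding norm_mult using assms ln_ge_zero[of "norm x"] by (intro mult_mono) auto
  then have "Re (c * Ln (x / 2)) \<le> 5 * real n + real n * ln (norm x)"
    using complex_Re_le_cmod[of "c * Ln (x / 2)"] by (simp add: algebra_simps)
  then have "exp (Re (c * Ln (x / 2))) \<le> exp (5 * real n) * exp (real n * ln (norm x))"
    unfolding exp_add[symmetric] by simp
  also have "exp (real n * ln (norm x)) = norm x ^ n"
    using assms by (simp add: exp_of_nat_mult) (metis exp_ln less_le_trans zero_less_one)
  finally show ?thesis by (simp add: norm_exp_eq_Re)
qed

lemma eval_slowF:
  "eval_fps (slowF \<rho> \<eta> b) s = of_real pi / sin (of_real pi * b) *
     (eval_fps (bes (1 - b)) s * eval_fps (kum \<eta> b) s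
       - \<rho> * (s * eval_fps (bes (b + 1)) s * eval_fps (kum \<eta> (2 - b)) s))"
  unfolding slowF_def
  by (simp add: eval_entire entire_hyp entire_kum entire_fps_intros)

lemma eval_slowH:
  "eval_fps (slowH \<rho> \<eta> b) s = of_real pi / sin (of_real pi * b) *
     (- (eval_fps (bes (2 - b)) s * eval_fps (kum \<eta> b) s)
       + \<rho> * (eval_fps (bes b) s * eval_fps (kum \<eta> (2 - b)) s))"
  unfolding slowH_def
  by (simp add: eval_entire entire_hyp entire_kum entire_fps_intros)

lemma entire_slow: "entire_fps (slowF \<rho> \<eta> b)" "entire_fps (slowH \<rho> \<eta> b)"
  unfolding slowF_def slowH_def
  by (simp_all add: entire_hyp entire_kum entire_fps_intros)

text \<open>The product \<open>J2 * K\<close> of two dominant factors is inserted and subtracted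
  again, which turns each summand into dominant times recessive.\<close>

lemma slow_aux:
  fixes e :: complex
  assumes "E * e = s" "E * i = 1"
  shows "J1 * K - r * (s * J2 * K2) = E * (J2 * (K - r * (e * K2)) - (J2 - i * J1) * K)"
    "e \<noteq> 0 \<Longrightarrow> - (J1 * K) + r * (J2 * K2) = inverse e * ((J2 - e * J1) * K - J2 * (K - r * (e * K2)))"
proof -
  have "E * (J2 * (K - r * (e * K2)) - (J2 - i * J1) * K) = (E * i) * J1 * K - r * ((E * e) * J2 * K2)"
    by (simp add: algebra_simps)
  then show "J1 * K - r * (s * J2 * K2) = E * (J2 * (K - r * (e * K2)) - (J2 - i * J1) * K)"
    unfolding assms by simp
  show "- (J1 * K) + r * (J2 * K2) = inverse e * ((J2 - e * J1) * K - J2 * (K - r * (e * K2)))" if "e \<noteq> 0"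
    using that by (simp add: field_simps)
qed

text \<open>
  Each term pairs a dominant with a recessive function, which cancels the exponential growth that is present
  in the separate summands of \<open>slowF\<close> and \<open>slowH\<close>.
\<close>

lemma slow_eq_sol:
  assumes "x \<noteq> 0"
  defines "L \<equiv> Ln (x / 2)"
  shows "eval_fps (slowF \<rho> (of_real \<eta>) b) (x\<^sup>2 / 4) = of_real pi / sin (of_real pi * b) *
      (exp (2 * b * L) * (kumR 0 (b + 1) x * sol \<rho> \<eta> b x - sol 1 0 (b + 1) x * kumR \<eta> b x))"
    "eval_fps (slowH \<rho> (of_real \<eta>) b) (x\<^sup>2 / 4) = of_real pi / sin (of_real pi * b) *
      (exp ((2 * b - 2) * L) * (sol 1 0 b x * kumR \<eta> b x - kumR 0 b x * sol \<rho> \<eta> b x))"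
proof -
  define s where "s = x\<^sup>2 / 4"
  define E where "E = exp (2 * b * L)"
  define e where "e = exp ((2 - 2 * b) * L)"
  have k: "kumR 0 c x = eval_fps (bes c) s" "kumR \<eta> c x = eval_fps (kum (of_real \<eta>) c) s" for c
    by (simp_all add: kumR_def kum_0 s_def)
  have "E * e = exp (2 * L)" unfolding E_def e_def exp_add[symmetric] by (simp add: algebra_simps)
  also have "\<dots> = s" using assms by (simp add: exp_double s_def L_def power_divide)
  finally have Ee: "E * e = s" .
  have Ei: "E * exp ((2 - 2 * (b + 1)) * L) = 1" unfolding E_def exp_add[symmetric] by (simp add: algebra_simps)
  have i: "exp ((2 * b - 2) * L) = inverse e" unfolding e_def exp_minus[symmetric] by (simp add: algebra_simps)
  have b2: "2 - (b + 1) = 1 - b" by simp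
  show "eval_fps (slowF \<rho> (of_real \<eta>) b) (x\<^sup>2 / 4) = of_real pi / sin (of_real pi * b) *
      (exp (2 * b * L) * (kumR 0 (b + 1) x * sol \<rho> \<eta> b x - sol 1 0 (b + 1) x * kumR \<eta> b x))"
    unfolding eval_slowF s_def[symmetric] sol_def k L_def[symmetric] E_def[symmetric] e_def[symmetric] b2
      mult_1 slow_aux(1)[OF Ee Ei] ..
  have e0: "e \<noteq> 0" by (simp add: e_def)
  show "eval_fps (slowH \<rho> (of_real \<eta>) b) (x\<^sup>2 / 4) = of_real pi / sin (of_real pi * b) *
      (exp ((2 * b - 2) * L) * (sol 1 0 b x * kumR \<eta> b x - kumR 0 b x * sol \<rho> \<eta> b x))"
    unfolding eval_slowH s_def[symmetric] sol_def k L_def[symmetric] E_def[symmetric] e_def[symmetric] i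
      mult_1 slow_aux(2)[OF Ee Ei e0] ..
qed

text \<open>\<open>A\<close> bounds the dominant and \<open>T\<close> the recessive factors. In
  \<open>A * T\<close> the exponentials have cancelled and a factor \<open>norm S\<close> is left,
  which \<open>norm S * norm p = pi\<close> removes.\<close>

lemma prod_diff_bound:
  fixes a b c d p e :: complex
  assumes "norm a \<le> A" "norm b \<le> T" "norm c \<le> T" "norm d \<le> A" "norm e \<le> E"
    "norm S * norm p = pi" "A * T = W * norm S"
  shows "norm (p * (e * (a * b - c * d))) \<le> 2 * pi * E * W" "norm (p * (e * (c * d - a * b))) \<le> 2 * pi * E * W"
proof -
  have nn: "A \<ge> 0" "T \<ge> 0" "E \<ge> 0"
    using assms(1,2,5) norm_ge_zero order_trans by blast+
  have "norm (a * b) \<le> A * T" "norm (c * d) \<le> T * A"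
    using mult_mono[OF assms(1,2)] mult_mono[OF assms(3,4)] nn by (auto simp: norm_mult)
  then have "norm (a * b - c * d) \<le> 2 * (A * T)"
    using norm_triangle_ineq4[of "a * b" "c * d"] by (simp add: mult.commute)
  then have "norm e * norm (a * b - c * d) \<le> E * (2 * (A * T))"
    using assms nn by (intro mult_mono) auto
  then have "norm p * (norm e * norm (a * b - c * d)) \<le> norm p * (E * (2 * (A * T)))"
    by (rule mult_left_mono) simp
  also have "\<dots> = 2 * (norm S * norm p) * E * W" unfolding assms(7) by simp
  finally show *: "norm (p * (e * (a * b - c * d))) \<le> 2 * pi * E * W" unfolding norm_mult assms(6) .
  have "p * (e * (c * d - a * b)) = - (p * (e * (a * b - c * d)))" by (simp add: algebra_simps)
  then show "norm (p * (e * (c * d - a * b))) \<le> 2 * pi * E * W" using * by simp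
qed

lemma sin_pi_neq_0: "Re b \<notin> \<int> \<Longrightarrow> sin (of_real pi * b) \<noteq> 0"
proof
  assume b: "Re b \<notin> \<int>" and "sin (of_real pi * b) = 0"
  then obtain n :: int where "of_real pi * b = of_real (of_int n * pi)" unfolding sin_eq_0 by auto
  then have "Re (of_real pi * b) = of_int n * pi" by simp
  then have "Re b = of_int n" by simp
  then show False using b by simp
qed

text \<open>In every product \<open>exp (Re x)\<close> meets \<open>exp (- Re x)\<close>, and the
  sine meets its reciprocal. Only powers of \<open>norm x\<close> survive, with constants that stay
  bounded as \<open>Re b\<close> approaches an integer.\<close>

lemma slow_growth:
  fixes B :: real
  assumes "B \<ge> 0"
  obtains C \<eta>0 :: real and m :: nat where "C > 0" "0 < \<eta>0" "\<eta>0 \<le> 1"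
    "\<And>\<eta> b x. 0 < \<eta> \<Longrightarrow> \<eta> \<le> \<eta>0 \<Longrightarrow> norm b \<le> B \<Longrightarrow> Re b \<notin> \<int> \<Longrightarrow> norm x \<ge> 1 \<Longrightarrow> Re x \<ge> 0 \<Longrightarrow>
       \<eta> * norm x \<le> 1 \<Longrightarrow> \<eta>\<^sup>2 * norm x ^ 3 \<le> 1 \<Longrightarrow>
       norm (eval_fps (slowF (rho \<eta> b) (of_real \<eta>) b) (x\<^sup>2 / 4)) \<le> C * norm x ^ m \<and>
       norm (eval_fps (slowH (rho \<eta> b) (of_real \<eta>) b) (x\<^sup>2 / 4)) \<le> C * norm x ^ m"
proof -
  have B1: "B + 1 \<ge> 0" using assms by simp
  obtain C1 m1 where C1: "C1 > 0"
    "\<And>\<eta> b x. 0 \<le> \<eta> \<Longrightarrow> \<eta> \<le> 1 \<Longrightarrow> norm b \<le> B + 1 \<Longrightarrow> norm x \<ge> 1 \<Longrightarrow> Re x \<ge> 0 \<Longrightarrow> \<eta>\<^sup>2 * norm x ^ 3 \<le> 1 \<Longrightarrow>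
       norm (kumR \<eta> b x) \<le> C1 * norm x ^ m1 * exp (Re x)"
    using kumR_growth[OF B1] by metis
  obtain C2 \<eta>0 m2 where C2: "C2 > 0" "0 < \<eta>0" "\<eta>0 \<le> 1"
    "\<And>\<eta> b x. 0 < \<eta> \<Longrightarrow> \<eta> \<le> \<eta>0 \<Longrightarrow> norm b \<le> B + 1 \<Longrightarrow> Re b \<notin> \<int> \<Longrightarrow> norm x \<ge> 1 \<Longrightarrow> Re x \<ge> 0 \<Longrightarrow>
       \<eta> * norm x \<le> 1 \<Longrightarrow> \<eta>\<^sup>2 * norm x ^ 3 \<le> 1 \<Longrightarrow>
       norm (sol (rho \<eta> b) \<eta> b x) \<le> C2 * norm (sin (of_real pi * b)) * norm x ^ m2 * exp (- Re x) \<and>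
       norm (sol 1 0 b x) \<le> C2 * norm (sin (of_real pi * b)) * norm x ^ m2 * exp (- Re x)"
    using recessive_bound[OF B1] by metis
  \<comment> \<open>Covers the exponents \<open>2 * b\<close> and \<open>2 * b - 2\<close> of the
    powers of \<open>x / 2\<close> in \<open>slow_eq_sol\<close>.\<close>
  define n where "n = nat \<lceil>2 * B + 2\<rceil>"
  have n: "real n \<ge> 2 * B + 2" unfolding n_def by linarith
  define C where "C = 2 * pi * exp (5 * real n) * (C1 * C2)"
  have C: "C > 0" unfolding C_def using C1 C2 by simp
  show ?thesis
  proof (rule that[OF C C2(2,3), of "n + (m1 + m2)"])
    fix \<eta> :: real and b x :: complex
    assume *: "0 < \<eta>" "\<eta> \<le> \<eta>0" "norm b \<le> B" "Re b \<notin> \<int>" "norm x \<ge> 1" "Re x \<ge> 0"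
       "\<eta> * norm x \<le> 1" "\<eta>\<^sup>2 * norm x ^ 3 \<le> 1"
    define S where "S = sin (of_real pi * b)"
    define p where "p = of_real pi / S"
    have "S \<noteq> 0" unfolding S_def by (rule sin_pi_neq_0[OF *(4)])
    then have p: "norm S * norm p = pi" by (simp add: p_def norm_divide)
    define A T where "A = C1 * norm x ^ m1 * exp (Re x)" and "T = C2 * norm S * norm x ^ m2 * exp (- Re x)"
    define W where "W = C1 * C2 * norm x ^ (m1 + m2)"
    have AT: "A * T = W * norm S"
      unfolding A_def T_def W_def power_add exp_minus by (simp add: field_simps)
    have b1: "norm b \<le> B + 1" using * by simp
    have b2: "norm (b + 1) \<le> B + 1" using *(3) norm_triangle_ineq[of b 1] by simp
    have b3: "Re (b + 1) \<notin> \<int>" using *(4) by (metis Ints_1 Ints_diff add_diff_cancel_right' one_complex.sel(1) plus_complex.sel(1))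
    have k0: "norm (kumR 0 c x) \<le> A" if "norm c \<le> B + 1" for c
      using C1(2)[of 0 c x] that * unfolding A_def by simp
    have k: "norm (kumR \<eta> b x) \<le> A"
      using C1(2)[of \<eta> b x] b1 * C2(3) unfolding A_def by simp
    have q: "norm (sol (rho \<eta> b) \<eta> b x) \<le> T" "norm (sol 1 0 b x) \<le> T"
      using C2(4)[OF *(1,2) b1 *(4-8)] unfolding T_def S_def by auto
    have "norm (sin (complex_of_real pi * (b + 1))) = norm S" unfolding sin_pi_add1 S_def by simp
    then have q1: "norm (sol 1 0 (b + 1) x) \<le> T"
      using C2(4)[OF *(1,2) b2 b3 *(5-8)] unfolding T_def by simp
    have nb: "norm (2 * b) \<le> real n" "norm (2 * b - 2) \<le> real n"
      using *(3) n norm_triangle_ineq4[of "2 * b" 2] assms by (simp_all add: norm_mult)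
    note E = norm_exp_Ln_half_le[OF *(5) nb(1)] norm_exp_Ln_half_le[OF *(5) nb(2)]
    have x0: "x \<noteq> 0" using * by auto
    have Ceq: "2 * pi * (exp (5 * real n) * norm x ^ n) * W = C * norm x ^ (n + (m1 + m2))"
      unfolding C_def W_def power_add by (simp add: algebra_simps)
    show "norm (eval_fps (slowF (rho \<eta> b) (of_real \<eta>) b) (x\<^sup>2 / 4)) \<le> C * norm x ^ (n + (m1 + m2)) \<and>
       norm (eval_fps (slowH (rho \<eta> b) (of_real \<eta>) b) (x\<^sup>2 / 4)) \<le> C * norm x ^ (n + (m1 + m2))"
      unfolding slow_eq_sol[OF x0] S_def[symmetric] p_def[symmetric]
      using prod_diff_bound(1)[OF k0[OF b2] q(1) q1 k E(1) p AT]
        prod_diff_bound(2)[OF k0[OF b1] q(1) q(2) k E(2) p AT] unfolding Ceq by simp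
  qed
qed

section \<open>From growth bounds to Taylor coefficients and the expansion\<close>

lemma fps_coeff_Cauchy:
  assumes "entire_fps f" "r > 0" "\<And>s. norm s = r \<Longrightarrow> norm (eval_fps f s) \<le> M"
  shows "norm (fps_nth f k) * r ^ k \<le> M"
proof -
  have hol: "eval_fps f holomorphic_on UNIV"
    using eval_fps_deriv_entire[OF assms(1)] by (auto simp: holomorphic_on_def field_differentiable_def)
  have "norm ((deriv ^^ k) (eval_fps f) 0) \<le> fact k * M / r ^ k"
    by (rule Cauchy_inequality) (use hol assms in \<open>auto intro: holomorphic_on_subset holomorphic_on_imp_continuous_on\<close>)
  moreover have "fps_nth f k = (deriv ^^ k) (eval_fps f) 0 / fact k"
    by (rule fps_nth_conv_deriv) (simp add: assms)
  ultimately have "norm (fps_nth f k) \<le> (fact k * M / r ^ k) / fact k"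
    by (simp only: norm_divide norm_fact) (rule divide_right_mono, simp_all)
  then have "norm (fps_nth f k) \<le> M / r ^ k" by simp
  then show ?thesis using assms(2) by (simp add: field_simps)
qed

text \<open>Taylor coefficients in \<open>z\<^sup>2\<close> instead of
  \<open>s = u\<^sup>2 * z\<^sup>2 / 4\<close>; the additional factor \<open>u\<^sup>2 / 2\<close>
  of \<open>hcoef\<close> undoes the normalization \<open>H = (2 / u\<^sup>2) G / z\<close>.\<close>

definition fcoef :: "real \<Rightarrow> complex \<Rightarrow> nat \<Rightarrow> complex" where
  "fcoef u b k = fps_nth (slowF (rho (1 / u\<^sup>2) b) (of_real (1 / u\<^sup>2)) b) k * of_real (u\<^sup>2 / 4) ^ k"

definition hcoef :: "real \<Rightarrow> complex \<Rightarrow> nat \<Rightarrow> complex" where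
  "hcoef u b k = of_real (u\<^sup>2 / 2) * fps_nth (slowH (rho (1 / u\<^sup>2) b) (of_real (1 / u\<^sup>2)) b) k * of_real (u\<^sup>2 / 4) ^ k"

lemma slow_coef_growth:
  assumes "B \<ge> 0" and D: "D = {b. norm b \<le> B \<and> Re b \<notin> \<int>}"
  obtains m where "poly_order D (int m) fcoef" "poly_order D (int m) hcoef"
proof -
  obtain C \<eta>0 m where C: "C > 0" "0 < \<eta>0" "\<eta>0 \<le> 1"
    "\<And>\<eta> b x. 0 < \<eta> \<Longrightarrow> \<eta> \<le> \<eta>0 \<Longrightarrow> norm b \<le> B \<Longrightarrow> Re b \<notin> \<int> \<Longrightarrow> norm x \<ge> 1 \<Longrightarrow> Re x \<ge> 0 \<Longrightarrow>
       \<eta> * norm x \<le> 1 \<Longrightarrow> \<eta>\<^sup>2 * norm x ^ 3 \<le> 1 \<Longrightarrow>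
       norm (eval_fps (slowF (rho \<eta> b) (of_real \<eta>) b) (x\<^sup>2 / 4)) \<le> C * norm x ^ m \<and>
       norm (eval_fps (slowH (rho \<eta> b) (of_real \<eta>) b) (x\<^sup>2 / 4)) \<le> C * norm x ^ m"
    using slow_growth[OF assms(1)] by metis
  have main: "\<exists>K u0. u0 \<ge> 1 \<and> (\<forall>u\<ge>u0. \<forall>b\<in>D. \<forall>k. norm (fcoef u b k) * R ^ k \<le> K * u powi (int (m + 2)) \<and>
       norm (hcoef u b k) * R ^ k \<le> K * u powi (int (m + 2)))" if R: "R > 0" for R
  proof -
    define q where "q = sqrt R"
    have q: "q > 0" "R = q\<^sup>2" using R by (simp_all add: q_def)
    \<comment> \<open>With \<open>norm x = u * q\<close> the summands ensure
      \<open>norm x \<ge> 1\<close>, \<open>\<eta> * norm x = q / u \<le> 1\<close>,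
      \<open>\<eta>\<^sup>2 * norm x ^ 3 = q ^ 3 / u \<le> 1\<close> and
      \<open>\<eta> \<le> \<eta>0\<close>.\<close>
    define u0 where "u0 = 1 + 1 / q + q + q ^ 3 + 1 / \<eta>0"
    have u0: "u0 \<ge> 1" "u0 \<ge> 1 / q" "u0 \<ge> q" "u0 \<ge> q ^ 3" "u0 \<ge> 1 / \<eta>0"
      using q C by (simp_all add: u0_def)
    have bound: "norm (fcoef u b k) * R ^ k \<le> C * q ^ m * u powi (int (m + 2)) \<and>
       norm (hcoef u b k) * R ^ k \<le> C * q ^ m * u powi (int (m + 2))" if "u \<ge> u0" "b \<in> D" for u b k
    proof -
      have u: "u \<ge> 1" using u0 that by linarith
      define \<eta> where "\<eta> = 1 / u\<^sup>2"
      define r where "r = u\<^sup>2 * R / 4"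
      have \<eta>: "\<eta> > 0" using u by (simp add: \<eta>_def)
      have r: "r > 0" using u R by (simp add: r_def)
      have uu: "u \<le> u\<^sup>2" using u by (simp add: self_le_power)
      have "\<eta> \<le> 1 / u" unfolding \<eta>_def using uu u by (intro divide_left_mono) auto
      also have "\<dots> \<le> \<eta>0" using le_imp_inverse_le[of "1 / \<eta>0" u] that(1) u0(5) C by (simp add: inverse_eq_divide)
      finally have \<eta>0: "\<eta> \<le> \<eta>0" .
      have M: "norm (eval_fps (slowF (rho \<eta> b) (of_real \<eta>) b) s) \<le> C * (u * q) ^ m \<and>
         norm (eval_fps (slowH (rho \<eta> b) (of_real \<eta>) b) s) \<le> C * (u * q) ^ m" if s: "norm s = r" for s
      proof -
        \<comment> \<open>The principal square root lies in the right half plane, so the half plane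
          bound covers every \<open>s\<close> on the circle.\<close>
        define x where "x = 2 * csqrt s"
        have xs: "x\<^sup>2 / 4 = s" by (simp add: x_def power_mult_distrib)
        have "norm x = 2 * sqrt r" using s by (simp add: x_def norm_mult norm_csqrt)
        also have "\<dots> = u * q" unfolding r_def q(2) using u q by (simp add: real_sqrt_divide real_sqrt_mult)
        finally have nx: "norm x = u * q" .
        have "1 / q \<le> u" "q \<le> u" "q ^ 3 \<le> u" using u0 \<open>u \<ge> u0\<close> by linarith+
        then have 1: "u * q \<ge> 1" "\<eta> * (u * q) \<le> 1" "\<eta>\<^sup>2 * (u * q) ^ 3 \<le> 1"
          using u q by (simp_all add: \<eta>_def field_simps power2_eq_square power3_eq_cube)
        have "Re x \<ge> 0" using csqrt_principal[of s] by (auto simp: x_def simp del: csqrt.sel)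
        then show ?thesis
          using C(4)[OF \<eta> \<eta>0, of b x] \<open>b \<in> D\<close> 1 unfolding xs nx D by simp
      qed
      \<comment> \<open>The prefactor \<open>u\<^sup>2 / 2\<close> of \<open>hcoef\<close> raises
        the order from \<open>m\<close> to \<open>m + 2\<close>; the bound for \<open>fcoef\<close>
        is weakened to share the exponent.\<close>
      have p: "u powi (int (m + 2)) = u ^ m * u\<^sup>2" unfolding power_int_of_nat power_add ..
      have F: "norm (fps_nth (slowF (rho \<eta> b) (of_real \<eta>) b) k) * r ^ k \<le> C * (u * q) ^ m"
        using M by (intro fps_coeff_Cauchy entire_slow r) auto
      have H: "norm (fps_nth (slowH (rho \<eta> b) (of_real \<eta>) b) k) * r ^ k \<le> C * (u * q) ^ m"
        using M by (intro fps_coeff_Cauchy entire_slow r) auto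
      have rr: "r ^ k = (u\<^sup>2 / 4) ^ k * R ^ k" unfolding r_def power_mult_distrib[symmetric] by (simp add: ac_simps)
      have nk: "norm (complex_of_real (u\<^sup>2 / 4) ^ k) = (u\<^sup>2 / 4) ^ k" unfolding norm_power norm_of_real by simp
      have "norm (fcoef u b k) * R ^ k \<le> C * (u * q) ^ m"
        unfolding fcoef_def norm_mult nk \<eta>_def[symmetric] using F unfolding rr by (simp add: mult.assoc)
      also have "\<dots> = C * q ^ m * (u ^ m * 1)" by (simp add: power_mult_distrib)
      also have "\<dots> \<le> C * q ^ m * (u ^ m * u\<^sup>2)" using C q u by (intro mult_left_mono) auto
      finally have 1: "norm (fcoef u b k) * R ^ k \<le> C * q ^ m * u powi (int (m + 2))" unfolding p .
      have n2: "norm (complex_of_real (u\<^sup>2 / 2)) = u\<^sup>2 / 2" unfolding norm_of_real by simp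
      have "norm (hcoef u b k) * R ^ k = u\<^sup>2 / 2 * (norm (fps_nth (slowH (rho \<eta> b) (of_real \<eta>) b) k) * r ^ k)"
        unfolding hcoef_def norm_mult nk n2 \<eta>_def[symmetric] rr by simp
      also have "\<dots> \<le> u\<^sup>2 / 2 * (C * (u * q) ^ m)" using H by (intro mult_left_mono) auto
      also have "\<dots> \<le> u\<^sup>2 * (C * (u * q) ^ m)" using C u q by (intro mult_right_mono) auto
      also have "\<dots> = C * q ^ m * u powi (int (m + 2))" unfolding p by (simp add: power_mult_distrib)
      finally show ?thesis using 1 by simp
    qed
    show ?thesis using bound u0(1) by blast
  qed
  show ?thesis
  proof (rule that[of "m + 2"])
    show "poly_order D (int (m + 2)) fcoef" unfolding poly_order_def
    proof (intro allI impI)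
      fix R :: real assume "R > 0"
      from main[OF this] show "\<exists>C u0. u0 \<ge> 1 \<and> (\<forall>u\<ge>u0. \<forall>b\<in>D. \<forall>k. norm (fcoef u b k) * R ^ k \<le> C * u powi (int (m + 2)))"
        by blast
    qed
    show "poly_order D (int (m + 2)) hcoef" unfolding poly_order_def
    proof (intro allI impI)
      fix R :: real assume "R > 0"
      from main[OF this] show "\<exists>C u0. u0 \<ge> 1 \<and> (\<forall>u\<ge>u0. \<forall>b\<in>D. \<forall>k. norm (hcoef u b k) * R ^ k \<le> C * u powi (int (m + 2)))"
        by blast
    qed
  qed
qed

text \<open>The reflection formula cancels the prefactor. This is the exact counterpart of
  \<open>A_0(0) = 1\<close> and \<open>A_s(0) = 0\<close>.\<close>

lemma fcoef_0: "Re b \<notin> \<int> \<Longrightarrow> fcoef u b 0 = 1"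
proof -
  assume "Re b \<notin> \<int>"
  then have S: "sin (of_real pi * b) \<noteq> 0" by (rule sin_pi_neq_0)
  have "fps_nth (slowF r \<eta> b) 0 = of_real pi / sin (of_real pi * b) * (rGamma (1 - b) * rGamma b)" for r \<eta>
    by (simp add: slowF_def kum_def hyp_nth)
  also have "rGamma (1 - b) * rGamma b = sin (of_real pi * b) / of_real pi"
    using rGamma_reflection_complex[of b] by (simp add: mult.commute)
  finally show ?thesis using S by (simp add: fcoef_def)
qed

text \<open>Rescaling from \<open>s\<close> to \<open>z\<^sup>2\<close> turns
  \<open>4 * \<eta>\<^sup>2\<close> into 1 and moves the whole dependence on \<open>u\<close> into
  the factor \<open>u\<^sup>2\<close> of the second relation, in agreement with
  \<open>bcoef_rec\<close> and \<open>acoef_rec\<close>.\<close>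

lemma slow_coef_recs:
  assumes "u > 0"
  shows "2 * (2 * of_nat k + 1) * hcoef u b k =
       (if k = 0 then 0 else fcoef u b (k - 1)) - 4 * of_nat (Suc k) * (of_nat k + b) * fcoef u b (Suc k)"
    and "4 * of_nat (Suc k) * of_real u ^ 2 * fcoef u b (Suc k) =
       (if k = 0 then 0 else hcoef u b (k - 1)) - 4 * of_nat (Suc k) * (of_nat k + 2 - b) * hcoef u b (Suc k)"
proof -
  define \<eta> where "\<eta> = complex_of_real (1 / u\<^sup>2)"
  define F where "F = fps_nth (slowF (rho (1 / u\<^sup>2) b) \<eta> b)"
  define H where "H = fps_nth (slowH (rho (1 / u\<^sup>2) b) \<eta> b)"
  define v where "v = complex_of_real u ^ 2"
  have v: "v \<noteq> 0" "\<eta> = 1 / v" "complex_of_real (u\<^sup>2 / 4) = v / 4" "complex_of_real (u\<^sup>2 / 2) = v / 2"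
    using assms by (simp_all add: v_def \<eta>_def)
  note sc = slow_system_coeffs[OF slow_system_slow[of \<eta> b "rho (1 / u\<^sup>2) b"], of k, folded F_def H_def]
  have f: "fcoef u b k = F k * (v / 4) ^ k" "hcoef u b k = v / 2 * H k * (v / 4) ^ k" for k
    unfolding fcoef_def hcoef_def F_def H_def \<eta>_def[symmetric] v(3,4) by (rule refl)+
  show "2 * (2 * of_nat k + 1) * hcoef u b k =
       (if k = 0 then 0 else fcoef u b (k - 1)) - 4 * of_nat (Suc k) * (of_nat k + b) * fcoef u b (Suc k)"
  proof (cases k)
    case 0
    then have "H 0 = - (b * F (Suc 0))" using sc(1) by (simp add: add_eq_0_iff2)
    then show ?thesis unfolding f using 0 by simp
  next
    case (Suc j)
    have "2 * (2 * of_nat k + 1) * (v / 2 * H k * (v / 4) ^ k) = v * (v / 4) ^ k * ((2 * of_nat k + 1) * H k)"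
      by simp
    also have "(2 * of_nat k + 1) * H k = 4 * \<eta>\<^sup>2 * F j - of_nat (Suc k) * (of_nat k + b) * F (Suc k)"
      using sc(1) Suc by (simp add: algebra_simps)
    also have "v * (v / 4) ^ k * (4 * \<eta>\<^sup>2 * F j - of_nat (Suc k) * (of_nat k + b) * F (Suc k))
       = F j * (v / 4) ^ j - 4 * of_nat (Suc k) * (of_nat k + b) * (F (Suc k) * (v / 4) ^ Suc k)"
      using v(1) unfolding Suc v(2) by (simp add: field_simps power2_eq_square)
    finally show ?thesis unfolding f using Suc by simp
  qed
  show "4 * of_nat (Suc k) * of_real u ^ 2 * fcoef u b (Suc k) =
       (if k = 0 then 0 else hcoef u b (k - 1)) - 4 * of_nat (Suc k) * (of_nat k + 2 - b) * hcoef u b (Suc k)"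
  proof (cases k)
    case 0
    then have "2 * F (Suc 0) = - ((2 - b) * H (Suc 0))" using sc(2) by (simp add: add_eq_0_iff2)
    then have e: "F (Suc 0) = - ((2 - b) * H (Suc 0)) / 2" by (metis nonzero_mult_div_cancel_left zero_neq_numeral)
    have "4 * v * (F (Suc 0) * (v / 4)) = - (4 * (2 - b) * (v / 2 * H (Suc 0) * (v / 4)))"
      unfolding e by (simp add: field_simps)
    then show ?thesis unfolding f v_def[symmetric] 0 by simp
  next
    case (Suc j)
    have "4 * of_nat (Suc k) * v * (F (Suc k) * (v / 4) ^ Suc k) = v\<^sup>2 / 2 * (v / 4) ^ k * (2 * of_nat (Suc k) * F (Suc k))"
      by (simp add: power2_eq_square)
    also have "2 * of_nat (Suc k) * F (Suc k) = 4 * \<eta>\<^sup>2 * H j - of_nat (Suc k) * (of_nat k + 2 - b) * H (Suc k)"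
      using sc(2) Suc by (simp add: algebra_simps)
    also have "v\<^sup>2 / 2 * (v / 4) ^ k * (4 * \<eta>\<^sup>2 * H j - of_nat (Suc k) * (of_nat k + 2 - b) * H (Suc k))
       = v / 2 * H j * (v / 4) ^ j - 4 * of_nat (Suc k) * (of_nat k + 2 - b) * (v / 2 * H (Suc k) * (v / 4) ^ Suc k)"
      using v(1) unfolding Suc v(2) by (simp add: field_simps power2_eq_square)
    finally show ?thesis unfolding f v_def[symmetric] using Suc by simp
  qed
qed

lemma slow_coef_expansion:
  assumes "B \<ge> 0" and D: "D = {b. norm b \<le> B \<and> Re b \<notin> \<int>}"
  shows "poly_order D (- 2 * int N) (\<lambda>u b k. fcoef u b k - (\<Sum>s<N. acoef s b k / of_real u ^ (2 * s)))"
    "poly_order D (- 2 * int N) (\<lambda>u b k. hcoef u b k - (\<Sum>s<N. bcoef s b k / of_real u ^ (2 * s)))"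
proof -
  obtain m where m: "poly_order D (int m) fcoef" "poly_order D (int m) hcoef"
    using slow_coef_growth[OF assms] .
  have DB: "D \<subseteq> cball 0 B" by (auto simp: D)
  show "poly_order D (- 2 * int N) (\<lambda>u b k. fcoef u b k - (\<Sum>s<N. acoef s b k / of_real u ^ (2 * s)))"
    "poly_order D (- 2 * int N) (\<lambda>u b k. hcoef u b k - (\<Sum>s<N. bcoef s b k / of_real u ^ (2 * s)))"
    using slow_expansion[OF DB m fcoef_0 slow_coef_recs] D by auto
qed

section \<open>From Taylor coefficients back to functions of z\<close>

lemma poly_even_sums:
  fixes p :: "complex poly"
  assumes "\<And>n. odd n \<Longrightarrow> coeff p n = 0"
  shows "(\<lambda>k. coeff p (2 * k) * (z\<^sup>2) ^ k) sums poly p z"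
proof -
  define d where "d = degree p"
  have "poly p z = (\<Sum>i<2 * Suc d. coeff p i * z ^ i)"
    unfolding poly_altdef d_def by (rule sum.mono_neutral_left) (auto simp: coeff_eq_0)
  also have "\<dots> = (\<Sum>i\<in>{0..<2 * Suc d}. coeff p i * z ^ i)" by (simp add: lessThan_atLeast0)
  also have "\<dots> = (\<Sum>k<Suc d. coeff p (2 * k) * z ^ (2 * k) + coeff p (2 * k + 1) * z ^ (2 * k + 1))"
  proof -
    have "(\<Sum>i\<in>{0..<2 * n}. g i) = (\<Sum>k<n. g (2 * k) + g (2 * k + 1))" for n and g :: "nat \<Rightarrow> complex"
      by (induction n) (simp_all add: add.assoc)
    then show ?thesis .
  qed
  also have "\<dots> = (\<Sum>k<Suc d. coeff p (2 * k) * (z\<^sup>2) ^ k)"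
    by (intro sum.cong) (auto simp: assms power_mult)
  finally have "poly p z = (\<Sum>k<Suc d. coeff p (2 * k) * (z\<^sup>2) ^ k)" .
  moreover have "(\<lambda>k. coeff p (2 * k) * (z\<^sup>2) ^ k) sums (\<Sum>k<Suc d. coeff p (2 * k) * (z\<^sup>2) ^ k)"
    by (rule sums_finite) (auto simp: d_def coeff_eq_0)
  ultimately show ?thesis by simp
qed

lemma A_poly_sums: "(\<lambda>k. acoef s b k * (z\<^sup>2) ^ k) sums poly (A_poly (b - 1) s) z"
  unfolding acoef_def by (rule poly_even_sums) (rule A_poly_even)

lemma B_poly_eq: "B_poly \<mu> s = pCons 0 (div_z (B_poly \<mu> s))"
  by (rule poly_eqI) (auto simp: coeff_pCons coeff_div_z B_poly_odd split: nat.split)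

lemma B_poly_sums: "(\<lambda>k. bcoef s b k * (z\<^sup>2) ^ k) sums poly (div_z (B_poly (b - 1) s)) z"
proof -
  have "(\<lambda>k. coeff (div_z (B_poly (b - 1) s)) (2 * k) * (z\<^sup>2) ^ k) sums poly (div_z (B_poly (b - 1) s)) z"
    by (rule poly_even_sums) (simp add: coeff_div_z B_poly_odd)
  then show ?thesis by (simp add: bcoef_def coeff_div_z)
qed

lemma poly_B_poly: "poly (B_poly \<mu> s) z = z * poly (div_z (B_poly \<mu> s)) z"
  by (subst B_poly_eq) simp

lemma poly_order_eval:
  fixes f :: "real \<Rightarrow> complex \<Rightarrow> nat \<Rightarrow> complex"
  assumes g: "poly_order D (- 2 * int N) (\<lambda>u b k. f u b k - (\<Sum>s<N. c s b k / of_real u ^ (2 * s)))"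
    and f: "\<And>u b z. u > 0 \<Longrightarrow> (\<lambda>k. f u b k * (z\<^sup>2) ^ k) sums F u b z"
    and c: "\<And>s b z. (\<lambda>k. c s b k * (z\<^sup>2) ^ k) sums P s b z"
  obtains K u0 :: real where "u0 \<ge> 1" "K \<ge> 0" "\<And>u b z. u \<ge> u0 \<Longrightarrow> b \<in> D \<Longrightarrow> norm z \<le> R \<Longrightarrow>
     norm (F u b z - (\<Sum>s<N. P s b z / of_real u ^ (2 * s))) \<le> K / u ^ (2 * N)"
proof -
  \<comment> \<open>At least twice \<open>norm (z\<^sup>2)\<close>, so that the coefficient bounds
    sum up as a geometric series with ratio 1/2.\<close>
  define R' where "R' = 2 * (R\<^sup>2 + 1)"
  have R': "R' > 0" by (simp add: R'_def add_pos_nonneg add_nonneg_pos)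
  define d where "d = (\<lambda>u b k. f u b k - (\<Sum>s<N. c s b k / of_real u ^ (2 * s)))"
  have g': "poly_order D (- 2 * int N) d" unfolding d_def by (rule g)
  obtain C u0 where C: "u0 \<ge> 1" "C \<ge> 0" "\<forall>u b k. u \<ge> u0 \<longrightarrow> b \<in> D \<longrightarrow> norm (d u b k) * R' ^ k \<le> C * u powi (- 2 * int N)"
    by (rule poly_orderE[OF g' R'])
  show ?thesis
  proof (rule that[of u0 "2 * C"])
    fix u :: real and b z :: complex assume *: "u \<ge> u0" "b \<in> D" "norm z \<le> R"
    have u: "u > 0" using * C by linarith
    define M where "M = C / u ^ (2 * N)"
    have up: "u powi (- 2 * int N) = 1 / u ^ (2 * N)"
      using power_int_minus[of u "int (2 * N)"] unfolding power_int_of_nat by (simp add: divide_inverse)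
    have "(\<lambda>k. f u b k * (z\<^sup>2) ^ k - (\<Sum>s<N. c s b k * (z\<^sup>2) ^ k / of_real u ^ (2 * s))) sums
        (F u b z - (\<Sum>s<N. P s b z / of_real u ^ (2 * s)))"
      by (intro sums_diff f sums_sum sums_divide c u)
    moreover have "f u b k * (z\<^sup>2) ^ k - (\<Sum>s<N. c s b k * (z\<^sup>2) ^ k / of_real u ^ (2 * s)) = d u b k * (z\<^sup>2) ^ k" for k
      unfolding d_def by (simp add: left_diff_distrib sum_distrib_right)
    ultimately have s: "(\<lambda>k. d u b k * (z\<^sup>2) ^ k) sums (F u b z - (\<Sum>s<N. P s b z / of_real u ^ (2 * s)))"
      by simp
    have bd: "norm (d u b k * (z\<^sup>2) ^ k) \<le> M * (1/2) ^ k" for k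
    proof -
      have "norm z ^ 2 \<le> R\<^sup>2" using * by (intro power_mono) auto
      then have "norm (z\<^sup>2) \<le> R' / 2" unfolding norm_power R'_def by simp
      then have "norm ((z\<^sup>2) ^ k) \<le> (R' / 2) ^ k" unfolding norm_power[of _ k] by (intro power_mono) auto
      then have "norm (d u b k * (z\<^sup>2) ^ k) \<le> norm (d u b k) * (R' / 2) ^ k"
        unfolding norm_mult by (intro mult_left_mono) auto
      also have "\<dots> = norm (d u b k) * R' ^ k * (1/2) ^ k" by (simp add: power_divide)
      also have "\<dots> \<le> M * (1/2) ^ k"
        using C(3)[rule_format, OF *(1,2), of k] unfolding up M_def by (intro mult_right_mono) auto
      finally show ?thesis .
    qed
    have g: "(\<lambda>k. M * (1/2) ^ k) sums (M * 2)"
      using sums_mult[OF geometric_sums[of "1/2 :: real"], of M] by simp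
    have "norm (\<Sum>k. d u b k * (z\<^sup>2) ^ k) \<le> (\<Sum>k. M * (1/2) ^ k)"
      by (rule norm_suminf_le) (use bd g in \<open>auto intro: sums_summable\<close>)
    then show "norm (F u b z - (\<Sum>s<N. P s b z / of_real u ^ (2 * s))) \<le> 2 * C / u ^ (2 * N)"
      using sums_unique[OF s] sums_unique[OF g] by (simp add: M_def mult.commute)
  qed (use C in auto)
qed

definition bigF :: "real \<Rightarrow> complex \<Rightarrow> complex \<Rightarrow> complex" where
  "bigF u b z = eval_fps (slowF (rho (1 / u\<^sup>2) b) (of_real (1 / u\<^sup>2)) b) (of_real (u\<^sup>2) * z\<^sup>2 / 4)"

definition bigH :: "real \<Rightarrow> complex \<Rightarrow> complex \<Rightarrow> complex" where
  "bigH u b z = of_real (u\<^sup>2) / 2 * eval_fps (slowH (rho (1 / u\<^sup>2) b) (of_real (1 / u\<^sup>2)) b) (of_real (u\<^sup>2) * z\<^sup>2 / 4)"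

lemma entire_sums: "entire_fps f \<Longrightarrow> (\<lambda>k. fps_nth f k * s ^ k) sums eval_fps f s"
  by (rule sums_eval_fps) simp

lemma bigF_sums: "(\<lambda>k. fcoef u b k * (z\<^sup>2) ^ k) sums bigF u b z"
proof -
  have "fcoef u b k * (z\<^sup>2) ^ k = fps_nth (slowF (rho (1 / u\<^sup>2) b) (of_real (1 / u\<^sup>2)) b) k * (of_real (u\<^sup>2) * z\<^sup>2 / 4) ^ k" for k
    unfolding fcoef_def mult.assoc power_mult_distrib[symmetric] by (simp add: ac_simps)
  then show ?thesis unfolding bigF_def using entire_sums[OF entire_slow(1)] by simp
qed

lemma bigH_sums: "(\<lambda>k. hcoef u b k * (z\<^sup>2) ^ k) sums bigH u b z"
proof -
  have "hcoef u b k * (z\<^sup>2) ^ k = of_real (u\<^sup>2) / 2 * (fps_nth (slowH (rho (1 / u\<^sup>2) b) (of_real (1 / u\<^sup>2)) b) k * (of_real (u\<^sup>2) * z\<^sup>2 / 4) ^ k)" for k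
    unfolding hcoef_def mult.assoc power_mult_distrib[symmetric] by (simp add: ac_simps)
  then show ?thesis unfolding bigH_def by (simp only: sums_mult[OF entire_sums[OF entire_slow(2)]])
qed

lemma slow_asymptotics:
  fixes B R :: real
  assumes "B \<ge> 0"
  obtains K u0 :: real where "u0 \<ge> 1" "K \<ge> 0"
    "\<And>u b z. u \<ge> u0 \<Longrightarrow> norm b \<le> B \<Longrightarrow> Re b \<notin> \<int> \<Longrightarrow> norm z \<le> R \<Longrightarrow>
       norm (bigF u b z - (\<Sum>s<N. poly (A_poly (b - 1) s) z / of_real u ^ (2 * s))) \<le> K / u ^ (2 * N) \<and>
       norm (bigH u b z - (\<Sum>s<N. poly (div_z (B_poly (b - 1) s)) z / of_real u ^ (2 * s))) \<le> K / u ^ (2 * N)"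
proof -
  define D where "D = {b. norm b \<le> B \<and> Re b \<notin> \<int>}"
  note e = slow_coef_expansion[OF assms D_def, of N]
  obtain K1 u1 where 1: "u1 \<ge> 1" "K1 \<ge> 0" "\<And>u b z. u \<ge> u1 \<Longrightarrow> b \<in> D \<Longrightarrow> norm z \<le> R \<Longrightarrow>
     norm (bigF u b z - (\<Sum>s<N. poly (A_poly (b - 1) s) z / of_real u ^ (2 * s))) \<le> K1 / u ^ (2 * N)"
    by (rule poly_order_eval[OF e(1) bigF_sums A_poly_sums, where R=R]) blast
  obtain K2 u2 where 2: "u2 \<ge> 1" "K2 \<ge> 0" "\<And>u b z. u \<ge> u2 \<Longrightarrow> b \<in> D \<Longrightarrow> norm z \<le> R \<Longrightarrow>
     norm (bigH u b z - (\<Sum>s<N. poly (div_z (B_poly (b - 1) s)) z / of_real u ^ (2 * s))) \<le> K2 / u ^ (2 * N)"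
    by (rule poly_order_eval[OF e(2) bigH_sums B_poly_sums, where R=R]) blast
  show ?thesis
  proof (rule that[of "max u1 u2" "max K1 K2"])
    fix u :: real and b z :: complex assume *: "u \<ge> max u1 u2" "norm b \<le> B" "Re b \<notin> \<int>" "norm z \<le> R"
    have u: "u > 0" using * 1 by linarith
    have "K1 / u ^ (2 * N) \<le> max K1 K2 / u ^ (2 * N)" "K2 / u ^ (2 * N) \<le> max K1 K2 / u ^ (2 * N)"
      using u by (auto intro!: divide_right_mono)
    then show "norm (bigF u b z - (\<Sum>s<N. poly (A_poly (b - 1) s) z / of_real u ^ (2 * s))) \<le> max K1 K2 / u ^ (2 * N) \<and>
       norm (bigH u b z - (\<Sum>s<N. poly (div_z (B_poly (b - 1) s)) z / of_real u ^ (2 * s))) \<le> max K1 K2 / u ^ (2 * N)"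
      using 1(3)[of u b z] 2(3)[of u b z] * by (force simp: D_def)
  qed (use 1 2 in auto)
qed

section \<open>The exact representation for nonintegral \<open>Re b\<close>\<close>

lemma besselI_eq: "besselI \<nu> w = exp (\<nu> * (w - of_real (ln 2))) * eval_fps (bes (\<nu> + 1)) ((exp w / 2)\<^sup>2)"
  unfolding besselI_def eval_fps_def hyp_nth by (simp add: power_mult add_ac)

lemma kummerM_reg_eq: "kummerM_reg a b z = kM a b z"
  unfolding kummerM_reg_def eval_fps_def hyp_nth pochhammer_prod by (simp add: atLeast0LessThan)

lemma not_Ints_Re: "Re b \<notin> \<int> \<Longrightarrow> b \<notin> \<int>"
  by (auto elim!: Ints_cases)

lemma Re_shift_not_Ints:
  assumes "Re b \<notin> \<int>"
  shows "Re (b - 1) \<notin> \<int>" "Re (1 - b) \<notin> \<int>" "Re (2 - b) \<notin> \<int>"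
proof -
  have "Re b \<in> \<int>" if "Re b - 1 \<in> \<int>" using Ints_add[OF that Ints_1] by simp
  then show "Re (b - 1) \<notin> \<int>" using assms by auto
  have "Re b \<in> \<int>" if "1 - Re b \<in> \<int>" using Ints_diff[OF Ints_1 that] by simp
  then show "Re (1 - b) \<notin> \<int>" using assms by auto
  have "Re b \<in> \<int>" if "2 - Re b \<in> \<int>" using Ints_diff[OF Ints_numeral[of "num.Bit0 num.One"] that] by simp
  then show "Re (2 - b) \<notin> \<int>" using assms by auto
qed

lemma sin_pi_diff1: "sin (of_real pi * (b - 1)) = - sin (of_real pi * b :: complex)"
  using sin_pi_add1[of "b - 1"] by simp

text \<open>All multivaluedness on the Riemann surface sits in \<open>P w\<close>, the power
  \<open>b - 1\<close> of half the argument; the series depend on the square of half the argument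
  only.\<close>

lemma besselK_nonint:
  assumes "Re b \<notin> \<int>"
  defines "P \<equiv> \<lambda>w. exp ((b - 1) * (w - of_real (ln 2)))" and "y \<equiv> \<lambda>w. exp w / 2"
    and "c \<equiv> of_real pi / 2 / sin (of_real pi * b)"
  shows "besselK (b - 1) w = c * (P w * eval_fps (bes b) ((y w)\<^sup>2) - inverse (P w) * eval_fps (bes (2 - b)) ((y w)\<^sup>2))"
    "besselK b w = c * (inverse (P w) * inverse (y w) * eval_fps (bes (1 - b)) ((y w)\<^sup>2)
        - P w * y w * eval_fps (bes (b + 1)) ((y w)\<^sup>2))"
proof -
  have l2: "exp (complex_of_real (ln 2)) = 2" unfolding exp_of_real by simp
  have y: "y w = exp (w - of_real (ln 2))" by (simp add: y_def exp_diff l2)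
  have i: "exp (- (b - 1) * (w - of_real (ln 2))) = inverse (P w)"
    unfolding P_def exp_minus[symmetric] by (rule arg_cong[of _ _ exp]) (simp add: algebra_simps)
  have e1: "exp (b * (w - of_real (ln 2))) = P w * y w"
    unfolding P_def y exp_add[symmetric] by (simp add: algebra_simps)
  have e2: "exp (- b * (w - of_real (ln 2))) = inverse (P w) * inverse (y w)"
    unfolding P_def y exp_minus[symmetric] exp_add[symmetric] by (simp add: algebra_simps)
  have K_sign: "x * (A - B) / - S = x / S * (B - A)" for x A B S :: complex
    by (cases "S = 0") (simp_all add: field_simps)
  have Py: "exp ((b - 1) * (w - of_real (ln 2))) = P w" "exp w / 2 = y w" by (simp_all add: P_def y_def)
  have a: "- (b - 1) + 1 = 2 - b" "b - 1 + 1 = b" "- b + 1 = 1 - b" by simp_all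
  have "besselK (b - 1) w = besselK_quot w (b - 1)"
    using not_Ints_Re[OF Re_shift_not_Ints(1)[OF assms(1)]] by (simp add: besselK_def)
  also have "\<dots> = c * (P w * eval_fps (bes b) ((y w)\<^sup>2) - inverse (P w) * eval_fps (bes (2 - b)) ((y w)\<^sup>2))"
    unfolding besselK_quot_def besselI_eq sin_pi_diff1 i a Py
    unfolding c_def by (rule K_sign)
  finally show "besselK (b - 1) w = c * (P w * eval_fps (bes b) ((y w)\<^sup>2) - inverse (P w) * eval_fps (bes (2 - b)) ((y w)\<^sup>2))" .
  have "besselK b w = besselK_quot w b"
    using not_Ints_Re[OF assms(1)] by (simp add: besselK_def)
  also have "\<dots> = c * (inverse (P w) * inverse (y w) * eval_fps (bes (1 - b)) ((y w)\<^sup>2)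
        - P w * y w * eval_fps (bes (b + 1)) ((y w)\<^sup>2))"
    unfolding besselK_quot_def besselI_eq e1 e2 a Py by (simp add: c_def)
  finally show "besselK b w = c * (inverse (P w) * inverse (y w) * eval_fps (bes (1 - b)) ((y w)\<^sup>2)
        - P w * y w * eval_fps (bes (b + 1)) ((y w)\<^sup>2))" .
qed

lemma besselK_recurrence_aux:
  fixes y :: complex
  assumes "y \<noteq> 0"
  shows "c / y * (Q * (A - (1 - b) * J2) - P * (y\<^sup>2 * J1 + (b - 1) * J0))
    = c * (Q * inverse y * A - P * y * J1) - 2 * (b - 1) / (2 * y) * (c * (P * J0 - Q * J2))"
  using assms by (simp add: field_simps power2_eq_square)

lemma besselK_recurrence_nonint:
  assumes "Re b \<notin> \<int>"
  shows "besselK (1 - b) w = besselK (b - 1) w"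
    "besselK (2 - b) w = besselK b w - 2 * (b - 1) / exp w * besselK (b - 1) w"
proof -
  define P y where "P = exp ((b - 1) * (w - of_real (ln 2)))" and "y = exp w / 2"
  define c where "c = of_real pi / 2 / sin (of_real pi * b)"
  define J where "J = (\<lambda>b. eval_fps (bes b) (y\<^sup>2))"
  have J: "eval_fps (bes b) (y\<^sup>2) = J b" for b by (simp add: J_def)
  note k = besselK_nonint[OF assms(1), of w, folded c_def P_def y_def, unfolded J]
  note k' = besselK_nonint[OF Re_shift_not_Ints(3)[OF assms(1)], of w, folded y_def, unfolded J]
  have p: "2 - b - 1 = 1 - b" "2 - (2 - b) = b" "1 - (2 - b) = b - 1" "2 - b + 1 = 3 - b" by simp_all
  have P': "exp ((1 - b) * (w - of_real (ln 2))) = inverse P"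
    unfolding P_def exp_minus[symmetric] by (simp add: algebra_simps)
  have c': "of_real pi / 2 / sin (of_real pi * (2 - b)) = - c"
    unfolding sin_pi_2_minus c_def by simp
  show "besselK (1 - b) w = besselK (b - 1) w"
    using k'(1) unfolding p P' c' k by (simp add: algebra_simps)
  have J1: "y\<^sup>2 * J (b + 1) = J (b - 1) - (b - 1) * J b" for b
    using arg_cong[OF bes_lower[of b], of "\<lambda>f. eval_fps f (y\<^sup>2)"]
    unfolding J_def by (simp add: eval_entire entire_hyp entire_fps_mult)
  have y: "y \<noteq> 0" "exp w = 2 * y" by (simp_all add: y_def)
  have P: "P \<noteq> 0" by (simp add: P_def)
  have 3: "y\<^sup>2 * J (3 - b) = J (1 - b) - (1 - b) * J (2 - b)" using J1[of "2 - b"] by (simp add: p)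
  have "besselK (2 - b) w = c / y * (inverse P * (y\<^sup>2 * J (3 - b)) - P * J (b - 1))"
    unfolding k'(2)[unfolded p P' c'] using y(1) P by (simp add: field_simps power2_eq_square)
  also have "\<dots> = c / y * (inverse P * (J (1 - b) - (1 - b) * J (2 - b)) - P * (y\<^sup>2 * J (b + 1) + (b - 1) * J b))"
    unfolding 3 J1 by simp
  also have "\<dots> = besselK b w - 2 * (b - 1) / exp w * besselK (b - 1) w"
    unfolding k y(2) by (rule besselK_recurrence_aux[OF y(1)])
  finally show "besselK (2 - b) w = besselK b w - 2 * (b - 1) / exp w * besselK (b - 1) w" .
qed

lemma of_real_powr_exp: "u > 0 \<Longrightarrow> complex_of_real u powr c = exp (c * of_real (ln u))"
  by (simp add: powr_def Ln_of_real)

definition scaledU1 :: "complex \<Rightarrow> real \<Rightarrow> complex \<Rightarrow> complex" where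
  "scaledU1 b u w = Gamma (1 + of_real (u\<^sup>2) / 4 - b / 2) * 2 powr (- b) * of_real u powr (b - 1)
     * exp (- (exp w)\<^sup>2 / 2) * exp (b * w) * kummerU (of_real (u\<^sup>2) / 4 + b / 2) b (2 * w)"

definition scaledU2 :: "complex \<Rightarrow> real \<Rightarrow> complex \<Rightarrow> complex" where
  "scaledU2 b u w = Gamma (of_real (u\<^sup>2) / 4 + b / 2) * 2 powr (b - 2) * of_real u powr (1 - b)
     * exp (- (exp w)\<^sup>2 / 2) * exp (b * w) * kummerU (of_real (u\<^sup>2) / 4 + b / 2) b (2 * w)"

text \<open>Kummer's transformation at the point \<open>z\<^sup>2\<close>, whose logarithm is
  \<open>2 * w\<close>: reflecting \<open>b\<close> to \<open>2 - b\<close> exchanges the two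
  series, and the sign of the sine compensates.\<close>

lemma kummerU_reflect:
  assumes "Re b \<notin> \<int>"
  shows "exp (b * w) * kummerU a b (2 * w) = exp ((2 - b) * w) * kummerU (a - b + 1) (2 - b) (2 * w)"
proof -
  define M1 M2 where "M1 = rGamma (a - b + 1) * kummerM_reg a b (exp (2 * w))"
    and "M2 = rGamma a * kummerM_reg (a - b + 1) (2 - b) (exp (2 * w))"
  define p where "p = of_real pi / sin (of_real pi * b)"
  have i: "b \<notin> \<int>" "2 - b \<notin> \<int>" using assms Re_shift_not_Ints(3)[OF assms] by (simp_all add: not_Ints_Re)
  have s: "of_real pi / sin (of_real pi * (2 - b)) = - p" unfolding sin_pi_2_minus p_def by simp
  have a: "a - b + 1 - (2 - b) + 1 = a" "2 - (2 - b) = b" by simp_all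
  have U1: "kummerU a b (2 * w) = p * (M1 - exp ((1 - b) * (2 * w)) * M2)"
    unfolding kummerU_def kummerU_quot_def p_def M1_def M2_def using i(1) by (simp add: mult.assoc)
  have U2: "kummerU (a - b + 1) (2 - b) (2 * w) = - p * (M2 - exp ((1 - (2 - b)) * (2 * w)) * M1)"
    unfolding kummerU_def kummerU_quot_def s a M1_def M2_def using i(2) by (simp add: mult.assoc)
  have e: "exp (b * w) * exp ((1 - b) * (2 * w)) = exp ((2 - b) * w)"
    "exp ((2 - b) * w) * exp ((1 - (2 - b)) * (2 * w)) = exp (b * w)"
    unfolding exp_add[symmetric] by (simp_all add: algebra_simps)
  have "exp (b * w) * kummerU a b (2 * w) = p * (exp (b * w) * M1 - (exp (b * w) * exp ((1 - b) * (2 * w))) * M2)"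
    unfolding U1 by (simp add: algebra_simps)
  also have "\<dots> = p * ((exp ((2 - b) * w) * exp ((1 - (2 - b)) * (2 * w))) * M1 - exp ((2 - b) * w) * M2)"
    unfolding e ..
  also have "\<dots> = exp ((2 - b) * w) * kummerU (a - b + 1) (2 - b) (2 * w)"
    unfolding U2 by (simp only: algebra_simps) simp
  finally show ?thesis .
qed

text \<open>For \<open>a = u\<^sup>2 / 4 + b / 2\<close> the reflected parameter
  \<open>a - b + 1\<close> is \<open>u\<^sup>2 / 4 + (2 - b) / 2\<close>, so the family is mapped to
  itself; the Gamma factor and the powers of 2 and \<open>u\<close> match as well.\<close>

lemma scaledU2_eq_scaledU1:
  assumes "Re b \<notin> \<int>"
  shows "scaledU2 b u w = scaledU1 (2 - b) u w"
proof -
  have "of_real (u\<^sup>2) / 4 + b / 2 - b + 1 = of_real (u\<^sup>2) / 4 + (2 - b) / 2" by (simp add: field_simps)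
  note r = kummerU_reflect[OF assms, of w "of_real (u\<^sup>2) / 4 + b / 2", unfolded this]
  have g: "1 + of_real (u\<^sup>2) / 4 - (2 - b) / 2 = of_real (u\<^sup>2) / 4 + b / 2" "- (2 - b) = b - 2" "2 - b - 1 = 1 - b"
    by (simp_all add: field_simps)
  show ?thesis unfolding scaledU1_def scaledU2_def g mult.assoc r ..
qed

lemma slow_inverse:
  fixes F :: complex
  assumes "J0 * Ja - s * J1 * Jb = S / p" "S \<noteq> 0" "p \<noteq> 0"
    "F = p / S * (Ja * T - r * (s * J1 * T'))" "H = p / S * (- (Jb * T) + r * (J0 * T'))"
  shows "J0 * F + s * J1 * H = T" "Jb * F + Ja * H = r * T'"
proof -
  have "J0 * F + s * J1 * H = p / S * (T * (J0 * Ja - s * J1 * Jb))"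
    unfolding assms(4,5) by (simp add: algebra_simps)
  then show "J0 * F + s * J1 * H = T" using assms(2,3) unfolding assms(1) by simp
  have "Jb * F + Ja * H = p / S * (r * T' * (J0 * Ja - s * J1 * Jb))"
    unfolding assms(4,5) by (simp add: algebra_simps)
  then show "Jb * F + Ja * H = r * T'" using assms(2,3) unfolding assms(1) by simp
qed

text \<open>Sorts the Bessel side by the two branches \<open>P\<close> and \<open>inverse P\<close>;
  their coefficients are the left sides of the equations in \<open>slow_inverse\<close>.\<close>

lemma slow_rhs_aux:
  fixes u :: complex
  assumes "u \<noteq> 0" "z \<noteq> 0" "y = u * z / 2" "c = p / 2"
  shows "z * (c * (P * J0 - inverse P * Jb)) * F
      - z / u * (c * (inverse P * inverse y * Ja - P * y * J1)) * (z * (u\<^sup>2 / 2 * H))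
    = p * (z / 2 * (P * (J0 * F + y\<^sup>2 * J1 * H) - inverse P * (Jb * F + Ja * H)))"
proof -
  have i: "z / u * (inverse y) * (z * (u\<^sup>2 / 2)) = z" "z / u * y * (z * (u\<^sup>2 / 2)) = z * y\<^sup>2"
    using assms(1,2) unfolding assms(3) by (simp_all add: field_simps power2_eq_square)
  have "z / u * (c * (inverse P * inverse y * Ja - P * y * J1)) * (z * (u\<^sup>2 / 2 * H))
     = c * H * (inverse P * Ja * (z / u * (inverse y) * (z * (u\<^sup>2 / 2))) - P * J1 * (z / u * y * (z * (u\<^sup>2 / 2))))"
    by (simp add: algebra_simps)
  then have X: "z / u * (c * (inverse P * inverse y * Ja - P * y * J1)) * (z * (u\<^sup>2 / 2 * H))
     = c * H * (inverse P * Ja * z - P * J1 * (z * y\<^sup>2))"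
    unfolding i .
  show ?thesis unfolding X unfolding assms(4) by (simp add: algebra_simps)
qed

text \<open>Both sides are combinations of the branches \<open>P\<close> and
  \<open>inverse P\<close>, and \<open>slow_inverse\<close> matches the two coefficients. Only
  exponentials of multiples of \<open>w\<close> are manipulated, so the identity holds on the whole
  Riemann surface.\<close>

lemma exact_identity:
  assumes "Re b \<notin> \<int>" "u > 0" "norm b \<le> u\<^sup>2 / 4"
  shows "scaledU1 b u w = exp w * besselK (b - 1) (of_real (ln u) + w) * bigF u b (exp w)
     - exp w / of_real u * besselK b (of_real (ln u) + w) * (exp w * bigH u b (exp w))"
proof -
  define z where "z = exp w"
  define W where "W = of_real (ln u) + w"
  define y where "y = exp W / 2"
  define S where "S = sin (of_real pi * b)"
  define P where "P = exp ((b - 1) * (W - of_real (ln 2)))"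
  define \<eta> where "\<eta> = 1 / u\<^sup>2"
  define a where "a = of_real (u\<^sup>2) / 4 + b / 2"
  define G where "G = Gamma (a - b + 1)"
  have \<eta>: "\<eta> > 0" using assms by (simp add: \<eta>_def)
  have z: "z \<noteq> 0" by (simp add: z_def)
  have u: "complex_of_real u \<noteq> 0" using assms by simp
  have eW: "exp W = of_real u * z"
    unfolding W_def z_def exp_add exp_of_real using assms by simp
  have y: "y = of_real u * z / 2" unfolding y_def eW ..
  have y2: "y\<^sup>2 = of_real (u\<^sup>2) * z\<^sup>2 / 4" unfolding y by (simp add: power_mult_distrib power_divide)
  have S: "S \<noteq> 0" unfolding S_def by (rule sin_pi_neq_0[OF assms(1)])
  have P: "P \<noteq> 0" by (simp add: P_def)
  define J where "J = (\<lambda>b. eval_fps (bes b) (y\<^sup>2))"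
  define T where "T = (\<lambda>b. eval_fps (kum (of_real \<eta>) b) (y\<^sup>2))"
  define F where "F = eval_fps (slowF (rho \<eta> b) (of_real \<eta>) b) (y\<^sup>2)"
  define H where "H = eval_fps (slowH (rho \<eta> b) (of_real \<eta>) b) (y\<^sup>2)"
  have wr: "J b * J (1 - b) - y\<^sup>2 * J (b + 1) * J (2 - b) = S / of_real pi"
    using arg_cong[OF bes_wronskian[of b], of "\<lambda>f. eval_fps f (y\<^sup>2)"]
    unfolding J_def S_def by (simp add: eval_entire entire_hyp entire_fps_mult entire_fps_diff)
  have pi0: "complex_of_real pi \<noteq> 0" by simp
  have F: "F = of_real pi / S * (J (1 - b) * T b - rho \<eta> b * (y\<^sup>2 * J (b + 1) * T (2 - b)))"
    unfolding F_def eval_slowF J_def T_def S_def ..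
  have H: "H = of_real pi / S * (- (J (2 - b) * T b) + rho \<eta> b * (J b * T (2 - b)))"
    unfolding H_def eval_slowH J_def T_def S_def ..
  note inv = slow_inverse[OF wr S pi0 F H]
  have T: "T c = exp (- z\<^sup>2 / 2) * kM (of_real (u\<^sup>2) / 4 + c / 2) c (z\<^sup>2)" for c
  proof -
    have "T c = kumR \<eta> c (of_real u * z)" unfolding T_def kumR_def y2 by (simp add: power_mult_distrib)
    also have "\<dots> = exp (- (of_real \<eta> * (of_real u * z)\<^sup>2) / 2)
        * kM (1 / (4 * of_real \<eta>) + c / 2) c (of_real \<eta> * (of_real u * z)\<^sup>2)"
      by (rule kumR_kM[OF \<eta>])
    also have "of_real \<eta> * (of_real u * z)\<^sup>2 = z\<^sup>2" using u by (simp add: \<eta>_def power_mult_distrib)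
    also have "1 / (4 * complex_of_real \<eta>) = of_real (u\<^sup>2) / 4" by (simp add: \<eta>_def)
    finally show ?thesis .
  qed
  have a1: "1 + of_real (u\<^sup>2) / 4 - b / 2 = a - b + 1" "of_real (u\<^sup>2) / 4 + (2 - b) / 2 = a - b + 1"
    by (simp_all add: a_def field_simps)
  \<comment> \<open>The hypothesis on \<open>norm b\<close> keeps the Gamma factor away from its
    poles, so that it cancels against \<open>rGamma\<close>.\<close>
  have "Re (a - b + 1) > 0"
  proof -
    have "Re (a - b + 1) = u\<^sup>2 / 4 - Re b / 2 + 1" by (simp add: a_def)
    then show ?thesis using assms(3) complex_Re_le_cmod[of b] zero_le_power2[of u] by linarith
  qed
  then have "a - b + 1 \<notin> \<int>\<^sub>\<le>\<^sub>0"
    using right_half_plane_not_nonpos nonpos_Ints_subset_nonpos_Reals by blast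
  then have GG: "G * rGamma (a - b + 1) = 1" by (simp add: G_def rGamma_inverse_Gamma Gamma_eq_zero_iff)
  define l2 lu where "l2 = complex_of_real (ln 2)" and "lu = complex_of_real (ln u)"
  have l4: "complex_of_real (ln (4 * \<eta>)) = 2 * l2 - 2 * lu"
  proof -
    have "ln (4 * \<eta>) = ln (2\<^sup>2) - ln (u\<^sup>2)" unfolding \<eta>_def using assms by (simp add: ln_div)
    also have "\<dots> = 2 * ln 2 - 2 * ln u"
    proof -
      have "ln (x\<^sup>2) = 2 * ln x" if "x > 0" for x :: real
        using that by (simp add: power2_eq_square ln_mult)
      from this[of 2] this[of u] show ?thesis using assms by simp
    qed
    finally show ?thesis unfolding l2_def lu_def by simp
  qed
  have e1: "2 powr (- b) * of_real u powr (b - 1) * exp (b * w) = z / 2 * P"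
  proof -
    have "2 powr (- b) = exp (- b * l2)" using of_real_powr_exp[of 2 "- b"] by (simp add: l2_def)
    moreover have "exp (- b * l2) * exp ((b - 1) * lu) * exp (b * w) = exp w * exp (- l2) * P"
      unfolding P_def W_def l2_def[symmetric] lu_def[symmetric] exp_add[symmetric] by (simp add: algebra_simps)
    moreover have "exp (- l2) = 1 / 2" unfolding exp_minus l2_def exp_of_real by simp
    ultimately show ?thesis using of_real_powr_exp[OF assms(2), of "b - 1"] by (simp add: lu_def z_def)
  qed
  have e2: "P * exp ((1 - b) * (2 * w)) * exp (-(1 - b) * of_real (ln (4 * \<eta>))) = inverse P"
    unfolding P_def W_def l4 l2_def[symmetric] lu_def[symmetric] exp_minus[symmetric] exp_add[symmetric]
    by (simp add: algebra_simps)
  have rho: "rho \<eta> b = G * rGamma a * exp ((1 - b) * of_real (ln (4 * \<eta>)))"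
    unfolding rho_def G_def a_def by (simp add: \<eta>_def algebra_simps)
  \<comment> \<open>The branch \<open>inverse P\<close> fixes the weight of the second Kummer
    solution, and \<open>rho\<close> was defined to have exactly this value.\<close>
  have e3: "P * exp ((1 - b) * (2 * w)) * (G * rGamma a) = inverse P * rho \<eta> b"
  proof -
    define e where "e = exp ((1 - b) * of_real (ln (4 * \<eta>)))"
    have e0: "e \<noteq> 0" by (simp add: e_def)
    have e1: "exp (-(1 - b) * of_real (ln (4 * \<eta>))) = inverse e"
      unfolding e_def exp_minus[symmetric] by (rule arg_cong[of _ _ exp]) (simp add: algebra_simps)
    note e = e0 e1
    have "P * exp ((1 - b) * (2 * w)) = inverse P * e" using e2 e(1) unfolding e(2) by (simp add: field_simps)
    then show ?thesis unfolding rho e_def[symmetric] by (simp add: ac_simps)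
  qed
  have U: "kummerU a b (2 * w) = of_real pi / S * (rGamma (a - b + 1) * kM a b (z\<^sup>2)
      - exp ((1 - b) * (2 * w)) * rGamma a * kM (a - b + 1) (2 - b) (z\<^sup>2))"
    unfolding kummerU_def kummerU_quot_def kummerM_reg_eq S_def z_def
    using not_Ints_Re[OF assms(1)] by (simp add: exp_double)
  have KK: "besselK (b - 1) W = of_real pi / 2 / S * (P * J b - inverse P * J (2 - b))"
    "besselK b W = of_real pi / 2 / S * (inverse P * inverse y * J (1 - b) - P * y * J (b + 1))"
    using besselK_nonint[OF assms(1), of W] unfolding S_def P_def y_def J_def by auto
  have R: "z * besselK (b - 1) W * F - z / of_real u * besselK b W * (z * ((of_real u)\<^sup>2 / 2 * H))
     = of_real pi / S * (z / 2 * (P * T b - inverse P * (rho \<eta> b * T (2 - b))))"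
    unfolding KK
    by (subst slow_rhs_aux[OF u z y, where p = "of_real pi / S"]) (simp_all add: inv)
  have FH: "bigF u b z = F" "bigH u b z = (of_real u)\<^sup>2 / 2 * H"
    unfolding bigF_def bigH_def F_def H_def y2 \<eta>_def by simp_all
  define E where "E = exp (- z\<^sup>2 / 2)"
  define X where "X = exp ((1 - b) * (2 * w))"
  define M1 M2 where "M1 = kM a b (z\<^sup>2)" and "M2 = kM (a - b + 1) (2 - b) (z\<^sup>2)"
  have TM: "T b = E * M1" "T (2 - b) = E * M2"
    unfolding T a1(2) M1_def M2_def E_def a_def by simp_all
  have "scaledU1 b u w = G * E * (2 powr (- b) * of_real u powr (b - 1) * exp (b * w)) * kummerU a b (2 * w)"
    unfolding scaledU1_def a1(1) G_def[symmetric] a_def[symmetric] z_def[symmetric] E_def by (simp add: ac_simps)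
  also have "\<dots> = of_real pi / S * (z / 2 * E * (P * M1 * (G * rGamma (a - b + 1)) - (P * X * (G * rGamma a)) * M2))"
    unfolding e1 U X_def[symmetric] M1_def[symmetric] M2_def[symmetric] by (simp add: algebra_simps)
  also have "\<dots> = of_real pi / S * (z / 2 * (P * T b - inverse P * (rho \<eta> b * T (2 - b))))"
    unfolding GG e3[folded X_def] TM by (simp add: algebra_simps)
  also note R[symmetric]
  finally show ?thesis unfolding W_def[symmetric] z_def[symmetric] FH .
qed

section \<open>Removable singularities in the order\<close>

text \<open>The partial sums are entire in the parameter and converge uniformly on discs by the
  bound of \<open>hyp_nth_bound\<close>.\<close>

lemma holomorphic_hyp:
  fixes p r :: "complex \<Rightarrow> complex"
  assumes p: "p holomorphic_on UNIV" and r: "r holomorphic_on UNIV"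
  shows "(\<lambda>\<beta>. eval_fps (hyp (p \<beta>) q (r \<beta>)) s) holomorphic_on UNIV"
proof (rule holomorphic_uniform_sequence)
  define g where "g = (\<lambda>i \<beta>. fps_nth (hyp (p \<beta>) q (r \<beta>)) i * s ^ i)"
  show "(\<lambda>\<beta>. \<Sum>i<n. g i \<beta>) holomorphic_on UNIV" for n
  proof -
    have "g i holomorphic_on UNIV" for i
      unfolding g_def hyp_nth
      by (intro holomorphic_intros p r holomorphic_on_compose_gen[OF _ holomorphic_rGamma, unfolded o_def]) auto
    then show ?thesis by (intro holomorphic_intros)
  qed
  fix x :: complex
  have "compact (p ` cball x 1)" "compact (r ` cball x 1)"
    using p r by (auto intro!: compact_continuous_image intro: holomorphic_on_imp_continuous_on holomorphic_on_subset)
  then have "bounded (p ` cball x 1)" "bounded (r ` cball x 1)" by (auto intro: compact_imp_bounded)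
  then obtain P0 R0 where "\<forall>y\<in>p ` cball x 1. norm y \<le> P0" "\<forall>y\<in>r ` cball x 1. norm y \<le> R0"
    unfolding bounded_iff by blast
  then have PR: "\<And>\<beta>. \<beta> \<in> cball x 1 \<Longrightarrow> norm (p \<beta>) \<le> P0" "\<And>\<beta>. \<beta> \<in> cball x 1 \<Longrightarrow> norm (r \<beta>) \<le> R0"
    by blast+
  define L where "L = max (max P0 (norm q)) 0"
  define \<delta> where "\<delta> = 1 / (2 * (norm s + 1))"
  have s1: "norm s + 1 > 0" by (simp add: add_nonneg_pos)
  obtain C where C: "C > 0" "\<And>p q b n. norm p \<le> L \<Longrightarrow> norm q \<le> L \<Longrightarrow> norm b \<le> R0 \<Longrightarrow>
     norm (fps_nth (hyp p q b) n) \<le> C * \<delta> ^ n"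
    using hyp_nth_bound[of L \<delta> R0] s1 unfolding L_def \<delta>_def by (metis divide_pos_pos max.cobounded2 mult_pos_pos zero_less_numeral zero_less_one)
  have gb: "norm (g i \<beta>) \<le> C * (1/2) ^ i" if "\<beta> \<in> cball x 1" for i \<beta>
  proof -
    have "norm (p \<beta>) \<le> L" "norm q \<le> L" using PR(1)[OF that] by (auto simp: L_def)
    then have "norm (fps_nth (hyp (p \<beta>) q (r \<beta>)) i) \<le> C * \<delta> ^ i" using C(2) PR(2)[OF that] by blast
    then have "norm (g i \<beta>) \<le> C * \<delta> ^ i * norm s ^ i"
      unfolding g_def norm_mult norm_power by (rule mult_right_mono) simp
    also have "\<dots> = C * (\<delta> * norm s) ^ i" by (simp add: power_mult_distrib)
    also have "\<dots> \<le> C * (1/2) ^ i"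
      using C s1 by (intro mult_left_mono power_mono) (auto simp: \<delta>_def field_simps)
    finally show ?thesis .
  qed
  have "uniform_limit (cball x 1) (\<lambda>n \<beta>. \<Sum>i<n. g i \<beta>) (\<lambda>\<beta>. \<Sum>i. g i \<beta>) sequentially"
    by (rule Weierstrass_m_test[OF gb]) (auto intro: summable_mult)
  then show "\<exists>d>0. cball x d \<subseteq> UNIV \<and>
      uniform_limit (cball x d) (\<lambda>n \<beta>. \<Sum>i<n. g i \<beta>) (\<lambda>\<beta>. eval_fps (hyp (p \<beta>) q (r \<beta>)) s) sequentially"
    unfolding eval_fps_def g_def by (intro exI[of _ 1]) auto
qed simp

text \<open>For the second parameter \<open>1 - j\<close> the zeros of \<open>rGamma\<close> kill
  the first \<open>j\<close> coefficients, and what remains is the shifted series with second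
  parameter \<open>1 + j\<close>.\<close>

lemma hyp_reindex:
  "hyp p q (1 - of_nat j) = fps_const (\<Prod>i<j. p + q * of_nat i) * (fps_X ^ j * hyp (p + q * of_nat j) q (1 + of_nat j))"
proof (rule fps_ext)
  fix n
  show "fps_nth (hyp p q (1 - of_nat j)) n =
    fps_nth (fps_const (\<Prod>i<j. p + q * of_nat i) * (fps_X ^ j * hyp (p + q * of_nat j) q (1 + of_nat j))) n"
  proof (cases "n < j")
    case True
    then have "1 - of_nat j + of_nat n = - (of_nat (j - Suc n) :: complex)" by (simp add: of_nat_diff)
    then have "rGamma (1 - of_nat j + of_nat n :: complex) = 0" by (simp add: rGamma_eq_zero_iff)
    then show ?thesis using True by (simp add: hyp_nth fps_X_power_mult_nth)
  next
    case False
    then obtain i where n: "n = j + i" using le_Suc_ex by (metis not_less)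
    have "rGamma (1 + of_nat k :: complex) = 1 / fact k" for k
      using Gamma_fact[of k] by (metis Gamma_fact inverse_eq_divide rGamma_inverse_Gamma add.commute)
    moreover have "1 - of_nat j + of_nat n = (1 + of_nat i :: complex)" "1 + of_nat j + of_nat i = (1 + of_nat n :: complex)"
      by (simp_all add: n)
    ultimately have r: "rGamma (1 - of_nat j + of_nat n :: complex) = 1 / fact i"
      "rGamma (1 + of_nat j + of_nat i :: complex) = 1 / fact n"
      by metis+
    have p: "(\<Prod>l<j + i. p + q * of_nat l) = (\<Prod>l<j. p + q * of_nat l) * (\<Prod>l<i. p + q * of_nat j + q * of_nat l)"
      by (induction i) (simp_all add: algebra_simps)
    show ?thesis using False n p r by (simp add: hyp_nth fps_X_power_mult_nth)
  qed
qed

lemma eval_hyp_reindex: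
  "eval_fps (hyp p q (1 - of_nat j)) s = (\<Prod>i<j. p + q * of_nat i) * s ^ j * eval_fps (hyp (p + q * of_nat j) q (1 + of_nat j)) s"
proof -
  have X: "entire_fps (fps_X ^ j)" "eval_fps (fps_X ^ j) s = s ^ j"
    by (induction j) (auto simp: eval_entire entire_fps_mult)
  show ?thesis unfolding hyp_reindex using X
    by (simp add: eval_entire entire_fps_mult entire_hyp)
qed

text \<open>The quotient without its sine: entire in the order and zero at the integers, which is
  why the singularities are removable.\<close>

definition besselK_num :: "complex \<Rightarrow> complex \<Rightarrow> complex" where
  "besselK_num w \<nu> = of_real pi / 2 * (besselI (- \<nu>) w - besselI \<nu> w)"

definition kummerU_num :: "complex \<Rightarrow> complex \<Rightarrow> complex \<Rightarrow> complex" where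
  "kummerU_num w a b = of_real pi * (rGamma (a - b + 1) * kM a b (exp w)
     - exp ((1 - b) * w) * rGamma a * kM (a - b + 1) (2 - b) (exp w))"

lemma besselK_quot_eq: "besselK_quot w = (\<lambda>\<nu>. besselK_num w \<nu> / sin (of_real pi * \<nu>))"
  by (simp add: besselK_quot_def besselK_num_def fun_eq_iff)

lemma kummerU_quot_eq: "kummerU_quot a w = (\<lambda>b. kummerU_num w a b / sin (of_real pi * b))"
  by (simp add: kummerU_quot_def kummerU_num_def kummerM_reg_eq fun_eq_iff)

lemma besselK_num_holomorphic: "besselK_num w holomorphic_on UNIV"
proof -
  have "(\<lambda>\<nu>. besselI \<nu> w) holomorphic_on UNIV" "(\<lambda>\<nu>. besselI (- \<nu>) w) holomorphic_on UNIV"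
    unfolding besselI_eq by (intro holomorphic_intros holomorphic_hyp)+
  then show ?thesis unfolding besselK_num_def[abs_def] by (intro holomorphic_intros) auto
qed

lemma besselI_minus_nat: "besselI (- of_nat j) w = besselI (of_nat j) w"
proof -
  have "exp (complex_of_real (ln 2)) = 2" unfolding exp_of_real by simp
  then have y: "exp w / 2 = exp (w - of_real (ln 2))" by (simp add: exp_diff)
  have "exp (- of_nat j * (w - of_real (ln 2))) * ((exp w / 2)\<^sup>2) ^ j = exp (of_nat j * (w - of_real (ln 2)))"
    unfolding y exp_of_nat_mult[symmetric] exp_add[symmetric] by (simp add: exp_double[symmetric] exp_of_nat_mult[symmetric] exp_add[symmetric] algebra_simps)
  then have e: "exp (- (of_nat j * (w - of_real (ln 2)))) * ((exp w / 2)\<^sup>2) ^ j * x = exp (of_nat j * (w - of_real (ln 2))) * x" for x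
    by simp
  have "1 - of_nat j = - of_nat j + (1 :: complex)" by simp
  note h = eval_hyp_reindex[of 1 0 j "(exp w / 2)\<^sup>2", unfolded this]
  show ?thesis unfolding besselI_eq h using e by (simp add: add.commute mult.assoc)
qed

lemma besselK_num_int: "\<nu> \<in> \<int> \<Longrightarrow> besselK_num w \<nu> = 0"
proof -
  assume "\<nu> \<in> \<int>"
  then obtain m :: int where m: "\<nu> = of_int m" by (auto elim: Ints_cases)
  show ?thesis
  proof (cases m)
    case (nonneg j)
    then show ?thesis using besselI_minus_nat[of j w] by (simp add: besselK_num_def m)
  next
    case (neg j)
    then have "\<nu> = - of_nat (Suc j)" by (simp add: m)
    then show ?thesis using besselI_minus_nat[of "Suc j" w] by (simp add: besselK_num_def del: of_nat_Suc)
  qed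
qed

text \<open>At integral \<open>b\<close> the two Kummer solutions become proportional; the
  Pochhammer factor of the reindexed series is the quotient of the two reciprocal Gamma
  values.\<close>

lemma kummerU_num_aux:
  "rGamma (a - of_nat j) * kM a (1 + of_nat j) z * z ^ j = rGamma a * kM (a - of_nat j) (1 - of_nat j) z"
proof -
  have "rGamma (a - of_nat j) = (\<Prod>i<j. (a - of_nat j) + 1 * of_nat i) * rGamma a"
    using pochhammer_rGamma[of "a - of_nat j" j] by (simp add: pochhammer_prod atLeast0LessThan)
  then show ?thesis unfolding eval_hyp_reindex by simp
qed

lemma kummerU_num_int: "b \<in> \<int> \<Longrightarrow> kummerU_num w a b = 0"
proof -
  assume "b \<in> \<int>"
  then obtain m :: int where m: "b = of_int m" by (auto elim: Ints_cases)
  show ?thesis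
  \<comment> \<open>The reflection of \<open>b\<close> to \<open>2 - b\<close> is centred at 1,
    hence the distinction by the sign of \<open>m - 1\<close>.\<close>
  proof (cases "m - 1")
    case (nonneg j)
    then have "m = 1 + int j" by simp
    then have b: "b = 1 + of_nat j" "a - b + 1 = a - of_nat j" "2 - b = 1 - of_nat j" "1 - b = - of_nat j"
      by (simp_all add: m)
    have "exp (- of_nat j * w) = inverse (exp w ^ j)"
      by (simp add: exp_minus exp_of_nat_mult)
    moreover have "rGamma (a - of_nat j) * kM a (1 + of_nat j) (exp w)
        = inverse (exp w ^ j) * (rGamma a * kM (a - of_nat j) (1 - of_nat j) (exp w))"
      by (simp flip: kummerU_num_aux)
    ultimately show ?thesis unfolding kummerU_num_def b(2,3,4) unfolding b(1) by (simp add: mult.assoc)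
  next
    case (neg j)
    define i where "i = Suc j"
    have "m = 1 - int i" using neg by (simp add: i_def)
    then have b: "b = 1 - of_nat i" "a - b + 1 = a + of_nat i" "2 - b = 1 + of_nat i" "1 - b = of_nat i"
      by (simp_all add: m)
    have e: "exp (of_nat i * w) = exp w ^ i" by (rule exp_of_nat_mult)
    show ?thesis unfolding kummerU_num_def b(2,3,4) e unfolding b(1)
      using kummerU_num_aux[of "a + of_nat i" i "exp w"] by (simp add: mult_ac)
  qed
qed

lemma kummerU_num_holomorphic: "kummerU_num w a holomorphic_on UNIV"
  unfolding kummerU_num_def[abs_def]
  by (intro holomorphic_intros holomorphic_hyp holomorphic_on_compose_gen[OF _ holomorphic_rGamma, unfolded o_def]) auto

lemma tendsto_rGamma_complex:
  "(g \<longlongrightarrow> a) F \<Longrightarrow> ((\<lambda>x. rGamma (g x)) \<longlongrightarrow> rGamma (a :: complex)) F"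
  using continuous_on_rGamma[of "UNIV :: complex set"]
  by (auto simp: continuous_on_eq_continuous_at intro: isCont_tendsto_compose)

lemma kummerU_num_continuous: "continuous_on UNIV (\<lambda>x. kummerU_num w (fst x) (snd x))"
  unfolding continuous_on_def
proof
  fix x :: "complex \<times> complex"
  show "((\<lambda>x. kummerU_num w (fst x) (snd x)) \<longlongrightarrow> kummerU_num w (fst x) (snd x)) (at x within UNIV)"
  proof (cases "at x within UNIV = bot")
    case False
    then show ?thesis unfolding kummerU_num_def
      by (intro tendsto_intros hyp_tendsto tendsto_rGamma_complex) auto
  qed simp
qed

text \<open>
  The limit defining \<open>U\<close> at integral \<open>b\<close> has the first parameter fixed, whereas here both parameters move;
  Schwarz's lemma makes the quotient uniform in the first one.
\<close>

lemma removable_joint: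
  fixes f :: "complex \<Rightarrow> complex \<Rightarrow> complex"
  assumes cont: "continuous_on UNIV (\<lambda>x. f (fst x) (snd x))"
    and hol: "\<And>a. f a holomorphic_on UNIV" and zero: "\<And>a. f a b0 = 0"
    and a: "a \<longlonglongrightarrow> a0" and b: "b \<longlonglongrightarrow> b0" "\<And>n. b n \<noteq> b0"
  shows "(\<lambda>n. (f (a n) (b n) - f a0 (b n)) / (b n - b0)) \<longlonglongrightarrow> 0"
proof (rule tendstoI)
  fix e :: real assume e: "e > 0"
  \<comment> \<open>Schwarz's lemma needs the difference to be small on a whole disc around
    \<open>b0\<close> and not only at \<open>b n\<close>.\<close>
  have "uniformly_continuous_on (cball a0 1 \<times> cball b0 1) (\<lambda>x. f (fst x) (snd x))"
    by (intro compact_uniformly_continuous compact_Times continuous_on_subset[OF cont]) auto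
  then obtain d where d: "d > 0" "\<And>x x'. x \<in> cball a0 1 \<times> cball b0 1 \<Longrightarrow> x' \<in> cball a0 1 \<times> cball b0 1 \<Longrightarrow>
      dist x' x < d \<Longrightarrow> dist (f (fst x') (snd x')) (f (fst x) (snd x)) < e / 2"
    using e unfolding uniformly_continuous_on_def by (metis half_gt_zero)
  have "eventually (\<lambda>n. dist (a n) a0 < min d 1) sequentially" "eventually (\<lambda>n. dist (b n) b0 < 1) sequentially"
    using tendstoD[OF a, of "min d 1"] tendstoD[OF b(1), of 1] d by auto
  then show "eventually (\<lambda>n. dist ((f (a n) (b n) - f a0 (b n)) / (b n - b0)) 0 < e) sequentially"
  proof eventually_elim
    case (elim n)
    \<comment> \<open>Normalized to map the unit disc into itself and vanishing at 0, since both
      functions vanish at \<open>b0\<close>; the bound \<open>e / 2\<close> thereby improves to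
      \<open>e / 2 * norm (b n - b0)\<close>.\<close>
    define D where "D = (\<lambda>\<zeta>. (f (a n) (b0 + \<zeta>) - f a0 (b0 + \<zeta>)) / of_real (e / 2))"
    have "norm (D (b n - b0)) \<le> norm (b n - b0)"
    proof (rule Schwarz_Lemma)
      have "(\<lambda>\<zeta>. f c (b0 + \<zeta>)) holomorphic_on ball 0 1" for c
        by (rule holomorphic_on_compose_gen[OF _ hol, unfolded o_def]) (auto intro!: holomorphic_intros)
      then show "D holomorphic_on ball 0 1" unfolding D_def using e by (intro holomorphic_intros) auto
      show "D 0 = 0" by (simp add: D_def zero)
      fix z :: complex assume z: "norm z < 1"
      have "dist (f (a n) (b0 + z)) (f a0 (b0 + z)) < e / 2"
        using d(2)[of "(a0, b0 + z)" "(a n, b0 + z)"] z elim by (simp add: dist_Pair_Pair dist_commute) (simp add: dist_norm)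
      moreover have "norm (complex_of_real (e / 2)) = e / 2" using e unfolding norm_of_real by simp
      ultimately show "norm (D z) < 1" unfolding D_def norm_divide using e by (simp add: dist_norm)
    qed (use elim in \<open>simp add: dist_norm\<close>)
    moreover have "norm (complex_of_real (e / 2)) = e / 2" using e unfolding norm_of_real by simp
    ultimately have "norm (f (a n) (b n) - f a0 (b n)) \<le> e / 2 * norm (b n - b0)"
      unfolding D_def norm_divide using e by (simp add: field_simps)
    moreover have "norm (b n - b0) > 0" using b(2) by simp
    ultimately have "norm (f (a n) (b n) - f a0 (b n)) / norm (b n - b0) \<le> e / 2"
      by (simp add: field_simps)
    then have "norm (f (a n) (b n) - f a0 (b n)) / norm (b n - b0) < e" using e by linarith
    then show ?case by (simp add: dist_norm norm_divide)
  qed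
qed

lemma sin_pi_int:
  assumes "b \<in> \<int>"
  shows "sin (of_real pi * b :: complex) = 0" "cos (of_real pi * b :: complex) \<noteq> 0"
proof -
  obtain m :: int where m: "b = of_int m" using assms by (auto elim: Ints_cases)
  show s: "sin (of_real pi * b :: complex) = 0"
    unfolding sin_eq_0 m by (intro exI[of _ m]) simp
  show "cos (of_real pi * b :: complex) \<noteq> 0"
    using sin_cos_squared_add[of "of_real pi * b :: complex"] s by auto
qed

text \<open>Both numerator and sine have a zero at \<open>b0\<close>, that of the sine being simple,
  so the limit is the quotient of the derivatives.\<close>

lemma removable_sin:
  assumes "f holomorphic_on UNIV" "f b0 = 0" "b0 \<in> \<int>"
  obtains l :: complex where "((\<lambda>b. f b / sin (of_real pi * b)) \<longlongrightarrow> l) (at b0)"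
proof -
  obtain d where "(f has_field_derivative d) (at b0)"
    using assms(1) by (metis UNIV_I holomorphic_on_imp_differentiable_at open_UNIV field_differentiable_def)
  then have 1: "((\<lambda>b. f b / (b - b0)) \<longlongrightarrow> d) (at b0)"
    using assms(2) by (simp add: has_field_derivative_iff)
  have "((\<lambda>b. sin (of_real pi * b)) has_field_derivative (of_real pi * cos (of_real pi * b0))) (at b0)"
    by (auto intro!: derivative_eq_intros)
  then have 2: "((\<lambda>b. sin (of_real pi * b) / (b - b0)) \<longlongrightarrow> of_real pi * cos (of_real pi * b0)) (at b0)"
    using sin_pi_int(1)[OF assms(3)] by (simp add: has_field_derivative_iff)
  have "((\<lambda>b. (f b / (b - b0)) / (sin (of_real pi * b) / (b - b0))) \<longlongrightarrow> d / (of_real pi * cos (of_real pi * b0))) (at b0)"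
    by (rule tendsto_divide[OF 1 2]) (use sin_pi_int(2)[OF assms(3)] in simp)
  then have "((\<lambda>b. f b / sin (of_real pi * b)) \<longlongrightarrow> d / (of_real pi * cos (of_real pi * b0))) (at b0)"
    by (rule Lim_transform_eventually) (auto simp: eventually_at_filter)
  then show ?thesis using that by blast
qed

lemma removable_quotient_tendsto:
  fixes f :: "complex \<Rightarrow> complex \<Rightarrow> complex"
  assumes cont: "continuous_on UNIV (\<lambda>x. f (fst x) (snd x))"
    and hol: "\<And>a. f a holomorphic_on UNIV" and zero: "\<And>a b. b \<in> \<int> \<Longrightarrow> f a b = 0"
    and a: "a \<longlonglongrightarrow> a0" and b: "b \<longlonglongrightarrow> b0" "\<And>n. b n \<notin> \<int>"
  shows "(\<lambda>n. f (a n) (b n) / sin (of_real pi * b n)) \<longlonglongrightarrow>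
    (if b0 \<in> \<int> then Lim (at b0) (\<lambda>b. f a0 b / sin (of_real pi * b)) else f a0 b0 / sin (of_real pi * b0))"
proof (cases "b0 \<in> \<int>")
  case True
  then have ne: "b n \<noteq> b0" for n using b(2) by metis
  have at: "filterlim b (at b0) sequentially"
    using b(1) ne by (auto simp: filterlim_at)
  obtain l where l: "((\<lambda>b. f a0 b / sin (of_real pi * b)) \<longlongrightarrow> l) (at b0)"
    using removable_sin[OF hol zero[OF True] True] by metis
  have L: "Lim (at b0) (\<lambda>b. f a0 b / sin (of_real pi * b)) = l"
    by (rule tendsto_Lim[OF _ l]) simp
  obtain l' where l': "((\<lambda>b. (b - b0) / sin (of_real pi * b)) \<longlongrightarrow> l') (at b0)"
    by (rule removable_sin[of "\<lambda>b. b - b0" b0]) (auto intro!: holomorphic_intros True)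
  \<comment> \<open>The quotient with frozen first parameter plus a correction: the first factor of
    the correction tends to 0 by \<open>removable_joint\<close>, the second one converges.\<close>
  have "(\<lambda>n. f a0 (b n) / sin (of_real pi * b n) +
      (f (a n) (b n) - f a0 (b n)) / (b n - b0) * ((b n - b0) / sin (of_real pi * b n))) \<longlonglongrightarrow> l + 0 * l'"
    by (intro tendsto_add tendsto_mult removable_joint[OF cont hol zero[OF True] a b(1) ne]
        filterlim_compose[OF l at] filterlim_compose[OF l' at])
  moreover have "f a0 (b n) / sin (of_real pi * b n) +
      (f (a n) (b n) - f a0 (b n)) / (b n - b0) * ((b n - b0) / sin (of_real pi * b n)) = f (a n) (b n) / sin (of_real pi * b n)" for n
  proof -
    have "x / S + (y - x) / c * (c / S) = y / S" if "c \<noteq> 0" for x y c S :: complex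
    proof -
      have "(y - x) / c * (c / S) = (y - x) / S" using that by simp
      then show ?thesis by (simp add: diff_divide_distrib)
    qed
    then show ?thesis using ne[of n] by (metis eq_iff_diff_eq_0)
  qed
  ultimately show ?thesis using True L by simp
next
  case False
  have "isCont (\<lambda>x. f (fst x) (snd x)) (a0, b0)"
    using cont by (simp add: continuous_on_eq_continuous_at)
  then have "(\<lambda>n. f (a n) (b n)) \<longlonglongrightarrow> f a0 b0"
    using isCont_tendsto_compose[OF _ tendsto_Pair[OF a b(1)]] by fastforce
  moreover have "sin (of_real pi * b0) \<noteq> 0"
  proof
    assume "sin (of_real pi * b0) = 0"
    then obtain n :: int where "of_real pi * b0 = of_real (of_int n * pi)" unfolding sin_eq_0 by auto
    then have "b0 = of_int n" by simp
    then show False using False by simp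
  qed
  ultimately have "(\<lambda>n. f (a n) (b n) / sin (of_real pi * b n)) \<longlonglongrightarrow> f a0 b0 / sin (of_real pi * b0)"
    by (intro tendsto_intros b(1))
  then show ?thesis using False by simp
qed

lemma kummerU_tendsto:
  assumes "a \<longlonglongrightarrow> a0" "b \<longlonglongrightarrow> b0" "\<And>n. b n \<notin> \<int>"
  shows "(\<lambda>n. kummerU (a n) (b n) w) \<longlonglongrightarrow> kummerU a0 b0 w"
  using removable_quotient_tendsto[OF kummerU_num_continuous kummerU_num_holomorphic kummerU_num_int assms, of w] assms(3)
  unfolding kummerU_def kummerU_quot_eq by simp

lemma besselK_tendsto:
  assumes "b \<longlonglongrightarrow> b0" "\<And>n. b n \<notin> \<int>"
  shows "(\<lambda>n. besselK (b n) w) \<longlonglongrightarrow> besselK b0 w"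
proof -
  have "continuous_on UNIV (besselK_num w)"
    by (rule holomorphic_on_imp_continuous_on[OF besselK_num_holomorphic])
  then have "continuous_on UNIV (\<lambda>x :: complex \<times> complex. besselK_num w (snd x))"
    by (rule continuous_on_compose2) (auto intro!: continuous_intros)
  from removable_quotient_tendsto[of "\<lambda>_. besselK_num w", OF this besselK_num_holomorphic besselK_num_int tendsto_const assms]
  show ?thesis using assms(2) unfolding besselK_def besselK_quot_eq by simp
qed

section \<open>Passage to arbitrary order\<close>

text \<open>The degree bound uniform in \<open>\<mu>\<close> makes evaluation a finite sum with a
  fixed number of terms, so that continuity of the coefficients suffices.\<close>

definition poly_cont :: "(complex \<Rightarrow> complex poly) \<Rightarrow> bool" where
  "poly_cont p \<longleftrightarrow> (\<exists>d. \<forall>\<mu> k. k > d \<longrightarrow> coeff (p \<mu>) k = 0) \<and> (\<forall>k. continuous_on UNIV (\<lambda>\<mu>. coeff (p \<mu>) k))"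

lemma poly_cont_tendsto:
  assumes "poly_cont p" "\<mu> \<longlonglongrightarrow> \<mu>0"
  shows "(\<lambda>n. poly (p (\<mu> n)) z) \<longlonglongrightarrow> poly (p \<mu>0) z"
proof -
  obtain d where d: "\<And>\<mu> k. k > d \<Longrightarrow> coeff (p \<mu>) k = 0" using assms(1) unfolding poly_cont_def by blast
  have "poly (p \<mu>) z = (\<Sum>k\<le>d. coeff (p \<mu>) k * z ^ k)" for \<mu>
    unfolding poly_altdef by (rule sum.mono_neutral_left) (auto simp: coeff_eq_0 intro!: degree_le d)
  moreover have "(\<lambda>n. coeff (p (\<mu> n)) k) \<longlonglongrightarrow> coeff (p \<mu>0) k" for k
    using assms unfolding poly_cont_def by (auto simp: continuous_on_eq_continuous_at intro: isCont_tendsto_compose)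
  ultimately show ?thesis by (auto intro!: tendsto_intros)
qed

lemma poly_cont_div_z: "poly_cont p \<Longrightarrow> poly_cont (\<lambda>\<mu>. div_z (p \<mu>))"
  unfolding poly_cont_def coeff_div_z by (meson less_SucI)

lemma poly_cont_B_of_A:
  assumes "poly_cont p"
  shows "poly_cont (\<lambda>\<mu>. B_of_A \<mu> (p \<mu>))"
proof -
  obtain d where d: "\<And>\<mu> k. k > d \<Longrightarrow> coeff (p \<mu>) k = 0" using assms(1) unfolding poly_cont_def by blast
  have c: "continuous_on UNIV (\<lambda>\<mu>. coeff (p \<mu>) k)" for k using assms unfolding poly_cont_def by blast
  have e: "coeff (B_of_A \<mu> (p \<mu>)) k = (- (of_nat (Suc k) * coeff (p \<mu>) (Suc k)) + (if k = 0 then 0 else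
     ((if k - 1 < 2 then 0 else coeff (p \<mu>) (k - 1 - 2)) - (2 * \<mu> + 1) * (of_nat (Suc k) * coeff (p \<mu>) (Suc k))) / of_nat k)) / 2" for \<mu> k
    by (auto simp: B_of_A_def coeff_pderiv coeff_antideriv0 coeff_div_z coeff_f_poly_mult simp del: of_nat_Suc)
  \<comment> \<open>Multiplication by \<open>f\<close> raises the degree by 2 and the integration by
    1.\<close>
  have "coeff (B_of_A \<mu> (p \<mu>)) k = 0" if "k > d + 3" for \<mu> k
    unfolding e using that by (simp add: d)
  moreover have "continuous_on UNIV (\<lambda>\<mu>. coeff (B_of_A \<mu> (p \<mu>)) k)" for k
    unfolding e by (cases "k = 0"; cases "k - 1 < 2") (auto intro!: continuous_intros c)
  ultimately show ?thesis unfolding poly_cont_def by blast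
qed

lemma poly_cont_A_of_B:
  assumes "poly_cont p"
  shows "poly_cont (\<lambda>\<mu>. A_of_B \<mu> (p \<mu>))"
proof -
  obtain d where d: "\<And>\<mu> k. k > d \<Longrightarrow> coeff (p \<mu>) k = 0" using assms(1) unfolding poly_cont_def by blast
  have c: "continuous_on UNIV (\<lambda>\<mu>. coeff (p \<mu>) k)" for k using assms unfolding poly_cont_def by blast
  have e: "coeff (A_of_B \<mu> (p \<mu>)) k = (if k = 0 then 0 else ((2 * \<mu> + 1) * coeff (p \<mu>) (Suc k) - of_nat (Suc k) * coeff (p \<mu>) (Suc k)
      + (if k - 1 < 2 then 0 else coeff (p \<mu>) (k - 1 - 2)) / of_nat k) / 2)" for \<mu> k
  proof -
    have "coeff [:c:] k = (if k = 0 then c else 0)" for c :: complex by (cases k) auto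
    then show ?thesis
      by (auto simp: A_of_B_def Let_def coeff_pderiv coeff_antideriv0 coeff_div_z coeff_f_poly_mult simp del: of_nat_Suc)
  qed
  have "coeff (A_of_B \<mu> (p \<mu>)) k = 0" if "k > d + 3" for \<mu> k
    unfolding e using that by (simp add: d)
  moreover have "continuous_on UNIV (\<lambda>\<mu>. coeff (A_of_B \<mu> (p \<mu>)) k)" for k
    unfolding e by (cases "k = 0"; cases "k - 1 < 2") (auto intro!: continuous_intros c)
  ultimately show ?thesis unfolding poly_cont_def by blast
qed

lemma poly_cont_A_poly: "poly_cont (\<lambda>\<mu>. A_poly \<mu> s)"
proof (induction s)
  case 0
  show ?case unfolding poly_cont_def by (auto intro!: exI[of _ 0] continuous_intros)
next
  case (Suc s)
  then show ?case unfolding A_poly.simps by (intro poly_cont_A_of_B poly_cont_B_of_A)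
qed

lemma poly_cont_B_poly: "poly_cont (\<lambda>\<mu>. B_poly \<mu> s)"
  unfolding B_poly_def by (rule poly_cont_B_of_A[OF poly_cont_A_poly])

lemma poly_a_poly_tendsto:
  assumes "\<mu> \<longlonglongrightarrow> \<mu>0"
  shows "(\<lambda>n. poly (a_poly (\<mu> n) s) z) \<longlonglongrightarrow> poly (a_poly \<mu>0 s) z"
proof (cases s)
  case (Suc r)
  have "(\<lambda>n. poly (A_poly (- \<mu> n) (Suc r)) z + 2 * \<mu> n * poly (div_z (B_poly (- \<mu> n) r)) z)
     \<longlonglongrightarrow> poly (A_poly (- \<mu>0) (Suc r)) z + 2 * \<mu>0 * poly (div_z (B_poly (- \<mu>0) r)) z"
    by (intro tendsto_intros assms poly_cont_tendsto[OF poly_cont_A_poly]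
        poly_cont_tendsto[OF poly_cont_div_z[OF poly_cont_B_poly]])
  then show ?thesis unfolding Suc a_poly.simps poly_add poly_smult .
qed simp

text \<open>The brackets \<open>F n\<close> and \<open>H n\<close> are not known to converge, since
  their explicit formulas have a vanishing sine in the denominator. They are bounded, however, so a
  subsequence of the pairs converges, and the closed conditions pass to its limit.\<close>

lemma bounded_decomposition_limit:
  fixes F H :: "nat \<Rightarrow> complex"
  assumes lim: "L \<longlonglongrightarrow> l" "k \<longlonglongrightarrow> k0" "k' \<longlonglongrightarrow> k0'" "p \<longlonglongrightarrow> p0" "q \<longlonglongrightarrow> q0"
    and eq: "\<And>n. L n = k n * F n - k' n * H n"
    and le: "\<And>n. norm (F n - p n) \<le> e" "\<And>n. norm (H n - q n) \<le> e"
  obtains F0 H0 where "l = k0 * F0 - k0' * H0" "norm (F0 - p0) \<le> e" "norm (H0 - q0) \<le> e"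
proof -
  have "Bseq p" "Bseq q" using lim(4,5) by (auto intro: convergent_imp_Bseq convergentI)
  then obtain P Q where PQ: "\<And>n. norm (p n) \<le> P" "\<And>n. norm (q n) \<le> Q" unfolding Bseq_def by blast
  have "norm (F n) \<le> P + e" "norm (H n) \<le> Q + e" for n
    using norm_triangle_sub[of "F n" "p n"] norm_triangle_sub[of "H n" "q n"] PQ[of n] le[of n] by linarith+
  then have "norm (F n, H n) \<le> (P + e) + (Q + e)" for n
    using norm_Pair_le[of "F n" "H n"] add_mono order_trans by blast
  then have "bounded (range (\<lambda>n. (F n, H n)))" unfolding bounded_iff by blast
  then obtain c r where r: "strict_mono r" "((\<lambda>n. (F n, H n)) \<circ> r) \<longlonglongrightarrow> c"
    using bounded_imp_convergent_subsequence by metis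
  have FH: "(\<lambda>n. F (r n)) \<longlonglongrightarrow> fst c" "(\<lambda>n. H (r n)) \<longlonglongrightarrow> snd c"
    using tendsto_fst[OF r(2)] tendsto_snd[OF r(2)] by (simp_all add: o_def)
  have sub: "(\<lambda>n. x (r n)) \<longlonglongrightarrow> a" if "x \<longlonglongrightarrow> a" for x :: "nat \<Rightarrow> complex" and a
    using LIMSEQ_subseq_LIMSEQ[OF that r(1)] by (simp add: o_def)
  have "(\<lambda>n. L (r n)) \<longlonglongrightarrow> k0 * fst c - k0' * snd c"
    unfolding eq by (intro tendsto_intros FH sub lim)
  with sub[OF lim(1)] have 1: "l = k0 * fst c - k0' * snd c" by (rule LIMSEQ_unique)
  have 2: "norm (fst c - p0) \<le> e" "norm (snd c - q0) \<le> e"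
    by (rule LIMSEQ_le_const2[OF tendsto_norm[OF tendsto_diff[OF FH(1) sub[OF lim(4)]]]], use le in blast)
      (rule LIMSEQ_le_const2[OF tendsto_norm[OF tendsto_diff[OF FH(2) sub[OF lim(5)]]]], use le in blast)
  show ?thesis using that 1 2 by blast
qed

lemma approximating_orders:
  obtains b :: "nat \<Rightarrow> complex" where "b \<longlonglongrightarrow> b0" "\<And>n. Re (b n) \<notin> \<int>" "\<And>n. norm (b n) \<le> norm b0 + 1"
proof (cases "Re b0 \<in> \<int>")
  case False
  show ?thesis by (rule that[of "\<lambda>_. b0"]) (use False in auto)
next
  case True
  \<comment> \<open>Strictly between 0 and 1 for every \<open>n\<close>, so adding it to an integral
    real part never yields an integer.\<close>
  define t where "t = (\<lambda>n. 1 / real (Suc (Suc n)))"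
  have t: "0 < t n" "t n < 1" for n by (simp_all add: t_def)
  have t0: "t \<longlonglongrightarrow> 0" unfolding t_def using LIMSEQ_Suc[OF LIMSEQ_inverse_real_of_nat] by (simp add: inverse_eq_divide)
  show ?thesis
  proof (rule that[of "\<lambda>n. b0 + of_real (t n)"])
    show "(\<lambda>n. b0 + of_real (t n)) \<longlonglongrightarrow> b0"
      using tendsto_add[OF tendsto_const[of b0] tendsto_of_real[OF t0]] by simp
    show "norm (b0 + of_real (t n)) \<le> norm b0 + 1" for n
      using norm_triangle_ineq[of b0 "of_real (t n)"] t[of n] by simp
    show "Re (b0 + of_real (t n)) \<notin> \<int>" for n
    proof
      assume "Re (b0 + of_real (t n)) \<in> \<int>"
      then have "t n \<in> \<int>" using Ints_diff[OF _ True, of "Re (b0 + of_real (t n))"] by simp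
      then show False using t[of n] by (auto elim!: Ints_cases)
    qed
  qed
qed

text \<open>The bound on \<open>norm b0\<close> keeps both Gamma factors away from their poles; the
  continuity of \<open>U\<close> up to integral \<open>b\<close> is
  \<open>kummerU_tendsto\<close>.\<close>

lemma lhs_tendsto:
  assumes "b \<longlonglongrightarrow> b0" "\<And>n. b n \<notin> \<int>" "u \<ge> 1" "norm b0 \<le> u\<^sup>2 / 4"
  shows "(\<lambda>n. scaledU1 (b n) u w) \<longlonglongrightarrow> scaledU1 b0 u w" "(\<lambda>n. scaledU2 (b n) u w) \<longlonglongrightarrow> scaledU2 b0 u w"
proof -
  have u: "u > 0" "u\<^sup>2 > 0" using assms by auto
  have b: "\<bar>Re b0\<bar> \<le> u\<^sup>2 / 4" using abs_Re_le_cmod[of b0] assms by linarith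
  have G1: "1 + of_real (u\<^sup>2) / 4 - b0 / 2 \<notin> \<int>\<^sub>\<le>\<^sub>0"
  proof -
    have "Re (1 + of_real (u\<^sup>2) / 4 - b0 / 2) = 1 + u\<^sup>2 / 4 - Re b0 / 2" by simp
    then have "Re (1 + of_real (u\<^sup>2) / 4 - b0 / 2) > 0" using b u by linarith
    from right_half_plane_not_nonpos[OF this] show ?thesis using nonpos_Ints_subset_nonpos_Reals by blast
  qed
  have G2: "of_real (u\<^sup>2) / 4 + b0 / 2 \<notin> \<int>\<^sub>\<le>\<^sub>0"
  proof -
    have "Re (of_real (u\<^sup>2) / 4 + b0 / 2) = u\<^sup>2 / 4 + Re b0 / 2" by simp
    then have "Re (of_real (u\<^sup>2) / 4 + b0 / 2) > 0" using b u by linarith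
    from right_half_plane_not_nonpos[OF this] show ?thesis using nonpos_Ints_subset_nonpos_Reals by blast
  qed
  have p: "2 powr c = exp (c * of_real (ln 2))" for c :: complex using of_real_powr_exp[of 2 c] by simp
  have U: "(\<lambda>n. kummerU (of_real (u\<^sup>2) / 4 + b n / 2) (b n) (2 * w)) \<longlonglongrightarrow> kummerU (of_real (u\<^sup>2) / 4 + b0 / 2) b0 (2 * w)"
    by (intro kummerU_tendsto tendsto_intros assms) auto
  show "(\<lambda>n. scaledU1 (b n) u w) \<longlonglongrightarrow> scaledU1 b0 u w"
    unfolding scaledU1_def p of_real_powr_exp[OF u(1)] by (intro tendsto_intros tendsto_Gamma U G1 assms) auto
  show "(\<lambda>n. scaledU2 (b n) u w) \<longlonglongrightarrow> scaledU2 b0 u w"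
    unfolding scaledU2_def p of_real_powr_exp[OF u(1)] by (intro tendsto_intros tendsto_Gamma U G2 assms) auto
qed

text \<open>\<open>F\<close> and \<open>H\<close> are the entire brackets, the second one divided by
  \<open>z\<close>, so that the limit in \<open>b\<close> can be taken before any remainder is split
  off. The parameters \<open>T\<close>, \<open>P\<close>, \<open>Q\<close> let both parts of the
  theorem share the limit argument.\<close>

definition expansion_pair where
  "expansion_pair T P Q N K b u w F H \<longleftrightarrow>
     T b u w = exp w * besselK (b - 1) (of_real (ln u) + w) * F
       - exp w / of_real u * besselK b (of_real (ln u) + w) * (exp w * H) \<and>
     norm (F - (\<Sum>s<N. poly (P (b - 1) s) (exp w) / of_real u ^ (2 * s))) \<le> K / u ^ (2 * N) \<and>
     norm (H - (\<Sum>s<N. poly (div_z (Q (b - 1) s)) (exp w) / of_real u ^ (2 * s))) \<le> K / u ^ (2 * N)"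

definition expansion_bound where
  "expansion_bound T P Q N K b u w \<longleftrightarrow> (\<exists>F H :: complex. expansion_pair T P Q N K b u w F H)"

lemma expansion_bound_limit:
  fixes b0 :: complex
  assumes "b \<longlonglongrightarrow> b0" "\<And>n. b n \<notin> \<int>" "\<And>n. expansion_bound T P Q N K (b n) u w"
    and T: "(\<lambda>n. T (b n) u w) \<longlonglongrightarrow> T b0 u w"
    and P: "\<And>s. (\<lambda>n. poly (P (b n - 1) s) (exp w)) \<longlonglongrightarrow> poly (P (b0 - 1) s) (exp w)"
    and Q: "\<And>s. (\<lambda>n. poly (div_z (Q (b n - 1) s)) (exp w)) \<longlonglongrightarrow> poly (div_z (Q (b0 - 1) s)) (exp w)"
  shows "expansion_bound T P Q N K b0 u w"
proof -
  obtain F H where "\<And>n. expansion_pair T P Q N K (b n) u w (F n) (H n)"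
    using assms(3) unfolding expansion_bound_def by metis
  then have FH: "\<And>n. T (b n) u w = exp w * besselK (b n - 1) (of_real (ln u) + w) * F n
       - exp w / of_real u * besselK (b n) (of_real (ln u) + w) * (exp w * H n)"
     "\<And>n. norm (F n - (\<Sum>s<N. poly (P (b n - 1) s) (exp w) / of_real u ^ (2 * s))) \<le> K / u ^ (2 * N)"
     "\<And>n. norm (H n - (\<Sum>s<N. poly (div_z (Q (b n - 1) s)) (exp w) / of_real u ^ (2 * s))) \<le> K / u ^ (2 * N)"
    unfolding expansion_pair_def by blast+
  have n1: "b n - 1 \<notin> \<int>" for n
  proof
    assume "b n - 1 \<in> \<int>"
    then have "b n - 1 + 1 \<in> \<int>" by (rule Ints_add) simp
    then show False using assms(2)[of n] by simp
  qed
  have K: "(\<lambda>n. exp w * besselK (b n - 1) (of_real (ln u) + w)) \<longlonglongrightarrow> exp w * besselK (b0 - 1) (of_real (ln u) + w)"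
    by (intro tendsto_intros besselK_tendsto assms n1)
  have K': "(\<lambda>n. exp w / of_real u * besselK (b n) (of_real (ln u) + w) * exp w) \<longlonglongrightarrow>
      exp w / of_real u * besselK b0 (of_real (ln u) + w) * exp w"
    by (intro tendsto_mult tendsto_const besselK_tendsto assms)
  have Ps: "(\<lambda>n. \<Sum>s<N. poly (P (b n - 1) s) (exp w) / of_real u ^ (2 * s)) \<longlonglongrightarrow> (\<Sum>s<N. poly (P (b0 - 1) s) (exp w) / of_real u ^ (2 * s))"
    unfolding divide_inverse by (intro tendsto_sum tendsto_mult tendsto_const P)
  have Qs: "(\<lambda>n. \<Sum>s<N. poly (div_z (Q (b n - 1) s)) (exp w) / of_real u ^ (2 * s)) \<longlonglongrightarrow>
      (\<Sum>s<N. poly (div_z (Q (b0 - 1) s)) (exp w) / of_real u ^ (2 * s))"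
    unfolding divide_inverse by (intro tendsto_sum tendsto_mult tendsto_const Q)
  have eq: "T (b n) u w = exp w * besselK (b n - 1) (of_real (ln u) + w) * F n
       - exp w / of_real u * besselK (b n) (of_real (ln u) + w) * exp w * H n" for n
    using FH(1)[of n] by (simp add: mult.assoc)
  obtain F0 H0 where "T b0 u w = exp w * besselK (b0 - 1) (of_real (ln u) + w) * F0
       - exp w / of_real u * besselK b0 (of_real (ln u) + w) * exp w * H0"
     "norm (F0 - (\<Sum>s<N. poly (P (b0 - 1) s) (exp w) / of_real u ^ (2 * s))) \<le> K / u ^ (2 * N)"
     "norm (H0 - (\<Sum>s<N. poly (div_z (Q (b0 - 1) s)) (exp w) / of_real u ^ (2 * s))) \<le> K / u ^ (2 * N)"
    by (rule bounded_decomposition_limit[OF T K K' Ps Qs eq FH(2,3)])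
  then show ?thesis unfolding expansion_bound_def expansion_pair_def mult.assoc by blast
qed

lemma norm_le_quarter_square:
  fixes u :: real
  assumes "u \<ge> 1" "u \<ge> 4 * B" "norm b \<le> B"
  shows "norm b \<le> u\<^sup>2 / 4"
  using assms self_le_power[of u 2] by simp

lemma expansion_bound_nonint1:
  assumes "B \<ge> 0"
  obtains K u0 :: real where "u0 \<ge> 1" "u0 \<ge> 4 * B" "K \<ge> 0"
    "\<And>u b w. u \<ge> u0 \<Longrightarrow> norm b \<le> B \<Longrightarrow> Re b \<notin> \<int> \<Longrightarrow> norm (exp w) \<le> R \<Longrightarrow>
       expansion_bound scaledU1 A_poly B_poly N K b u w"
proof -
  obtain K u0 :: real where K: "u0 \<ge> 1" "K \<ge> 0"
    "\<And>u b z. u \<ge> u0 \<Longrightarrow> norm b \<le> B \<Longrightarrow> Re b \<notin> \<int> \<Longrightarrow> norm z \<le> R \<Longrightarrow>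
       norm (bigF u b z - (\<Sum>s<N. poly (A_poly (b - 1) s) z / of_real u ^ (2 * s))) \<le> K / u ^ (2 * N) \<and>
       norm (bigH u b z - (\<Sum>s<N. poly (div_z (B_poly (b - 1) s)) z / of_real u ^ (2 * s))) \<le> K / u ^ (2 * N)"
    by (rule slow_asymptotics[OF assms, where R = R and N = N]) blast
  show ?thesis
  proof (rule that[of "max u0 (4 * B)" K])
    fix u :: real and b w :: complex
    assume *: "u \<ge> max u0 (4 * B)" "norm b \<le> B" "Re b \<notin> \<int>" "norm (exp w) \<le> R"
    have u: "u > 0" "u \<ge> 1" "u \<ge> 4 * B" "u \<ge> u0" using * K by auto
    show "expansion_bound scaledU1 A_poly B_poly N K b u w"
      unfolding expansion_bound_def expansion_pair_def
      using exact_identity[OF *(3) u(1) norm_le_quarter_square[OF u(2,3) *(2)], of w] K(3)[OF u(4) *(2-4)] by blast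
  qed (use K in auto)
qed

text \<open>The \<open>B\<close>-part of \<open>a_(s+1)\<close> comes from index \<open>s\<close>,
  so it carries an extra factor \<open>1 / U\<^sup>2\<close> and one term fewer.\<close>

lemma a_poly_sum:
  "(\<Sum>s<Suc M. poly (a_poly \<mu> s) z / U ^ (2 * s)) =
     (\<Sum>s<Suc M. poly (A_poly (- \<mu>) s) z / U ^ (2 * s)) +
     2 * \<mu> / U\<^sup>2 * (\<Sum>s<M. poly (div_z (B_poly (- \<mu>) s)) z / U ^ (2 * s))"
proof -
  have "poly (a_poly \<mu> (Suc s)) z / U ^ (2 * Suc s) = poly (A_poly (- \<mu>) (Suc s)) z / U ^ (2 * Suc s)
      + 2 * \<mu> / U\<^sup>2 * (poly (div_z (B_poly (- \<mu>) s)) z / U ^ (2 * s))" for s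
    by (simp only: a_poly.simps poly_add poly_smult add_divide_distrib) (simp add: power2_eq_square mult.assoc)
  then show ?thesis
    by (simp only: sum.lessThan_Suc_shift sum.distrib sum_distrib_left a_poly.simps A_poly.simps(1)) (simp add: add.assoc)
qed

text \<open>The recurrence for \<open>K\<close> moves \<open>2 * (b - 1) / u\<^sup>2\<close> times
  \<open>bigH\<close> into the first bracket. As that factor already supplies
  \<open>1 / u\<^sup>2\<close>, its expansion must stop at length \<open>N - 1\<close> to match
  \<open>a_poly_sum\<close>; therefore \<open>slow_asymptotics\<close> is used at both
  lengths.\<close>

lemma expansion_bound_nonint2:
  assumes "B \<ge> 0" "N \<ge> 1"
  obtains K u0 :: real where "u0 \<ge> 1" "u0 \<ge> 4 * B" "K \<ge> 0"
    "\<And>u b w. u \<ge> u0 \<Longrightarrow> norm b \<le> B \<Longrightarrow> Re b \<notin> \<int> \<Longrightarrow> norm (exp w) \<le> R \<Longrightarrow>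
       expansion_bound scaledU2 a_poly b_poly N K b u w"
proof -
  obtain M where N: "N = Suc M" using assms(2) by (cases N) auto
  have B2: "B + 2 \<ge> 0" using assms by simp
  obtain K u0 :: real where K: "u0 \<ge> 1" "K \<ge> 0"
    "\<And>u b z. u \<ge> u0 \<Longrightarrow> norm b \<le> B + 2 \<Longrightarrow> Re b \<notin> \<int> \<Longrightarrow> norm z \<le> R \<Longrightarrow>
       norm (bigF u b z - (\<Sum>s<N. poly (A_poly (b - 1) s) z / of_real u ^ (2 * s))) \<le> K / u ^ (2 * N) \<and>
       norm (bigH u b z - (\<Sum>s<N. poly (div_z (B_poly (b - 1) s)) z / of_real u ^ (2 * s))) \<le> K / u ^ (2 * N)"
    by (rule slow_asymptotics[OF B2, where R = R and N = N]) blast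
  obtain K' u0' :: real where K': "u0' \<ge> 1" "K' \<ge> 0"
    "\<And>u b z. u \<ge> u0' \<Longrightarrow> norm b \<le> B + 2 \<Longrightarrow> Re b \<notin> \<int> \<Longrightarrow> norm z \<le> R \<Longrightarrow>
       norm (bigF u b z - (\<Sum>s<M. poly (A_poly (b - 1) s) z / of_real u ^ (2 * s))) \<le> K' / u ^ (2 * M) \<and>
       norm (bigH u b z - (\<Sum>s<M. poly (div_z (B_poly (b - 1) s)) z / of_real u ^ (2 * s))) \<le> K' / u ^ (2 * M)"
    by (rule slow_asymptotics[OF B2, where R = R and N = M]) blast
  show ?thesis
  proof (rule that[of "max (max u0 u0') (4 * (B + 2))" "K + 2 * (B + 1) * K'"])
    fix u :: real and b w :: complex
    assume *: "u \<ge> max (max u0 u0') (4 * (B + 2))" "norm b \<le> B" "Re b \<notin> \<int>" "norm (exp w) \<le> R"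
    define z where "z = exp w"
    define c where "c = 2 - b"
    define W where "W = of_real (ln u) + w"
    define x where "x = 2 * (b - 1) / (of_real u)\<^sup>2"
    have u: "u > 0" "u \<ge> 1" "u \<ge> 4 * (B + 2)" "u \<ge> u0" "u \<ge> u0'" using * K by auto
    have c: "norm c \<le> B + 2" "Re c \<notin> \<int>" "c - 1 = - (b - 1)"
      using *(2) norm_triangle_ineq4[of 2 b] Re_shift_not_Ints(3)[OF *(3)] by (simp_all add: c_def)
    have zR: "norm z \<le> R" using * by (simp add: z_def)
    define F H where "F = bigF u c z + x * bigH u c z" and "H = bigH u c z"
    have k: "besselK (c - 1) W = besselK (b - 1) W" "besselK c W = besselK b W - 2 * (b - 1) / exp W * besselK (b - 1) W"
      using besselK_recurrence_nonint[OF *(3), of W] by (simp_all add: c_def)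
    have eW: "exp W = of_real u * z" unfolding W_def z_def exp_add exp_of_real using u by simp
    have z0: "z \<noteq> 0" by (simp add: z_def)
    have "scaledU2 b u w = z * besselK (c - 1) W * bigF u c z - z / of_real u * besselK c W * (z * bigH u c z)"
      using exact_identity[OF c(2) u(1) norm_le_quarter_square[OF u(2,3) c(1)], of w]
      unfolding scaledU2_eq_scaledU1[OF *(3)] c_def[symmetric] z_def[symmetric] W_def[symmetric] .
    also have "\<dots> = z * besselK (b - 1) W * F - z / of_real u * besselK b W * (z * H)"
      unfolding k eW F_def H_def x_def using z0 u(1) by (simp add: field_simps power2_eq_square)
    finally have 1: "scaledU2 b u w = z * besselK (b - 1) W * F - z / of_real u * besselK b W * (z * H)" .
    define SA where "SA = (\<Sum>s<N. poly (A_poly (- (b - 1)) s) z / of_real u ^ (2 * s))"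
    define SB where "SB = (\<lambda>N. \<Sum>s<N. poly (div_z (B_poly (- (b - 1)) s)) z / of_real u ^ (2 * s))"
    have KK: "norm (bigF u c z - SA) \<le> K / u ^ (2 * N)" "norm (bigH u c z - SB N) \<le> K / u ^ (2 * N)"
        "norm (bigH u c z - SB M) \<le> K' / u ^ (2 * M)"
      using K(3)[OF u(4) c(1,2) zR] K'(3)[OF u(5) c(1,2) zR] unfolding SA_def SB_def c(3) by auto
    have sum: "(\<Sum>s<N. poly (a_poly (b - 1) s) z / of_real u ^ (2 * s)) = SA + x * SB M"
      unfolding N a_poly_sum SA_def SB_def x_def ..
    have "norm x \<le> 2 * (B + 1) / u\<^sup>2"
      unfolding x_def norm_divide norm_mult norm_power norm_of_real
      using *(2) norm_triangle_ineq4[of b 1] by (simp add: divide_right_mono)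
    then have "norm x * norm (bigH u c z - SB M) \<le> (2 * (B + 1) / u\<^sup>2) * (K' / u ^ (2 * M))"
      using KK(3) assms by (intro mult_mono) auto
    also have "\<dots> = 2 * (B + 1) * K' / u ^ (2 * N)" by (simp add: N power2_eq_square)
    finally have x: "norm (x * (bigH u c z - SB M)) \<le> 2 * (B + 1) * K' / u ^ (2 * N)" unfolding norm_mult .
    have e: "F - (SA + x * SB M) = (bigF u c z - SA) + x * (bigH u c z - SB M)"
      unfolding F_def by (simp add: algebra_simps)
    have "norm (F - (SA + x * SB M)) \<le> K / u ^ (2 * N) + 2 * (B + 1) * K' / u ^ (2 * N)"
      unfolding e by (rule order_trans[OF norm_triangle_ineq add_mono[OF KK(1) x]])
    then have 2: "norm (F - (SA + x * SB M)) \<le> (K + 2 * (B + 1) * K') / u ^ (2 * N)"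
      by (simp add: add_divide_distrib)
    have "K / u ^ (2 * N) \<le> (K + 2 * (B + 1) * K') / u ^ (2 * N)"
      using u K' assms by (intro divide_right_mono) auto
    then have 3: "norm (H - SB N) \<le> (K + 2 * (B + 1) * K') / u ^ (2 * N)"
      using KK(2) unfolding H_def by linarith
    show "expansion_bound scaledU2 a_poly b_poly N (K + 2 * (B + 1) * K') b u w"
      unfolding expansion_bound_def expansion_pair_def z_def[symmetric] W_def[symmetric] sum b_poly_def
      using 1 2 3 unfolding SB_def by blast
  qed (use K K' assms in auto)
qed

text \<open>The common end of both parts: bounds uniform in nonintegral \<open>Re b\<close> are
  carried to the given \<open>b\<close> for each \<open>u\<close> and \<open>w\<close> separately,
  after which the brackets are chosen pointwise and the remainders split off.\<close>

lemma expansion_from_bounds: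
  fixes b :: complex and R :: real
  assumes bound: "\<And>B. B \<ge> 0 \<Longrightarrow> \<exists>K u0. u0 \<ge> 1 \<and> u0 \<ge> 4 * B \<and> K \<ge> 0 \<and>
      (\<forall>u b w. u \<ge> u0 \<longrightarrow> norm b \<le> B \<longrightarrow> Re b \<notin> \<int> \<longrightarrow> norm (exp w) \<le> R \<longrightarrow> expansion_bound T P Q N K b u w)"
    and T: "\<And>\<beta> b u w. \<beta> \<longlonglongrightarrow> b \<Longrightarrow> (\<And>n. \<beta> n \<notin> \<int>) \<Longrightarrow> u \<ge> 1 \<Longrightarrow> norm b \<le> u\<^sup>2 / 4 \<Longrightarrow>
        (\<lambda>n. T (\<beta> n) u w) \<longlonglongrightarrow> T b u w"
    and P: "\<And>\<mu> \<mu>0 s z. \<mu> \<longlonglongrightarrow> \<mu>0 \<Longrightarrow> (\<lambda>n. poly (P (\<mu> n) s) z) \<longlonglongrightarrow> poly (P \<mu>0 s) z"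
    and Q: "\<And>\<mu> \<mu>0 s z. \<mu> \<longlonglongrightarrow> \<mu>0 \<Longrightarrow> (\<lambda>n. poly (div_z (Q (\<mu> n) s)) z) \<longlonglongrightarrow> poly (div_z (Q \<mu>0 s)) z"
    and odd: "\<And>\<mu> s z. poly (Q \<mu> s) z = z * poly (div_z (Q \<mu> s)) z"
  shows "\<exists>(g2 :: real \<Rightarrow> complex \<Rightarrow> complex) (h2 :: real \<Rightarrow> complex \<Rightarrow> complex) (K2 :: real) (u2 :: real).
        K2 > 0 \<and> u2 > 0 \<and>
        (\<forall>(u :: real) (w :: complex). u \<ge> u2 \<and> norm (exp w) \<le> R \<longrightarrow>
           T b u w
           = exp w * besselK (b - 1) (of_real (ln u) + w)
               * ((\<Sum>s<N. poly (P (b - 1) s) (exp w) / of_real u ^ (2 * s)) + g2 u w)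
             - exp w / of_real u * besselK b (of_real (ln u) + w)
               * ((\<Sum>s<N. poly (Q (b - 1) s) (exp w) / of_real u ^ (2 * s))
                  + exp w * h2 u w)
         \<and> norm (g2 u w) + norm (h2 u w) \<le> K2 / u ^ (2 * N))"
proof -
  \<comment> \<open>Leaves room for the approximating orders, which stay within distance 1 of
    \<open>b\<close>.\<close>
  define B where "B = norm b + 1"
  have B: "B \<ge> 0" by (simp add: B_def)
  obtain K u0 :: real where K: "u0 \<ge> 1" "u0 \<ge> 4 * B" "K \<ge> 0"
    "\<And>u b w. u \<ge> u0 \<Longrightarrow> norm b \<le> B \<Longrightarrow> Re b \<notin> \<int> \<Longrightarrow> norm (exp w) \<le> R \<Longrightarrow> expansion_bound T P Q N K b u w"
    using bound[OF B] by blast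
  obtain \<beta> where \<beta>: "\<beta> \<longlonglongrightarrow> b" "\<And>n. Re (\<beta> n) \<notin> \<int>" "\<And>n. norm (\<beta> n) \<le> B"
    unfolding B_def by (rule approximating_orders[of b]) blast
  have \<beta>1: "(\<lambda>n. \<beta> n - 1) \<longlonglongrightarrow> b - 1" by (intro tendsto_intros \<beta>)
  have EB: "expansion_bound T P Q N K b u w" if "u \<ge> u0" "norm (exp w) \<le> R" for u w
  proof (rule expansion_bound_limit[OF \<beta>(1)])
    show "\<beta> n \<notin> \<int>" for n using \<beta>(2) by (rule not_Ints_Re)
    then show "(\<lambda>n. T (\<beta> n) u w) \<longlonglongrightarrow> T b u w"
      using norm_le_quarter_square[of u B b] K(1,2) that by (intro T[OF \<beta>(1)]) (auto simp: B_def)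
    show "expansion_bound T P Q N K (\<beta> n) u w" for n
      using K(4)[OF that(1) \<beta>(3,2) that(2)] .
  qed (intro P Q \<beta>1)+
  obtain F H where "\<And>u w. u \<ge> u0 \<Longrightarrow> norm (exp w) \<le> R \<Longrightarrow> expansion_pair T P Q N K b u w (F u w) (H u w)"
    using EB unfolding expansion_bound_def by metis
  then have FH: "\<And>u w. u \<ge> u0 \<Longrightarrow> norm (exp w) \<le> R \<Longrightarrow>
       T b u w = exp w * besselK (b - 1) (of_real (ln u) + w) * F u w
       - exp w / of_real u * besselK b (of_real (ln u) + w) * (exp w * H u w)"
     "\<And>u w. u \<ge> u0 \<Longrightarrow> norm (exp w) \<le> R \<Longrightarrow>
       norm (F u w - (\<Sum>s<N. poly (P (b - 1) s) (exp w) / of_real u ^ (2 * s))) \<le> K / u ^ (2 * N)"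
     "\<And>u w. u \<ge> u0 \<Longrightarrow> norm (exp w) \<le> R \<Longrightarrow>
       norm (H u w - (\<Sum>s<N. poly (div_z (Q (b - 1) s)) (exp w) / of_real u ^ (2 * s))) \<le> K / u ^ (2 * N)"
    unfolding expansion_pair_def by blast+
  define SP where "SP = (\<lambda>u w. \<Sum>s<N. poly (P (b - 1) s) (exp w) / complex_of_real u ^ (2 * s))"
  define SQ where "SQ = (\<lambda>u w. \<Sum>s<N. poly (div_z (Q (b - 1) s)) (exp w) / complex_of_real u ^ (2 * s))"
  have SP: "(\<Sum>s<N. poly (P (b - 1) s) (exp w) / complex_of_real u ^ (2 * s)) = SP u w" for u w
    unfolding SP_def ..
  have SQ: "(\<Sum>s<N. poly (Q (b - 1) s) (exp w) / complex_of_real u ^ (2 * s)) = exp w * SQ u w" for u w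
    unfolding SQ_def sum_distrib_left odd[of "b - 1"] by simp
  have main: "T b u w = exp w * besselK (b - 1) (of_real (ln u) + w) * (SP u w + (F u w - SP u w))
             - exp w / of_real u * besselK b (of_real (ln u) + w) * (exp w * SQ u w + exp w * (H u w - SQ u w))
         \<and> norm (F u w - SP u w) + norm (H u w - SQ u w) \<le> (2 * K + 1) / u ^ (2 * N)"
    if "u \<ge> u0" "norm (exp w) \<le> R" for u w
  proof -
    have e: "SP u w + (F u w - SP u w) = F u w" "exp w * SQ u w + exp w * (H u w - SQ u w) = exp w * H u w"
      by (simp_all add: algebra_simps)
    have "u > 0" using that K by linarith
    \<comment> \<open>The added 1 makes the final constant positive even if
      \<open>K = 0\<close>.\<close>
    then have "K / u ^ (2 * N) + K / u ^ (2 * N) \<le> (2 * K + 1) / u ^ (2 * N)"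
      unfolding add_divide_distrib[symmetric] by (intro divide_right_mono) auto
    then have "norm (F u w - SP u w) + norm (H u w - SQ u w) \<le> (2 * K + 1) / u ^ (2 * N)"
      using FH(2,3)[OF that] unfolding SP_def SQ_def by linarith
    then show ?thesis unfolding e using FH(1)[OF that] by blast
  qed
  show ?thesis
    unfolding SQ SP
  proof (rule exI[of _ "\<lambda>u w. F u w - SP u w"], rule exI[of _ "\<lambda>u w. H u w - SQ u w"],
        rule exI[of _ "2 * K + 1"], rule exI[of _ u0], intro conjI allI impI)
    fix u :: real and w :: complex
    assume a: "u \<ge> u0 \<and> norm (exp w) \<le> R"
    note m = main[OF conjunct1[OF a] conjunct2[OF a]]
    show "T b u w = exp w * besselK (b - 1) (of_real (ln u) + w) * (SP u w + (F u w - SP u w))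
             - exp w / of_real u * besselK b (of_real (ln u) + w) * (exp w * SQ u w + exp w * (H u w - SQ u w))"
      by (rule conjunct1[OF m])
    show "norm (F u w - SP u w) + norm (H u w - SQ u w) \<le> (2 * K + 1) / u ^ (2 * N)"
      by (rule conjunct2[OF m])
  qed (use K in auto)
qed

theorem theorem8p7:
  fixes b :: complex and N :: nat and R :: real
  assumes "N \<ge> 1" and "R > 0"
  shows
    "(\<exists>(g2 :: real \<Rightarrow> complex \<Rightarrow> complex) (h2 :: real \<Rightarrow> complex \<Rightarrow> complex) (K2 :: real) (u2 :: real).
        K2 > 0 \<and> u2 > 0 \<and>
        (\<forall>(u :: real) (w :: complex). u \<ge> u2 \<and> norm (exp w) \<le> R \<longrightarrow>
           Gamma (1 + of_real (u\<^sup>2) / 4 - b / 2) * 2 powr (- b) * of_real u powr (b - 1)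
             * exp (- (exp w)\<^sup>2 / 2) * exp (b * w)
             * kummerU (of_real (u\<^sup>2) / 4 + b / 2) b (2 * w)
           = exp w * besselK (b - 1) (of_real (ln u) + w)
               * ((\<Sum>s<N. poly (A_poly (b - 1) s) (exp w) / of_real u ^ (2 * s)) + g2 u w)
             - exp w / of_real u * besselK b (of_real (ln u) + w)
               * ((\<Sum>s<N. poly (B_poly (b - 1) s) (exp w) / of_real u ^ (2 * s))
                  + exp w * h2 u w)
         \<and> norm (g2 u w) + norm (h2 u w) \<le> K2 / u ^ (2 * N)))
     \<and>
     (\<exists>(g2 :: real \<Rightarrow> complex \<Rightarrow> complex) (h2 :: real \<Rightarrow> complex \<Rightarrow> complex) (K2 :: real) (u2 :: real).
        K2 > 0 \<and> u2 > 0 \<and>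
        (\<forall>(u :: real) (w :: complex). u \<ge> u2 \<and> norm (exp w) \<le> R \<longrightarrow>
           Gamma (of_real (u\<^sup>2) / 4 + b / 2) * 2 powr (b - 2) * of_real u powr (1 - b)
             * exp (- (exp w)\<^sup>2 / 2) * exp (b * w)
             * kummerU (of_real (u\<^sup>2) / 4 + b / 2) b (2 * w)
           = exp w * besselK (b - 1) (of_real (ln u) + w)
               * ((\<Sum>s<N. poly (a_poly (b - 1) s) (exp w) / of_real u ^ (2 * s)) + g2 u w)
             - exp w / of_real u * besselK b (of_real (ln u) + w)
               * ((\<Sum>s<N. poly (b_poly (b - 1) s) (exp w) / of_real u ^ (2 * s))
                  + exp w * h2 u w)
         \<and> norm (g2 u w) + norm (h2 u w) \<le> K2 / u ^ (2 * N)))"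
  unfolding scaledU1_def[symmetric] scaledU2_def[symmetric]
proof (rule conjI; rule expansion_from_bounds)
  fix B :: real assume B: "B \<ge> 0"
  show "\<exists>K u0. u0 \<ge> 1 \<and> u0 \<ge> 4 * B \<and> K \<ge> 0 \<and> (\<forall>u b w. u \<ge> u0 \<longrightarrow> norm b \<le> B \<longrightarrow> Re b \<notin> \<int> \<longrightarrow>
      norm (exp w) \<le> R \<longrightarrow> expansion_bound scaledU1 A_poly B_poly N K b u w)"
    by (rule expansion_bound_nonint1[OF B]) blast
  show "\<exists>K u0. u0 \<ge> 1 \<and> u0 \<ge> 4 * B \<and> K \<ge> 0 \<and> (\<forall>u b w. u \<ge> u0 \<longrightarrow> norm b \<le> B \<longrightarrow> Re b \<notin> \<int> \<longrightarrow>
      norm (exp w) \<le> R \<longrightarrow> expansion_bound scaledU2 a_poly b_poly N K b u w)"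
    by (rule expansion_bound_nonint2[OF B assms(1)]) blast
next
  fix \<mu> :: "nat \<Rightarrow> complex" and \<mu>0 z s
  assume \<mu>: "\<mu> \<longlonglongrightarrow> \<mu>0"
  show "(\<lambda>n. poly (A_poly (\<mu> n) s) z) \<longlonglongrightarrow> poly (A_poly \<mu>0 s) z"
    by (rule poly_cont_tendsto[OF poly_cont_A_poly \<mu>])
  show "(\<lambda>n. poly (div_z (B_poly (\<mu> n) s)) z) \<longlonglongrightarrow> poly (div_z (B_poly \<mu>0 s)) z"
    by (rule poly_cont_tendsto[OF poly_cont_div_z[OF poly_cont_B_poly] \<mu>])
  show "(\<lambda>n. poly (a_poly (\<mu> n) s) z) \<longlonglongrightarrow> poly (a_poly \<mu>0 s) z"
    by (rule poly_a_poly_tendsto[OF \<mu>])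
  show "(\<lambda>n. poly (div_z (b_poly (\<mu> n) s)) z) \<longlonglongrightarrow> poly (div_z (b_poly \<mu>0 s)) z"
    unfolding b_poly_def
    by (rule poly_cont_tendsto[OF poly_cont_div_z[OF poly_cont_B_poly] tendsto_minus[OF \<mu>]])
qed (auto simp: b_poly_def intro: lhs_tendsto poly_B_poly)

end
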